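(* Let $\mu^*$ be a non-degenerate probability distribution on $[-1,1]$ (i.e. not a point mass). Suppose there are constants $C_1\in(0,1]$, $C_2\in[1,\infty)$, free of $n,p$, with $C_1\le \lambda_{\min}(\mathbf X^\top\mathbf X)/\sigma^2\le\lambda_{\max}(\mathbf X^\top\mathbf X)/\sigma^2\le C_2$; that $\mathcal P$ is a closed subset of the set of all probability measures supported on $[-1,1]$; and that $\mathrm{Tr}(A^2)=o(p)$. Let $\{\mu^{(p)}:p\ge1\}\subset\mathcal P$ be a sequence of probability distributions converging weakly to $\mu^*$ as $p\to\infty$. Assume that $\mathcal M_p(\cdot,\mathbf w,\mu^* )$ has a well-separated optimizer $\mathbf u^*$. Let $\mathbf u^{(p)}=(u_1^{(p)},\dots,u_p^{(p)})\in[-1,1]^p$ be any global optimizer (maximizer) of $\mathcal M_p(\cdot,\mathbf w,\mu^{(p)})$ on $I_{\mu^{(p)}}^p$, and let $$\widetilde{\mathbf u}:=\mathbb E_{\mathbb P_{\mu^*}}[\boldsymbol\beta\mid\mathbf y]\in[-1,1]^p,\qquad \widetilde{\boldsymbol\tau}=(\widetilde\tau_1,\dots,\widetilde\tau_p):=h_{\mu^*,\mathbf d}(\widetilde{\mathbf u})\in\mathbb R^p,\qquad \tau_i^{(p)}:=h_{\mu^{(p)},d_i}(u_i^{(p)}),\ i\in[p].$$ Then, as $p\to\infty$: (i) $\frac1p\|\mathbf u^*-\mathbf u^{(p)}\|_2^2\stackrel{\mathbb P_{\mu^*}}{\to}0$ and $\frac1p\|\mathbf u^*-\widetilde{\mathbf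 u}\|_2^2\stackrel{\mathbb P_{\mu^*}}{\to}0$; (ii) $\frac1p\mathrm{D_{KL}}\Big(\mathbb P_{\mu^*}(\cdot\mid\mathbf y)\,\Big\|\,\prod_{i=1}^p\mu^*_{\widetilde\tau_i,d_i}\Big)\stackrel{\mathbb P_{\mu^*}}{\to}0$; (iii) $\frac1p d_{W_1}\Big(\mathbb P_{\mu^*}(\cdot\mid\mathbf y),\prod_{i=1}^p\mu^*_{\widetilde\tau_i,d_i}\Big)\stackrel{\mathbb P_{\mu^*}}{\to}0$ and $\frac1p d_{W_1}\Big(\mathbb P_{\mu^*}(\cdot\mid\mathbf y),\prod_{i=1}^p\mu^{(p)}_{\tau_i^{(p)},d_i}\Big)\stackrel{\mathbb P_{\mu^*}}{\to}0$.
   Context: Model: $\mathbf y=\mathbf X\boldsymbol\beta+\boldsymbol\varepsilon\in\mathbb R^n$, with $\mathbf X\in\mathbb R^{n\times p}$ deterministic ($n$ and $\mathbf X$ depend on $p$), $\boldsymbol\varepsilon\sim N_n(\mathbf 0,\sigma^2\mathbf I)$, $\sigma^2>0$ known, and, independently of $\boldsymbol\varepsilon$, $\beta_1,\dots,\beta_p\stackrel{iid}{\sim}\mu$. $\mathbb P_\mu$ denotes the joint law of $(\mathbf y,\boldsymbol\beta)$ when the prior is $\mu$, and $\mathbb P_\mu(\cdot\mid\mathbf y)$ the posterior law of $\boldsymbol\beta$ given $\mathbf y$. $\stackrel{\mathbb P_{\mu^*}}{\to}$ is convergence in probability under $\mathbb P_{\mu^*}$. "Closed" refers to the topology of weak convergence.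 Notation: $A\in\mathbb R^{p\times p}$ is the off-diagonal part of $\sigma^{-2}\mathbf X^\top\mathbf X$ (zero diagonal), $\mathbf w:=\sigma^{-2}\mathbf X^\top\mathbf y$, $d_i:=\sigma^{-2}(\mathbf X^\top\mathbf X)_{ii}$, $\mathbf d=(d_1,\dots,d_p)$, $[p]=\{1,\dots,p\}$. For a probability measure $\mu$ on $\mathbb R$ and $(\gamma,d)\in\mathbb R\times(0,\infty)$, $c_\mu(\gamma,d):=\log\int\exp(\gamma\beta-\frac d2\beta^2)d\mu(\beta)$, and $\mu_{\gamma,d}$ is the probability measure with $\frac{d\mu_{\gamma,d}}{d\mu}(\beta)=\exp(\gamma\beta-\frac d2\beta^2-c_\mu(\gamma,d))$. Its mean is $\dot c_\mu(\gamma,d):=\partial c_\mu(\gamma,d)/\partial\gamma$. Let $I_\mu:=(\inf\mathrm{Supp}(\mu),\sup\mathrm{Supp}(\mu))$. For $\mu$ non-degenerate with compact support, $\dot c_\mu(\cdot,d)$ is strictly increasing from $\mathbb R$ onto $I_\mu$; $h_{\mu,d}:I_\mu\to\mathbb R$ is its inverse, so $\dot c_\mu(h_{\mu,d}(u),d)=u$. For $\mathbf u\in I_\mu^p$, $h_{\mu,\mathbf d}(\mathbf u)$ is the vector with coordinates $h_{\mu,d_i}(u_i)$. (Since $\mu^{(p)}\to\mu^*$ weakly with $\mu^*$ non-degenerate, $\mu^{(p)}$ is non-degenerate for all large $p$, which is all that matters for the limits.) For $\mathbf u\in I_\mu^p$, $\mathbf v\in\mathbb R^p$, $$\mathcal M_p(\mathbf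 u,\mathbf v,\mu):=-\frac12\mathbf u^\top A\mathbf u+\mathbf u^\top\mathbf v-\sum_{i=1}^p\mathrm{D_{KL}}(\mu_{h_{\mu,d_i}(u_i),d_i}\|\mu_{0,d_i}).$$ Well-separated optimizer: $\mathcal M_p(\cdot,\mathbf w,\mu^* )$ has a well-separated optimizer $\mathbf u^*$ if $\mathbf u^*=\mathbf u^*_p\in I_{\mu^*}^p$ is a sequence of random vectors such that for every $\delta>0$ there is $\varepsilon>0$ with $$\mathbb P_{\mu^*}\Big(\sup_{\mathbf u\in I_{\mu^*}^p:\ \|\mathbf u-\mathbf u^*\|_2^2>p\delta}\mathcal M_p(\mathbf u,\mathbf w,\mu^* )<\sup_{\mathbf u\in I_{\mu^*}^p}\mathcal M_p(\mathbf u,\mathbf w,\mu^* )-p\varepsilon\Big)\to1\quad\text{as }p\to\infty.$$ For distributions $P,Q$ on $\mathbb R^k$ with finite first moments, $d_{W_1}(P,Q):=\inf_\Pi\mathbb E_{(\mathbf X,\mathbf Y)\sim\Pi}\|\mathbf X-\mathbf Y\|_1$, the infimum over couplings $\Pi$ of $P$ and $Q$, with $\|\mathbf a\|_1=\sum_i|a_i|$. $\mathrm{D_{KL}}(P\|Q)$ is the Kullback–Leibler divergence. *)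

theory Defs
  imports
    "HOL-Probability.Probability"
    "HOL-Library.Landau_Symbols"
    "Jordan_Normal_Form.Spectral_Radius"
begin

unbundle no inner_syntax and no vec_syntax

text \<open>
  Deterministic vectors and matrices are the dynamically sized ones of \<open>Jordan_Normal_Form\<close>
  (coordinates \<open>0, \<dots>, p - 1\<close>). Probability measures on \<open>\<real>\<^sup>k\<close> live on the finite product
  \<open>PiM {..<k} (\<lambda>_. borel)\<close>; \<open>vec k x\<close> turns a point \<open>x\<close> of that space into a vector.
\<close>

abbreviation rspace :: "nat \<Rightarrow> (nat \<Rightarrow> real) measure" where
  "rspace k \<equiv> PiM {..<k} (\<lambda>_. borel)"

definition sq_dist :: "real vec \<Rightarrow> real vec \<Rightarrow> real" where
  "sq_dist u v = (u - v) \<bullet> (u - v)"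

definition mat_trace :: "real mat \<Rightarrow> real" where
  "mat_trace M = (\<Sum>i<dim_row M. M $$ (i, i))"

text \<open>Meant for real symmetric matrices of positive dimension, whose spectrum over \<open>\<real>\<close> is
  finite, nonempty and contains all complex eigenvalues.\<close>

definition lambda_min :: "real mat \<Rightarrow> real" where
  "lambda_min M = Min (spectrum M)"

definition lambda_max :: "real mat \<Rightarrow> real" where
  "lambda_max M = Max (spectrum M)"


section \<open>Probability measures on the real line\<close>

definition prob_measures_on :: "real set \<Rightarrow> real measure set" where
  "prob_measures_on S = {\<mu>. prob_space \<mu> \<and> sets \<mu> = sets borel \<and> emeasure \<mu> S = 1}"

text \<open>The topology of weak convergence on all Borel probability measures: the coarsest one
  making \<open>\<mu> \<mapsto> \<integral> f d\<mu>\<close> continuous for every bounded continuous \<open>f\<close>.\<close>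

definition weak_topology :: "real measure topology" where
  "weak_topology = topology_generated_by
     {{\<mu> \<in> prob_measures_on UNIV. (\<integral>x. f x \<partial>\<mu>) \<in> U} | (f :: real \<Rightarrow> real) U.
        continuous_on UNIV f \<and> bounded (range f) \<and> open U}"

definition degenerate :: "real measure \<Rightarrow> bool" where
  "degenerate \<mu> \<longleftrightarrow> (\<exists>x. \<mu> = return borel x)"

definition Supp :: "real measure \<Rightarrow> real set" where
  "Supp \<mu> = {x. \<forall>U. open U \<and> x \<in> U \<longrightarrow> emeasure \<mu> U > 0}"

definition supp_interval :: "real measure \<Rightarrow> real set" where
  "supp_interval \<mu> = {Inf (Supp \<mu>) <..< Sup (Supp \<mu>)}"

definition cgf :: "real measure \<Rightarrow> real \<Rightarrow> real \<Rightarrow> real" where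
  "cgf \<mu> \<gamma> d = ln (\<integral>\<beta>. exp (\<gamma> * \<beta> - d / 2 * \<beta>\<^sup>2) \<partial>\<mu>)"

definition tilt :: "real measure \<Rightarrow> real \<Rightarrow> real \<Rightarrow> real measure" where
  "tilt \<mu> \<gamma> d = density \<mu> (\<lambda>\<beta>. ennreal (exp (\<gamma> * \<beta> - d / 2 * \<beta>\<^sup>2 - cgf \<mu> \<gamma> d)))"

definition cgf_deriv :: "real measure \<Rightarrow> real \<Rightarrow> real \<Rightarrow> real" where
  "cgf_deriv \<mu> \<gamma> d = deriv (\<lambda>g. cgf \<mu> g d) \<gamma>"

text \<open>For non-degenerate compactly supported \<open>\<mu>\<close> and \<open>u \<in> supp_interval \<mu>\<close>, this is the unique
  \<open>\<gamma>\<close> with \<open>cgf_deriv \<mu> \<gamma> d = u\<close>; elsewhere the value is arbitrary.\<close>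

definition hfun :: "real measure \<Rightarrow> real \<Rightarrow> real \<Rightarrow> real" where
  "hfun \<mu> d u = inv_into UNIV (\<lambda>\<gamma>. cgf_deriv \<mu> \<gamma> d) u"

text \<open>The library's \<open>KL_divergence b Q P\<close> is the divergence of \<open>P\<close> from \<open>Q\<close>, with the reference
  measure as first argument. It is real-valued and meaningful when \<open>P\<close> is absolutely
  continuous with respect to \<open>Q\<close> with integrable log-density, as for the tilted and
  posterior laws below.\<close>

definition KL :: "'a measure \<Rightarrow> 'a measure \<Rightarrow> real" where
  "KL P Q = KL_divergence (exp 1) Q P"


section \<open>The regression model\<close>

text \<open>Joint law of \<open>(y, \<beta>)\<close> with \<open>y = X \<beta> + \<epsilon>\<close>, where \<open>\<epsilon>\<close> has i.i.d. \<open>N(0, \<sigma>\<^sup>2)\<close> coordinates and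
  \<open>\<beta>\<close> is independent of \<open>\<epsilon>\<close> with i.i.d. coordinates of law \<open>\<mu>\<close>.\<close>

definition joint_law ::
    "real mat \<Rightarrow> real \<Rightarrow> real measure \<Rightarrow> ((nat \<Rightarrow> real) \<times> (nat \<Rightarrow> real)) measure" where
  "joint_law X \<sigma> \<mu> =
     distr (PiM {..<dim_row X} (\<lambda>_. density lborel (normal_density 0 \<sigma>))
              \<Otimes>\<^sub>M PiM {..<dim_col X} (\<lambda>_. \<mu>))
           (rspace (dim_row X) \<Otimes>\<^sub>M rspace (dim_col X))
           (\<lambda>(\<epsilon>, \<beta>). (\<lambda>i\<in>{..<dim_row X}. (X *\<^sub>v vec (dim_col X) \<beta>) $ i + \<epsilon> i, \<beta>))"

text \<open>\<open>K\<close> is a version of the posterior, i.e. a regular conditional law of \<open>\<beta>\<close> given \<open>y\<close>.\<close>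

definition is_posterior ::
    "real mat \<Rightarrow> real \<Rightarrow> real measure \<Rightarrow> ((nat \<Rightarrow> real) \<Rightarrow> (nat \<Rightarrow> real) measure) \<Rightarrow> bool" where
  "is_posterior X \<sigma> \<mu> K \<longleftrightarrow>
     K \<in> rspace (dim_row X) \<rightarrow>\<^sub>M prob_algebra (rspace (dim_col X)) \<and>
     (\<forall>B \<in> sets (rspace (dim_row X)). \<forall>C \<in> sets (rspace (dim_col X)).
        emeasure (joint_law X \<sigma> \<mu>) (B \<times> C) =
        (\<integral>\<^sup>+y\<in>B. emeasure (K y) C \<partial>distr (joint_law X \<sigma> \<mu>) (rspace (dim_row X)) fst))"

definition mean_vec :: "nat \<Rightarrow> (nat \<Rightarrow> real) measure \<Rightarrow> real vec" where
  "mean_vec p P = vec p (\<lambda>i. \<integral>\<beta>. \<beta> i \<partial>P)"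

definition off_diag :: "real mat \<Rightarrow> real \<Rightarrow> real mat" where
  "off_diag X \<sigma> = mat (dim_col X) (dim_col X)
     (\<lambda>(i, j). if i = j then 0 else (X\<^sup>T * X) $$ (i, j) / \<sigma>\<^sup>2)"

definition diag_coef :: "real mat \<Rightarrow> real \<Rightarrow> nat \<Rightarrow> real" where
  "diag_coef X \<sigma> i = (X\<^sup>T * X) $$ (i, i) / \<sigma>\<^sup>2"

definition wvec :: "real mat \<Rightarrow> real \<Rightarrow> (nat \<Rightarrow> real) \<Rightarrow> real vec" where
  "wvec X \<sigma> y = (1 / \<sigma>\<^sup>2) \<cdot>\<^sub>v (X\<^sup>T *\<^sub>v vec (dim_row X) y)"

definition product_tilt :: "real mat \<Rightarrow> real \<Rightarrow> real measure \<Rightarrow> real vec \<Rightarrow> (nat \<Rightarrow> real) measure" where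
  "product_tilt X \<sigma> \<mu> \<tau> = PiM {..<dim_col X} (\<lambda>i. tilt \<mu> (\<tau> $ i) (diag_coef X \<sigma> i))"

definition hvec :: "real mat \<Rightarrow> real \<Rightarrow> real measure \<Rightarrow> real vec \<Rightarrow> real vec" where
  "hvec X \<sigma> \<mu> u = vec (dim_col X) (\<lambda>i. hfun \<mu> (diag_coef X \<sigma> i) (u $ i))"

definition supp_box :: "nat \<Rightarrow> real measure \<Rightarrow> real vec set" where
  "supp_box p \<mu> = {u \<in> carrier_vec p. \<forall>i<p. u $ i \<in> supp_interval \<mu>}"

definition mf_objective :: "real mat \<Rightarrow> real \<Rightarrow> real vec \<Rightarrow> real vec \<Rightarrow> real measure \<Rightarrow> real" where
  "mf_objective X \<sigma> u v \<mu> =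
     - (1 / 2) * (u \<bullet> (off_diag X \<sigma> *\<^sub>v u)) + u \<bullet> v
     - (\<Sum>i<dim_col X. KL (tilt \<mu> (hfun \<mu> (diag_coef X \<sigma> i) (u $ i)) (diag_coef X \<sigma> i))
                           (tilt \<mu> 0 (diag_coef X \<sigma> i)))"

text \<open>Random vectors are functions of the sample point \<open>\<omega> = (y, \<beta>)\<close>. The suprema are taken in
  \<open>ereal\<close>, so that a supremum over the empty set is \<open>-\<infinity>\<close>.\<close>

definition well_separated_optimizer ::
    "(nat \<Rightarrow> real mat) \<Rightarrow> real \<Rightarrow> real measure \<Rightarrow>
     (nat \<Rightarrow> (nat \<Rightarrow> real) \<times> (nat \<Rightarrow> real) \<Rightarrow> real vec) \<Rightarrow> bool" where
  "well_separated_optimizer X \<sigma> \<mu> ustar \<longleftrightarrow>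
     (\<forall>p\<ge>1. \<forall>\<omega>\<in>space (joint_law (X p) \<sigma> \<mu>). ustar p \<omega> \<in> supp_box p \<mu>) \<and>
     (\<forall>p\<ge>1. \<forall>i<p. (\<lambda>\<omega>. ustar p \<omega> $ i) \<in> borel_measurable (joint_law (X p) \<sigma> \<mu>)) \<and>
     (\<forall>\<delta>>0. \<exists>\<epsilon>>0.
        (\<lambda>p. measure (joint_law (X p) \<sigma> \<mu>)
           {\<omega> \<in> space (joint_law (X p) \<sigma> \<mu>).
              (SUP u \<in> {u \<in> supp_box p \<mu>. sq_dist u (ustar p \<omega>) > real p * \<delta>}.
                 ereal (mf_objective (X p) \<sigma> u (wvec (X p) \<sigma> (fst \<omega>)) \<mu>))
              < (SUP u \<in> supp_box p \<mu>.
                 ereal (mf_objective (X p) \<sigma> u (wvec (X p) \<sigma> (fst \<omega>)) \<mu>)) - ereal (real p * \<epsilon>)})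
        \<longlonglongrightarrow> 1)"


section \<open>Modes of convergence\<close>

text \<open>Convergence in probability along a sequence of probability spaces. Outer measure is used
  because \<open>Z p\<close> is not required to be measurable (arbitrary selections of optimizers, infima
  over couplings), and \<open>measure\<close> would return 0 on a non-measurable set. On measurable events
  it coincides with the probability.\<close>

definition conv_in_prob :: "(nat \<Rightarrow> 'a measure) \<Rightarrow> (nat \<Rightarrow> 'a \<Rightarrow> real) \<Rightarrow> real \<Rightarrow> bool" where
  "conv_in_prob P Z c \<longleftrightarrow>
     (\<forall>\<epsilon>>0. (\<lambda>p. outer_measure_of (P p) {\<omega> \<in> space (P p). \<bar>Z p \<omega> - c\<bar> > \<epsilon>}) \<longlonglongrightarrow> 0)"

definition couplings ::
    "'a measure \<Rightarrow> 'a measure \<Rightarrow> ('a \<times> 'a) measure set" where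
  "couplings P Q = {R. prob_space R \<and> sets R = sets (P \<Otimes>\<^sub>M Q) \<and> distr R P fst = P \<and> distr R Q snd = Q}"

text \<open>Real-valued, hence only meaningful for laws with finite first moments, where the set of
  expected costs is nonempty and consists of genuine finite integrals.\<close>

definition wasserstein1 :: "nat \<Rightarrow> (nat \<Rightarrow> real) measure \<Rightarrow> (nat \<Rightarrow> real) measure \<Rightarrow> real" where
  "wasserstein1 k P Q = (INF R \<in> couplings P Q. \<integral>(x, y). (\<Sum>i<k. \<bar>x i - y i\<bar>) \<partial>R)"

end

theory Submission
  imports Defs
begin

text \<open>
  Given \<open>y\<close>, the posterior is a Gibbs measure with quadratic interaction \<open>A\<close>. Let \<open>\<Pi>\<close> be the product
  of tilts of the prior with the same means. The interaction is the only term that does not cancel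
  in the symmetrized relative entropy, which is \<open>- Tr (A Cov) / 2\<close> with \<open>Cov\<close> the posterior
  covariance. Averaged over the data, \<open>Cov\<close> is at most the covariance of the least squares estimator,
  hence at most \<open>1 / C1\<close> in operator norm, so Cauchy-Schwarz and \<open>Tr (A\<^sup>2) = o(p)\<close> make both
  relative entropies \<open>o(p)\<close>. One of them is the divergence in (ii), which controls the Wasserstein
  distance through a Knothe transport map. The other one is the gap between the log partition function
  and the mean field objective at the posterior mean; the log partition function bounds the objective
  from above, so the posterior mean is a near-maximizer and well-separation places it near \<open>u\<^sup>*\<close>.
  A maximizer for the prior \<open>\<mu>\<^sup>(\<^sup>p\<^sup>)\<close> is moved to a near-maximizer for \<open>\<mu>\<^sup>*\<close> coordinate by coordinate,
  using the uniform continuity in the prior of tilts with truncated parameters.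
\<close>

section \<open>Exponential tilts of laws on the interval [-1, 1]\<close>

text \<open>Against a product of tilts the posterior log-density is a quadratic form in A plus
  affine terms, since the diagonal of X^T X / sigma^2 sits inside the tilts. Matched means cancel
  the affine terms. No operator bound on the covariance is available for a fixed y: the prior is
  arbitrary and the posterior need not be log-concave. The averaged bound holds because y comes from
  the very model whose posterior is taken, so the posterior mean has least mean squared error. For
  the transport, p errors must be added, so Pinsker's inequality is used in a form linear in the
  entropy: the L1 distance is at most KL / s + s for every s > 0. The chain rule sums this to KL / s
  + p s, and KL = o(p) allows an arbitrarily small s. In the change of prior the obstacle is that
  support endpoints are not continuous under weak convergence: mu^(p) may put tiny mass beyond the
  support of mu*. A mean out there costs relative entropy, so the discrepancy of means is charged to
  the divergence terms of the objective, whose sum at a maximizer is O(p) with high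
  probability.\<close>

locale unit_law = prob_space \<mu> for \<mu> :: "real measure" +
  assumes sets_eq [measurable_cong, simp]: "sets \<mu> = sets borel"
    and bounded: "AE x in \<mu>. \<bar>x\<bar> \<le> 1"
begin

lemma space_eq [simp]: "space \<mu> = UNIV"
  using sets_eq_imp_space_eq[OF sets_eq] by simp

lemma prob_UNIV [simp]: "prob UNIV = 1"
  using prob_space by simp

lemma integrable_bdd:
  assumes [measurable]: "f \<in> borel_measurable borel" and "\<And>x. \<bar>x\<bar> \<le> 1 \<Longrightarrow> \<bar>f x\<bar> \<le> (B::real)"
  shows "integrable \<mu> f"
  by (rule integrable_const_bound[where B = B]) (use bounded assms in auto)

lemma abs_integral_le:
  assumes [measurable]: "f \<in> borel_measurable borel" and B: "\<And>x. \<bar>x\<bar> \<le> 1 \<Longrightarrow> \<bar>f x\<bar> \<le> (B::real)"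
  shows "\<bar>\<integral>x. f x \<partial>\<mu>\<bar> \<le> B"
proof -
  have i: "integrable \<mu> f" by (rule integrable_bdd[OF assms])
  have "\<bar>\<integral>x. f x \<partial>\<mu>\<bar> \<le> (\<integral>x. \<bar>f x\<bar> \<partial>\<mu>)" by (rule integral_abs_bound)
  also have "\<dots> \<le> (\<integral>x. B \<partial>\<mu>)"
    by (rule integral_mono_AE) (use i bounded B in auto)
  finally show ?thesis by (simp add: prob_space)
qed

text \<open>Gives access to the generalized inverse of the cdf and to the fact that it pushes the
  uniform law on (0, 1) forward to \<mu>, the basis of all couplings below.\<close>

sublocale cdf_distribution \<mu>
  by unfold_locales auto

end

lemma unit_lawI: "\<mu> \<in> prob_measures_on {-1..1} \<Longrightarrow> unit_law \<mu>"
proof -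
  assume a: "\<mu> \<in> prob_measures_on {-1..1}"
  interpret prob_space \<mu> using a by (simp add: prob_measures_on_def)
  have s[measurable_cong]: "sets \<mu> = sets borel" using a by (simp add: prob_measures_on_def)
  have "AE x in \<mu>. x \<in> {-1..1}"
    using a s by (intro AE_prob_1) (simp add: prob_measures_on_def measure_def)
  hence "AE x in \<mu>. \<bar>x\<bar> \<le> 1" by eventually_elim auto
  thus ?thesis by unfold_locales (use s in auto)
qed

abbreviation expo :: "real \<Rightarrow> real \<Rightarrow> real \<Rightarrow> real" where
  "expo \<gamma> d x \<equiv> \<gamma> * x - d / 2 * x\<^sup>2"

definition pfun :: "real measure \<Rightarrow> real \<Rightarrow> real \<Rightarrow> real" where
  "pfun \<mu> \<gamma> d = (\<integral>x. exp (expo \<gamma> d x) \<partial>\<mu>)"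

text \<open>An integral rather than a derivative, so that nothing about differentiability has to be
  known first; \<open>cgf_deriv_eq\<close> identifies it with \<open>cgf_deriv\<close>.\<close>

definition tmean :: "real measure \<Rightarrow> real \<Rightarrow> real \<Rightarrow> real" where
  "tmean \<mu> \<gamma> d = (\<integral>x. x \<partial>tilt \<mu> \<gamma> d)"

lemma cgf_eq: "cgf \<mu> \<gamma> d = ln (pfun \<mu> \<gamma> d)"
  by (simp add: cgf_def pfun_def)

lemma expo_bound:
  assumes "\<bar>x\<bar> \<le> (1::real)" shows "\<bar>expo \<gamma> d x\<bar> \<le> \<bar>\<gamma>\<bar> + \<bar>d\<bar>"
proof -
  have "x\<^sup>2 \<le> 1" using assms by (simp add: abs_square_le_1)
  hence "\<bar>d / 2 * x\<^sup>2\<bar> \<le> \<bar>d\<bar>" using mult_left_mono[of "x\<^sup>2" 1 "\<bar>d\<bar>"] by (simp add: abs_mult)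
  moreover have "\<bar>\<gamma> * x\<bar> \<le> \<bar>\<gamma>\<bar>" using mult_left_mono[OF assms, of "\<bar>\<gamma>\<bar>"] by (simp add: abs_mult)
  ultimately show ?thesis by linarith
qed

lemma exp_lipschitz:
  fixes a b B :: real
  assumes "a \<le> B" "b \<le> B" shows "\<bar>exp a - exp b\<bar> \<le> exp B * \<bar>a - b\<bar>"
proof -
  have *: "exp x - exp y \<le> exp B * (x - y)" if "x \<ge> y" "x \<le> B" for x y :: real
  proof -
    have "exp x - exp y = exp x * (1 - exp (y - x))" by (simp add: algebra_simps exp_diff)
    also have "1 - exp (y - x) \<le> x - y"
      using exp_ge_add_one_self[of "y - x"] by linarith
    hence "exp x * (1 - exp (y - x)) \<le> exp x * (x - y)" by (intro mult_left_mono) auto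
    also have "\<dots> \<le> exp B * (x - y)" using that by (intro mult_right_mono) auto
    finally show ?thesis .
  qed
  show ?thesis using *[of a b] *[of b a] assms by (cases "a \<ge> b") auto
qed

lemma expo_lipschitz:
  assumes "\<bar>x\<bar> \<le> (1::real)" "\<bar>y\<bar> \<le> 1"
  shows "\<bar>exp (expo \<gamma> d x) - exp (expo \<gamma> d y)\<bar> \<le> exp (\<bar>\<gamma>\<bar> + \<bar>d\<bar>) * (\<bar>\<gamma>\<bar> + \<bar>d\<bar>) * \<bar>x - y\<bar>"
proof -
  have "expo \<gamma> d x - expo \<gamma> d y = (x - y) * (\<gamma> - d / 2 * (x + y))"
    by (simp add: field_simps power2_eq_square)
  moreover have "\<bar>\<gamma> - d / 2 * (x + y)\<bar> \<le> \<bar>\<gamma>\<bar> + \<bar>d\<bar>"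
  proof -
    have "\<bar>d / 2 * (x + y)\<bar> \<le> \<bar>d\<bar> / 2 * 2"
      unfolding abs_mult by (intro mult_mono) (use assms in auto)
    thus ?thesis by simp
  qed
  ultimately have "\<bar>expo \<gamma> d x - expo \<gamma> d y\<bar> \<le> \<bar>x - y\<bar> * (\<bar>\<gamma>\<bar> + \<bar>d\<bar>)"
    by (simp only: abs_mult) (rule mult_left_mono, auto)
  moreover have "\<bar>exp (expo \<gamma> d x) - exp (expo \<gamma> d y)\<bar> \<le> exp (\<bar>\<gamma>\<bar> + \<bar>d\<bar>) * \<bar>expo \<gamma> d x - expo \<gamma> d y\<bar>"
    using expo_bound[OF assms(1), of \<gamma> d] expo_bound[OF assms(2), of \<gamma> d] by (intro exp_lipschitz) auto
  ultimately have "\<bar>exp (expo \<gamma> d x) - exp (expo \<gamma> d y)\<bar> \<le> exp (\<bar>\<gamma>\<bar> + \<bar>d\<bar>) * (\<bar>x - y\<bar> * (\<bar>\<gamma>\<bar> + \<bar>d\<bar>))"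
    by (meson exp_ge_zero mult_left_mono order_trans)
  thus ?thesis by (simp add: mult_ac)
qed

lemma isCont_if_lipschitz_near:
  fixes F :: "real \<Rightarrow> real"
  assumes "\<And>y. \<bar>y - x\<bar> \<le> 1 \<Longrightarrow> \<bar>F y - F x\<bar> \<le> K * \<bar>y - x\<bar>"
  shows "isCont F x"
proof -
  have "((\<lambda>y. F y - F x) \<longlongrightarrow> 0) (at x)"
  proof (rule tendsto_rabs_zero_cancel, rule tendsto_sandwich[OF _ _ tendsto_const])
    show "\<forall>\<^sub>F y in at x. 0 \<le> \<bar>F y - F x\<bar>" by simp
    show "\<forall>\<^sub>F y in at x. \<bar>F y - F x\<bar> \<le> K * \<bar>y - x\<bar>"
      using assms by (auto simp: eventually_at dist_real_def intro!: exI[of _ 1])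
    have "((\<lambda>y. K * \<bar>y - x\<bar>) \<longlongrightarrow> K * \<bar>x - x\<bar>) (at x)" by (intro tendsto_intros)
    thus "((\<lambda>y. K * \<bar>y - x\<bar>) \<longlongrightarrow> 0) (at x)" by simp
  qed
  thus ?thesis unfolding isCont_def by (rule LIM_zero_cancel)
qed

section \<open>Convexity of the cumulant function and continuity of the tilted mean\<close>

context unit_law
begin

lemma exp_expo_bound: "\<bar>x\<bar> \<le> 1 \<Longrightarrow> \<bar>exp (expo \<gamma> d x)\<bar> \<le> exp (\<bar>\<gamma>\<bar> + \<bar>d\<bar>)"
  using expo_bound[of x \<gamma> d] by simp

lemma integrable_expo: "integrable \<mu> (\<lambda>x. exp (expo \<gamma> d x))"
  by (rule integrable_bdd[OF _ exp_expo_bound]) auto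

lemma integrable_expo' [simp]: "integrable \<mu> (\<lambda>x. exp (\<gamma> * x - d * x\<^sup>2 / 2))"
proof -
  have "(\<lambda>x. exp (\<gamma> * x - d * x\<^sup>2 / 2)) = (\<lambda>x. exp (expo \<gamma> d x))" by simp
  thus ?thesis by (metis integrable_expo)
qed

lemma pfun_bounds: "exp (- (\<bar>\<gamma>\<bar> + \<bar>d\<bar>)) \<le> pfun \<mu> \<gamma> d" "pfun \<mu> \<gamma> d \<le> exp (\<bar>\<gamma>\<bar> + \<bar>d\<bar>)"
proof -
  have "(\<integral>x. exp (- (\<bar>\<gamma>\<bar> + \<bar>d\<bar>)) \<partial>\<mu>) \<le> pfun \<mu> \<gamma> d" unfolding pfun_def
  proof (rule integral_mono_AE)
    show "AE x in \<mu>. exp (- (\<bar>\<gamma>\<bar> + \<bar>d\<bar>)) \<le> exp (expo \<gamma> d x)"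
      using bounded
    proof eventually_elim
      case (elim x)
      show ?case using expo_bound[OF elim, of \<gamma> d] unfolding exp_le_cancel_iff by linarith
    qed
  qed auto
  thus "exp (- (\<bar>\<gamma>\<bar> + \<bar>d\<bar>)) \<le> pfun \<mu> \<gamma> d" by (simp add: prob_space)
  show "pfun \<mu> \<gamma> d \<le> exp (\<bar>\<gamma>\<bar> + \<bar>d\<bar>)"
  proof -
    have "\<bar>\<integral>x. exp (expo \<gamma> d x) \<partial>\<mu>\<bar> \<le> exp (\<bar>\<gamma>\<bar> + \<bar>d\<bar>)"
      by (rule abs_integral_le[OF _ exp_expo_bound]) auto
    thus ?thesis unfolding pfun_def by linarith
  qed
qed

lemma pfun_pos: "pfun \<mu> \<gamma> d > 0"
  by (rule less_le_trans[OF exp_gt_zero pfun_bounds(1)])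

lemma exp_cgf: "exp (cgf \<mu> \<gamma> d) = pfun \<mu> \<gamma> d"
  by (simp add: cgf_eq pfun_pos)

lemma tilt_alt: "tilt \<mu> \<gamma> d = density \<mu> (\<lambda>x. ennreal (exp (expo \<gamma> d x) / pfun \<mu> \<gamma> d))"
  by (simp add: tilt_def exp_diff[of _ "cgf \<mu> \<gamma> d"] exp_cgf)

lemma integral_tilt:
  assumes [measurable]: "(f :: real \<Rightarrow> real) \<in> borel_measurable borel"
  shows "(\<integral>x. f x \<partial>tilt \<mu> \<gamma> d) = (\<integral>x. f x * exp (expo \<gamma> d x) \<partial>\<mu>) / pfun \<mu> \<gamma> d"
proof -
  have "(\<integral>x. f x \<partial>tilt \<mu> \<gamma> d) = (\<integral>x. (exp (expo \<gamma> d x) / pfun \<mu> \<gamma> d) *\<^sub>R f x \<partial>\<mu>)"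
    unfolding tilt_alt by (rule integral_density) (use pfun_pos[of \<gamma> d] in \<open>auto intro!: AE_I2\<close>)
  thus ?thesis by (simp add: mult.commute)
qed

lemma AE_tilt_iff:
  assumes [measurable]: "Measurable.pred borel P"
  shows "(AE x in tilt \<mu> \<gamma> d. P x) \<longleftrightarrow> (AE x in \<mu>. P x)"
  unfolding tilt_alt using pfun_pos[of \<gamma> d] by (subst AE_density) auto

lemma unit_law_tilt: "unit_law (tilt \<mu> \<gamma> d)"
proof -
  have "emeasure (tilt \<mu> \<gamma> d) (space (tilt \<mu> \<gamma> d)) = (\<integral>\<^sup>+x. ennreal (exp (expo \<gamma> d x) / pfun \<mu> \<gamma> d) \<partial>\<mu>)"
    unfolding tilt_alt by (subst emeasure_density) auto
  also have "\<dots> = ennreal (\<integral>x. exp (expo \<gamma> d x) / pfun \<mu> \<gamma> d \<partial>\<mu>)"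
    using pfun_pos[of \<gamma> d] by (intro nn_integral_eq_integral) auto
  also have "(\<integral>x. exp (expo \<gamma> d x) / pfun \<mu> \<gamma> d \<partial>\<mu>) = 1"
    using pfun_pos[of \<gamma> d] by (simp add: pfun_def)
  finally have 1: "emeasure (tilt \<mu> \<gamma> d) (space (tilt \<mu> \<gamma> d)) = 1" by simp
  have 2: "sets (tilt \<mu> \<gamma> d) = sets borel" by (simp add: tilt_alt)
  have 3: "AE x in tilt \<mu> \<gamma> d. \<bar>x\<bar> \<le> 1" by (subst AE_tilt_iff) (use bounded in auto)
  show ?thesis
    unfolding unit_law_def unit_law_axioms_def using 1 2 3 by (auto intro: prob_spaceI)
qed

text \<open>Supporting line inequality: \<open>1 + t \<le> exp t\<close> is integrated under the
  tilt at \<gamma>, whose exponential moment of order \<open>\<gamma>' - \<gamma>\<close> is a ratio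
  of partition functions. It stands in for second derivatives: monotonicity of the mean, the
  derivative of \<open>cgf\<close> and the variational form of \<open>rate\<close> all come from
  it.\<close>

lemma cgf_convex: "cgf \<mu> \<gamma>' d \<ge> cgf \<mu> \<gamma> d + (\<gamma>' - \<gamma>) * tmean \<mu> \<gamma> d"
proof -
  interpret t: unit_law "tilt \<mu> \<gamma> d" by (rule unit_law_tilt)
  define b where "b = (\<gamma>' - \<gamma>) * tmean \<mu> \<gamma> d"
  have ix: "integrable (tilt \<mu> \<gamma> d) (\<lambda>x. x)" by (rule t.integrable_bdd) auto
  \<comment> \<open>The bracket \<open>(\<gamma>' - \<gamma>) * x - b\<close> has mean zero under
    the tilt, so it may be inserted before comparing pointwise.\<close>
  have "exp b = (\<integral>x. exp b * (1 + ((\<gamma>' - \<gamma>) * x - b)) \<partial>tilt \<mu> \<gamma> d)"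
    using ix by (simp add: t.prob_space b_def tmean_def)
  also have "\<dots> \<le> (\<integral>x. exp ((\<gamma>' - \<gamma>) * x) \<partial>tilt \<mu> \<gamma> d)"
  proof (rule integral_mono)
    show "integrable (tilt \<mu> \<gamma> d) (\<lambda>x. exp b * (1 + ((\<gamma>' - \<gamma>) * x - b)))" using ix by simp
    show "integrable (tilt \<mu> \<gamma> d) (\<lambda>x. exp ((\<gamma>' - \<gamma>) * x))"
      using t.integrable_expo[of "\<gamma>' - \<gamma>" 0] by simp
    fix x show "exp b * (1 + ((\<gamma>' - \<gamma>) * x - b)) \<le> exp ((\<gamma>' - \<gamma>) * x)"
      using mult_left_mono[OF exp_ge_add_one_self[of "(\<gamma>' - \<gamma>) * x - b"], of "exp b"]
      by (simp add: exp_diff)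
  qed
  also have "\<dots> = pfun \<mu> \<gamma>' d / pfun \<mu> \<gamma> d"
    by (subst integral_tilt) (auto simp: pfun_def exp_add[symmetric] algebra_simps)
  finally have "b \<le> ln (pfun \<mu> \<gamma>' d / pfun \<mu> \<gamma> d)"
    using pfun_pos[of \<gamma>' d] pfun_pos[of \<gamma> d] by (subst ln_ge_iff) auto
  hence "b \<le> ln (pfun \<mu> \<gamma>' d) - ln (pfun \<mu> \<gamma> d)"
    using pfun_pos[of \<gamma>' d] pfun_pos[of \<gamma> d] by (simp add: ln_div)
  thus ?thesis by (simp add: cgf_eq b_def)
qed

text \<open>Adding the supporting line inequalities at \<gamma> and at \<gamma>' cancels the values
  of \<open>cgf\<close>.\<close>

lemma tmean_mono: "\<gamma> \<le> \<gamma>' \<Longrightarrow> tmean \<mu> \<gamma> d \<le> tmean \<mu> \<gamma>' d"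
proof (cases "\<gamma> = \<gamma>'")
  case False
  assume "\<gamma> \<le> \<gamma>'"
  have "(\<gamma>' - \<gamma>) * tmean \<mu> \<gamma> d \<le> (\<gamma>' - \<gamma>) * tmean \<mu> \<gamma>' d"
    using cgf_convex[of \<gamma> d \<gamma>'] cgf_convex[of \<gamma>' d \<gamma>] by (simp add: algebra_simps)
  thus ?thesis using False \<open>\<gamma> \<le> \<gamma>'\<close> by (simp add: mult_le_cancel_left)
qed auto

text \<open>Covers the numerator (\<open>f x = x\<close>) and the denominator
  (\<open>f x = 1\<close>) of the mean at once; both are locally Lipschitz in \<gamma>.\<close>

lemma isCont_weighted:
  assumes [measurable]: "(f :: real \<Rightarrow> real) \<in> borel_measurable borel" and f: "\<And>x. \<bar>x\<bar> \<le> 1 \<Longrightarrow> \<bar>f x\<bar> \<le> 1"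
  shows "isCont (\<lambda>\<gamma>. \<integral>x. f x * exp (expo \<gamma> d x) \<partial>\<mu>) \<gamma>"
proof (rule isCont_if_lipschitz_near[where K = "exp (\<bar>\<gamma>\<bar> + 1 + \<bar>d\<bar>)"])
  fix \<gamma>' assume g: "\<bar>\<gamma>' - \<gamma>\<bar> \<le> 1"
  have i: "integrable \<mu> (\<lambda>x. f x * exp (expo g d x))" for g
  proof (rule integrable_bdd[where B = "1 * exp (\<bar>g\<bar> + \<bar>d\<bar>)"])
    fix x :: real assume "\<bar>x\<bar> \<le> 1" thus "\<bar>f x * exp (expo g d x)\<bar> \<le> 1 * exp (\<bar>g\<bar> + \<bar>d\<bar>)"
      unfolding abs_mult by (intro mult_mono f exp_expo_bound) auto
  qed auto
  have "\<bar>(\<integral>x. f x * exp (expo \<gamma>' d x) \<partial>\<mu>) - (\<integral>x. f x * exp (expo \<gamma> d x) \<partial>\<mu>)\<bar>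
     = \<bar>\<integral>x. f x * (exp (expo \<gamma>' d x) - exp (expo \<gamma> d x)) \<partial>\<mu>\<bar>"
    using i[of \<gamma>'] i[of \<gamma>] by (simp add: right_diff_distrib)
  also have "\<dots> \<le> exp (\<bar>\<gamma>\<bar> + 1 + \<bar>d\<bar>) * \<bar>\<gamma>' - \<gamma>\<bar>"
  proof (rule abs_integral_le)
    fix x :: real assume x: "\<bar>x\<bar> \<le> 1"
    have "\<bar>f x * (exp (expo \<gamma>' d x) - exp (expo \<gamma> d x))\<bar> \<le> 1 * (exp (\<bar>\<gamma>\<bar> + 1 + \<bar>d\<bar>) * \<bar>expo \<gamma>' d x - expo \<gamma> d x\<bar>)"
      unfolding abs_mult
    proof (intro mult_mono f x exp_lipschitz)
      show "expo \<gamma>' d x \<le> \<bar>\<gamma>\<bar> + 1 + \<bar>d\<bar>" "expo \<gamma> d x \<le> \<bar>\<gamma>\<bar> + 1 + \<bar>d\<bar>"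
        using expo_bound[OF x, of \<gamma> d] expo_bound[OF x, of \<gamma>' d] g by linarith+
    qed auto
    also have "expo \<gamma>' d x - expo \<gamma> d x = (\<gamma>' - \<gamma>) * x" by (simp add: left_diff_distrib)
    finally have *: "\<bar>f x * (exp (expo \<gamma>' d x) - exp (expo \<gamma> d x))\<bar> \<le> 1 * (exp (\<bar>\<gamma>\<bar> + 1 + \<bar>d\<bar>) * \<bar>(\<gamma>' - \<gamma>) * x\<bar>)" .
    have "\<bar>(\<gamma>' - \<gamma>) * x\<bar> \<le> \<bar>\<gamma>' - \<gamma>\<bar>"
      using mult_left_mono[OF x, of "\<bar>\<gamma>' - \<gamma>\<bar>"] by (simp add: abs_mult)
    hence "exp (\<bar>\<gamma>\<bar> + 1 + \<bar>d\<bar>) * \<bar>(\<gamma>' - \<gamma>) * x\<bar> \<le> exp (\<bar>\<gamma>\<bar> + 1 + \<bar>d\<bar>) * \<bar>\<gamma>' - \<gamma>\<bar>"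
      by (rule mult_left_mono) simp
    thus "\<bar>f x * (exp (expo \<gamma>' d x) - exp (expo \<gamma> d x))\<bar> \<le> exp (\<bar>\<gamma>\<bar> + 1 + \<bar>d\<bar>) * \<bar>\<gamma>' - \<gamma>\<bar>"
      using * by linarith
  qed simp
  finally show "\<bar>(\<integral>x. f x * exp (expo \<gamma>' d x) \<partial>\<mu>) - (\<integral>x. f x * exp (expo \<gamma> d x) \<partial>\<mu>)\<bar>
     \<le> exp (\<bar>\<gamma>\<bar> + 1 + \<bar>d\<bar>) * \<bar>\<gamma>' - \<gamma>\<bar>" .
qed

lemma isCont_tmean: "isCont (\<lambda>\<gamma>. tmean \<mu> \<gamma> d) \<gamma>"
proof -
  have "tmean \<mu> \<gamma> d = (\<integral>x. x * exp (expo \<gamma> d x) \<partial>\<mu>) / (\<integral>x. 1 * exp (expo \<gamma> d x) \<partial>\<mu>)" for \<gamma>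
    unfolding tmean_def by (subst integral_tilt) (auto simp: pfun_def)
  moreover have "(\<integral>x. 1 * exp (expo \<gamma> d x) \<partial>\<mu>) \<noteq> 0" using pfun_pos[of \<gamma> d] by (simp add: pfun_def)
  ultimately show ?thesis
    using isCont_weighted[of "\<lambda>x. x" \<gamma> d] isCont_weighted[of "\<lambda>x. 1" \<gamma> d] by (auto intro!: continuous_divide)
qed

text \<open>The supporting lines at \<gamma> and at \<gamma> + h trap the difference quotient
  between the means at these two points, so continuity of the mean replaces differentiation under
  the integral.\<close>

lemma DERIV_cgf: "((\<lambda>g. cgf \<mu> g d) has_field_derivative tmean \<mu> \<gamma> d) (at \<gamma>)"
  unfolding DERIV_def
proof (rule LIM_zero_cancel, rule tendsto_rabs_zero_cancel, rule tendsto_sandwich[OF _ _ tendsto_const])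
  show "\<forall>\<^sub>F h in at 0. 0 \<le> \<bar>(cgf \<mu> (\<gamma> + h) d - cgf \<mu> \<gamma> d) / h - tmean \<mu> \<gamma> d\<bar>" by simp
  have "((\<lambda>h. tmean \<mu> (\<gamma> + h) d) \<longlongrightarrow> tmean \<mu> \<gamma> d) (at 0)"
    using isCont_tmean[of \<gamma> d] unfolding isCont_def by (subst (asm) LIM_offset_zero_iff) auto
  hence "((\<lambda>h. \<bar>tmean \<mu> (\<gamma> + h) d - tmean \<mu> \<gamma> d\<bar>) \<longlongrightarrow> \<bar>tmean \<mu> \<gamma> d - tmean \<mu> \<gamma> d\<bar>) (at 0)"
    by (intro tendsto_intros)
  thus "((\<lambda>h. \<bar>tmean \<mu> (\<gamma> + h) d - tmean \<mu> \<gamma> d\<bar>) \<longlongrightarrow> 0) (at 0)" by simp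
  have "\<bar>(cgf \<mu> (\<gamma> + h) d - cgf \<mu> \<gamma> d) / h - tmean \<mu> \<gamma> d\<bar> \<le> \<bar>tmean \<mu> (\<gamma> + h) d - tmean \<mu> \<gamma> d\<bar>" if "h \<noteq> 0" for h
  proof -
    define D where "D = cgf \<mu> (\<gamma> + h) d - cgf \<mu> \<gamma> d"
    have a: "D \<ge> h * tmean \<mu> \<gamma> d" "D \<le> h * tmean \<mu> (\<gamma> + h) d"
      using cgf_convex[of \<gamma> d "\<gamma> + h"] cgf_convex[of "\<gamma> + h" d \<gamma>] by (auto simp: D_def algebra_simps)
    show ?thesis
    proof (cases "h > 0")
      case True
      have "D / h \<ge> tmean \<mu> \<gamma> d" "D / h \<le> tmean \<mu> (\<gamma> + h) d"
        using a True by (auto simp: field_simps)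
      thus ?thesis by (simp add: D_def)
    next
      case False
      hence "h < 0" using that by simp
      hence "D / h \<le> tmean \<mu> \<gamma> d" "D / h \<ge> tmean \<mu> (\<gamma> + h) d"
        using a by (auto simp: field_simps)
      thus ?thesis by (simp add: D_def)
    qed
  qed
  thus "\<forall>\<^sub>F h in at 0. \<bar>(cgf \<mu> (\<gamma> + h) d - cgf \<mu> \<gamma> d) / h - tmean \<mu> \<gamma> d\<bar> \<le> \<bar>tmean \<mu> (\<gamma> + h) d - tmean \<mu> \<gamma> d\<bar>"
    by (auto simp: eventually_at_filter)
qed

lemma cgf_deriv_eq: "cgf_deriv \<mu> \<gamma> d = tmean \<mu> \<gamma> d"
  unfolding cgf_deriv_def by (rule DERIV_imp_deriv[OF DERIV_cgf])

section \<open>Support endpoints and the range of the tilted mean\<close>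

lemma AE_Supp: "AE x in \<mu>. x \<in> Supp \<mu>"
proof -
  obtain \<B> :: "real set set" where B: "countable \<B>" "topological_basis \<B>"
    using ex_countable_basis by blast
  \<comment> \<open>A point off the support has a null neighbourhood, hence a null basic one; there
    are only countably many of these, so their union is null.\<close>
  let ?N = "\<Union>{U \<in> \<B>. emeasure \<mu> U = 0}"
  have "?N \<in> null_sets \<mu>"
  proof (rule null_sets_UN'[of "{U \<in> \<B>. emeasure \<mu> U = 0}" "\<lambda>x. x", simplified])
    show "countable {U \<in> \<B>. emeasure \<mu> U = 0}" by (rule countable_subset[OF _ B(1)]) auto
    fix U assume "U \<in> \<B> \<and> emeasure \<mu> U = 0"
    thus "U \<in> null_sets \<mu>" using topological_basis_open[OF B(2)] by (auto simp: null_sets_def)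
  qed
  moreover have "x \<in> ?N" if "x \<notin> Supp \<mu>" for x
  proof -
    obtain U where U: "open U" "x \<in> U" "emeasure \<mu> U = 0" using \<open>x \<notin> Supp \<mu>\<close> by (auto simp: Supp_def)
    obtain V where V: "V \<in> \<B>" "x \<in> V" "V \<subseteq> U" using topological_basisE[OF B(2) U(1,2)] by blast
    have "emeasure \<mu> V \<le> emeasure \<mu> U" using V U by (intro emeasure_mono) auto
    thus ?thesis using V U by auto
  qed
  ultimately show ?thesis by (intro AE_I'[where N = ?N]) auto
qed

lemma Supp_bounded: "Supp \<mu> \<subseteq> {-1..1}"
proof
  fix x assume x: "x \<in> Supp \<mu>"
  show "x \<in> {-1..1}"
  proof (rule ccontr)
    assume "x \<notin> {-1..1}"
    moreover have "open (- {-1..1::real})" by (simp add: open_Compl)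
    ultimately have "emeasure \<mu> (- {-1..1}) > 0" using x by (auto simp: Supp_def)
    moreover have "AE x in \<mu>. x \<notin> - {-1..1}" using bounded by eventually_elim auto
    hence "emeasure \<mu> (- {-1..1}) = 0" by (subst (asm) AE_iff_measurable[where N = "- {-1..1}"]) auto
    ultimately show False by simp
  qed
qed

lemma Supp_ne: "Supp \<mu> \<noteq> {}"
  using AE_Supp by (auto simp: AE_False)

lemma AE_Supp_bounds: "AE x in \<mu>. Inf (Supp \<mu>) \<le> x \<and> x \<le> Sup (Supp \<mu>)"
  using AE_Supp
proof eventually_elim
  case (elim x)
  have "bdd_below (Supp \<mu>)" "bdd_above (Supp \<mu>)"
    using Supp_bounded bdd_below_mono[of "{-1..1}"] bdd_above_mono[of "{-1..1}"] by auto
  thus ?case using elim by (auto intro: cInf_lower cSup_upper)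
qed

lemma supp_interval_bounded: "supp_interval \<mu> \<subseteq> {-1..1}"
proof -
  have "Inf (Supp \<mu>) \<ge> -1" using Supp_ne Supp_bounded by (intro cInf_greatest) auto
  moreover have "Sup (Supp \<mu>) \<le> 1" using Supp_ne Supp_bounded by (intro cSup_least) auto
  ultimately show ?thesis by (auto simp: supp_interval_def)
qed

lemma degenerateI: "AE x in \<mu>. x = c \<Longrightarrow> degenerate \<mu>"
proof -
  assume a: "AE x in \<mu>. x = c"
  have "\<mu> = return borel c"
  proof (rule measure_eqI)
    fix A assume A: "A \<in> sets \<mu>"
    hence [measurable]: "A \<in> sets borel" by simp
    show "emeasure \<mu> A = emeasure (return borel c) A"
    proof (cases "c \<in> A")
      case True
      have "AE x in \<mu>. x \<in> A" using a by eventually_elim (use True in simp)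
      hence "emeasure \<mu> A = 1" using A emeasure_eq_1_AE by blast
      thus ?thesis using True A by simp
    next
      case False
      have "AE x in \<mu>. x \<notin> A" using a by eventually_elim (use False in auto)
      hence "emeasure \<mu> A = 0" using A by (subst (asm) AE_iff_measurable[where N = A]) auto
      thus ?thesis using False A by simp
    qed
  qed simp
  thus ?thesis by (auto simp: degenerate_def)
qed

text \<open>A mean at an endpoint would force the tilt, and with it the equivalent law \<mu>, to sit
  at that endpoint.\<close>

lemma tmean_in_interval:
  assumes "\<not> degenerate \<mu>" shows "tmean \<mu> \<gamma> d \<in> supp_interval \<mu>"
proof -
  interpret t: unit_law "tilt \<mu> \<gamma> d" by (rule unit_law_tilt)
  have ix [simp]: "integrable (tilt \<mu> \<gamma> d) (\<lambda>x. x)" by (rule t.integrable_bdd) auto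
  \<comment> \<open>The sign s lets one argument serve both ends: \<open>s = 1\<close> at the
    infimum, \<open>s = -1\<close> at the supremum.\<close>
  have *: "(\<integral>x. s * (x - c) \<partial>tilt \<mu> \<gamma> d) > 0" if "AE x in \<mu>. s * (x - c) \<ge> 0" "s \<noteq> 0" for s c
  proof (rule ccontr)
    assume n: "\<not> (\<integral>x. s * (x - c) \<partial>tilt \<mu> \<gamma> d) > 0"
    have ae: "AE x in tilt \<mu> \<gamma> d. s * (x - c) \<ge> 0" using that(1) by (subst AE_tilt_iff) auto
    have "(\<integral>x. s * (x - c) \<partial>tilt \<mu> \<gamma> d) = 0" using integral_nonneg_AE[OF ae] n by simp
    hence "AE x in tilt \<mu> \<gamma> d. s * (x - c) = 0"
      by (subst (asm) integral_nonneg_eq_0_iff_AE) (use ae in auto)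
    hence "AE x in \<mu>. s * (x - c) = 0" by (subst (asm) AE_tilt_iff) auto
    hence "AE x in \<mu>. x = c" by eventually_elim (use that in auto)
    thus False using assms degenerateI by blast
  qed
  have "AE x in \<mu>. 1 * (x - Inf (Supp \<mu>)) \<ge> 0" using AE_Supp_bounds by eventually_elim auto
  from *[OF this] have "Inf (Supp \<mu>) < tmean \<mu> \<gamma> d" by (simp add: tmean_def t.prob_space)
  moreover have "AE x in \<mu>. -1 * (x - Sup (Supp \<mu>)) \<ge> 0" using AE_Supp_bounds by eventually_elim auto
  from *[OF this] have "Sup (Supp \<mu>) > tmean \<mu> \<gamma> d" by (simp add: tmean_def t.prob_space)
  ultimately show ?thesis by (simp add: supp_interval_def)
qed

text \<open>The second claim is phrased with - x to fit the sign parameter of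
  \<open>tmean_far\<close>.\<close>

lemma measure_beyond_Supp:
  assumes "\<epsilon> > 0"
  shows "measure \<mu> {x. x > Sup (Supp \<mu>) - \<epsilon>} > 0" "measure \<mu> {x. - x > - Inf (Supp \<mu>) - \<epsilon>} > 0"
proof -
  obtain s where s: "s \<in> Supp \<mu>" "s > Sup (Supp \<mu>) - \<epsilon>"
    using less_cSupD[OF Supp_ne, of "Sup (Supp \<mu>) - \<epsilon>"] assms by auto
  have "open {x. x > Sup (Supp \<mu>) - \<epsilon>}" by (intro open_Collect_less continuous_intros)
  hence "emeasure \<mu> {x. x > Sup (Supp \<mu>) - \<epsilon>} > 0" using s by (auto simp: Supp_def)
  thus "measure \<mu> {x. x > Sup (Supp \<mu>) - \<epsilon>} > 0" by (simp add: emeasure_eq_measure)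
  obtain r where r: "r \<in> Supp \<mu>" "r < Inf (Supp \<mu>) + \<epsilon>"
    using cInf_lessD[OF Supp_ne, of "Inf (Supp \<mu>) + \<epsilon>"] assms by auto
  have "open {x::real. - x > - Inf (Supp \<mu>) - \<epsilon>}" by (intro open_Collect_less continuous_intros)
  hence "emeasure \<mu> {x. - x > - Inf (Supp \<mu>) - \<epsilon>} > 0" using r by (auto simp: Supp_def)
  thus "measure \<mu> {x. - x > - Inf (Supp \<mu>) - \<epsilon>} > 0" by (simp add: emeasure_eq_measure)
qed

lemma cgf_0_nonpos: "d \<ge> 0 \<Longrightarrow> cgf \<mu> 0 d \<le> 0"
proof -
  assume d: "d \<ge> 0"
  have "pfun \<mu> 0 d \<le> (\<integral>x. 1 \<partial>\<mu>)" unfolding pfun_def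
    using d integrable_expo[of 0 d] by (intro integral_mono) auto
  thus ?thesis by (simp add: cgf_eq prob_space pfun_pos)
qed

text \<open>A positive mass beyond t makes \<open>cgf\<close> grow at least like
  \<open>L * t\<close> in direction s, while the supporting line at \<open>s * L\<close>, evaluated
  at 0, bounds \<open>cgf\<close> above by \<open>s * L\<close> times the mean. Dividing by L leaves
  an error of order 1 / L, uniformly over d.\<close>

lemma tmean_far:
  assumes pos: "measure \<mu> {x. s * x > t} > 0" and \<epsilon>: "\<epsilon> > 0"
  shows "\<exists>L0>0. \<forall>L\<ge>L0. \<forall>d\<in>{0..D}. s * tmean \<mu> (s * L) d \<ge> t - \<epsilon>"
proof -
  define m where "m = measure \<mu> {x. s * x > t}"
  have m: "m > 0" using pos by (simp add: m_def)
  \<comment> \<open>Chosen so that \<open>(D / 2 - ln m) / L \<le> \<epsilon>\<close> for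
    \<open>L \<ge> L0\<close>; the added 1 makes \<open>L0\<close> positive.\<close>
  define L0 where "L0 = (\<bar>D / 2 - ln m\<bar> + 1) / \<epsilon>"
  have "L0 > 0" using \<epsilon> by (simp add: L0_def)
  moreover have "s * tmean \<mu> (s * L) d \<ge> t - \<epsilon>" if L: "L \<ge> L0" and d: "d \<in> {0..D}" for L d
  proof -
    have Lp: "L > 0" using L \<open>L0 > 0\<close> by linarith
    have "exp (L * t - D / 2) * m = (\<integral>x. exp (L * t - D / 2) * indicator {x. s * x > t} x \<partial>\<mu>)"
      by (simp add: m_def)
    also have "\<dots> \<le> pfun \<mu> (s * L) d" unfolding pfun_def
    proof (rule integral_mono_AE)
      show "AE x in \<mu>. exp (L * t - D / 2) * indicator {x. s * x > t} x \<le> exp (expo (s * L) d x)"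
        using bounded
      proof eventually_elim
        case (elim x)
        have "x\<^sup>2 \<le> 1" using elim by (simp add: abs_square_le_1)
        hence "d / 2 * x\<^sup>2 \<le> D / 2 * 1" using d by (intro mult_mono) auto
        moreover have "L * t \<le> s * L * x" if "s * x > t"
          using mult_left_mono[of t "s * x" L] that Lp by (simp add: mult_ac)
        ultimately show ?case by (auto simp: indicator_def)
      qed
    qed (auto intro!: integrable_bdd[where B = 1] simp: indicator_def)
    finally have "ln (exp (L * t - D / 2) * m) \<le> cgf \<mu> (s * L) d"
      unfolding cgf_eq using m pfun_pos by (subst ln_le_cancel_iff) auto
    hence "L * t - D / 2 + ln m \<le> cgf \<mu> (s * L) d" using m by (simp add: ln_mult)
    also have "\<dots> \<le> s * L * tmean \<mu> (s * L) d"
      using cgf_convex[of "s * L" d 0] cgf_0_nonpos[of d] d by (simp add: algebra_simps)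
    finally have "L * t - L * \<epsilon> \<le> L * (s * tmean \<mu> (s * L) d)"
      using L \<epsilon> by (simp add: L0_def field_simps)
    hence "L * (t - \<epsilon>) \<le> L * (s * tmean \<mu> (s * L) d)" by (simp add: algebra_simps)
    thus ?thesis using Lp by (simp add: mult_le_cancel_left)
  qed
  ultimately show ?thesis by blast
qed

lemma tmean_limits:
  assumes \<epsilon>: "\<epsilon> > 0" and D: "D \<ge> 0"
  shows "\<exists>L0>0. \<forall>L\<ge>L0. \<forall>d\<in>{0..D}. tmean \<mu> L d \<ge> Sup (Supp \<mu>) - \<epsilon> \<and> tmean \<mu> (- L) d \<le> Inf (Supp \<mu>) + \<epsilon>"
proof -
  have e2: "\<epsilon> / 2 > 0" using \<epsilon> by simp
  obtain L1 where L1: "L1 > 0" "\<And>L d. L \<ge> L1 \<Longrightarrow> d \<in> {0..D} \<Longrightarrow> tmean \<mu> L d \<ge> Sup (Supp \<mu>) - \<epsilon> / 2 - \<epsilon> / 2"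
    using tmean_far[where s = 1 and t = "Sup (Supp \<mu>) - \<epsilon> / 2", OF _ e2, of D] measure_beyond_Supp(1)[OF e2] by auto
  obtain L2 where L2: "L2 > 0" "\<And>L d. L \<ge> L2 \<Longrightarrow> d \<in> {0..D} \<Longrightarrow> - tmean \<mu> (- L) d \<ge> - Inf (Supp \<mu>) - \<epsilon> / 2 - \<epsilon> / 2"
    using tmean_far[where s = "-1" and t = "- Inf (Supp \<mu>) - \<epsilon> / 2", OF _ e2, of D] measure_beyond_Supp(2)[OF e2] by auto
  have "tmean \<mu> L d \<ge> Sup (Supp \<mu>) - \<epsilon> \<and> tmean \<mu> (- L) d \<le> Inf (Supp \<mu>) + \<epsilon>"
    if "L \<ge> max L1 L2" "d \<in> {0..D}" for L d
    using L1(2)[of L d] L2(2)[of L d] that by simp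
  thus ?thesis using L1(1) by (intro exI[of _ "max L1 L2"]) auto
qed

lemma tmean_surj:
  assumes u: "u \<in> supp_interval \<mu>" and d: "d \<ge> 0" shows "\<exists>\<gamma>. tmean \<mu> \<gamma> d = u"
proof -
  \<comment> \<open>The distance from u to the nearer endpoint: the means at plus and minus a large
    L then bracket u, and the intermediate value theorem applies.\<close>
  define \<epsilon> where "\<epsilon> = min (u - Inf (Supp \<mu>)) (Sup (Supp \<mu>) - u)"
  have "\<epsilon> > 0" using u by (simp add: \<epsilon>_def supp_interval_def)
  from tmean_limits[OF this d] obtain L where "L > 0"
    and L': "\<forall>L'\<ge>L. \<forall>d'\<in>{0..d}. tmean \<mu> L' d' \<ge> Sup (Supp \<mu>) - \<epsilon> \<and> tmean \<mu> (- L') d' \<le> Inf (Supp \<mu>) + \<epsilon>"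
    by blast
  have L: "L > 0" "tmean \<mu> L d \<ge> Sup (Supp \<mu>) - \<epsilon>" "tmean \<mu> (- L) d \<le> Inf (Supp \<mu>) + \<epsilon>"
    using \<open>L > 0\<close> L'[rule_format, of L d] d by auto
  have "\<exists>x\<ge>-L. x \<le> L \<and> tmean \<mu> x d = u"
    using L isCont_tmean[of _ d] by (intro IVT) (auto simp: \<epsilon>_def)
  thus ?thesis by blast
qed

text \<open>\<open>inv_into\<close> yields a right inverse as soon as u is attained;
  \<open>rate_cong\<close> later makes the choice of the preimage immaterial.\<close>

lemma tmean_hfun:
  assumes "u \<in> supp_interval \<mu>" "d \<ge> 0" shows "tmean \<mu> (hfun \<mu> d u) d = u"
proof -
  have "u \<in> range (\<lambda>\<gamma>. cgf_deriv \<mu> \<gamma> d)" using tmean_surj[OF assms] by (auto simp: cgf_deriv_eq)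
  from f_inv_into_f[OF this] show ?thesis by (simp add: hfun_def cgf_deriv_eq)
qed

end

text \<open>The Legendre transform of \<open>\<lambda>g. cgf \<mu> g d - cgf \<mu> 0 d\<close> at
  the mean of the tilt, parametrized by the tilting parameter instead of the mean. By
  \<open>KL_tilt\<close> it is the divergence in the objective.\<close>

definition rate :: "real measure \<Rightarrow> real \<Rightarrow> real \<Rightarrow> real" where
  "rate \<mu> \<gamma> d = \<gamma> * tmean \<mu> \<gamma> d - cgf \<mu> \<gamma> d + cgf \<mu> 0 d"

context unit_law
begin

text \<open>The two tilts share the quadratic term, so their log-density ratio is affine in x and
  its mean needs only \<open>tmean\<close>.\<close>

lemma KL_tilt: "KL (tilt \<mu> \<gamma> d) (tilt \<mu> 0 d) = rate \<mu> \<gamma> d"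
proof -
  interpret t: unit_law "tilt \<mu> \<gamma> d" by (rule unit_law_tilt)
  let ?g = "\<lambda>g x. exp (expo g d x - cgf \<mu> g d)"
  have ix: "integrable (tilt \<mu> \<gamma> d) (\<lambda>x. x)" by (rule t.integrable_bdd) auto
  have "KL (tilt \<mu> \<gamma> d) (tilt \<mu> 0 d) = (\<integral>x. ?g \<gamma> x * log (exp 1) (?g \<gamma> x / ?g 0 x) \<partial>\<mu>)"
    unfolding KL_def tilt_def by (rule KL_density_density) auto
  also have "\<dots> = (\<integral>x. ?g \<gamma> x *\<^sub>R (\<gamma> * x - cgf \<mu> \<gamma> d + cgf \<mu> 0 d) \<partial>\<mu>)"
    by (intro Bochner_Integration.integral_cong refl) (auto simp: log_def exp_diff[symmetric])
  also have "\<dots> = (\<integral>x. (\<gamma> * x - cgf \<mu> \<gamma> d + cgf \<mu> 0 d) \<partial>tilt \<mu> \<gamma> d)"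
    unfolding tilt_def by (rule integral_density[symmetric]) auto
  also have "\<dots> = rate \<mu> \<gamma> d"
    using ix by (simp add: rate_def tmean_def t.prob_space)
  finally show ?thesis .
qed

text \<open>Each \<delta> gives an affine lower bound in the mean, with equality at
  \<open>\<delta> = \<gamma>\<close>. The comparisons of rates below consist in choosing this slope:
  a clamped parameter, or plus and minus a large M.\<close>

lemma rate_ge: "rate \<mu> \<gamma> d \<ge> \<delta> * tmean \<mu> \<gamma> d - cgf \<mu> \<delta> d + cgf \<mu> 0 d"
  using cgf_convex[of \<gamma> d \<delta>] by (simp add: rate_def algebra_simps)

lemma rate_nonneg: "rate \<mu> \<gamma> d \<ge> 0"
  using rate_ge[of 0 \<gamma> d] by simp

text \<open>Each rate is an upper bound for the affine bound that defines the other at the common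
  mean. Hence \<open>hfun\<close> may be replaced by any parameter with the right mean.\<close>

lemma rate_cong: "tmean \<mu> \<gamma> d = tmean \<mu> \<gamma>' d \<Longrightarrow> rate \<mu> \<gamma> d = rate \<mu> \<gamma>' d"
  using rate_ge[of \<gamma> \<gamma>' d] rate_ge[of \<gamma>' \<gamma> d] by (simp add: rate_def)

end

section \<open>Quantile couplings\<close>

definition U01 :: "real measure" where "U01 = restrict_space lborel {0<..<1}"

definition quantile :: "real measure \<Rightarrow> real \<Rightarrow> real" where
  "quantile M \<omega> = Inf {x. \<omega> \<le> cdf M x}"

text \<open>The Wasserstein-1 distance of two laws on the line, in its quantile form.\<close>

definition qdist :: "real measure \<Rightarrow> real measure \<Rightarrow> real" where
  "qdist \<mu> \<nu> = (\<integral>\<omega>. \<bar>quantile \<mu> \<omega> - quantile \<nu> \<omega>\<bar> \<partial>U01)"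

lemma space_U01 [simp]: "space U01 = {0<..<1}"
  by (simp add: U01_def space_restrict_space)

lemma prob_space_U01: "prob_space U01"
  by (auto simp: U01_def space_restrict_space emeasure_restrict_space intro!: prob_spaceI)

interpretation U01: prob_space U01 by (rule prob_space_U01)

lemma integrable_U01:
  assumes [measurable]: "f \<in> borel_measurable U01" and "AE x in U01. \<bar>f x\<bar> \<le> (B::real)"
  shows "integrable U01 f"
  by (rule U01.integrable_const_bound[where B = B]) (use assms in auto)

context unit_law
begin

lemma quantile_le_iff: "0 < \<omega> \<Longrightarrow> \<omega> < 1 \<Longrightarrow> quantile \<mu> \<omega> \<le> t \<longleftrightarrow> \<omega> \<le> cdf \<mu> t"
  using pseudoinverse[of \<omega> t] by (simp add: quantile_def)

lemma measurable_quantile [measurable]: "quantile \<mu> \<in> borel_measurable U01"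
proof -
  have "quantile \<mu> \<in> borel_measurable (restrict_space borel {0<..<1})"
    using measurable_CI by (simp add: quantile_def[abs_def])
  thus ?thesis by (simp add: U01_def cong: measurable_cong_sets sets_restrict_space_cong)
qed

lemma distr_quantile: "distr U01 borel (quantile \<mu>) = \<mu>"
  using distr_I_eq_M by (simp add: U01_def quantile_def[abs_def])

lemma AE_quantile:
  assumes [measurable]: "Measurable.pred borel P" and "AE x in \<mu>. P x"
  shows "AE \<omega> in U01. P (quantile \<mu> \<omega>)"
proof -
  have "AE x in distr U01 borel (quantile \<mu>). P x" unfolding distr_quantile by (rule assms(2))
  thus ?thesis by (subst (asm) AE_distr_iff) auto
qed

lemma AE_quantile_bounded: "AE \<omega> in U01. \<bar>quantile \<mu> \<omega>\<bar> \<le> 1"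
  by (rule AE_quantile) (use bounded in auto)

lemma integral_quantile:
  assumes [measurable]: "(f :: real \<Rightarrow> real) \<in> borel_measurable borel"
  shows "(\<integral>x. f x \<partial>\<mu>) = (\<integral>\<omega>. f (quantile \<mu> \<omega>) \<partial>U01)"
  by (subst distr_quantile[symmetric], subst integral_distr) auto

lemma integrable_quantile: "integrable U01 (quantile \<mu>)"
  by (rule integrable_U01[OF _ AE_quantile_bounded]) auto

end

text \<open>Layer-cake form of a distance: |a - b| is the length of the set of thresholds that
  separate a from b.\<close>

lemma nn_integral_indicator_diff:
  assumes "\<bar>a\<bar> \<le> 1" "\<bar>b\<bar> \<le> (1::real)"
  shows "(\<integral>\<^sup>+t. ennreal \<bar>indicator {..t} a - indicator {..t} b\<bar> * indicator {-1..1} t \<partial>lborel) = ennreal \<bar>a - b\<bar>"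
proof -
  have "(\<integral>\<^sup>+t. ennreal \<bar>indicator {..t} a - indicator {..t} b\<bar> * indicator {-1..1} t \<partial>lborel)
      = (\<integral>\<^sup>+t. indicator {min a b..<max a b} t \<partial>lborel)"
    using assms by (intro nn_integral_cong) (auto simp: indicator_def min_def max_def)
  thus ?thesis by (simp add: min_def max_def)
qed

locale two_unit_laws = M: unit_law \<mu> + N: unit_law \<nu> for \<mu> \<nu>
begin

lemma integrable_qdiff: "integrable U01 (\<lambda>\<omega>. \<bar>quantile \<mu> \<omega> - quantile \<nu> \<omega>\<bar>)"
  using M.integrable_quantile N.integrable_quantile by auto

lemma qdist_nonneg: "qdist \<mu> \<nu> \<ge> 0"
  unfolding qdist_def by (rule integral_nonneg_AE) simp

lemma nn_qdist: "(\<integral>\<^sup>+\<omega>. ennreal \<bar>quantile \<mu> \<omega> - quantile \<nu> \<omega>\<bar> \<partial>U01) = ennreal (qdist \<mu> \<nu>)"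
  unfolding qdist_def by (intro nn_integral_eq_integral integrable_qdiff) auto

text \<open>Averages the layer-cake identity over the quantile coupling. As an integral over
  thresholds, \<open>qdist\<close> can be compared with differences of cdfs.\<close>

lemma qdist_fubini:
  "(\<integral>\<^sup>+t. (\<integral>\<^sup>+\<omega>. ennreal \<bar>indicator {..t} (quantile \<mu> \<omega>) - indicator {..t} (quantile \<nu> \<omega>)\<bar> \<partial>U01) * indicator {-1..1} t \<partial>lborel)
   = ennreal (qdist \<mu> \<nu>)"
proof -
  interpret P: pair_sigma_finite U01 lborel ..
  have m: "(\<lambda>x. indicator {..snd x} (f (fst x)) :: real) \<in> borel_measurable (U01 \<Otimes>\<^sub>M lborel)"
    if [measurable]: "f \<in> borel_measurable U01" for f :: "real \<Rightarrow> real"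
  proof -
    have "(\<lambda>x. indicator {..snd x} (f (fst x)) :: real) = (\<lambda>x. if f (fst x) \<le> snd x then 1 else 0)"
      by (auto simp: indicator_def)
    thus ?thesis by simp
  qed
  note [measurable] = m[OF M.measurable_quantile] m[OF N.measurable_quantile]
  have "(\<integral>\<^sup>+t. (\<integral>\<^sup>+\<omega>. ennreal \<bar>indicator {..t} (quantile \<mu> \<omega>) - indicator {..t} (quantile \<nu> \<omega>)\<bar> \<partial>U01) * indicator {-1..1} t \<partial>lborel)
     = (\<integral>\<^sup>+t. (\<integral>\<^sup>+\<omega>. ennreal \<bar>indicator {..t} (quantile \<mu> \<omega>) - indicator {..t} (quantile \<nu> \<omega>)\<bar> * indicator {-1..1} t \<partial>U01) \<partial>lborel)"
  proof (intro nn_integral_cong nn_integral_multc[symmetric])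
    fix t :: real
    show "(\<lambda>\<omega>. ennreal \<bar>indicator {..t} (quantile \<mu> \<omega>) - indicator {..t} (quantile \<nu> \<omega>)\<bar>) \<in> borel_measurable U01"
      by measurable
  qed
  also have "\<dots> = (\<integral>\<^sup>+\<omega>. (\<integral>\<^sup>+t. ennreal \<bar>indicator {..t} (quantile \<mu> \<omega>) - indicator {..t} (quantile \<nu> \<omega>)\<bar> * indicator {-1..1} t \<partial>lborel) \<partial>U01)"
    by (rule P.Fubini'[where f = "\<lambda>\<omega> t. ennreal \<bar>indicator {..t} (quantile \<mu> \<omega>) - indicator {..t} (quantile \<nu> \<omega>)\<bar> * indicator {-1..1} t"])
       (simp add: split_beta')
  also have "\<dots> = (\<integral>\<^sup>+\<omega>. ennreal \<bar>quantile \<mu> \<omega> - quantile \<nu> \<omega>\<bar> \<partial>U01)"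
  proof (rule nn_integral_cong_AE)
    show "AE \<omega> in U01. (\<integral>\<^sup>+t. ennreal \<bar>indicator {..t} (quantile \<mu> \<omega>) - indicator {..t} (quantile \<nu> \<omega>)\<bar> * indicator {-1..1} t \<partial>lborel)
       = ennreal \<bar>quantile \<mu> \<omega> - quantile \<nu> \<omega>\<bar>"
      using M.AE_quantile_bounded N.AE_quantile_bounded
      by eventually_elim (rule nn_integral_indicator_diff)
  qed
  finally show ?thesis by (simp add: nn_qdist)
qed

text \<open>For a fixed threshold t the two quantiles lie on different sides of t exactly when
  \<omega> falls between the two cdf values, an event whose probability is at most their
  difference.\<close>

lemma qdist_le_cdf:
  "ennreal (qdist \<mu> \<nu>) \<le> (\<integral>\<^sup>+t. ennreal \<bar>cdf \<mu> t - cdf \<nu> t\<bar> * indicator {-1..1} t \<partial>lborel)"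
  unfolding qdist_fubini[symmetric]
proof (intro nn_integral_mono mult_right_mono)
  fix t :: real
  have "(\<integral>\<^sup>+\<omega>. ennreal \<bar>indicator {..t} (quantile \<mu> \<omega>) - indicator {..t} (quantile \<nu> \<omega>)\<bar> \<partial>U01)
     = (\<integral>\<^sup>+\<omega>. indicator {min (cdf \<mu> t) (cdf \<nu> t)<..max (cdf \<mu> t) (cdf \<nu> t)} \<omega> \<partial>U01)"
    by (intro nn_integral_cong) (auto simp: indicator_def M.quantile_le_iff N.quantile_le_iff min_def max_def)
  also have "\<dots> = (\<integral>\<^sup>+\<omega>. indicator {min (cdf \<mu> t) (cdf \<nu> t)<..max (cdf \<mu> t) (cdf \<nu> t)} \<omega> * indicator {0<..<1} \<omega> \<partial>lborel)"
    unfolding U01_def by (subst nn_integral_restrict_space) (auto simp: mult.commute)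
  also have "\<dots> \<le> (\<integral>\<^sup>+\<omega>. indicator {min (cdf \<mu> t) (cdf \<nu> t)<..max (cdf \<mu> t) (cdf \<nu> t)} \<omega> \<partial>lborel)"
    by (intro nn_integral_mono) (auto simp: indicator_def)
  also have "\<dots> = ennreal \<bar>cdf \<mu> t - cdf \<nu> t\<bar>" by (simp add: min_def max_def)
  finally show "(\<integral>\<^sup>+\<omega>. ennreal \<bar>indicator {..t} (quantile \<mu> \<omega>) - indicator {..t} (quantile \<nu> \<omega>)\<bar> \<partial>U01)
     \<le> ennreal \<bar>cdf \<mu> t - cdf \<nu> t\<bar>" .
qed simp

text \<open>The easy half of Kantorovich duality, read off from the quantile coupling.\<close>

lemma lipschitz_integral_diff:
  assumes [measurable]: "(f :: real \<Rightarrow> real) \<in> borel_measurable borel"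
    and lip: "\<And>x y. \<bar>x\<bar> \<le> 1 \<Longrightarrow> \<bar>y\<bar> \<le> 1 \<Longrightarrow> \<bar>f x - f y\<bar> \<le> \<Lambda> * \<bar>x - y\<bar>"
  shows "\<bar>(\<integral>x. f x \<partial>\<mu>) - (\<integral>x. f x \<partial>\<nu>)\<bar> \<le> \<Lambda> * qdist \<mu> \<nu>"
proof -
  have b: "\<bar>f x\<bar> \<le> \<bar>f 0\<bar> + \<bar>\<Lambda>\<bar>" if "\<bar>x\<bar> \<le> 1" for x
  proof -
    have "\<Lambda> * \<bar>x\<bar> \<le> \<bar>\<Lambda>\<bar> * 1"
      by (metis abs_ge_self abs_ge_zero mult_mono that)
    thus ?thesis using lip[of x 0] that by simp
  qed
  have i: "integrable U01 (\<lambda>\<omega>. f (quantile \<mu> \<omega>))" "integrable U01 (\<lambda>\<omega>. f (quantile \<nu> \<omega>))"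
    by (rule integrable_U01[where B = "\<bar>f 0\<bar> + \<bar>\<Lambda>\<bar>"]; use M.AE_quantile_bounded N.AE_quantile_bounded b in auto)+
  have "\<bar>(\<integral>x. f x \<partial>\<mu>) - (\<integral>x. f x \<partial>\<nu>)\<bar> = \<bar>\<integral>\<omega>. f (quantile \<mu> \<omega>) - f (quantile \<nu> \<omega>) \<partial>U01\<bar>"
    using i by (simp add: M.integral_quantile N.integral_quantile)
  also have "\<dots> \<le> (\<integral>\<omega>. \<bar>f (quantile \<mu> \<omega>) - f (quantile \<nu> \<omega>)\<bar> \<partial>U01)" by (rule integral_abs_bound)
  also have "\<dots> \<le> (\<integral>\<omega>. \<Lambda> * \<bar>quantile \<mu> \<omega> - quantile \<nu> \<omega>\<bar> \<partial>U01)"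
  proof (rule integral_mono_AE)
    show "AE \<omega> in U01. \<bar>f (quantile \<mu> \<omega>) - f (quantile \<nu> \<omega>)\<bar> \<le> \<Lambda> * \<bar>quantile \<mu> \<omega> - quantile \<nu> \<omega>\<bar>"
      using M.AE_quantile_bounded N.AE_quantile_bounded by eventually_elim (rule lip)
    show "integrable U01 (\<lambda>\<omega>. \<bar>f (quantile \<mu> \<omega>) - f (quantile \<nu> \<omega>)\<bar>)" using i by auto
    show "integrable U01 (\<lambda>\<omega>. \<Lambda> * \<bar>quantile \<mu> \<omega> - quantile \<nu> \<omega>\<bar>)" using integrable_qdiff by auto
  qed
  finally show ?thesis by (simp add: qdist_def)
qed

lemma mean_diff: "\<bar>(\<integral>x. x \<partial>\<mu>) - (\<integral>x. x \<partial>\<nu>)\<bar> \<le> qdist \<mu> \<nu>"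
  using lipschitz_integral_diff[of "\<lambda>x. x" 1] by simp

lemma qdist_dominated:
  assumes "\<And>t. cdf \<nu> t \<le> cdf \<mu> t"
  shows "qdist \<mu> \<nu> = (\<integral>x. x \<partial>\<nu>) - (\<integral>x. x \<partial>\<mu>)"
proof -
  have "quantile \<mu> \<omega> \<le> quantile \<nu> \<omega>" if w: "\<omega> \<in> {0<..<1}" for \<omega>
  proof -
    have "\<omega> \<le> cdf \<nu> (quantile \<nu> \<omega>)" using w N.quantile_le_iff[of \<omega> "quantile \<nu> \<omega>"] by simp
    hence "\<omega> \<le> cdf \<mu> (quantile \<nu> \<omega>)" using assms order_trans by blast
    thus ?thesis using w M.quantile_le_iff[of \<omega> "quantile \<nu> \<omega>"] by simp
  qed
  hence "qdist \<mu> \<nu> = (\<integral>\<omega>. quantile \<nu> \<omega> - quantile \<mu> \<omega> \<partial>U01)"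
    unfolding qdist_def by (intro Bochner_Integration.integral_cong) auto
  thus ?thesis using M.integrable_quantile N.integrable_quantile
    by (simp add: M.integral_quantile N.integral_quantile)
qed

end

lemma qdist_commute: "qdist \<mu> \<nu> = qdist \<nu> \<mu>"
  by (simp add: qdist_def abs_minus_commute)

lemma qdist_triangle:
  assumes "unit_law a" "unit_law b" "unit_law c"
  shows "qdist a c \<le> qdist a b + qdist b c"
proof -
  interpret A: unit_law a by fact
  interpret B: unit_law b by fact
  interpret C: unit_law c by fact
  note i = A.integrable_quantile B.integrable_quantile C.integrable_quantile
  have "qdist a c \<le> (\<integral>\<omega>. \<bar>quantile a \<omega> - quantile b \<omega>\<bar> + \<bar>quantile b \<omega> - quantile c \<omega>\<bar> \<partial>U01)"
    unfolding qdist_def using i by (intro integral_mono) auto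
  also have "\<dots> = qdist a b + qdist b c"
    unfolding qdist_def using i by (intro Bochner_Integration.integral_add) auto
  finally show ?thesis .
qed

text \<open>The cdfs converge off the countably many discontinuities of the limit, and dominated
  convergence on [-1, 1] applies to the bound of \<open>qdist_le_cdf\<close>.\<close>

lemma qdist_tendsto_0:
  assumes "\<And>p. unit_law (\<mu>s p)" "unit_law \<mu>" and conv: "weak_conv_m \<mu>s \<mu>"
  shows "(\<lambda>p. qdist \<mu> (\<mu>s p)) \<longlonglongrightarrow> 0"
proof -
  interpret unit_law \<mu> by fact
  interpret S: unit_law "\<mu>s p" for p by fact
  interpret two: two_unit_laws \<mu> "\<mu>s p" for p by unfold_locales
  define f where "f p t = indicator {-1..1} t * \<bar>cdf \<mu> t - cdf (\<mu>s p) t\<bar>" for p t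
  have [measurable]: "f p \<in> borel_measurable lborel" for p unfolding f_def by measurable
  have fb: "\<bar>f p t\<bar> \<le> indicator {-1..1} t" for p t
    using cdf_bounded_prob[of t] cdf_nonneg[of t] S.cdf_bounded_prob[of p t] S.cdf_nonneg[of p t]
    by (auto simp: f_def indicator_def)
  have int: "integrable lborel (\<lambda>t. indicator {-1..1::real} t :: real)" by simp
  have fi: "integrable lborel (f p)" for p
    by (rule Bochner_Integration.integrable_bound[OF int]) (use fb in auto)
  have le: "qdist \<mu> (\<mu>s p) \<le> (\<integral>t. f p t \<partial>lborel)" for p
  proof -
    have "ennreal (qdist \<mu> (\<mu>s p)) \<le> (\<integral>\<^sup>+t. ennreal (f p t) \<partial>lborel)"
      using two.qdist_le_cdf[of p] unfolding f_def by (simp add: ennreal_mult'' ennreal_indicator mult.commute)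
    also have "\<dots> = ennreal (\<integral>t. f p t \<partial>lborel)"
      by (rule nn_integral_eq_integral[OF fi]) (simp add: f_def)
    moreover have "(\<integral>t. f p t \<partial>lborel) \<ge> 0" by (rule integral_nonneg_AE) (simp add: f_def)
    ultimately show ?thesis by (metis (no_types, lifting) ennreal_le_iff order_trans)
  qed
  have "countable {t. \<not> isCont (cdf \<mu>) t}"
    using mono_ctble_discont[OF mono] by simp
  hence "{t. \<not> isCont (cdf \<mu>) t} \<in> null_sets lborel" by (rule countable_imp_null_set_lborel)
  hence "AE t in lborel. t \<notin> {t. \<not> isCont (cdf \<mu>) t}" by (rule AE_not_in)
  hence ae: "AE t in lborel. (\<lambda>p. f p t) \<longlonglongrightarrow> 0"
  proof eventually_elim
    case (elim t)
    hence "(\<lambda>p. cdf (\<mu>s p) t) \<longlonglongrightarrow> cdf \<mu> t" using conv by (simp add: weak_conv_m_def weak_conv_def)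
    hence "(\<lambda>p. indicator {-1..1} t * \<bar>cdf \<mu> t - cdf (\<mu>s p) t\<bar>) \<longlonglongrightarrow> indicator {-1..1} t * \<bar>cdf \<mu> t - cdf \<mu> t\<bar>"
      by (intro tendsto_intros)
    thus ?case by (simp add: f_def)
  qed
  have "(\<lambda>p. \<integral>t. f p t \<partial>lborel) \<longlonglongrightarrow> integral\<^sup>L lborel (\<lambda>t::real. 0)"
  proof (rule integral_dominated_convergence[where w = "\<lambda>t. indicator {-1..1::real} t"])
    show "AE t in lborel. (\<lambda>p. f p t) \<longlonglongrightarrow> 0" by (rule ae)
    show "AE t in lborel. norm (f p t) \<le> indicator {-1..1} t" for p using fb by simp
  qed auto
  hence "(\<lambda>p. \<integral>t. f p t \<partial>lborel) \<longlonglongrightarrow> 0" by simp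
  thus ?thesis
    by (rule tendsto_sandwich[OF _ _ tendsto_const[of 0], rotated 2])
       (use le two.qdist_nonneg in \<open>auto intro!: always_eventually\<close>)
qed

section \<open>Tilts of one law are stochastically ordered\<close>

context unit_law
begin

lemma cdf_tilt: "cdf (tilt \<mu> \<gamma> d) t = (\<integral>x. indicator {..t} x * exp (expo \<gamma> d x) \<partial>\<mu>) / pfun \<mu> \<gamma> d"
proof -
  interpret t: unit_law "tilt \<mu> \<gamma> d" by (rule unit_law_tilt)
  have "cdf (tilt \<mu> \<gamma> d) t = (\<integral>x. indicator {..t} x \<partial>tilt \<mu> \<gamma> d)" by (simp add: cdf_def)
  thus ?thesis by (subst (asm) integral_tilt) auto
qed

text \<open>Monotone likelihood ratio: passing from \<gamma> to \<gamma>' multiplies the weight by a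
  nondecreasing function of x.\<close>

lemma cdf_tilt_antimono:
  assumes "\<gamma> \<le> \<gamma>'" shows "cdf (tilt \<mu> \<gamma>' d) t \<le> cdf (tilt \<mu> \<gamma> d) t"
proof -
  \<comment> \<open>\<open>A\<close> and \<open>B\<close> are the unnormalized masses left and right
    of t, and \<open>k\<close> is the likelihood ratio at t: the left mass is multiplied by at most
    \<open>k\<close>, the right mass by at least \<open>k\<close>.\<close>
  define A where "A g = (\<integral>x. indicator {..t} x * exp (expo g d x) \<partial>\<mu>)" for g
  define B where "B g = (\<integral>x. indicator {t<..} x * exp (expo g d x) \<partial>\<mu>)" for g
  define k where "k = exp ((\<gamma>' - \<gamma>) * t)"
  have i: "integrable \<mu> (\<lambda>x. indicator S x * exp (expo g d x))" if [measurable]: "S \<in> sets borel" for S g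
    by (rule integrable_bdd[where B = "exp (\<bar>g\<bar> + \<bar>d\<bar>)"])
       (auto simp: indicator_def intro!: exp_expo_bound[of _ g d, simplified])
  have split: "pfun \<mu> g d = A g + B g" for g
  proof -
    have "pfun \<mu> g d = (\<integral>x. indicator {..t} x * exp (expo g d x) + indicator {t<..} x * exp (expo g d x) \<partial>\<mu>)"
      unfolding pfun_def by (intro Bochner_Integration.integral_cong) (auto simp: indicator_def)
    also have "\<dots> = A g + B g" unfolding A_def B_def by (intro Bochner_Integration.integral_add i) auto
    finally show ?thesis .
  qed
  have A0: "A g \<ge> 0" and B0: "B g \<ge> 0" for g
    unfolding A_def B_def by (auto intro!: integral_nonneg_AE)
  have e: "exp (expo \<gamma>' d x) = exp ((\<gamma>' - \<gamma>) * x) * exp (expo \<gamma> d x)" for x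
    by (simp add: exp_add[symmetric] algebra_simps)
  have "A \<gamma>' \<le> (\<integral>x. k * (indicator {..t} x * exp (expo \<gamma> d x)) \<partial>\<mu>)"
    unfolding A_def
  proof (rule integral_mono)
    fix x show "indicator {..t} x * exp (expo \<gamma>' d x) \<le> k * (indicator {..t} x * exp (expo \<gamma> d x))"
      unfolding e k_def using assms by (auto simp: indicator_def mult_left_mono)
  qed (auto intro!: i[simplified] integrable_mult_right)
  hence A: "A \<gamma>' \<le> k * A \<gamma>" by (simp add: A_def)
  have "B \<gamma>' \<ge> (\<integral>x. k * (indicator {t<..} x * exp (expo \<gamma> d x)) \<partial>\<mu>)"
    unfolding B_def
  proof (rule integral_mono)
    fix x show "indicator {t<..} x * exp (expo \<gamma>' d x) \<ge> k * (indicator {t<..} x * exp (expo \<gamma> d x))"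
      unfolding e k_def using assms by (auto simp: indicator_def mult_left_mono)
  qed (auto intro!: i[simplified] integrable_mult_right)
  hence B: "B \<gamma>' \<ge> k * B \<gamma>" by (simp add: B_def)
  have "A \<gamma>' * B \<gamma> \<le> k * A \<gamma> * B \<gamma>" using A B0[of \<gamma>] by (intro mult_right_mono) auto
  also have "\<dots> \<le> A \<gamma> * B \<gamma>'" using mult_left_mono[OF B A0[of \<gamma>]] by (simp add: mult_ac)
  finally have AB: "A \<gamma>' * B \<gamma> \<le> A \<gamma> * B \<gamma>'" .
  have "A \<gamma>' / pfun \<mu> \<gamma>' d \<le> A \<gamma> / pfun \<mu> \<gamma> d"
  proof (subst frac_le_eq)
    show "(A \<gamma>' * pfun \<mu> \<gamma> d - A \<gamma> * pfun \<mu> \<gamma>' d) / (pfun \<mu> \<gamma>' d * pfun \<mu> \<gamma> d) \<le> 0"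
      using AB pfun_pos[of \<gamma> d] pfun_pos[of \<gamma>' d]
      by (intro divide_nonpos_pos mult_pos_pos) (auto simp: split algebra_simps)
  qed (use pfun_pos[of \<gamma> d] pfun_pos[of \<gamma>' d] in auto)
  thus ?thesis unfolding cdf_tilt A_def .
qed

text \<open>In an ordered family the Wasserstein distance reduces to means. This is what turns
  closeness of posterior means into closeness of product laws.\<close>

lemma qdist_tilt: "qdist (tilt \<mu> \<gamma> d) (tilt \<mu> \<gamma>' d) = \<bar>tmean \<mu> \<gamma> d - tmean \<mu> \<gamma>' d\<bar>"
proof -
  have *: "qdist (tilt \<mu> \<gamma> d) (tilt \<mu> \<gamma>' d) = tmean \<mu> \<gamma>' d - tmean \<mu> \<gamma> d" if "\<gamma> \<le> \<gamma>'" for \<gamma> \<gamma>'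
  proof -
    interpret two_unit_laws "tilt \<mu> \<gamma> d" "tilt \<mu> \<gamma>' d"
      unfolding two_unit_laws_def using unit_law_tilt by auto
    show ?thesis unfolding tmean_def by (rule qdist_dominated) (rule cdf_tilt_antimono[OF that])
  qed
  show ?thesis
    using *[of \<gamma> \<gamma>'] *[of \<gamma>' \<gamma>] tmean_mono[of \<gamma> \<gamma>' d] tmean_mono[of \<gamma>' \<gamma> d] qdist_commute[of "tilt \<mu> \<gamma> d" "tilt \<mu> \<gamma>' d"]
    by (cases "\<gamma> \<le> \<gamma>'") auto
qed

end

section \<open>Dependence on the prior\<close>

lemma ln_diff_le:
  fixes x y :: real
  assumes "x \<ge> c" "y \<ge> c" "c > 0" shows "\<bar>ln x - ln y\<bar> \<le> \<bar>x - y\<bar> / c"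
proof -
  have *: "ln x - ln y \<le> \<bar>x - y\<bar> / c" if "x \<ge> c" "y \<ge> c" for x y
  proof -
    \<comment> \<open>Here \<open>ln_diff_le\<close> is the library fact
      \<open>ln x - ln y \<le> (x - y) / y\<close>, which the present lemma shadows
      afterwards.\<close>
    have "ln x - ln y \<le> (x - y) / y" using that assms(3) ln_diff_le[of x y] by simp
    also have "\<dots> \<le> \<bar>x - y\<bar> / c" using that assms(3) by (intro frac_le) auto
    finally show ?thesis .
  qed
  show ?thesis using *[OF assms(1,2)] *[OF assms(2,1)] by (simp add: abs_minus_commute abs_le_iff)
qed

text \<open>B bounds the exponent of a tilt on [-1, 1] and \<Lambda> is a Lipschitz constant of its
  unnormalized density. In \<open>qdist_tilt_le\<close> the first summand comes from thresholds that
  separate the quantiles, the rest from the change of the normalized density, integrated over an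
  interval of length 2.\<close>

definition tilt_const :: "real \<Rightarrow> real \<Rightarrow> real" where
  "tilt_const L D = (let B = L + D; \<Lambda> = exp B * (B + 1) in exp (2 * B) + 2 * (exp B * \<Lambda> + exp (3 * B) * \<Lambda>))"

context two_unit_laws
begin

lemma pfun_diff:
  assumes "\<bar>\<gamma>\<bar> \<le> L" "\<bar>d\<bar> \<le> D"
  shows "\<bar>pfun \<mu> \<gamma> d - pfun \<nu> \<gamma> d\<bar> \<le> exp (L + D) * (L + D + 1) * qdist \<mu> \<nu>"
  unfolding pfun_def
proof (rule lipschitz_integral_diff)
  fix x y :: real assume xy: "\<bar>x\<bar> \<le> 1" "\<bar>y\<bar> \<le> 1"
  have "\<bar>exp (expo \<gamma> d x) - exp (expo \<gamma> d y)\<bar> \<le> exp (\<bar>\<gamma>\<bar> + \<bar>d\<bar>) * (\<bar>\<gamma>\<bar> + \<bar>d\<bar>) * \<bar>x - y\<bar>"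
    by (rule expo_lipschitz[OF xy])
  also have "\<dots> \<le> exp (L + D) * (L + D + 1) * \<bar>x - y\<bar>"
    using assms by (intro mult_right_mono mult_mono) auto
  finally show "\<bar>exp (expo \<gamma> d x) - exp (expo \<gamma> d y)\<bar> \<le> exp (L + D) * (L + D + 1) * \<bar>x - y\<bar>" .
qed simp

lemma cgf_diff:
  assumes g: "\<bar>\<gamma>\<bar> \<le> L" and d: "\<bar>d\<bar> \<le> D"
  shows "\<bar>cgf \<mu> \<gamma> d - cgf \<nu> \<gamma> d\<bar> \<le> tilt_const L D * qdist \<mu> \<nu>"
proof -
  let ?B = "L + D"
  have B: "?B \<ge> 0" using g d by linarith
  have "exp (- ?B) \<le> pfun \<mu> \<gamma> d"
    by (rule order_trans[OF _ M.pfun_bounds(1)]) (use g d in simp)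
  moreover have "exp (- ?B) \<le> pfun \<nu> \<gamma> d"
    by (rule order_trans[OF _ N.pfun_bounds(1)]) (use g d in simp)
  ultimately have "\<bar>cgf \<mu> \<gamma> d - cgf \<nu> \<gamma> d\<bar> \<le> \<bar>pfun \<mu> \<gamma> d - pfun \<nu> \<gamma> d\<bar> / exp (- ?B)"
    unfolding cgf_eq by (rule ln_diff_le) simp
  also have "\<dots> = exp ?B * \<bar>pfun \<mu> \<gamma> d - pfun \<nu> \<gamma> d\<bar>"
    unfolding exp_minus by (simp add: divide_inverse)
  also have "\<dots> \<le> exp ?B * (exp ?B * (?B + 1) * qdist \<mu> \<nu>)"
    by (intro mult_left_mono pfun_diff[OF g d]) simp
  also have "\<dots> = exp ?B * (exp ?B * (?B + 1)) * qdist \<mu> \<nu>" by (simp only: mult.assoc)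
  also have "\<dots> \<le> tilt_const L D * qdist \<mu> \<nu>"
  proof (rule mult_right_mono[OF _ qdist_nonneg])
    have "0 \<le> exp ?B * (exp ?B * (?B + 1))" "0 \<le> exp (3 * ?B) * (exp ?B * (?B + 1))" "0 \<le> exp (2 * ?B)"
      using B by simp_all
    moreover have "x \<le> y + 2 * (x + z)" if "0 \<le> x" "0 \<le> z" "0 \<le> y" for x y z :: real
      using that by simp
    ultimately show "exp ?B * (exp ?B * (?B + 1)) \<le> tilt_const L D"
      unfolding tilt_const_def Let_def by blast
  qed
  finally show ?thesis .
qed

text \<open>Both cdfs are integrals over one uniform variable. Their difference at t splits into a
  part where the quantiles fall on different sides of t, which integrates over t to
  \<open>qdist \<mu> \<nu>\<close>, and a part where only the normalized density changes, which is
  of that order uniformly in t.\<close>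

lemma qdist_tilt_le:
  assumes g: "\<bar>\<gamma>\<bar> \<le> L" and d: "\<bar>d\<bar> \<le> D"
  shows "qdist (tilt \<mu> \<gamma> d) (tilt \<nu> \<gamma> d) \<le> tilt_const L D * qdist \<mu> \<nu>"
proof -
  define B where "B = L + D"
  have B: "B \<ge> 0" using g d by (auto simp: B_def)
  define \<Lambda> where "\<Lambda> = exp B * (B + 1)"
  have L0: "\<Lambda> \<ge> 0" using B by (simp add: \<Lambda>_def)
  interpret t: two_unit_laws "tilt \<mu> \<gamma> d" "tilt \<nu> \<gamma> d"
    unfolding two_unit_laws_def using M.unit_law_tilt N.unit_law_tilt by auto
  define f where "f x = exp (expo \<gamma> d x)" for x
  define Z where "Z = pfun \<mu> \<gamma> d"
  define Z' where "Z' = pfun \<nu> \<gamma> d"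
  define q where "q = quantile \<mu>"
  define q' where "q' = quantile \<nu>"
  define \<delta> where "\<delta> = qdist \<mu> \<nu>"
  have \<delta>: "\<delta> \<ge> 0" by (simp add: \<delta>_def qdist_nonneg)
  have [measurable]: "q \<in> borel_measurable U01" "q' \<in> borel_measurable U01" "f \<in> borel_measurable borel"
    by (auto simp: q_def q'_def f_def[abs_def])
  have gd: "\<bar>\<gamma>\<bar> + \<bar>d\<bar> \<le> B" using g d by (simp add: B_def)
  have Z: "Z \<ge> exp (- B)" "Z' \<ge> exp (- B)" "Z > 0" "Z' > 0"
    unfolding Z_def Z'_def using gd M.pfun_pos N.pfun_pos
    by (auto intro: order_trans[OF _ M.pfun_bounds(1)] order_trans[OF _ N.pfun_bounds(1)])
  have Zi: "1 / Z \<le> exp B" "1 / Z' \<le> exp B"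
    using Z by (auto simp: exp_minus field_simps)
  have fb: "f x \<le> exp B" "f x > 0" if "\<bar>x\<bar> \<le> 1" for x
    using expo_bound[OF that, of \<gamma> d] gd by (auto simp: f_def)
  have flip: "\<bar>f x - f y\<bar> \<le> \<Lambda> * \<bar>x - y\<bar>" if "\<bar>x\<bar> \<le> 1" "\<bar>y\<bar> \<le> 1" for x y
  proof -
    have "\<bar>f x - f y\<bar> \<le> exp (\<bar>\<gamma>\<bar> + \<bar>d\<bar>) * (\<bar>\<gamma>\<bar> + \<bar>d\<bar>) * \<bar>x - y\<bar>"
      unfolding f_def by (rule expo_lipschitz[OF that])
    also have "\<dots> \<le> \<Lambda> * \<bar>x - y\<bar>" unfolding \<Lambda>_def using gd by (intro mult_right_mono mult_mono) auto
    finally show ?thesis .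
  qed
  have Zd: "\<bar>Z - Z'\<bar> \<le> \<Lambda> * \<delta>"
    using pfun_diff[OF g d] unfolding Z_def Z'_def \<Lambda>_def B_def \<delta>_def .
  have AEb: "AE \<omega> in U01. \<bar>q \<omega>\<bar> \<le> 1 \<and> \<bar>q' \<omega>\<bar> \<le> 1"
    using M.AE_quantile_bounded N.AE_quantile_bounded by (simp add: q_def q'_def)
  define c where "c = (exp B * \<Lambda> + exp (3 * B) * \<Lambda>) * \<delta>"
  have c0: "c \<ge> 0" using L0 \<delta> by (simp add: c_def)
  define I :: "real \<Rightarrow> real \<Rightarrow> real"
    where "I t \<omega> = \<bar>indicator {..t} (q \<omega>) - indicator {..t} (q' \<omega>)\<bar>" for t \<omega>
  have [measurable]: "I t \<in> borel_measurable U01" for t unfolding I_def by measurable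
  have intI: "integrable U01 (I t)" for t
    by (rule integrable_U01[where B = 1]) (auto simp: I_def indicator_def)
  have bound: "\<bar>f a / Z - f b / Z'\<bar> \<le> exp B * \<Lambda> * \<bar>a - b\<bar> + exp (3 * B) * \<Lambda> * \<delta>" if ab: "\<bar>a\<bar> \<le> 1" "\<bar>b\<bar> \<le> 1" for a b
  proof -
    \<comment> \<open>The numerator is changed first, the normalization second.\<close>
    have "f a / Z - f b / Z' = (f a - f b) * (1 / Z) + f b * ((Z' - Z) * ((1 / Z) * (1 / Z')))"
      using Z by (simp add: field_simps)
    also have "\<bar>\<dots>\<bar> \<le> \<bar>f a - f b\<bar> * (1 / Z) + f b * (\<bar>Z - Z'\<bar> * ((1 / Z) * (1 / Z')))"
      using Z fb[OF ab(2)] by (intro order_trans[OF abs_triangle_ineq]) (simp add: abs_mult abs_minus_commute)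
    also have "\<dots> \<le> (\<Lambda> * \<bar>a - b\<bar>) * exp B + exp B * ((\<Lambda> * \<delta>) * (exp B * exp B))"
      using Z Zi fb[OF ab(2)] flip[OF ab] Zd L0 \<delta> by (intro add_mono mult_mono) auto
    also have "exp B * ((\<Lambda> * \<delta>) * (exp B * exp B)) = exp (3 * B) * \<Lambda> * \<delta>"
      by (simp add: exp_add[symmetric] mult_ac)
    finally show ?thesis by (simp add: mult_ac)
  qed
  have intq: "integrable U01 (\<lambda>\<omega>. \<bar>q \<omega> - q' \<omega>\<bar>)" using integrable_qdiff by (simp add: q_def q'_def)
  have cdf_le: "\<bar>cdf (tilt \<mu> \<gamma> d) t - cdf (tilt \<nu> \<gamma> d) t\<bar> \<le> exp (2 * B) * (\<integral>\<omega>. I t \<omega> \<partial>U01) + c" for t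
  proof -
    have fZ: "cdf (tilt \<mu> \<gamma> d) t = (\<integral>\<omega>. indicator {..t} (q \<omega>) * f (q \<omega>) / Z \<partial>U01)"
      unfolding M.cdf_tilt f_def Z_def q_def by (subst M.integral_quantile) auto
    have fZ': "cdf (tilt \<nu> \<gamma> d) t = (\<integral>\<omega>. indicator {..t} (q' \<omega>) * f (q' \<omega>) / Z' \<partial>U01)"
      unfolding N.cdf_tilt f_def Z'_def q'_def by (subst N.integral_quantile) auto
    have i: "integrable U01 (\<lambda>\<omega>. indicator {..t} (q \<omega>) * f (q \<omega>) / Z)"
    proof (rule integrable_U01[where B = "exp B / Z"])
      show "AE \<omega> in U01. \<bar>indicator {..t} (q \<omega>) * f (q \<omega>) / Z\<bar> \<le> exp B / Z"
        using AEb by eventually_elim (use Z fb in \<open>auto simp: indicator_def divide_right_mono less_imp_le\<close>)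
    qed measurable
    have i': "integrable U01 (\<lambda>\<omega>. indicator {..t} (q' \<omega>) * f (q' \<omega>) / Z')"
    proof (rule integrable_U01[where B = "exp B / Z'"])
      show "AE \<omega> in U01. \<bar>indicator {..t} (q' \<omega>) * f (q' \<omega>) / Z'\<bar> \<le> exp B / Z'"
        using AEb by eventually_elim (use Z fb in \<open>auto simp: indicator_def divide_right_mono less_imp_le\<close>)
    qed measurable
    have "\<bar>cdf (tilt \<mu> \<gamma> d) t - cdf (tilt \<nu> \<gamma> d) t\<bar>
       = \<bar>\<integral>\<omega>. indicator {..t} (q \<omega>) * f (q \<omega>) / Z - indicator {..t} (q' \<omega>) * f (q' \<omega>) / Z' \<partial>U01\<bar>"
      unfolding fZ fZ' using i i' by simp
    also have "\<dots> \<le> (\<integral>\<omega>. \<bar>indicator {..t} (q \<omega>) * f (q \<omega>) / Z - indicator {..t} (q' \<omega>) * f (q' \<omega>) / Z'\<bar> \<partial>U01)"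
      by (rule integral_abs_bound)
    also have "\<dots> \<le> (\<integral>\<omega>. exp (2 * B) * I t \<omega> + (exp B * \<Lambda> * \<bar>q \<omega> - q' \<omega>\<bar> + exp (3 * B) * \<Lambda> * \<delta>) \<partial>U01)"
    proof (rule integral_mono_AE)
      show "integrable U01 (\<lambda>\<omega>. \<bar>indicator {..t} (q \<omega>) * f (q \<omega>) / Z - indicator {..t} (q' \<omega>) * f (q' \<omega>) / Z'\<bar>)"
        using i i' by auto
      show "integrable U01 (\<lambda>\<omega>. exp (2 * B) * I t \<omega> + (exp B * \<Lambda> * \<bar>q \<omega> - q' \<omega>\<bar> + exp (3 * B) * \<Lambda> * \<delta>))"
        using intI intq by auto
      show "AE \<omega> in U01. \<bar>indicator {..t} (q \<omega>) * f (q \<omega>) / Z - indicator {..t} (q' \<omega>) * f (q' \<omega>) / Z'\<bar>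
        \<le> exp (2 * B) * I t \<omega> + (exp B * \<Lambda> * \<bar>q \<omega> - q' \<omega>\<bar> + exp (3 * B) * \<Lambda> * \<delta>)"
        using AEb
      proof eventually_elim
        case (elim \<omega>)
        let ?a = "indicator {..t} (q \<omega>) :: real" and ?b = "indicator {..t} (q' \<omega>) :: real"
        have "?a * f (q \<omega>) / Z - ?b * f (q' \<omega>) / Z' = (f (q \<omega>) / Z) * (?a - ?b) + ?b * (f (q \<omega>) / Z - f (q' \<omega>) / Z')"
          by (simp add: algebra_simps diff_divide_distrib)
        also have "\<bar>\<dots>\<bar> \<le> (f (q \<omega>) * (1 / Z)) * \<bar>?a - ?b\<bar> + ?b * \<bar>f (q \<omega>) / Z - f (q' \<omega>) / Z'\<bar>"
          using Z fb[of "q \<omega>"] elim by (intro order_trans[OF abs_triangle_ineq]) (simp add: abs_mult)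
        also have "\<dots> \<le> (exp B * exp B) * \<bar>?a - ?b\<bar> + 1 * (exp B * \<Lambda> * \<bar>q \<omega> - q' \<omega>\<bar> + exp (3 * B) * \<Lambda> * \<delta>)"
          using Z Zi fb[of "q \<omega>"] bound[of "q \<omega>" "q' \<omega>"] elim
          by (intro add_mono mult_right_mono mult_mono) (auto simp: indicator_def)
        also have "exp B * exp B = exp (2 * B)" by (simp add: exp_add[symmetric])
        finally show ?case by (simp add: I_def)
      qed
    qed
    also have "\<dots> = exp (2 * B) * (\<integral>\<omega>. I t \<omega> \<partial>U01) + c"
      using intI intq
      by (simp add: U01.prob_space[simplified] c_def \<delta>_def qdist_def q_def[symmetric] q'_def[symmetric] algebra_simps)
    finally show ?thesis .
  qed
  have Inn: "(\<integral>\<omega>. I t \<omega> \<partial>U01) \<ge> 0" for t by (rule integral_nonneg_AE) (simp add: I_def)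
  have "ennreal (qdist (tilt \<mu> \<gamma> d) (tilt \<nu> \<gamma> d))
     \<le> (\<integral>\<^sup>+t. ennreal \<bar>cdf (tilt \<mu> \<gamma> d) t - cdf (tilt \<nu> \<gamma> d) t\<bar> * indicator {-1..1} t \<partial>lborel)"
    by (rule t.qdist_le_cdf)
  also have "\<dots> \<le> (\<integral>\<^sup>+t. ennreal (exp (2 * B)) * ((\<integral>\<^sup>+\<omega>. ennreal (I t \<omega>) \<partial>U01) * indicator {-1..1} t) + ennreal c * indicator {-1..1} t \<partial>lborel)"
  proof (rule nn_integral_mono)
    fix t :: real
    have "ennreal \<bar>cdf (tilt \<mu> \<gamma> d) t - cdf (tilt \<nu> \<gamma> d) t\<bar> \<le> ennreal (exp (2 * B) * (\<integral>\<omega>. I t \<omega> \<partial>U01) + c)"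
      by (rule ennreal_leI[OF cdf_le])
    also have "\<dots> = ennreal (exp (2 * B)) * ennreal (\<integral>\<omega>. I t \<omega> \<partial>U01) + ennreal c"
      using c0 Inn[of t] by (simp add: ennreal_plus ennreal_mult)
    also have "ennreal (\<integral>\<omega>. I t \<omega> \<partial>U01) = (\<integral>\<^sup>+\<omega>. ennreal (I t \<omega>) \<partial>U01)"
      by (rule nn_integral_eq_integral[symmetric, OF intI]) (simp add: I_def)
    finally show "ennreal \<bar>cdf (tilt \<mu> \<gamma> d) t - cdf (tilt \<nu> \<gamma> d) t\<bar> * indicator {-1..1} t
       \<le> ennreal (exp (2 * B)) * ((\<integral>\<^sup>+\<omega>. ennreal (I t \<omega>) \<partial>U01) * indicator {-1..1} t) + ennreal c * indicator {-1..1} t"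
      by (auto simp: indicator_def)
  qed
  also have "\<dots> = ennreal (exp (2 * B)) * (\<integral>\<^sup>+t. (\<integral>\<^sup>+\<omega>. ennreal (I t \<omega>) \<partial>U01) * indicator {-1..1} t \<partial>lborel) + ennreal c * 2"
  proof -
    have [measurable]: "(\<lambda>t. \<integral>\<^sup>+\<omega>. ennreal (I t \<omega>) \<partial>U01) \<in> borel_measurable lborel"
    proof (rule U01.borel_measurable_nn_integral)
      have "(\<lambda>(t, \<omega>). ennreal (I t \<omega>)) = (\<lambda>x. ennreal \<bar>(if q (snd x) \<le> fst x then 1 else 0) - (if q' (snd x) \<le> fst x then 1 else 0)\<bar>)"
        by (auto simp: I_def indicator_def fun_eq_iff)
      thus "(\<lambda>(t, \<omega>). ennreal (I t \<omega>)) \<in> borel_measurable (lborel \<Otimes>\<^sub>M U01)" by simp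
    qed
    show ?thesis
      by (subst nn_integral_add, measurable, subst nn_integral_cmult, measurable, subst nn_integral_cmult_indicator) auto
  qed
  also have "(\<integral>\<^sup>+t. (\<integral>\<^sup>+\<omega>. ennreal (I t \<omega>) \<partial>U01) * indicator {-1..1} t \<partial>lborel) = ennreal \<delta>"
    using qdist_fubini by (simp add: I_def q_def q'_def \<delta>_def)
  also have "ennreal (exp (2 * B)) * ennreal \<delta> + ennreal c * 2 = ennreal (exp (2 * B) * \<delta> + 2 * c)"
    using c0 \<delta> by (simp add: ennreal_plus ennreal_mult mult.commute)
  finally have "qdist (tilt \<mu> \<gamma> d) (tilt \<nu> \<gamma> d) \<le> exp (2 * B) * \<delta> + 2 * c"
    using c0 \<delta> by (subst (asm) ennreal_le_iff) auto
  also have "\<dots> = (exp (2 * B) + 2 * (exp B * \<Lambda> + exp (3 * B) * \<Lambda>)) * \<delta>"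
    by (simp add: c_def algebra_simps)
  also have "\<dots> = tilt_const L D * \<delta>"
    by (simp only: tilt_const_def Let_def B_def \<Lambda>_def)
  finally show ?thesis by (simp add: \<delta>_def)
qed

end

lemma tilt_const_ge_0: "L \<ge> 0 \<Longrightarrow> D \<ge> 0 \<Longrightarrow> tilt_const L D \<ge> 0"
  by (simp add: tilt_const_def Let_def)

lemma cancel_factor: "(a::real) \<noteq> 0 \<Longrightarrow> a * (e / (2 * a * b)) = e / 2 / b"
  by (simp add: divide_simps)

section \<open>Truncation of the tilting parameter\<close>

definition clamp1 :: "real \<Rightarrow> real \<Rightarrow> real" where
  "clamp1 L \<gamma> = max (- L) (min L \<gamma>)"

lemma clamp1_cases:
  assumes "L > 0"
  obtains "\<bar>\<gamma>\<bar> \<le> L" "clamp1 L \<gamma> = \<gamma>" | "\<gamma> > L" "clamp1 L \<gamma> = L" | "\<gamma> < - L" "clamp1 L \<gamma> = - L"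
  using assms by (force simp: clamp1_def)

lemma abs_clamp1_le: "L > 0 \<Longrightarrow> \<bar>clamp1 L \<gamma>\<bar> \<le> L"
  by (auto simp: clamp1_def)

context unit_law
begin

lemma tmean_bounds: "Inf (Supp \<mu>) \<le> tmean \<mu> \<gamma> d" "tmean \<mu> \<gamma> d \<le> Sup (Supp \<mu>)"
proof -
  interpret t: unit_law "tilt \<mu> \<gamma> d" by (rule unit_law_tilt)
  have ix: "integrable (tilt \<mu> \<gamma> d) (\<lambda>x. x)" by (rule t.integrable_bdd) auto
  have ae: "AE x in tilt \<mu> \<gamma> d. Inf (Supp \<mu>) \<le> x \<and> x \<le> Sup (Supp \<mu>)"
    using AE_Supp_bounds by (subst AE_tilt_iff) auto
  show "tmean \<mu> \<gamma> d \<le> Sup (Supp \<mu>)" "Inf (Supp \<mu>) \<le> tmean \<mu> \<gamma> d"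
    unfolding tmean_def using ix ae by (auto intro!: t.integral_le_const t.integral_ge_const)
qed

text \<open>Supporting lines at plus and minus M, evaluated at 0, with the mean replaced by the
  endpoint of the support. It later limits how far a mean under another law can lie beyond that
  endpoint.\<close>

lemma cgf_le_linear:
  assumes "d \<ge> 0" "M \<ge> 0"
  shows "cgf \<mu> M d - cgf \<mu> 0 d \<le> M * Sup (Supp \<mu>)" "cgf \<mu> (- M) d - cgf \<mu> 0 d \<le> - M * Inf (Supp \<mu>)"
  using cgf_convex[of M d 0] cgf_convex[of "- M" d 0] tmean_bounds[of M d] tmean_bounds[of "- M" d]
    mult_left_mono[of "tmean \<mu> M d" "Sup (Supp \<mu>)" M] mult_left_mono[of "Inf (Supp \<mu>)" "tmean \<mu> (- M) d" M] assms
  by auto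

text \<open>At the edge of the window the mean is within \<epsilon> of the endpoint of the support,
  which no mean can pass.\<close>

lemma tmean_clamp:
  assumes "\<epsilon> > 0" "D \<ge> 0"
  shows "\<exists>L>0. \<forall>d\<in>{0..D}. \<forall>\<gamma>. \<bar>tmean \<mu> \<gamma> d - tmean \<mu> (clamp1 L \<gamma>) d\<bar> \<le> \<epsilon> \<and>
     tmean \<mu> L d \<ge> Sup (Supp \<mu>) - \<epsilon> \<and> tmean \<mu> (- L) d \<le> Inf (Supp \<mu>) + \<epsilon>"
proof -
  obtain L where L: "L > 0" "\<And>d. d \<in> {0..D} \<Longrightarrow> tmean \<mu> L d \<ge> Sup (Supp \<mu>) - \<epsilon> \<and> tmean \<mu> (- L) d \<le> Inf (Supp \<mu>) + \<epsilon>"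
    using tmean_limits[OF assms] by blast
  have "\<bar>tmean \<mu> \<gamma> d - tmean \<mu> (clamp1 L \<gamma>) d\<bar> \<le> \<epsilon>" if d: "d \<in> {0..D}" for d \<gamma>
  proof (cases rule: clamp1_cases[OF L(1), of \<gamma>, case_names 1 2 3])
    case 1 thus ?thesis using assms by simp
  next
    case 2 thus ?thesis using L(2)[OF d] tmean_bounds(2)[of \<gamma> d] tmean_mono[of L \<gamma> d] by auto
  next
    case 3 thus ?thesis using L(2)[OF d] tmean_bounds(1)[of \<gamma> d] tmean_mono[of \<gamma> "-L" d] by auto
  qed
  thus ?thesis using L by blast
qed

text \<open>Take the affine bound of \<open>rate_ge\<close> with the clamped slope. Moving from the
  clamped mean to the original one goes in the direction of that slope, so the bound does not
  decrease.\<close>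

lemma rate_clamp: "L > 0 \<Longrightarrow> rate \<mu> (clamp1 L \<gamma>) d \<le> rate \<mu> \<gamma> d"
proof -
  assume L: "L > 0"
  let ?g = "clamp1 L \<gamma>"
  have "rate \<mu> \<gamma> d \<ge> ?g * tmean \<mu> \<gamma> d - cgf \<mu> ?g d + cgf \<mu> 0 d" by (rule rate_ge)
  moreover have "?g * tmean \<mu> \<gamma> d \<ge> ?g * tmean \<mu> ?g d"
    by (rule clamp1_cases[OF L, of \<gamma>]) (use L in \<open>auto intro!: tmean_mono\<close>)
  ultimately show ?thesis by (simp add: rate_def)
qed

end

context two_unit_laws
begin

lemma tmean_diff: "\<bar>\<gamma>\<bar> \<le> L \<Longrightarrow> \<bar>d\<bar> \<le> D \<Longrightarrow> \<bar>tmean \<mu> \<gamma> d - tmean \<nu> \<gamma> d\<bar> \<le> tilt_const L D * qdist \<mu> \<nu>"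
proof -
  assume a: "\<bar>\<gamma>\<bar> \<le> L" "\<bar>d\<bar> \<le> D"
  interpret t: two_unit_laws "tilt \<mu> \<gamma> d" "tilt \<nu> \<gamma> d"
    unfolding two_unit_laws_def using M.unit_law_tilt N.unit_law_tilt by auto
  show ?thesis using t.mean_diff qdist_tilt_le[OF a] unfolding tmean_def by linarith
qed

end

text \<open>The supports of \<open>\<mu>\<close> and \<open>\<nu>\<close> may differ, so tilting parameters are truncated to a window
  \<open>[-L, L]\<close> on which everything is Lipschitz in \<open>qdist \<mu> \<nu>\<close>.\<close>

lemma rate_transfer_to:
  assumes \<mu>: "unit_law \<mu>" and \<epsilon>: "\<epsilon> > 0" and D: "D \<ge> 0"
  shows "\<exists>\<delta>>0. \<forall>\<nu>. unit_law \<nu> \<longrightarrow> qdist \<mu> \<nu> < \<delta> \<longrightarrow> (\<forall>d\<in>{0..D}. \<forall>\<gamma>. \<exists>\<gamma>'.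
     \<bar>tmean \<mu> \<gamma> d - tmean \<nu> \<gamma>' d\<bar> \<le> \<epsilon> \<and> rate \<nu> \<gamma>' d \<le> rate \<mu> \<gamma> d + \<epsilon>)"
proof -
  interpret unit_law \<mu> by fact
  obtain L where L: "L > 0" "\<forall>d\<in>{0..D}. \<forall>\<gamma>. \<bar>tmean \<mu> \<gamma> d - tmean \<mu> (clamp1 L \<gamma>) d\<bar> \<le> \<epsilon> / 2"
    using tmean_clamp[of "\<epsilon> / 2" D] \<epsilon> D by auto
  define K where "K = tilt_const L D"
  have K: "K \<ge> 0" unfolding K_def using L D by (intro tilt_const_ge_0) auto
  \<comment> \<open>The two rates differ by one difference of means times a slope of size at most L,
    and by two differences of \<open>cgf\<close>; hence the factor L + 2. The 1 in
    \<open>K + 1\<close> keeps the denominator positive.\<close>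
  define \<delta> where "\<delta> = \<epsilon> / (2 * (K + 1) * (L + 2))"
  have "\<delta> > 0" using \<epsilon> K L by (simp add: \<delta>_def)
  moreover have "\<bar>tmean \<mu> \<gamma> d - tmean \<nu> (clamp1 L \<gamma>) d\<bar> \<le> \<epsilon> \<and> rate \<nu> (clamp1 L \<gamma>) d \<le> rate \<mu> \<gamma> d + \<epsilon>"
    if \<nu>: "unit_law \<nu>" "qdist \<mu> \<nu> < \<delta>" and d: "d \<in> {0..D}" for \<nu> d \<gamma>
  proof -
    interpret two_unit_laws \<mu> \<nu> unfolding two_unit_laws_def using \<mu> \<nu> by auto
    let ?g = "clamp1 L \<gamma>"
    have g: "\<bar>?g\<bar> \<le> L" using L by (simp add: abs_clamp1_le)
    have "K * qdist \<mu> \<nu> \<le> (K + 1) * \<delta>" using K \<nu>(2) qdist_nonneg by (intro mult_mono) auto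
    also have "\<dots> = \<epsilon> / 2 / (L + 2)" unfolding \<delta>_def by (rule cancel_factor) (use K in simp)
    finally have Kd: "(L + 2) * (K * qdist \<mu> \<nu>) \<le> \<epsilon> / 2" using L(1) by (simp add: field_simps)
    have nn: "0 \<le> L * (K * qdist \<mu> \<nu>)" "0 \<le> K * qdist \<mu> \<nu>" using K L(1) qdist_nonneg by auto
    have m: "\<bar>tmean \<mu> ?g d - tmean \<nu> ?g d\<bar> \<le> K * qdist \<mu> \<nu>"
      unfolding K_def by (rule tmean_diff[OF g]) (use d in auto)
    have c: "\<bar>cgf \<mu> ?g d - cgf \<nu> ?g d\<bar> \<le> K * qdist \<mu> \<nu>"
      unfolding K_def by (rule cgf_diff[OF g]) (use d in auto)
    have c0: "\<bar>cgf \<mu> 0 d - cgf \<nu> 0 d\<bar> \<le> K * qdist \<mu> \<nu>"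
      unfolding K_def by (rule cgf_diff) (use d L in auto)
    have "\<bar>?g * (tmean \<nu> ?g d - tmean \<mu> ?g d)\<bar> \<le> L * (K * qdist \<mu> \<nu>)"
      unfolding abs_mult using g m by (intro mult_mono) (auto simp: abs_minus_commute)
    hence "rate \<nu> ?g d - rate \<mu> ?g d \<le> L * (K * qdist \<mu> \<nu>) + 2 * (K * qdist \<mu> \<nu>)"
      using c c0 by (simp add: rate_def algebra_simps abs_le_iff)
    also have "\<dots> \<le> \<epsilon> / 2" using Kd by (simp add: algebra_simps)
    finally have "rate \<nu> ?g d \<le> rate \<mu> \<gamma> d + \<epsilon>" using rate_clamp[OF L(1), of \<gamma> d] \<epsilon> by simp
    moreover have "\<bar>tmean \<mu> \<gamma> d - tmean \<nu> ?g d\<bar> \<le> \<epsilon>"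
    proof -
      have "L * (K * qdist \<mu> \<nu>) + 2 * (K * qdist \<mu> \<nu>) \<le> \<epsilon> / 2" using Kd by (simp only: distrib_right)
      thus ?thesis using L(2)[rule_format, OF d, of \<gamma>] m nn by linarith
    qed
    ultimately show ?thesis by blast
  qed
  ultimately show ?thesis by blast
qed

text \<open>In this direction no uniform error is possible: \<nu> may charge points beyond the
  support of \<mu>, where no \<mu>-mean can follow. A \<nu>-mean out there has a large rate, so the
  error is allowed to grow with the rate, whose sum over the coordinates is controlled at a
  maximizer.\<close>

lemma rate_transfer_from:
  assumes \<mu>: "unit_law \<mu>" and \<epsilon>: "\<epsilon> > 0" and D: "D \<ge> 0"
  shows "\<exists>\<delta>>0. \<forall>\<nu>. unit_law \<nu> \<longrightarrow> qdist \<mu> \<nu> < \<delta> \<longrightarrow> (\<forall>d\<in>{0..D}. \<forall>\<gamma>'. \<exists>\<gamma>.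
     \<bar>tmean \<mu> \<gamma> d - tmean \<nu> \<gamma>' d\<bar> \<le> \<epsilon> * (1 + rate \<nu> \<gamma>' d) \<and> rate \<mu> \<gamma> d \<le> rate \<nu> \<gamma>' d + \<epsilon>)"
proof -
  interpret unit_law \<mu> by fact
  obtain L where L: "L > 0" "\<forall>d\<in>{0..D}. tmean \<mu> L d \<ge> Sup (Supp \<mu>) - \<epsilon> / 2 \<and> tmean \<mu> (- L) d \<le> Inf (Supp \<mu>) + \<epsilon> / 2"
    using tmean_clamp[of "\<epsilon> / 2" D] \<epsilon> D by auto
  \<comment> \<open>A slope for \<open>rate_ge\<close>: it lets a \<nu>-mean exceed the support of
    \<mu> by about rate / M, and \<open>1 / M \<le> \<epsilon>\<close>.\<close>
  define M where "M = 1 / \<epsilon> + 1"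
  have M: "M \<ge> 1" "1 / M \<le> \<epsilon>" using \<epsilon> by (auto simp: M_def field_simps)
  define K where "K = tilt_const L D + tilt_const M D"
  have K': "tilt_const L D \<ge> 0" "tilt_const M D \<ge> 0" using L D M by (auto intro!: tilt_const_ge_0)
  hence K: "K \<ge> 0" by (simp add: K_def)
  define \<delta> where "\<delta> = \<epsilon> / (2 * (K + 1) * (L + 3))"
  have "\<delta> > 0" using \<epsilon> K L by (simp add: \<delta>_def)
  moreover have "\<bar>tmean \<mu> (clamp1 L \<gamma>) d - tmean \<nu> \<gamma> d\<bar> \<le> \<epsilon> * (1 + rate \<nu> \<gamma> d) \<and> rate \<mu> (clamp1 L \<gamma>) d \<le> rate \<nu> \<gamma> d + \<epsilon>"
    if \<nu>: "unit_law \<nu>" "qdist \<mu> \<nu> < \<delta>" and d: "d \<in> {0..D}" for \<nu> d \<gamma>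
  proof -
    interpret two_unit_laws \<mu> \<nu> unfolding two_unit_laws_def using \<mu> \<nu> by auto
    let ?g = "clamp1 L \<gamma>"
    define \<kappa> where "\<kappa> = K * qdist \<mu> \<nu>"
    have \<kappa>0: "\<kappa> \<ge> 0" using K qdist_nonneg by (simp add: \<kappa>_def)
    have g: "\<bar>?g\<bar> \<le> L" using L by (simp add: abs_clamp1_le)
    have le: "tilt_const L D * qdist \<mu> \<nu> \<le> \<kappa>" "tilt_const M D * qdist \<mu> \<nu> \<le> \<kappa>"
      unfolding \<kappa>_def K_def using K' qdist_nonneg by (auto intro!: mult_right_mono)
    have "\<kappa> \<le> (K + 1) * \<delta>" unfolding \<kappa>_def using K \<nu>(2) qdist_nonneg by (intro mult_mono) auto
    also have "\<dots> = \<epsilon> / 2 / (L + 3)" unfolding \<delta>_def by (rule cancel_factor) (use K in simp)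
    finally have "(L + 3) * \<kappa> \<le> \<epsilon> / 2" using L(1) by (simp add: field_simps)
    hence Kd: "L * \<kappa> + 3 * \<kappa> \<le> \<epsilon> / 2" by (simp add: algebra_simps)
    have nn: "0 \<le> L * \<kappa>" using \<kappa>0 L(1) by auto
    have m: "\<bar>tmean \<mu> g' d - tmean \<nu> g' d\<bar> \<le> \<kappa>" if "\<bar>g'\<bar> \<le> L" for g'
      by (rule order_trans[OF tmean_diff[OF that] le(1)]) (use d in auto)
    have mL: "\<bar>tmean \<mu> L d - tmean \<nu> L d\<bar> \<le> \<kappa>" "\<bar>tmean \<mu> (- L) d - tmean \<nu> (- L) d\<bar> \<le> \<kappa>"
      using L(1) by (auto intro!: m)
    have c: "\<bar>cgf \<mu> ?g d - cgf \<nu> ?g d\<bar> \<le> \<kappa>" "\<bar>cgf \<mu> 0 d - cgf \<nu> 0 d\<bar> \<le> \<kappa>"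
      by (rule order_trans[OF cgf_diff le(1)]; use g d L in auto)+
    have cM: "\<bar>cgf \<mu> g' d - cgf \<nu> g' d\<bar> \<le> \<kappa>" if "\<bar>g'\<bar> \<le> M" for g'
      by (rule order_trans[OF cgf_diff[OF that] le(2)]) (use d in auto)
    have rate_nn: "rate \<nu> \<gamma> d \<ge> 0" by (rule N.rate_nonneg)
    have "rate \<nu> \<gamma> d \<ge> ?g * tmean \<nu> \<gamma> d - cgf \<nu> ?g d + cgf \<nu> 0 d" by (rule N.rate_ge)
    moreover have "?g * tmean \<mu> ?g d - ?g * tmean \<nu> \<gamma> d \<le> L * \<kappa>"
    proof -
      have "?g * tmean \<nu> ?g d \<le> ?g * tmean \<nu> \<gamma> d"
        by (rule clamp1_cases[OF L(1), of \<gamma>]) (use L(1) in \<open>auto intro!: N.tmean_mono\<close>)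
      moreover have "\<bar>?g * (tmean \<mu> ?g d - tmean \<nu> ?g d)\<bar> \<le> L * \<kappa>"
        unfolding abs_mult using g m[OF g] by (intro mult_mono) auto
      ultimately show ?thesis by (simp add: algebra_simps abs_le_iff)
    qed
    ultimately have r: "rate \<mu> ?g d \<le> rate \<nu> \<gamma> d + \<epsilon>"
      using c Kd \<kappa>0 \<epsilon> unfolding rate_def by (simp add: abs_le_iff)
    \<comment> \<open>Each bound combines the affine bound of slope plus or minus M under \<nu>, the
      exchange of two values of \<open>cgf\<close> at cost 2 * \<kappa>, and
      \<open>cgf_le_linear\<close> under \<mu>.\<close>
    have bd: "tmean \<nu> \<gamma> d \<le> Sup (Supp \<mu>) + \<epsilon> * rate \<nu> \<gamma> d + 2 * \<kappa>" "tmean \<nu> \<gamma> d \<ge> Inf (Supp \<mu>) - \<epsilon> * rate \<nu> \<gamma> d - 2 * \<kappa>"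
    proof -
      have rM: "rate \<nu> \<gamma> d / M \<le> \<epsilon> * rate \<nu> \<gamma> d"
        using mult_right_mono[OF M(2) rate_nn] by simp
      have kM: "2 * \<kappa> / M \<le> 2 * \<kappa>" using M(1) \<kappa>0 by (simp add: divide_le_eq mult_le_cancel_left1)
      have "M * tmean \<nu> \<gamma> d \<le> rate \<nu> \<gamma> d + M * Sup (Supp \<mu>) + 2 * \<kappa>"
        using N.rate_ge[of M \<gamma> d] cM[of M] cM[of 0] cgf_le_linear(1)[of d M] M(1) d by (auto simp: abs_le_iff)
      hence "tmean \<nu> \<gamma> d \<le> (rate \<nu> \<gamma> d + M * Sup (Supp \<mu>) + 2 * \<kappa>) / M" using M(1) by (simp add: field_simps)
      also have "\<dots> = rate \<nu> \<gamma> d / M + Sup (Supp \<mu>) + 2 * \<kappa> / M" using M(1) by (simp add: add_divide_distrib)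
      finally show "tmean \<nu> \<gamma> d \<le> Sup (Supp \<mu>) + \<epsilon> * rate \<nu> \<gamma> d + 2 * \<kappa>" using rM kM by linarith
      have "- M * tmean \<nu> \<gamma> d \<le> rate \<nu> \<gamma> d - M * Inf (Supp \<mu>) + 2 * \<kappa>"
        using N.rate_ge[of "- M" \<gamma> d] cM[of "- M"] cM[of 0] cgf_le_linear(2)[of d M] M(1) d by (auto simp: abs_le_iff)
      hence "- tmean \<nu> \<gamma> d \<le> (rate \<nu> \<gamma> d - M * Inf (Supp \<mu>) + 2 * \<kappa>) / M" using M(1) by (simp add: field_simps)
      also have "\<dots> = rate \<nu> \<gamma> d / M - Inf (Supp \<mu>) + 2 * \<kappa> / M" using M(1) by (simp add: add_divide_distrib diff_divide_distrib)
      finally show "tmean \<nu> \<gamma> d \<ge> Inf (Supp \<mu>) - \<epsilon> * rate \<nu> \<gamma> d - 2 * \<kappa>" using rM kM by linarith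
    qed
    have er: "0 \<le> \<epsilon> * rate \<nu> \<gamma> d" using \<epsilon> rate_nn by simp
    have "\<bar>tmean \<mu> ?g d - tmean \<nu> \<gamma> d\<bar> \<le> \<epsilon> + \<epsilon> * rate \<nu> \<gamma> d"
      proof (cases rule: clamp1_cases[OF L(1), of \<gamma>, case_names 1 2 3])
      case 1 show ?thesis unfolding 1(2) using m[OF 1(1)] Kd nn \<kappa>0 er by linarith
    next
      case 2
      have "tmean \<nu> \<gamma> d \<ge> tmean \<nu> L d" by (rule N.tmean_mono) (use 2 in simp)
      thus ?thesis unfolding 2(2) using 2(1) mL bd(1) L(1) L(2)[rule_format, OF d] Kd nn \<kappa>0 er \<epsilon> by linarith
    next
      case 3
      have "tmean \<nu> \<gamma> d \<le> tmean \<nu> (- L) d" by (rule N.tmean_mono) (use 3 in simp)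
      thus ?thesis unfolding 3(2) using 3(1) mL bd(2) L(1) L(2)[rule_format, OF d] Kd nn \<kappa>0 er \<epsilon> by linarith
    qed
    thus ?thesis using r by (simp add: algebra_simps)
  qed
  ultimately show ?thesis by blast
qed

text \<open>Triangle inequality through the tilts of \<mu> and of \<nu> at the clamped \<gamma>'.
  The outer legs stay within one family and are differences of means by \<open>qdist_tilt\<close>;
  only the middle leg changes the prior, at a bounded parameter. The outer legs cost two and one
  copies of the given difference of means, up to small errors.\<close>

lemma qdist_tilt_transfer:
  assumes \<mu>: "unit_law \<mu>" and \<epsilon>: "\<epsilon> > 0" and D: "D \<ge> 0"
  shows "\<exists>\<delta>>0. \<forall>\<nu>. unit_law \<nu> \<longrightarrow> qdist \<mu> \<nu> < \<delta> \<longrightarrow> (\<forall>d\<in>{0..D}. \<forall>\<gamma> \<gamma>'.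
     qdist (tilt \<mu> \<gamma> d) (tilt \<nu> \<gamma>' d) \<le> 3 * \<bar>tmean \<mu> \<gamma> d - tmean \<nu> \<gamma>' d\<bar> + \<epsilon>)"
proof -
  interpret unit_law \<mu> by fact
  obtain L where L: "L > 0" "\<forall>d\<in>{0..D}. tmean \<mu> L d \<ge> Sup (Supp \<mu>) - \<epsilon> / 8 \<and> tmean \<mu> (- L) d \<le> Inf (Supp \<mu>) + \<epsilon> / 8"
    "\<forall>d\<in>{0..D}. \<forall>\<gamma>. \<bar>tmean \<mu> \<gamma> d - tmean \<mu> (clamp1 L \<gamma>) d\<bar> \<le> \<epsilon> / 8"
    using tmean_clamp[of "\<epsilon> / 8" D] \<epsilon> D by auto
  define K where "K = tilt_const L D"
  have K: "K \<ge> 0" unfolding K_def using L D by (intro tilt_const_ge_0) auto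
  define \<delta> where "\<delta> = \<epsilon> / (8 * (K + 1))"
  have "\<delta> > 0" using \<epsilon> K L by (simp add: \<delta>_def)
  moreover have "qdist (tilt \<mu> \<gamma> d) (tilt \<nu> \<gamma>' d) \<le> 3 * \<bar>tmean \<mu> \<gamma> d - tmean \<nu> \<gamma>' d\<bar> + \<epsilon>"
    if \<nu>: "unit_law \<nu>" "qdist \<mu> \<nu> < \<delta>" and d: "d \<in> {0..D}" for \<nu> d \<gamma> \<gamma>'
  proof -
    interpret two_unit_laws \<mu> \<nu> unfolding two_unit_laws_def using \<mu> \<nu> by auto
    let ?g = "clamp1 L \<gamma>'"
    define \<kappa> where "\<kappa> = K * qdist \<mu> \<nu>"
    have "\<kappa> \<le> (K + 1) * \<delta>" unfolding \<kappa>_def using K \<nu>(2) qdist_nonneg by (intro mult_mono) auto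
    also have "\<dots> = \<epsilon> / 8" using K by (simp add: \<delta>_def field_simps)
    finally have \<kappa>: "\<kappa> \<le> \<epsilon> / 8" .
    note ul = unit_law_tilt N.unit_law_tilt
    have m: "\<bar>tmean \<mu> g' d - tmean \<nu> g' d\<bar> \<le> \<kappa>" if "\<bar>g'\<bar> \<le> L" for g'
      unfolding \<kappa>_def K_def by (rule tmean_diff[OF that]) (use d in auto)
    have mL: "\<bar>tmean \<mu> L d - tmean \<nu> L d\<bar> \<le> \<kappa>" "\<bar>tmean \<mu> (- L) d - tmean \<nu> (- L) d\<bar> \<le> \<kappa>"
      using L(1) by (auto intro!: m)
    have g: "\<bar>?g\<bar> \<le> L" using L by (simp add: abs_clamp1_le)
    have q: "qdist (tilt \<mu> ?g d) (tilt \<nu> ?g d) \<le> \<kappa>"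
      unfolding \<kappa>_def K_def by (rule qdist_tilt_le[OF g]) (use d in auto)
    let ?x = "\<bar>tmean \<mu> \<gamma> d - tmean \<nu> \<gamma>' d\<bar>"
    \<comment> \<open>Beyond the window, the \<nu>-mean at the edge is already close to the endpoint
      of the support of \<mu>, which \<open>tmean \<mu> \<gamma> d\<close> cannot pass; so the
      effect of clamping is controlled by the difference of means itself.\<close>
    have a: "\<bar>tmean \<nu> ?g d - tmean \<nu> \<gamma>' d\<bar> \<le> ?x + \<epsilon> / 4"
      proof (cases rule: clamp1_cases[OF L(1), of \<gamma>', case_names 1 2 3])
      case 1 thus ?thesis using \<epsilon> by simp
    next
      case 2
      have "tmean \<nu> \<gamma>' d \<ge> tmean \<nu> L d" by (rule N.tmean_mono) (use 2 in simp)
      thus ?thesis unfolding 2(2) using 2(1) mL \<kappa> tmean_bounds(2)[of \<gamma> d] L(1) L(2)[rule_format, OF d] \<epsilon> by linarith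
    next
      case 3
      have "tmean \<nu> \<gamma>' d \<le> tmean \<nu> (- L) d" by (rule N.tmean_mono) (use 3 in simp)
      thus ?thesis unfolding 3(2) using 3(1) mL \<kappa> tmean_bounds(1)[of \<gamma> d] L(1) L(2)[rule_format, OF d] \<epsilon> by linarith
    qed
    have "qdist (tilt \<mu> \<gamma> d) (tilt \<nu> \<gamma>' d) \<le> qdist (tilt \<mu> \<gamma> d) (tilt \<mu> ?g d) + (qdist (tilt \<mu> ?g d) (tilt \<nu> ?g d) + qdist (tilt \<nu> ?g d) (tilt \<nu> \<gamma>' d))"
      by (rule order_trans[OF qdist_triangle add_left_mono[OF qdist_triangle]]) (rule ul)+
    also have "\<dots> \<le> \<bar>tmean \<mu> \<gamma> d - tmean \<mu> ?g d\<bar> + (\<kappa> + \<bar>tmean \<nu> ?g d - tmean \<nu> \<gamma>' d\<bar>)"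
      unfolding qdist_tilt N.qdist_tilt using q by simp
    also have "\<dots> \<le> 3 * ?x + \<epsilon>"
      using a m[OF g] \<kappa> by (simp add: abs_le_iff abs_if split: if_splits)
    finally show ?thesis .
  qed
  ultimately show ?thesis by blast
qed

section \<open>Transport by the Knothe map\<close>

text \<open>Factor |x - 1| through the square root r of x and split the product by the
  arithmetic-geometric mean inequality with weight s. The factor (r - 1)^2 is a Hellinger term below
  the entropy density, and (r + 1)^2 is at most 2 * (x + 1).\<close>

lemma abs_minus_1_le:
  fixes x s :: real
  assumes x: "x > 0" and s: "s > 0"
  shows "\<bar>x - 1\<bar> \<le> (x * ln x - x + 1) / s + s * (x + 1) / 2"
proof -
  define r where "r = sqrt x"
  have r: "r > 0" "x = r\<^sup>2" using x by (auto simp: r_def)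
  have "ln (1 / r) \<le> 1 / r - 1" using r by (intro ln_le_minus_one) auto
  hence "1 - 1 / r \<le> ln r" using r by (simp add: ln_div)
  hence "x * (2 * (1 - 1 / r)) \<le> x * (2 * ln r)" using x by (intro mult_left_mono) auto
  moreover have "x * ln x = x * (2 * ln r)" using r by (simp add: ln_realpow)
  moreover have "x * (2 * (1 - 1 / r)) = 2 * r\<^sup>2 - 2 * r" using r by (simp add: power2_eq_square field_simps)
  ultimately have h: "(r - 1)\<^sup>2 \<le> x * ln x - x + 1" using r by (simp add: power2_eq_square algebra_simps)
  define a where "a = \<bar>r - 1\<bar>"
  define b where "b = r + 1"
  have "x - 1 = (r - 1) * (r + 1)" using r by (simp add: power2_eq_square algebra_simps)
  hence "\<bar>x - 1\<bar> = a * b" using r by (simp add: abs_mult a_def b_def)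
  also have "a * b \<le> a\<^sup>2 / s + s * b\<^sup>2 / 4"
  proof -
    have "0 \<le> (a - s * b / 2)\<^sup>2 / s" using s by simp
    also have "(a - s * b / 2)\<^sup>2 / s = a\<^sup>2 / s + s * b\<^sup>2 / 4 - a * b"
      using s by (simp add: power2_eq_square field_simps)
    finally show ?thesis by simp
  qed
  also have "a\<^sup>2 / s \<le> (x * ln x - x + 1) / s" using h s by (simp add: a_def divide_right_mono)
  also have "s * b\<^sup>2 / 4 \<le> s * (x + 1) / 2"
  proof -
    have "b\<^sup>2 \<le> 2 * (x + 1)" using sum_squares_bound[of r 1] r by (simp add: b_def power2_eq_square algebra_simps)
    hence "s * b\<^sup>2 \<le> s * (2 * (x + 1))" using s by (intro mult_left_mono) auto
    thus ?thesis by (simp add: algebra_simps)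
  qed
  finally show ?thesis by simp
qed

text \<open>Pinsker's inequality linearized by a free parameter; bounds linear in the entropy can be
  added along the chain rule.\<close>

lemma (in prob_space) total_variation_le_entropy:
  assumes [measurable]: "g \<in> borel_measurable M" and g: "\<And>x. c \<le> g x \<and> g x \<le> (C::real)" "c > 0"
    and 1: "(\<integral>x. g x \<partial>M) = 1" and s: "s > 0"
  shows "(\<integral>x. \<bar>g x - 1\<bar> \<partial>M) \<le> (\<integral>x. g x * ln (g x) \<partial>M) / s + s"
proof -
  have gC: "\<bar>g x\<bar> \<le> C" for x using g(1)[of x] g(2) by linarith
  have ig: "integrable M g" by (rule integrable_const_bound[where B = C]) (use gC in auto)
  have il: "integrable M (\<lambda>x. g x * ln (g x))"
  proof (rule integrable_const_bound[where B = "C * (\<bar>ln c\<bar> + \<bar>ln C\<bar>)"])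
    have "\<bar>g x * ln (g x)\<bar> \<le> C * (\<bar>ln c\<bar> + \<bar>ln C\<bar>)" for x
    proof -
      have gx: "0 < c" "c \<le> g x" "g x \<le> C" using g by auto
      have "ln c \<le> ln (g x)" "ln (g x) \<le> ln C" using gx by auto
      hence "\<bar>ln (g x)\<bar> \<le> \<bar>ln c\<bar> + \<bar>ln C\<bar>" by linarith
      thus ?thesis unfolding abs_mult using gx by (intro mult_mono) auto
    qed
    thus "AE x in M. norm (g x * ln (g x)) \<le> C * (\<bar>ln c\<bar> + \<bar>ln C\<bar>)" by simp
  qed measurable
  have "(\<integral>x. \<bar>g x - 1\<bar> \<partial>M) \<le> (\<integral>x. (g x * ln (g x) - g x + 1) / s + s * (g x + 1) / 2 \<partial>M)"
  proof (rule integral_mono)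
    fix x show "\<bar>g x - 1\<bar> \<le> (g x * ln (g x) - g x + 1) / s + s * (g x + 1) / 2"
      using g(1)[of x] g(2) s by (intro abs_minus_1_le) auto
  qed (use ig il in auto)
  also have "\<dots> = (\<integral>x. g x * ln (g x) \<partial>M) / s + s"
    using ig il by (simp add: 1 prob_space)
  finally show ?thesis .
qed

lemma (in prob_space) entropy_nonneg:
  assumes "integrable M g" "integrable M (\<lambda>x. g x * ln (g x))" and g: "\<And>x. 0 < (g x :: real)" and 1: "(\<integral>x. g x \<partial>M) = 1"
  shows "(\<integral>x. g x * ln (g x) \<partial>M) \<ge> 0"
proof -
  have "(\<integral>x. g x - 1 \<partial>M) \<le> (\<integral>x. g x * ln (g x) \<partial>M)"
  proof (rule integral_mono)
    fix x
    have "ln (1 / g x) \<le> 1 / g x - 1" using g[of x] by (intro ln_le_minus_one) auto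
    hence "g x * (1 - 1 / g x) \<le> g x * ln (g x)" using g[of x] by (intro mult_left_mono) (auto simp: ln_div)
    thus "g x - 1 \<le> g x * ln (g x)" using g[of x] by (simp add: right_diff_distrib)
  qed (use assms in auto)
  thus ?thesis using assms by (simp add: prob_space)
qed

lemma (in unit_law) unit_law_density:
  assumes [measurable]: "g \<in> borel_measurable borel" and g: "\<And>x. 0 \<le> (g x :: real)"
    and ig: "integrable \<mu> g" and 1: "(\<integral>x. g x \<partial>\<mu>) = 1"
  shows "unit_law (density \<mu> g)"
proof -
  have "emeasure (density \<mu> g) (space (density \<mu> g)) = (\<integral>\<^sup>+x. ennreal (g x) \<partial>\<mu>)"
    by (subst emeasure_density) auto
  also have "\<dots> = ennreal (\<integral>x. g x \<partial>\<mu>)" by (rule nn_integral_eq_integral[OF ig]) (use g in auto)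
  finally have "prob_space (density \<mu> g)" using 1 by (intro prob_spaceI) simp
  moreover have "AE x in density \<mu> g. \<bar>x\<bar> \<le> 1" using bounded by (subst AE_density) auto
  ultimately show ?thesis by (simp add: unit_law_def unit_law_axioms_def)
qed

text \<open>The cdfs differ by at most the L1 distance of the densities, and the thresholds range
  over an interval of length 2.\<close>

lemma (in unit_law) qdist_density:
  assumes [measurable]: "g \<in> borel_measurable borel" and g: "\<And>x. 0 \<le> (g x :: real)"
    and ig: "integrable \<mu> g" and 1: "(\<integral>x. g x \<partial>\<mu>) = 1"
  shows "qdist (density \<mu> g) \<mu> \<le> 2 * (\<integral>x. \<bar>g x - 1\<bar> \<partial>\<mu>)"
proof -
  interpret D: unit_law "density \<mu> g" by (rule unit_law_density[OF assms])
  interpret two: two_unit_laws "density \<mu> g" \<mu> ..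
  define V where "V = (\<integral>x. \<bar>g x - 1\<bar> \<partial>\<mu>)"
  have V: "V \<ge> 0" unfolding V_def by (rule integral_nonneg_AE) simp
  have b: "\<bar>cdf (density \<mu> g) t - cdf \<mu> t\<bar> \<le> V" for t
  proof -
    have i1: "integrable \<mu> (\<lambda>x. indicator {..t} x * g x)"
      by (rule Bochner_Integration.integrable_bound[OF ig]) (auto simp: indicator_def)
    have i2: "integrable \<mu> (\<lambda>x. indicator {..t} x :: real)"
      by (rule integrable_bdd[where B = 1]) (auto simp: indicator_def)
    have "cdf (density \<mu> g) t = (\<integral>x. indicator {..t} x \<partial>density \<mu> g)" by (simp add: cdf_def)
    also have "\<dots> = (\<integral>x. g x *\<^sub>R indicator {..t} x \<partial>\<mu>)" by (rule integral_density) (use g in auto)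
    also have "\<dots> = (\<integral>x. indicator {..t} x * g x \<partial>\<mu>)" by (simp add: mult.commute)
    finally have e: "cdf (density \<mu> g) t = (\<integral>x. indicator {..t} x * g x \<partial>\<mu>)" .
    have "cdf \<mu> t = (\<integral>x. indicator {..t} x \<partial>\<mu>)" by (simp add: cdf_def)
    hence "\<bar>cdf (density \<mu> g) t - cdf \<mu> t\<bar> = \<bar>\<integral>x. indicator {..t} x * g x - indicator {..t} x \<partial>\<mu>\<bar>"
      using e i1 i2 by simp
    also have "\<dots> \<le> (\<integral>x. \<bar>indicator {..t} x * g x - indicator {..t} x\<bar> \<partial>\<mu>)" by (rule integral_abs_bound)
    also have "\<dots> \<le> V" unfolding V_def
      using ig i1 i2 by (intro integral_mono) (auto simp: indicator_def)
    finally show ?thesis .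
  qed
  have "ennreal (qdist (density \<mu> g) \<mu>) \<le> (\<integral>\<^sup>+t. ennreal \<bar>cdf (density \<mu> g) t - cdf \<mu> t\<bar> * indicator {-1..1} t \<partial>lborel)"
    by (rule two.qdist_le_cdf)
  also have "\<dots> \<le> (\<integral>\<^sup>+t. ennreal V * indicator {-1..1::real} t \<partial>lborel)"
    by (intro nn_integral_mono mult_right_mono ennreal_leI b) auto
  also have "\<dots> = ennreal (2 * V)"
    using V by (subst nn_integral_cmult_indicator) (auto simp: ennreal_mult mult.commute)
  finally show ?thesis using V by (subst (asm) ennreal_le_iff) (auto simp: V_def)
qed

lemma sets_PiM_rspace:
  assumes "\<And>i. i < k \<Longrightarrow> sets (Q i) = sets borel" shows "sets (PiM {..<k} Q) = sets (rspace k)"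
  by (intro sets_PiM_cong) (use assms in auto)

text \<open>The Knothe map pushes the uniform law on the cube forward to the law with density \<open>\<phi>\<close>, one
  conditional quantile function at a time; by \<open>qdist_density\<close> and the chain rule for the relative
  entropy it stays close on average to the coordinatewise quantile map of \<open>Q\<close>.\<close>

lemma knothe_map:
  fixes Q :: "nat \<Rightarrow> real measure"
  assumes Q: "\<And>i. unit_law (Q i)" and s: "s > 0"
  shows "\<phi> \<in> borel_measurable (rspace k) \<Longrightarrow> 0 < c \<Longrightarrow> (\<And>x. c \<le> \<phi> x \<and> \<phi> x \<le> (C::real)) \<Longrightarrow>
    (\<integral>x. \<phi> x \<partial>PiM {..<k} Q) = 1 \<Longrightarrow>
    \<exists>T. T \<in> PiM {..<k} (\<lambda>_. U01) \<rightarrow>\<^sub>M rspace k \<and>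
      distr (PiM {..<k} (\<lambda>_. U01)) (rspace k) T = density (PiM {..<k} Q) \<phi> \<and>
      (\<integral>\<^sup>+u. ennreal (\<Sum>i<k. \<bar>T u i - quantile (Q i) (u i)\<bar>) \<partial>PiM {..<k} (\<lambda>_. U01))
        \<le> ennreal (2 * ((\<integral>x. \<phi> x * ln (\<phi> x) \<partial>PiM {..<k} Q) / s + real k * s))"
proof (induction k arbitrary: \<phi>)
  case 0
  \<comment> \<open>The empty product has the single point \<open>\<lambda>_. undefined\<close>, so
    a density of total mass 1 equals 1 there.\<close>
  have e: "\<phi> (\<lambda>_. undefined) = 1"
    using 0(4) by (simp add: PiM_empty lebesgue_integral_count_space_finite)
  have "density (PiM {} Q) \<phi> = density (PiM {} Q) (\<lambda>_. 1)"
    by (rule density_cong) (auto simp: PiM_empty e)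
  hence d: "density (PiM {} Q) \<phi> = PiM {} Q" by (simp add: density_1)
  have "distr (PiM {} (\<lambda>_::nat. U01)) (PiM {} (\<lambda>_. borel)) (\<lambda>x. x) = density (PiM {} Q) \<phi>"
    unfolding d by (simp add: PiM_empty distr_id)
  moreover have "(\<lambda>x. x) \<in> PiM {} (\<lambda>_::nat. U01) \<rightarrow>\<^sub>M PiM {} (\<lambda>_. borel)"
    by (rule measurable_ident_sets) (simp add: PiM_empty)
  ultimately show ?case by (intro exI[of _ "\<lambda>x. x"]) simp
next
  case (Suc k)
  note [measurable] = Suc.prems(1)
  have sQ[measurable_cong]: "sets (Q i) = sets borel" for i using Q by (simp add: unit_law.sets_eq)
  have pQ: "prob_space (Q i)" for i using Q by (simp add: unit_law_def)
  interpret Qk: unit_law "Q k" by (rule Q)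
  interpret PQ: prob_space "PiM {..<k} Q" by (rule prob_space_PiM) (rule pQ)
  interpret PQS: prob_space "PiM {..<Suc k} Q" by (rule prob_space_PiM) (rule pQ)
  interpret Q: product_prob_space Q "{..<k}" by (intro product_prob_spaceI pQ)
  interpret U: product_prob_space "\<lambda>_::nat. U01" "{..<k}"
    by (intro product_prob_spaceI prob_space_U01)
  have sP[measurable_cong]: "sets (PiM {..<k} Q) = sets (rspace k)" by (intro sets_PiM_rspace sQ)
  have sP'[measurable_cong]: "sets (PiM {..<Suc k} Q) = sets (rspace (Suc k))" by (intro sets_PiM_rspace sQ)

  have upd[measurable]: "(\<lambda>x. (fst x)(k := snd x)) \<in> rspace k \<Otimes>\<^sub>M borel \<rightarrow>\<^sub>M rspace (Suc k)"
    using measurable_add_dim[of k "{..<k}" "\<lambda>_. borel"] by (simp add: lessThan_Suc split_beta')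
  have mupd: "(\<lambda>y. (f y)(k := g y)) \<in> N \<rightarrow>\<^sub>M rspace (Suc k)"
    if "f \<in> N \<rightarrow>\<^sub>M rspace k" "g \<in> N \<rightarrow>\<^sub>M borel" for N f g
    using measurable_compose[OF measurable_Pair[OF that] upd] by simp
  have c: "0 < c" "c \<le> \<phi> x" "\<phi> x \<le> C" "0 < \<phi> x" for x using Suc.prems(2) Suc.prems(3)[of x] by auto
  have lnb: "\<bar>ln y\<bar> \<le> \<bar>ln c\<bar> + \<bar>ln C\<bar>" if "c \<le> y" "y \<le> C" for y
  proof -
    have "ln c \<le> ln y" "ln y \<le> ln C" using that c(1) by auto
    thus ?thesis by linarith
  qed
  have m\<phi>[measurable]: "(\<lambda>x. \<phi> ((fst x)(k := snd x))) \<in> borel_measurable (rspace k \<Otimes>\<^sub>M Q k)"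
    using measurable_compose[OF upd Suc.prems(1)] by simp
  have m\<phi>x: "(\<lambda>z. \<phi> (x(k := z))) \<in> borel_measurable borel" if "x \<in> space (rspace k)" for x
  proof -
    have "(\<lambda>z. x(k := z)) \<in> borel \<rightarrow>\<^sub>M rspace (Suc k)" by (rule mupd) (use that in auto)
    thus ?thesis by (rule measurable_compose[OF _ Suc.prems(1)])
  qed
  define \<psi> where "\<psi> x = (\<integral>z. \<phi> (x(k := z)) \<partial>Q k)" for x
  have ix: "integrable (Q k) (\<lambda>z. \<phi> (x(k := z)))" if "x \<in> space (rspace k)" for x
    by (rule Qk.integrable_bdd[OF m\<phi>x[OF that], where B = C]) (use c less_imp_le in \<open>auto simp: abs_of_pos\<close>)
  have [measurable]: "(\<lambda>x. \<integral>z. \<phi> (x(k := z)) \<partial>Q k) \<in> borel_measurable (rspace k)"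
    using Qk.borel_measurable_lebesgue_integral[of "\<lambda>x z. \<phi> (x(k := z))" "rspace k"] m\<phi> by (simp add: split_beta')
  \<comment> \<open>The marginal density of the first k coordinates. Clamping to [c, C] changes
    nothing on the space (\<open>\<phi>k_eq\<close>), but gives the bounds at every function, as the
    induction hypothesis demands.\<close>
  define \<phi>k where "\<phi>k x = max c (min C (\<psi> x))" for x
  have m\<phi>k [measurable]: "\<phi>k \<in> borel_measurable (rspace k)"
    unfolding \<phi>k_def[abs_def] \<psi>_def by measurable
  have cC: "c \<le> C" using c(2,3)[of undefined] by linarith
  have \<phi>k_eq: "\<phi>k x = \<psi> x" if "x \<in> space (rspace k)" for x
  proof -
    have "\<psi> x \<le> C" "c \<le> \<psi> x" unfolding \<psi>_def
      using ix[OF that] c by (auto intro!: Qk.integral_le_const Qk.integral_ge_const)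
    thus ?thesis by (simp add: \<phi>k_def)
  qed
  have \<phi>kb: "c \<le> \<phi>k x" "\<phi>k x \<le> C" "0 < \<phi>k x" for x using cC c(1) by (auto simp: \<phi>k_def)
  have int_S: "integrable (PiM {..<Suc k} Q) f" if "f \<in> borel_measurable (rspace (Suc k))" "\<And>x. \<bar>f x\<bar> \<le> (B::real)" for f B
    by (rule PQS.integrable_const_bound[where B = B]) (use that in \<open>auto simp: measurable_cong_sets[OF sP' refl]\<close>)
  have int_k: "integrable (PiM {..<k} Q) f" if "f \<in> borel_measurable (rspace k)" "\<And>x. \<bar>f x\<bar> \<le> (B::real)" for f B
    by (rule PQ.integrable_const_bound[where B = B]) (use that in \<open>auto simp: measurable_cong_sets[OF sP refl]\<close>)
  have spk: "space (PiM {..<k} Q) = space (rspace k)" using sets_eq_imp_space_eq[OF sP] .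
  have insertS: "(\<integral>x. f x \<partial>PiM {..<Suc k} Q) = (\<integral>x. (\<integral>z. f (x(k := z)) \<partial>Q k) \<partial>PiM {..<k} Q)"
    if "f \<in> borel_measurable (rspace (Suc k))" "\<And>x. \<bar>f x\<bar> \<le> (B::real)" for f B
    unfolding lessThan_Suc
    using Q.product_integral_insert[of "{..<k}" k f] int_S[OF that] by (simp add: lessThan_Suc)
  have one: "(\<integral>x. \<phi>k x \<partial>PiM {..<k} Q) = 1"
  proof -
    have "(\<integral>x. \<phi>k x \<partial>PiM {..<k} Q) = (\<integral>x. (\<integral>z. \<phi> (x(k := z)) \<partial>Q k) \<partial>PiM {..<k} Q)"
      by (intro Bochner_Integration.integral_cong) (auto simp: \<phi>k_eq \<psi>_def spk)
    also have "\<dots> = (\<integral>x. \<phi> x \<partial>PiM {..<Suc k} Q)"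
      by (rule insertS[of _ C, symmetric]) (use c in \<open>auto simp: abs_of_pos\<close>)
    finally show ?thesis using Suc.prems(4) by simp
  qed
  obtain T where T [measurable]: "T \<in> PiM {..<k} (\<lambda>_. U01) \<rightarrow>\<^sub>M rspace k"
    and Td: "distr (PiM {..<k} (\<lambda>_. U01)) (rspace k) T = density (PiM {..<k} Q) \<phi>k"
    and Tc: "(\<integral>\<^sup>+u. ennreal (\<Sum>i<k. \<bar>T u i - quantile (Q i) (u i)\<bar>) \<partial>PiM {..<k} (\<lambda>_. U01))
        \<le> ennreal (2 * ((\<integral>x. \<phi>k x * ln (\<phi>k x) \<partial>PiM {..<k} Q) / s + real k * s))"
    using Suc.IH[OF m\<phi>k c(1) _ one] \<phi>kb(1,2) by blast
  \<comment> \<open>The conditional density of coordinate k given the earlier ones;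
    \<open>R x\<close> below is the conditional law and \<open>q x\<close> its quantile
    function.\<close>
  define g where "g x z = \<phi> (x(k := z)) / \<phi>k x" for x z
  have g0: "0 < g x z" for x z using c(4) \<phi>kb(3) by (simp add: g_def)
  have gb: "c / C \<le> g x z" "g x z \<le> C / c" for x z
    using c(1) c(2-4)[of "x(k := z)"] \<phi>kb[of x] unfolding g_def by (auto intro!: frac_le)
  have mg: "g x \<in> borel_measurable borel" if "x \<in> space (rspace k)" for x
    unfolding g_def[abs_def] using m\<phi>x[OF that] by simp
  have ig: "integrable (Q k) (g x)" if "x \<in> space (rspace k)" for x
    unfolding g_def[abs_def] using ix[OF that] by simp
  have g1: "(\<integral>z. g x z \<partial>Q k) = 1" if "x \<in> space (rspace k)" for x
    using \<phi>k_eq[OF that] \<phi>kb(3)[of x] by (simp add: g_def \<psi>_def)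
  define R where "R x = density (Q k) (g x)" for x
  have R: "unit_law (R x)" if "x \<in> space (rspace k)" for x
    unfolding R_def using g0 less_imp_le by (intro Qk.unit_law_density mg ig g1 that) auto
  define q where "q x \<omega> = quantile (R x) \<omega>" for x \<omega>
  \<comment> \<open>Joint measurability in the past and the uniform variable: the quantile is at
    most t iff the uniform variable is at most the conditional cdf at t, and that cdf is a
    measurable integral.\<close>
  have mq: "(\<lambda>y. q (fst y) (snd y)) \<in> borel_measurable (rspace k \<Otimes>\<^sub>M U01)"
  proof (rule borel_measurableI_le)
    fix t
    have cdfR: "cdf (R x) t = (\<integral>z. indicator {..t} z * g x z \<partial>Q k)" if "x \<in> space (rspace k)" for x
    proof -
      interpret R: unit_law "R x" by (rule R[OF that])
      have "cdf (R x) t = (\<integral>z. indicator {..t} z \<partial>R x)" by (simp add: cdf_def)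
      also have "\<dots> = (\<integral>z. g x z *\<^sub>R indicator {..t} z \<partial>Q k)"
        unfolding R_def using mg[OF that] g0 by (intro integral_density) (auto intro!: AE_I2 less_imp_le)
      finally show ?thesis by (simp add: mult.commute)
    qed
    have m: "(\<lambda>x. \<integral>z. indicator {..t} z * g x z \<partial>Q k) \<in> borel_measurable (rspace k)"
      unfolding g_def[abs_def]
      by (rule Qk.borel_measurable_lebesgue_integral) (simp add: split_beta')
    have "{y \<in> space (rspace k \<Otimes>\<^sub>M U01). q (fst y) (snd y) \<le> t}
        = {y \<in> space (rspace k \<Otimes>\<^sub>M U01). snd y \<le> (\<integral>z. indicator {..t} z * g (fst y) z \<partial>Q k)}"
    proof (intro Collect_cong conj_cong refl)
      fix y assume "y \<in> space (rspace k \<Otimes>\<^sub>M U01)"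
      hence y: "fst y \<in> space (rspace k)" "snd y \<in> {0<..<1}" by (auto simp: space_pair_measure)
      interpret R: unit_law "R (fst y)" by (rule R[OF y(1)])
      show "q (fst y) (snd y) \<le> t \<longleftrightarrow> snd y \<le> (\<integral>z. indicator {..t} z * g (fst y) z \<partial>Q k)"
        using R.quantile_le_iff[of "snd y" t] y by (simp add: q_def cdfR)
    qed
    moreover have "(\<lambda>\<omega>. \<omega>) \<in> borel_measurable U01"
      unfolding U01_def by (rule measurable_restrict_space1) simp
    hence "{y \<in> space (rspace k \<Otimes>\<^sub>M U01). snd y \<le> (\<integral>z. indicator {..t} z * g (fst y) z \<partial>Q k)} \<in> sets (rspace k \<Otimes>\<^sub>M U01)"
      by (intro borel_measurable_le measurable_compose[OF measurable_snd] measurable_compose[OF measurable_fst m])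
    ultimately show "{y \<in> space (rspace k \<Otimes>\<^sub>M U01). q (fst y) (snd y) \<le> t} \<in> sets (rspace k \<Otimes>\<^sub>M U01)"
      by simp
  qed
  \<comment> \<open>The new coordinate is the conditional quantile at the transported past, not at
    the uniform input.\<close>
  define T' where "T' u = (let x = T (restrict u {..<k}) in x(k := q x (u k)))" for u
  have mr: "(\<lambda>u. restrict u {..<k}) \<in> PiM {..<Suc k} (\<lambda>_. U01) \<rightarrow>\<^sub>M PiM {..<k} (\<lambda>_. U01)"
    by (rule measurable_restrict_subset) auto
  have mTr: "(\<lambda>u. T (restrict u {..<k})) \<in> PiM {..<Suc k} (\<lambda>_. U01) \<rightarrow>\<^sub>M rspace k"
    by (rule measurable_compose[OF mr T])
  have mT': "T' \<in> PiM {..<Suc k} (\<lambda>_. U01) \<rightarrow>\<^sub>M rspace (Suc k)"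
    unfolding T'_def[abs_def] Let_def
  proof (rule mupd[OF mTr])
    show "(\<lambda>u. q (T (restrict u {..<k})) (u k)) \<in> borel_measurable (PiM {..<Suc k} (\<lambda>_. U01))"
      using measurable_compose[OF measurable_Pair[OF mTr measurable_component_singleton[of k "{..<Suc k}" "\<lambda>_. U01"]] mq]
      by simp
  qed
  have T'upd: "T' (u(k := \<omega>)) = (T u)(k := q (T u) \<omega>)" if "u \<in> space (PiM {..<k} (\<lambda>_. U01))" for u \<omega>
  proof -
    have "restrict (u(k := \<omega>)) {..<k} = u"
      using that by (auto simp: space_PiM PiE_def extensional_def fun_eq_iff restrict_def)
    thus ?thesis by (simp add: T'_def Let_def)
  qed
  have nnU: "(\<integral>\<^sup>+u. f u \<partial>PiM {..<Suc k} (\<lambda>_. U01)) = (\<integral>\<^sup>+u. (\<integral>\<^sup>+\<omega>. f (u(k := \<omega>)) \<partial>U01) \<partial>PiM {..<k} (\<lambda>_. U01))"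
    if "f \<in> borel_measurable (PiM {..<Suc k} (\<lambda>_. U01))" for f
    unfolding lessThan_Suc using U.product_nn_integral_insert[of "{..<k}" k f] that by (simp add: lessThan_Suc)
  have nnQ: "(\<integral>\<^sup>+x. f x \<partial>PiM {..<Suc k} Q) = (\<integral>\<^sup>+x. (\<integral>\<^sup>+z. f (x(k := z)) \<partial>Q k) \<partial>PiM {..<k} Q)"
    if "f \<in> borel_measurable (rspace (Suc k))" for f
    unfolding lessThan_Suc using Q.product_nn_integral_insert[of "{..<k}" k f] that
    by (simp add: lessThan_Suc measurable_cong_sets[OF sP'[unfolded lessThan_Suc] refl])
  \<comment> \<open>The first k coordinates of the image have density \<open>\<phi>k\<close>, so
    integrals along \<open>T\<close> become weighted integrals against the product. Both the law and
    the cost of the extended map are computed this way.\<close>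
  have push: "(\<integral>\<^sup>+u. f (T u) \<partial>PiM {..<k} (\<lambda>_. U01)) = (\<integral>\<^sup>+x. ennreal (\<phi>k x) * f x \<partial>PiM {..<k} Q)"
    if [measurable]: "f \<in> borel_measurable (rspace k)" for f
  proof -
    have "(\<integral>\<^sup>+u. f (T u) \<partial>PiM {..<k} (\<lambda>_. U01)) = (\<integral>\<^sup>+x. f x \<partial>distr (PiM {..<k} (\<lambda>_. U01)) (rspace k) T)"
      by (subst nn_integral_distr) auto
    thus ?thesis unfolding Td by (subst (asm) nn_integral_density) auto
  qed
  have law: "distr (PiM {..<Suc k} (\<lambda>_. U01)) (rspace (Suc k)) T' = density (PiM {..<Suc k} Q) \<phi>"
  proof (rule measure_eqI)
    show "sets (distr (PiM {..<Suc k} (\<lambda>_. U01)) (rspace (Suc k)) T') = sets (density (PiM {..<Suc k} Q) \<phi>)"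
      using sP' by simp
    fix A assume "A \<in> sets (distr (PiM {..<Suc k} (\<lambda>_. U01)) (rspace (Suc k)) T')"
    hence A [measurable]: "A \<in> sets (rspace (Suc k))" by simp
    let ?I = "indicator A :: _ \<Rightarrow> ennreal"
    have mI: "(\<lambda>y. ?I ((fst y)(k := snd y))) \<in> borel_measurable (rspace k \<Otimes>\<^sub>M borel)"
      by (rule measurable_compose[OF upd]) simp
    have "emeasure (distr (PiM {..<Suc k} (\<lambda>_. U01)) (rspace (Suc k)) T') A
       = (\<integral>\<^sup>+x. ?I x \<partial>distr (PiM {..<Suc k} (\<lambda>_. U01)) (rspace (Suc k)) T')" by simp
    also have "\<dots> = (\<integral>\<^sup>+u. ?I (T' u) \<partial>PiM {..<Suc k} (\<lambda>_. U01))"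
      by (rule nn_integral_distr[OF mT']) simp
    also have "\<dots> = (\<integral>\<^sup>+u. (\<integral>\<^sup>+\<omega>. ?I (T' (u(k := \<omega>))) \<partial>U01) \<partial>PiM {..<k} (\<lambda>_. U01))"
      by (rule nnU) (rule measurable_compose[OF mT'], simp)
    also have "\<dots> = (\<integral>\<^sup>+u. (\<lambda>x. \<integral>\<^sup>+\<omega>. ?I (x(k := q x \<omega>)) \<partial>U01) (T u) \<partial>PiM {..<k} (\<lambda>_. U01))"
      by (intro nn_integral_cong) (simp add: T'upd)
    also have "\<dots> = (\<integral>\<^sup>+x. ennreal (\<phi>k x) * (\<integral>\<^sup>+\<omega>. ?I (x(k := q x \<omega>)) \<partial>U01) \<partial>PiM {..<k} Q)"
    proof (rule push)
      have "(\<lambda>y. (fst y)(k := q (fst y) (snd y))) \<in> rspace k \<Otimes>\<^sub>M U01 \<rightarrow>\<^sub>M rspace (Suc k)"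
        by (rule mupd[OF measurable_fst mq])
      from measurable_compose[OF this borel_measurable_indicator[OF A]]
      show "(\<lambda>x. \<integral>\<^sup>+\<omega>. ?I (x(k := q x \<omega>)) \<partial>U01) \<in> borel_measurable (rspace k)"
        by (intro U01.borel_measurable_nn_integral) (simp add: split_beta')
    qed
    also have "\<dots> = (\<integral>\<^sup>+x. (\<integral>\<^sup>+z. ennreal (\<phi> (x(k := z))) * ?I (x(k := z)) \<partial>Q k) \<partial>PiM {..<k} Q)"
    proof (rule nn_integral_cong)
      fix x assume "x \<in> space (PiM {..<k} Q)"
      hence x: "x \<in> space (rspace k)" by (simp add: spk)
      interpret R: unit_law "R x" by (rule R[OF x])
      have mI: "(\<lambda>z. ?I (x(k := z))) \<in> borel_measurable borel"
        by (rule measurable_compose[OF mupd[of "\<lambda>_. x"] borel_measurable_indicator[OF A]]) (use x in auto)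
      have "(\<integral>\<^sup>+\<omega>. ?I (x(k := q x \<omega>)) \<partial>U01) = (\<integral>\<^sup>+z. ?I (x(k := z)) \<partial>distr U01 borel (quantile (R x)))"
        unfolding q_def by (subst nn_integral_distr) (use mI in auto)
      also have "\<dots> = (\<integral>\<^sup>+z. ?I (x(k := z)) \<partial>density (Q k) (g x))" by (simp add: R.distr_quantile) (simp add: R_def)
      also have "\<dots> = (\<integral>\<^sup>+z. ennreal (g x z) * ?I (x(k := z)) \<partial>Q k)"
        by (rule nn_integral_density) (use mg[OF x] mI in auto)
      finally have e: "(\<integral>\<^sup>+\<omega>. ?I (x(k := q x \<omega>)) \<partial>U01) = (\<integral>\<^sup>+z. ennreal (g x z) * ?I (x(k := z)) \<partial>Q k)" .
      have "ennreal (\<phi>k x) * (\<integral>\<^sup>+\<omega>. ?I (x(k := q x \<omega>)) \<partial>U01) = (\<integral>\<^sup>+z. ennreal (\<phi>k x) * (ennreal (g x z) * ?I (x(k := z))) \<partial>Q k)"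
        unfolding e by (rule nn_integral_cmult[symmetric]) (use mg[OF x] mI in auto)
      also have "\<dots> = (\<integral>\<^sup>+z. ennreal (\<phi> (x(k := z))) * ?I (x(k := z)) \<partial>Q k)"
        using \<phi>kb(3)[of x] g0[of x]
        by (intro nn_integral_cong) (simp add: mult.assoc[symmetric] ennreal_mult'[symmetric] g_def)
      finally show "ennreal (\<phi>k x) * (\<integral>\<^sup>+\<omega>. ?I (x(k := q x \<omega>)) \<partial>U01) = (\<integral>\<^sup>+z. ennreal (\<phi> (x(k := z))) * ?I (x(k := z)) \<partial>Q k)" .
    qed
    also have "\<dots> = (\<integral>\<^sup>+x. ennreal (\<phi> x) * ?I x \<partial>PiM {..<Suc k} Q)"
      by (rule nnQ[symmetric]) measurable
    also have "\<dots> = emeasure (density (PiM {..<Suc k} Q) \<phi>) A"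
      by (rule emeasure_density[symmetric]) (simp_all add: sP' measurable_cong_sets[OF sP' refl])
    finally show "emeasure (distr (PiM {..<Suc k} (\<lambda>_. U01)) (rspace (Suc k)) T') A = emeasure (density (PiM {..<Suc k} Q) \<phi>) A" .
  qed
  define kl where "kl x = (\<integral>z. g x z * ln (g x z) \<partial>Q k)" for x
  define Ek where "Ek = (\<integral>x. \<phi>k x * ln (\<phi>k x) \<partial>PiM {..<k} Q)"
  have mkl [measurable]: "kl \<in> borel_measurable (rspace k)"
    unfolding kl_def[abs_def] g_def[abs_def]
    by (rule Qk.borel_measurable_lebesgue_integral) (simp add: split_beta')
  define Bk where "Bk = C / c * (\<bar>ln (c / C)\<bar> + \<bar>ln (C / c)\<bar>)"
  have C0: "C > 0" using c(1) cC by linarith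
  have gln: "\<bar>g x z * ln (g x z)\<bar> \<le> Bk" for x z
  proof -
    have "ln (c / C) \<le> ln (g x z)" "ln (g x z) \<le> ln (C / c)"
      using gb[of x z] g0[of x z] c(1) C0 by auto
    hence "\<bar>ln (g x z)\<bar> \<le> \<bar>ln (c / C)\<bar> + \<bar>ln (C / c)\<bar>" by linarith
    thus ?thesis unfolding abs_mult Bk_def using gb[of x z] g0[of x z] by (intro mult_mono) auto
  qed
  have igl: "integrable (Q k) (\<lambda>z. g x z * ln (g x z))" if "x \<in> space (rspace k)" for x
    using mg[OF that] by (intro Qk.integrable_bdd[where B = Bk] gln) auto
  have kl0: "kl x \<ge> 0" if "x \<in> space (rspace k)" for x
    unfolding kl_def using that by (intro Qk.entropy_nonneg ig igl g0 g1)
  have klB: "kl x \<le> Bk" if "x \<in> space (rspace k)" for x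
    unfolding kl_def using igl[OF that] gln[of x] by (intro Qk.integral_le_const) (auto simp: abs_le_iff)
  have qd: "qdist (R x) (Q k) \<le> 2 * (kl x / s + s)" if "x \<in> space (rspace k)" for x
  proof -
    have "qdist (R x) (Q k) \<le> 2 * (\<integral>z. \<bar>g x z - 1\<bar> \<partial>Q k)"
      unfolding R_def using g0 less_imp_le by (intro Qk.qdist_density mg ig g1 that) auto
    moreover have "(\<integral>z. \<bar>g x z - 1\<bar> \<partial>Q k) \<le> kl x / s + s"
      unfolding kl_def
      by (rule Qk.total_variation_le_entropy[where c = "c / C" and C = "C / c"])
         (use mg[OF that] gb[of x] c(1) C0 g1[OF that] s in auto)
    ultimately show ?thesis by simp
  qed
  \<comment> \<open>Chain rule for the relative entropy at a fixed past: the logarithm of the joint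
    density is the sum of those of the marginal and of the conditional density.\<close>
  have chain: "\<phi>k x * kl x = (\<integral>z. \<phi> (x(k := z)) * ln (\<phi> (x(k := z))) \<partial>Q k) - \<phi>k x * ln (\<phi>k x)"
    if x: "x \<in> space (rspace k)" for x
  proof -
    have il: "integrable (Q k) (\<lambda>z. \<phi> (x(k := z)) * ln (\<phi> (x(k := z))))"
    proof (rule Qk.integrable_bdd[where B = "C * (\<bar>ln c\<bar> + \<bar>ln C\<bar>)"])
      show "(\<lambda>z. \<phi> (x(k := z)) * ln (\<phi> (x(k := z)))) \<in> borel_measurable borel"
        using m\<phi>x[OF x] by measurable
      show "\<bar>\<phi> (x(k := z)) * ln (\<phi> (x(k := z)))\<bar> \<le> C * (\<bar>ln c\<bar> + \<bar>ln C\<bar>)" for z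
        unfolding abs_mult using c(2-4)[of "x(k := z)"] lnb[of "\<phi> (x(k := z))"] C0 by (intro mult_mono) auto
    qed
    have "\<phi>k x * kl x = (\<integral>z. \<phi>k x * (g x z * ln (g x z)) \<partial>Q k)" unfolding kl_def by simp
    also have "\<dots> = (\<integral>z. \<phi> (x(k := z)) * ln (\<phi> (x(k := z))) - \<phi> (x(k := z)) * ln (\<phi>k x) \<partial>Q k)"
      using \<phi>kb(3)[of x] c(4) by (intro Bochner_Integration.integral_cong) (auto simp: g_def ln_div right_diff_distrib less_imp_neq[symmetric])
    also have "\<dots> = (\<integral>z. \<phi> (x(k := z)) * ln (\<phi> (x(k := z))) \<partial>Q k) - (\<integral>z. \<phi> (x(k := z)) \<partial>Q k) * ln (\<phi>k x)"
      using il ix[OF x] by simp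
    also have "(\<integral>z. \<phi> (x(k := z)) \<partial>Q k) = \<phi>k x" using \<phi>k_eq[OF x] by (simp add: \<psi>_def)
    finally show ?thesis .
  qed
  have ik: "integrable (PiM {..<k} Q) (\<lambda>x. \<phi>k x * ln (\<phi>k x))"
  proof (rule int_k[of _ "C * (\<bar>ln c\<bar> + \<bar>ln C\<bar>)"])
    show "\<bar>\<phi>k x * ln (\<phi>k x)\<bar> \<le> C * (\<bar>ln c\<bar> + \<bar>ln C\<bar>)" for x
      unfolding abs_mult using \<phi>kb[of x] lnb[of "\<phi>k x"] C0 by (intro mult_mono) auto
  qed measurable

  have ikl: "integrable (PiM {..<k} Q) (\<lambda>x. \<phi>k x * kl x)"
  proof (rule PQ.integrable_const_bound[where B = "C * Bk"])
    have "\<bar>\<phi>k x * kl x\<bar> \<le> C * Bk" if "x \<in> space (rspace k)" for x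
      unfolding abs_mult using \<phi>kb[of x] kl0[OF that] klB[OF that] C0 by (intro mult_mono) auto
    thus "AE x in PiM {..<k} Q. norm (\<phi>k x * kl x) \<le> C * Bk" by (intro AE_I2) (simp add: spk)
  qed simp
  have ik1: "integrable (PiM {..<k} Q) \<phi>k"
    by (rule int_k[of _ C]) (use \<phi>kb in \<open>auto simp: abs_of_pos\<close>)
  have Ekl: "(\<integral>x. \<phi>k x * kl x \<partial>PiM {..<k} Q) = (\<integral>x. \<phi> x * ln (\<phi> x) \<partial>PiM {..<Suc k} Q) - Ek"
  proof -
    have "(\<integral>x. \<phi> x * ln (\<phi> x) \<partial>PiM {..<Suc k} Q) = (\<integral>x. (\<integral>z. \<phi> (x(k := z)) * ln (\<phi> (x(k := z))) \<partial>Q k) \<partial>PiM {..<k} Q)"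
    proof (rule insertS[of _ "C * (\<bar>ln c\<bar> + \<bar>ln C\<bar>)"])
      show "\<bar>\<phi> x * ln (\<phi> x)\<bar> \<le> C * (\<bar>ln c\<bar> + \<bar>ln C\<bar>)" for x
        unfolding abs_mult using c(2-4)[of x] lnb[of "\<phi> x"] C0 by (intro mult_mono) auto
    qed measurable
    also have "\<dots> = (\<integral>x. \<phi>k x * kl x + \<phi>k x * ln (\<phi>k x) \<partial>PiM {..<k} Q)"
      by (intro Bochner_Integration.integral_cong) (auto simp: chain spk)
    also have "\<dots> = (\<integral>x. \<phi>k x * kl x \<partial>PiM {..<k} Q) + Ek" unfolding Ek_def using ik ikl by simp
    finally show ?thesis by simp
  qed
  have Ek0: "Ek \<ge> 0" unfolding Ek_def by (rule PQ.entropy_nonneg[OF ik1 ik \<phi>kb(3) one])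
  have [measurable]: "quantile (Q i) \<in> borel_measurable U01" for i by (rule unit_law.measurable_quantile[OF Q])
  have mcost: "(\<lambda>u. ennreal (\<Sum>i<m. \<bar>t u i - quantile (Q i) (u i)\<bar>)) \<in> borel_measurable (PiM {..<m} (\<lambda>_. U01))"
    if [measurable]: "t \<in> PiM {..<m} (\<lambda>_. U01) \<rightarrow>\<^sub>M rspace m" for t m
  proof -
    have "(\<lambda>u. t u i) \<in> borel_measurable (PiM {..<m} (\<lambda>_. U01))" if "i < m" for i
      by (rule measurable_compose[OF _ measurable_component_singleton[of i "{..<m}" "\<lambda>_. borel"]]) (use that in auto)
    moreover have "(\<lambda>u. quantile (Q i) (u i)) \<in> borel_measurable (PiM {..<m} (\<lambda>_. U01))" if "i < m" for i
      by (rule measurable_compose[OF measurable_component_singleton[of i "{..<m}" "\<lambda>_. U01"]]) (use that in auto)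
    ultimately show ?thesis by (intro measurable_compose[OF _ measurable_ennreal] borel_measurable_sum borel_measurable_abs borel_measurable_diff) auto
  qed
  have "(\<integral>\<^sup>+u. ennreal (\<Sum>i<Suc k. \<bar>T' u i - quantile (Q i) (u i)\<bar>) \<partial>PiM {..<Suc k} (\<lambda>_. U01))
     = (\<integral>\<^sup>+u. (\<integral>\<^sup>+\<omega>. ennreal (\<Sum>i<Suc k. \<bar>T' (u(k := \<omega>)) i - quantile (Q i) ((u(k := \<omega>)) i)\<bar>) \<partial>U01) \<partial>PiM {..<k} (\<lambda>_. U01))"
    by (rule nnU[OF mcost[OF mT']])
  also have "\<dots> \<le> (\<integral>\<^sup>+u. ennreal (\<Sum>i<k. \<bar>T u i - quantile (Q i) (u i)\<bar>) + (\<lambda>x. ennreal (2 * (kl x / s + s))) (T u) \<partial>PiM {..<k} (\<lambda>_. U01))"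
  proof (rule nn_integral_mono)
    fix u assume u: "u \<in> space (PiM {..<k} (\<lambda>_. U01))"
    have Tu: "T u \<in> space (rspace k)" by (rule measurable_space[OF T u])
    interpret R: unit_law "R (T u)" by (rule R[OF Tu])
    interpret two: two_unit_laws "R (T u)" "Q k" ..
    let ?a = "\<Sum>i<k. \<bar>T u i - quantile (Q i) (u i)\<bar>"
    have "(\<integral>\<^sup>+\<omega>. ennreal (\<Sum>i<Suc k. \<bar>T' (u(k := \<omega>)) i - quantile (Q i) ((u(k := \<omega>)) i)\<bar>) \<partial>U01)
        = (\<integral>\<^sup>+\<omega>. ennreal ?a + ennreal \<bar>quantile (R (T u)) \<omega> - quantile (Q k) \<omega>\<bar> \<partial>U01)"
      by (intro nn_integral_cong) (simp add: T'upd[OF u] q_def ennreal_plus[symmetric] sum_nonneg del: ennreal_plus)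
    also have "\<dots> = ennreal ?a + ennreal (qdist (R (T u)) (Q k))"
      by (subst nn_integral_add) (auto simp: two.nn_qdist U01.emeasure_space_1[simplified])
    also have "\<dots> \<le> ennreal ?a + ennreal (2 * (kl (T u) / s + s))"
      by (intro add_left_mono ennreal_leI qd[OF Tu])
    finally show "(\<integral>\<^sup>+\<omega>. ennreal (\<Sum>i<Suc k. \<bar>T' (u(k := \<omega>)) i - quantile (Q i) ((u(k := \<omega>)) i)\<bar>) \<partial>U01)
      \<le> ennreal ?a + (\<lambda>x. ennreal (2 * (kl x / s + s))) (T u)" by simp
  qed
  also have "\<dots> = (\<integral>\<^sup>+u. ennreal (\<Sum>i<k. \<bar>T u i - quantile (Q i) (u i)\<bar>) \<partial>PiM {..<k} (\<lambda>_. U01))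
      + (\<integral>\<^sup>+u. (\<lambda>x. ennreal (2 * (kl x / s + s))) (T u) \<partial>PiM {..<k} (\<lambda>_. U01))"
    by (rule nn_integral_add) (auto intro!: mcost)
  also have "(\<integral>\<^sup>+u. (\<lambda>x. ennreal (2 * (kl x / s + s))) (T u) \<partial>PiM {..<k} (\<lambda>_. U01))
     = (\<integral>\<^sup>+x. ennreal (\<phi>k x) * ennreal (2 * (kl x / s + s)) \<partial>PiM {..<k} Q)"
    by (rule push) measurable
  also have "\<dots> = (\<integral>\<^sup>+x. ennreal (2 / s * (\<phi>k x * kl x) + 2 * s * \<phi>k x) \<partial>PiM {..<k} Q)"
  proof (rule nn_integral_cong)
    fix x assume "x \<in> space (PiM {..<k} Q)"
    have "ennreal (\<phi>k x) * ennreal (2 * (kl x / s + s)) = ennreal (\<phi>k x * (2 * (kl x / s + s)))"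
      using \<phi>kb(3)[of x] by (intro ennreal_mult'[symmetric]) simp
    thus "ennreal (\<phi>k x) * ennreal (2 * (kl x / s + s)) = ennreal (2 / s * (\<phi>k x * kl x) + 2 * s * \<phi>k x)"
      by (simp add: algebra_simps)
  qed
  also have "\<dots> = ennreal (\<integral>x. 2 / s * (\<phi>k x * kl x) + 2 * s * \<phi>k x \<partial>PiM {..<k} Q)"
    using ikl ik1 s \<phi>kb(3) kl0
    by (intro nn_integral_eq_integral) (auto simp: spk less_imp_le intro!: AE_I2 add_nonneg_nonneg mult_nonneg_nonneg)
  also have "(\<integral>x. 2 / s * (\<phi>k x * kl x) + 2 * s * \<phi>k x \<partial>PiM {..<k} Q)
     = 2 / s * ((\<integral>x. \<phi> x * ln (\<phi> x) \<partial>PiM {..<Suc k} Q) - Ek) + 2 * s"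
    using ikl ik1 by (simp add: Ekl one)
  finally have "(\<integral>\<^sup>+u. ennreal (\<Sum>i<Suc k. \<bar>T' u i - quantile (Q i) (u i)\<bar>) \<partial>PiM {..<Suc k} (\<lambda>_. U01))
     \<le> ennreal (2 * (Ek / s + real k * s)) + ennreal (2 / s * ((\<integral>x. \<phi> x * ln (\<phi> x) \<partial>PiM {..<Suc k} Q) - Ek) + 2 * s)"
    using Tc unfolding Ek_def by (meson add_right_mono order_trans)
  also have "\<dots> = ennreal (2 * (Ek / s + real k * s) + (2 / s * ((\<integral>x. \<phi> x * ln (\<phi> x) \<partial>PiM {..<Suc k} Q) - Ek) + 2 * s))"
  proof (rule ennreal_plus[symmetric])
    have "0 \<le> (\<integral>x. \<phi>k x * kl x \<partial>PiM {..<k} Q)"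
      using \<phi>kb(3) kl0 by (intro integral_nonneg_AE AE_I2) (auto simp: spk less_imp_le)
    thus "0 \<le> 2 / s * ((\<integral>x. \<phi> x * ln (\<phi> x) \<partial>PiM {..<Suc k} Q) - Ek) + 2 * s"
      unfolding Ekl using s by (intro add_nonneg_nonneg mult_nonneg_nonneg) auto
  qed (use Ek0 s in auto)
  \<comment> \<open>The entropy of the marginal cancels; this is where linearity in the entropy pays
    off.\<close>
  also have "2 * (Ek / s + real k * s) + (2 / s * ((\<integral>x. \<phi> x * ln (\<phi> x) \<partial>PiM {..<Suc k} Q) - Ek) + 2 * s)
     = 2 * ((\<integral>x. \<phi> x * ln (\<phi> x) \<partial>PiM {..<Suc k} Q) / s + real (Suc k) * s)"
    using s by (simp add: field_simps)
  finally show ?case using mT' law by blast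
qed

section \<open>Images and densities of finite product laws\<close>

lemma distr_PiM_maps:
  assumes I: "finite I" and M: "\<And>i. prob_space (M i)" and f: "\<And>i. i \<in> I \<Longrightarrow> f i \<in> M i \<rightarrow>\<^sub>M N i"
  shows "distr (PiM I M) (PiM I N) (\<lambda>x. \<lambda>i\<in>I. f i (x i)) = PiM I (\<lambda>i. distr (M i) (N i) (f i))"
proof -
  \<comment> \<open>\<open>PiM_eqI\<close> is used for a family of probability spaces at all
    indices, while f is controlled only on I; a point mass fills in off I.\<close>
  define M' where "M' i = (if i \<in> I then distr (M i) (N i) (f i) else return (count_space UNIV) undefined)" for i
  have pM': "prob_space (M' i)" for i
    unfolding M'_def using prob_space.prob_space_distr[OF M f] by (auto intro: prob_space_return)
  interpret M: product_prob_space M by (intro product_prob_spaceI M)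
  interpret M': product_prob_space M' by (intro product_prob_spaceI pM')
  have meas: "(\<lambda>x. \<lambda>i\<in>I. f i (x i)) \<in> PiM I M \<rightarrow>\<^sub>M PiM I N"
  proof (rule measurable_restrict)
    fix i assume i: "i \<in> I"
    show "(\<lambda>x. f i (x i)) \<in> PiM I M \<rightarrow>\<^sub>M N i"
      by (rule measurable_compose[where f = "\<lambda>x. x i" and g = "f i" and N = "M i"])
         (use i f in \<open>auto intro: measurable_component_singleton\<close>)
  qed
  have sets: "sets (PiM I N) = sets (PiM I M')"
    by (intro sets_PiM_cong) (auto simp: M'_def)
  have "distr (PiM I M) (PiM I N) (\<lambda>x. \<lambda>i\<in>I. f i (x i)) = PiM I M'"
  proof (rule M'.PiM_eqI[OF I])
    show "sets (distr (PiM I M) (PiM I N) (\<lambda>x. \<lambda>i\<in>I. f i (x i))) = sets (PiM I M')" using sets by simp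
    fix A assume A: "\<And>i. i \<in> I \<Longrightarrow> A i \<in> sets (M' i)"
    hence A': "A i \<in> sets (N i)" if "i \<in> I" for i using that by (fastforce simp: M'_def)
    have pre: "(\<lambda>x. \<lambda>i\<in>I. f i (x i)) -` Pi\<^sub>E I A \<inter> space (PiM I M) = Pi\<^sub>E I (\<lambda>i. f i -` A i \<inter> space (M i))"
      by (auto simp: space_PiM PiE_iff extensional_def)
    have "emeasure (distr (PiM I M) (PiM I N) (\<lambda>x. \<lambda>i\<in>I. f i (x i))) (Pi\<^sub>E I A)
       = emeasure (PiM I M) (Pi\<^sub>E I (\<lambda>i. f i -` A i \<inter> space (M i)))"
      unfolding pre[symmetric] using A' by (intro emeasure_distr meas) (auto intro!: sets_PiM_I_finite I)
    also have "\<dots> = (\<Prod>i\<in>I. emeasure (M i) (f i -` A i \<inter> space (M i)))"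
      using A' f by (intro M.emeasure_PiM I) (auto intro: measurable_sets)
    also have "\<dots> = (\<Prod>i\<in>I. emeasure (M' i) (A i))"
      using A' f by (intro prod.cong refl) (simp add: M'_def emeasure_distr)
    finally show "emeasure (distr (PiM I M) (PiM I N) (\<lambda>x. \<lambda>i\<in>I. f i (x i))) (Pi\<^sub>E I A) = (\<Prod>i\<in>I. emeasure (M' i) (A i))" .
  qed
  also have "PiM I M' = PiM I (\<lambda>i. distr (M i) (N i) (f i))"
    by (intro PiM_cong) (auto simp: M'_def)
  finally show ?thesis .
qed

lemma PiM_density:
  assumes I: "finite I" and M: "\<And>i. prob_space (M i)" and f: "\<And>i. i \<in> I \<Longrightarrow> f i \<in> borel_measurable (M i)"
    and D: "\<And>i. i \<in> I \<Longrightarrow> prob_space (density (M i) (f i))"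
  shows "PiM I (\<lambda>i. density (M i) (f i)) = density (PiM I M) (\<lambda>x. \<Prod>i\<in>I. f i (x i))"
proof -
  \<comment> \<open>The densities are normalized only on I, so the factors off I are left unchanged
    to keep a family of probability spaces.\<close>
  define M' where "M' i = (if i \<in> I then density (M i) (f i) else M i)" for i
  have pM': "prob_space (M' i)" for i unfolding M'_def using M D by auto
  interpret M: product_prob_space M by (intro product_prob_spaceI M)
  interpret M': product_prob_space M' by (intro product_prob_spaceI pM')
  have [measurable]: "(\<lambda>x. \<Prod>i\<in>I. f i (x i)) \<in> borel_measurable (PiM I M)"
  proof (rule borel_measurable_prod_ennreal)
    fix i assume i: "i \<in> I"
    show "(\<lambda>x. f i (x i)) \<in> borel_measurable (PiM I M)"
      by (rule measurable_compose[where f = "\<lambda>x. x i" and g = "f i" and N = "M i"])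
         (use i f in \<open>auto intro: measurable_component_singleton\<close>)
  qed
  have "density (PiM I M) (\<lambda>x. \<Prod>i\<in>I. f i (x i)) = PiM I M'"
  proof (rule M'.PiM_eqI[OF I])
    show "sets (density (PiM I M) (\<lambda>x. \<Prod>i\<in>I. f i (x i))) = sets (PiM I M')"
      by simp (intro sets_PiM_cong, auto simp: M'_def)
    fix A assume "\<And>i. i \<in> I \<Longrightarrow> A i \<in> sets (M' i)"
    hence A: "A i \<in> sets (M i)" if "i \<in> I" for i using that by (fastforce simp: M'_def)
    have "emeasure (density (PiM I M) (\<lambda>x. \<Prod>i\<in>I. f i (x i))) (Pi\<^sub>E I A)
       = (\<integral>\<^sup>+x. (\<Prod>i\<in>I. f i (x i)) * indicator (Pi\<^sub>E I A) x \<partial>PiM I M)"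
      by (rule emeasure_density) (auto intro!: sets_PiM_I_finite I A)
    also have "\<dots> = (\<integral>\<^sup>+x. (\<Prod>i\<in>I. f i (x i) * indicator (A i) (x i)) \<partial>PiM I M)"
    proof (rule nn_integral_cong)
      fix x assume "x \<in> space (PiM I M)"
      hence "x \<in> extensional I" by (simp add: space_PiM PiE_def)
      hence "indicator (Pi\<^sub>E I A) x = (\<Prod>i\<in>I. indicator (A i) (x i) :: ennreal)"
        using I by (auto simp: indicator_def PiE_iff prod_zero_iff)
      thus "(\<Prod>i\<in>I. f i (x i)) * indicator (Pi\<^sub>E I A) x = (\<Prod>i\<in>I. f i (x i) * indicator (A i) (x i))"
        by (simp add: prod.distrib)
    qed
    also have "\<dots> = (\<Prod>i\<in>I. \<integral>\<^sup>+x. f i x * indicator (A i) x \<partial>M i)"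
      using f A by (intro M.product_nn_integral_prod[OF I]) auto
    also have "\<dots> = (\<Prod>i\<in>I. emeasure (M' i) (A i))"
      using f A by (intro prod.cong refl) (simp add: M'_def emeasure_density)
    finally show "emeasure (density (PiM I M) (\<lambda>x. \<Prod>i\<in>I. f i (x i))) (Pi\<^sub>E I A) = (\<Prod>i\<in>I. emeasure (M' i) (A i))" .
  qed
  also have "PiM I M' = PiM I (\<lambda>i. density (M i) (f i))" by (intro PiM_cong) (auto simp: M'_def)
  finally show ?thesis by simp
qed

lemma measurable_coord: "i < k \<Longrightarrow> f \<in> N \<rightarrow>\<^sub>M PiM {..<k} M \<Longrightarrow> (\<lambda>x. f x i) \<in> N \<rightarrow>\<^sub>M M i"
  by (rule measurable_compose[OF _ measurable_component_singleton[of i "{..<k}"]]) auto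

text \<open>One uniform vector is fed to two maps: the Knothe map produces P, the quantiles of
  \<open>Q'\<close> produce the target product. The cost is split at the quantiles of Q, into the
  Knothe error and the coordinatewise \<open>qdist\<close>.\<close>

lemma wasserstein1_bounds:
  fixes Q Q' :: "nat \<Rightarrow> real measure"
  assumes Q: "\<And>i. unit_law (Q i)" and Q': "\<And>i. unit_law (Q' i)" and s: "s > 0"
    and \<phi>: "\<phi> \<in> borel_measurable (rspace k)" "0 < c" "\<And>x. c \<le> \<phi> x \<and> \<phi> x \<le> (C::real)"
    and 1: "(\<integral>x. \<phi> x \<partial>PiM {..<k} Q) = 1"
    and P: "P = density (PiM {..<k} Q) \<phi>"
  shows "0 \<le> wasserstein1 k P (PiM {..<k} Q')"
    and "wasserstein1 k P (PiM {..<k} Q') \<le>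
      2 * ((\<integral>x. \<phi> x * ln (\<phi> x) \<partial>PiM {..<k} Q) / s + real k * s) + (\<Sum>i<k. qdist (Q i) (Q' i))"
proof -
  let ?U = "PiM {..<k} (\<lambda>_. U01)"
  obtain T where T: "T \<in> ?U \<rightarrow>\<^sub>M rspace k" and Td: "distr ?U (rspace k) T = P"
    and Tc: "(\<integral>\<^sup>+u. ennreal (\<Sum>i<k. \<bar>T u i - quantile (Q i) (u i)\<bar>) \<partial>?U)
        \<le> ennreal (2 * ((\<integral>x. \<phi> x * ln (\<phi> x) \<partial>PiM {..<k} Q) / s + real k * s))"
    unfolding P using knothe_map[OF Q s \<phi> 1] by blast
  interpret U: prob_space ?U by (rule prob_space_PiM) (rule prob_space_U01)
  have mq [measurable]: "quantile (Q i) \<in> borel_measurable U01" "quantile (Q' i) \<in> borel_measurable U01" for i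
    by (rule unit_law.measurable_quantile[OF Q] unit_law.measurable_quantile[OF Q'])+
  define V where "V u = (\<lambda>i\<in>{..<k}. quantile (Q' i) (u i))" for u
  have V: "V \<in> ?U \<rightarrow>\<^sub>M rspace k"
    unfolding V_def by (rule measurable_restrict) (rule measurable_compose[OF measurable_component_singleton], auto)
  have sQ: "sets (Q i) = sets borel" "sets (Q' i) = sets borel" for i
    using Q Q' by (simp_all add: unit_law.sets_eq)
  have sP: "sets P = sets (rspace k)" unfolding P using sets_PiM_rspace[of k Q] sQ by simp
  have sP': "sets (PiM {..<k} Q') = sets (rspace k)" using sets_PiM_rspace[of k Q'] sQ by simp
  have T': "T \<in> ?U \<rightarrow>\<^sub>M P" using T by (simp add: measurable_cong_sets[OF refl sP])
  have V': "V \<in> ?U \<rightarrow>\<^sub>M PiM {..<k} Q'" using V by (simp add: measurable_cong_sets[OF refl sP'])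
  have Vd: "distr ?U (PiM {..<k} Q') V = PiM {..<k} Q'"
  proof -
    have "distr ?U (PiM {..<k} Q') V = distr ?U (PiM {..<k} (\<lambda>_. borel)) V"
      by (rule distr_cong) (use sP' in auto)
    also have "\<dots> = PiM {..<k} (\<lambda>i. distr U01 borel (quantile (Q' i)))"
      unfolding V_def by (rule distr_PiM_maps) (auto simp: prob_space_U01)
    also have "\<dots> = PiM {..<k} Q'" by (simp add: unit_law.distr_quantile[OF Q'])
    finally show ?thesis .
  qed
  define R where "R = distr ?U (P \<Otimes>\<^sub>M PiM {..<k} Q') (\<lambda>u. (T u, V u))"
  have TV: "(\<lambda>u. (T u, V u)) \<in> ?U \<rightarrow>\<^sub>M P \<Otimes>\<^sub>M PiM {..<k} Q'" by (rule measurable_Pair[OF T' V'])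
  have "distr R P fst = distr ?U P T"
    unfolding R_def by (subst distr_distr[OF _ TV]) (auto simp: comp_def)
  also have "\<dots> = distr ?U (rspace k) T" by (rule distr_cong) (use sP in auto)
  finally have R1: "distr R P fst = P" by (simp add: Td)
  have "distr R (PiM {..<k} Q') snd = distr ?U (PiM {..<k} Q') V"
    unfolding R_def by (subst distr_distr[OF _ TV]) (auto simp: comp_def)
  hence R2: "distr R (PiM {..<k} Q') snd = PiM {..<k} Q'" by (simp add: Vd)
  have Rc: "R \<in> couplings P (PiM {..<k} Q')"
    unfolding couplings_def using R1 R2 U.prob_space_distr[OF TV] by (auto simp: R_def)
  let ?cost = "\<lambda>(x, y). \<Sum>i<k. \<bar>x i - y i :: real\<bar>"
  have nn: "0 \<le> (\<integral>z. ?cost z \<partial>R')" for R' by (rule integral_nonneg_AE) (auto simp: split_beta' sum_nonneg)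
  \<comment> \<open>The explicit coupling is needed even here: the infimum over an empty set of
    reals is unspecified.\<close>
  show "0 \<le> wasserstein1 k P (PiM {..<k} Q')"
    unfolding wasserstein1_def by (rule cINF_greatest) (use Rc nn in auto)
  have mc: "?cost \<in> borel_measurable (P \<Otimes>\<^sub>M PiM {..<k} Q')"
  proof -
    have "(\<lambda>z. fst z i) \<in> borel_measurable (P \<Otimes>\<^sub>M PiM {..<k} Q')" if "i < k" for i
      by (rule measurable_coord[OF that]) (use measurable_fst[of P] in \<open>simp add: measurable_cong_sets[OF refl sP]\<close>)
    moreover have "(\<lambda>z. snd z i) \<in> borel_measurable (P \<Otimes>\<^sub>M PiM {..<k} Q')" if "i < k" for i
      by (rule measurable_coord[OF that]) (use measurable_snd[of P "PiM {..<k} Q'"] in \<open>simp add: measurable_cong_sets[OF refl sP']\<close>)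
    ultimately show ?thesis
      unfolding split_beta' by (intro borel_measurable_sum borel_measurable_abs borel_measurable_diff) auto
  qed
  have Tm: "(\<lambda>u. T u i) \<in> borel_measurable ?U" "(\<lambda>u. quantile (Q i) (u i)) \<in> borel_measurable ?U"
      "(\<lambda>u. quantile (Q' i) (u i)) \<in> borel_measurable ?U" if "i < k" for i
    using measurable_coord[OF that T]
      measurable_compose[OF measurable_component_singleton[of i "{..<k}" "\<lambda>_. U01"] mq(1)[of i]]
      measurable_compose[OF measurable_component_singleton[of i "{..<k}" "\<lambda>_. U01"] mq(2)[of i]] that by auto
  have m1: "(\<lambda>u. ennreal (\<Sum>i<k. \<bar>T u i - quantile (Q i) (u i)\<bar>)) \<in> borel_measurable ?U"
    using Tm by (intro measurable_compose[OF _ measurable_ennreal] borel_measurable_sum borel_measurable_abs borel_measurable_diff) auto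
  have m2: "(\<lambda>u. ennreal \<bar>quantile (Q i) (u i) - quantile (Q' i) (u i)\<bar>) \<in> borel_measurable ?U" if "i < k" for i
    using Tm[OF that] by (intro measurable_compose[OF _ measurable_ennreal] borel_measurable_abs borel_measurable_diff) auto
  have q: "(\<integral>\<^sup>+u. ennreal \<bar>quantile (Q i) (u i) - quantile (Q' i) (u i)\<bar> \<partial>?U) = ennreal (qdist (Q i) (Q' i))" if i: "i < k" for i
  proof -
    interpret two: two_unit_laws "Q i" "Q' i" unfolding two_unit_laws_def using Q Q' by auto
    have "ennreal (qdist (Q i) (Q' i)) = (\<integral>\<^sup>+\<omega>. ennreal \<bar>quantile (Q i) \<omega> - quantile (Q' i) \<omega>\<bar> \<partial>distr ?U U01 (\<lambda>u. u i))"
    proof -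
      have "distr ?U U01 (\<lambda>u. u i) = U01" by (rule distr_PiM_component) (use prob_space_U01 i in auto)
      thus ?thesis by (simp only: two.nn_qdist)
    qed
    also have "\<dots> = (\<integral>\<^sup>+u. ennreal \<bar>quantile (Q i) (u i) - quantile (Q' i) (u i)\<bar> \<partial>?U)"
    proof (rule nn_integral_distr)
      show "(\<lambda>u. u i) \<in> ?U \<rightarrow>\<^sub>M U01"
        by (rule measurable_component_singleton[of i "{..<k}" "\<lambda>_. U01"]) (use i in simp)
      show "(\<lambda>\<omega>. ennreal \<bar>quantile (Q i) \<omega> - quantile (Q' i) \<omega>\<bar>) \<in> borel_measurable (distr ?U U01 (\<lambda>u. u i))"
        by (simp, measurable)
    qed
    finally show ?thesis by simp
  qed
  have qn: "qdist (Q i) (Q' i) \<ge> 0" for i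
    by (rule two_unit_laws.qdist_nonneg) (auto simp: two_unit_laws_def Q Q')
  define E where "E = 2 * ((\<integral>x. \<phi> x * ln (\<phi> x) \<partial>PiM {..<k} Q) / s + real k * s)"
  have E: "E \<ge> 0"
  proof -
    interpret PQ: prob_space "PiM {..<k} Q" by (rule prob_space_PiM) (use Q in \<open>simp add: unit_law_def\<close>)
    have m\<phi>: "\<phi> \<in> borel_measurable (PiM {..<k} Q)"
    proof -
      have "sets (PiM {..<k} Q) = sets (rspace k)" by (rule sets_PiM_rspace) (rule sQ)
      from measurable_cong_sets[OF this refl] show ?thesis using \<phi>(1) by blast
    qed
    have b: "0 < \<phi> x" "\<bar>\<phi> x\<bar> \<le> C" "\<bar>\<phi> x * ln (\<phi> x)\<bar> \<le> C * (\<bar>ln c\<bar> + \<bar>ln C\<bar>)" for x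
    proof -
      have *: "0 < c" "c \<le> \<phi> x" "\<phi> x \<le> C" using \<phi> by auto
      have "ln c \<le> ln (\<phi> x)" "ln (\<phi> x) \<le> ln C" using * by auto
      hence "\<bar>ln (\<phi> x)\<bar> \<le> \<bar>ln c\<bar> + \<bar>ln C\<bar>" by linarith
      thus "\<bar>\<phi> x * ln (\<phi> x)\<bar> \<le> C * (\<bar>ln c\<bar> + \<bar>ln C\<bar>)" unfolding abs_mult using * by (intro mult_mono) auto
      show "0 < \<phi> x" "\<bar>\<phi> x\<bar> \<le> C" using * by auto
    qed
    have i1: "integrable (PiM {..<k} Q) \<phi>"
      by (rule PQ.integrable_const_bound[where B = C]) (use b m\<phi> in auto)
    have i2: "integrable (PiM {..<k} Q) (\<lambda>x. \<phi> x * ln (\<phi> x))"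
      by (rule PQ.integrable_const_bound[where B = "C * (\<bar>ln c\<bar> + \<bar>ln C\<bar>)"]) (use b m\<phi> in auto)
    have "(\<integral>x. \<phi> x * ln (\<phi> x) \<partial>PiM {..<k} Q) \<ge> 0" by (rule PQ.entropy_nonneg[OF i1 i2 b(1) 1])
    thus ?thesis using s by (simp add: E_def)
  qed
  have "wasserstein1 k P (PiM {..<k} Q') \<le> (\<integral>z. ?cost z \<partial>R)"
    unfolding wasserstein1_def by (rule cINF_lower[OF _ Rc]) (use nn in \<open>auto intro!: bdd_belowI[of _ 0]\<close>)
  also have "\<dots> = (\<integral>u. ?cost (T u, V u) \<partial>?U)"
    unfolding R_def by (rule integral_distr[OF TV mc])
  also have "\<dots> \<le> E + (\<Sum>i<k. qdist (Q i) (Q' i))"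
  proof (rule integral_real_bounded)
    show "0 \<le> E + (\<Sum>i<k. qdist (Q i) (Q' i))" using E qn by (simp add: sum_nonneg)
    have "(\<integral>\<^sup>+u. ennreal (?cost (T u, V u)) \<partial>?U)
       \<le> (\<integral>\<^sup>+u. ennreal (\<Sum>i<k. \<bar>T u i - quantile (Q i) (u i)\<bar>) + (\<Sum>i<k. ennreal \<bar>quantile (Q i) (u i) - quantile (Q' i) (u i)\<bar>) \<partial>?U)"
    proof (rule nn_integral_mono)
      fix u
      have "?cost (T u, V u) \<le> (\<Sum>i<k. \<bar>T u i - quantile (Q i) (u i)\<bar> + \<bar>quantile (Q i) (u i) - quantile (Q' i) (u i)\<bar>)"
        unfolding prod.case by (intro sum_mono) (auto simp: V_def)
      hence "ennreal (?cost (T u, V u)) \<le> ennreal ((\<Sum>i<k. \<bar>T u i - quantile (Q i) (u i)\<bar>) + (\<Sum>i<k. \<bar>quantile (Q i) (u i) - quantile (Q' i) (u i)\<bar>))"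
        by (intro ennreal_leI) (simp add: sum.distrib)
      thus "ennreal (?cost (T u, V u)) \<le> ennreal (\<Sum>i<k. \<bar>T u i - quantile (Q i) (u i)\<bar>) + (\<Sum>i<k. ennreal \<bar>quantile (Q i) (u i) - quantile (Q' i) (u i)\<bar>)"
        by (simp add: sum_nonneg)
    qed
    also have "\<dots> = (\<integral>\<^sup>+u. ennreal (\<Sum>i<k. \<bar>T u i - quantile (Q i) (u i)\<bar>) \<partial>?U) + (\<integral>\<^sup>+u. (\<Sum>i<k. ennreal \<bar>quantile (Q i) (u i) - quantile (Q' i) (u i)\<bar>) \<partial>?U)"
      using m1 m2 by (intro nn_integral_add borel_measurable_sum) auto
    also have "(\<integral>\<^sup>+u. (\<Sum>i<k. ennreal \<bar>quantile (Q i) (u i) - quantile (Q' i) (u i)\<bar>) \<partial>?U) = (\<Sum>i<k. ennreal (qdist (Q i) (Q' i)))"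
      using m2 by (subst nn_integral_sum) (auto simp: q)
    also have "(\<Sum>i<k. ennreal (qdist (Q i) (Q' i))) = ennreal (\<Sum>i<k. qdist (Q i) (Q' i))"
      using qn by (simp add: sum_ennreal)
    also have "(\<integral>\<^sup>+u. ennreal (\<Sum>i<k. \<bar>T u i - quantile (Q i) (u i)\<bar>) \<partial>?U) + ennreal (\<Sum>i<k. qdist (Q i) (Q' i))
       \<le> ennreal E + ennreal (\<Sum>i<k. qdist (Q i) (Q' i))"
      using Tc unfolding E_def by (intro add_right_mono)
    also have "\<dots> = ennreal (E + (\<Sum>i<k. qdist (Q i) (Q' i)))" using E qn by (simp add: sum_nonneg)
    finally show "(\<integral>\<^sup>+u. ennreal (?cost (T u, V u)) \<partial>?U) \<le> ennreal (E + (\<Sum>i<k. qdist (Q i) (Q' i)))" .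
  qed
  finally show "wasserstein1 k P (PiM {..<k} Q') \<le>
      2 * ((\<integral>x. \<phi> x * ln (\<phi> x) \<partial>PiM {..<k} Q) / s + real k * s) + (\<Sum>i<k. qdist (Q i) (Q' i))"
    by (simp add: E_def)
qed

section \<open>Quadratic forms\<close>

text \<open>Encoded on functions instead of vectors: no carrier conditions arise, and values at
  indices from p on are ignored.\<close>

definition qf :: "nat \<Rightarrow> (nat \<Rightarrow> nat \<Rightarrow> real) \<Rightarrow> (nat \<Rightarrow> real) \<Rightarrow> (nat \<Rightarrow> real) \<Rightarrow> real" where
  "qf p S x y = (\<Sum>i<p. \<Sum>j<p. S i j * x i * y j)"

lemma qf_add_right: "qf p S x (\<lambda>i. y i + z i) = qf p S x y + qf p S x z"
  by (simp add: qf_def algebra_simps sum.distrib)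

lemma qf_add_left: "qf p S (\<lambda>i. x i + y i) z = qf p S x z + qf p S y z"
  by (simp add: qf_def algebra_simps sum.distrib)

lemma qf_scale_right: "qf p S x (\<lambda>i. c * y i) = c * qf p S x y"
  by (simp add: qf_def sum_distrib_left mult_ac)

lemma qf_scale_left: "qf p S (\<lambda>i. c * x i) y = c * qf p S x y"
  by (simp add: qf_def sum_distrib_left mult_ac)

lemma qf_sym: "(\<And>i j. i < p \<Longrightarrow> j < p \<Longrightarrow> S i j = S j i) \<Longrightarrow> qf p S x y = qf p S y x"
  unfolding qf_def by (subst sum.swap) (auto intro!: sum.cong simp: mult_ac)

text \<open>Discriminant argument; a degenerate form needs the separate case in which y has length
  zero.\<close>

lemma qf_cauchy_schwarz:
  assumes sym: "\<And>i j. i < p \<Longrightarrow> j < p \<Longrightarrow> S i j = S j i" and psd: "\<And>x. qf p S x x \<ge> 0"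
  shows "(qf p S x y)\<^sup>2 \<le> qf p S x x * qf p S y y"
proof -
  let ?a = "qf p S x x" and ?b = "qf p S x y" and ?c = "qf p S y y"
  have e: "qf p S (\<lambda>i. s * x i + t * y i) (\<lambda>i. s * x i + t * y i) = s\<^sup>2 * ?a + 2 * s * t * ?b + t\<^sup>2 * ?c" for s t
    using qf_sym[of p S y x, OF sym]
    by (simp add: qf_add_left qf_add_right qf_scale_left qf_scale_right power2_eq_square algebra_simps)
  have nn: "0 \<le> s\<^sup>2 * ?a + 2 * s * t * ?b + t\<^sup>2 * ?c" for s t using psd[of "\<lambda>i. s * x i + t * y i"] unfolding e .
  show ?thesis
  proof (cases "?c = 0")
    case True
    have "?b = 0"
    proof (rule ccontr)
      assume b: "?b \<noteq> 0"
      \<comment> \<open>The expression is now affine in the second coefficient, which is chosen to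
        give the value -1.\<close>
      have "0 \<le> ?a + 2 * (- (?a + 1) / (2 * ?b)) * ?b" using nn[of 1 "- (?a + 1) / (2 * ?b)"] True by simp
      also have "2 * (- (?a + 1) / (2 * ?b)) * ?b = - (?a + 1)" using b by (simp add: field_simps)
      finally show False by simp
    qed
    thus ?thesis using True by simp
  next
    case False
    hence c: "?c > 0" using psd[of y] by simp
    \<comment> \<open>The minimizing combination of x and y, scaled by \<open>?c\<close> to avoid a
      division.\<close>
    have "0 \<le> ?c\<^sup>2 * ?a + 2 * ?c * (- ?b) * ?b + (- ?b)\<^sup>2 * ?c" by (rule nn)
    also have "\<dots> = ?c * (?c * ?a - ?b\<^sup>2)" by (simp add: power2_eq_square algebra_simps)
    finally have "0 \<le> ?c * ?a - ?b\<^sup>2" using c by (simp add: zero_le_mult_iff)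
    thus ?thesis by (simp add: mult.commute)
  qed
qed

text \<open>Cauchy-Schwarz for the form between the unit vector at i and row i itself; one factor of
  the squared row length then cancels.\<close>

lemma qf_row_bound:
  assumes sym: "\<And>i j. i < p \<Longrightarrow> j < p \<Longrightarrow> S i j = S j i" and psd: "\<And>x. qf p S x x \<ge> 0"
    and le: "\<And>x. qf p S x x \<le> c * (\<Sum>i<p. (x i)\<^sup>2)" and c: "c \<ge> 0" and i: "i < p"
  shows "(\<Sum>j<p. (S i j)\<^sup>2) \<le> c\<^sup>2"
proof -
  define e where "e j = (if j = i then 1 else 0 :: real)" for j
  define z where "z j = S i j" for j
  define n where "n = (\<Sum>j<p. (z j)\<^sup>2)"
  have qe: "qf p S e y = (\<Sum>j<p. S i j * y j)" for y
  proof -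
    have "qf p S e y = (\<Sum>k<p. if k = i then \<Sum>j<p. S k j * y j else 0)"
      unfolding qf_def e_def by (intro sum.cong refl) auto
    thus ?thesis using i by (simp add: sum.delta)
  qed
  have "qf p S e z = n" by (simp add: qe z_def n_def power2_eq_square)
  hence "n\<^sup>2 \<le> qf p S e e * qf p S z z" using qf_cauchy_schwarz[OF sym psd, of e z] by simp
  also have "\<dots> \<le> (c * 1) * (c * n)"
  proof (intro mult_mono)
    have "(\<Sum>j<p. (e j)\<^sup>2) = (\<Sum>j<p. if j = i then 1 else 0)" unfolding e_def by (intro sum.cong) auto
    hence "(\<Sum>j<p. (e j)\<^sup>2) = 1" using i by (simp add: sum.delta)
    thus "qf p S e e \<le> c * 1" using le[of e] by simp
    show "qf p S z z \<le> c * n" using le[of z] by (simp add: n_def)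
  qed (use c psd in auto)
  finally have h: "n * n \<le> c\<^sup>2 * n" by (simp add: power2_eq_square mult_ac)
  have n0: "n \<ge> 0" by (simp add: n_def sum_nonneg)
  have "n \<le> c\<^sup>2"
  proof (cases "n = 0")
    case False thus ?thesis using h n0 by (simp add: mult_le_cancel_right)
  qed simp
  thus ?thesis by (simp add: n_def z_def)
qed

lemma sum_mult_le_sqrt:
  fixes f g :: "'a \<Rightarrow> real"
  shows "\<bar>\<Sum>i\<in>I. f i * g i\<bar> \<le> sqrt (\<Sum>i\<in>I. (f i)\<^sup>2) * sqrt (\<Sum>i\<in>I. (g i)\<^sup>2)"
proof -
  have "\<bar>\<Sum>i\<in>I. f i * g i\<bar> \<le> (\<Sum>i\<in>I. \<bar>f i\<bar> * \<bar>g i\<bar>)"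
    by (rule order_trans[OF sum_abs]) (simp add: abs_mult)
  also have "\<dots> \<le> L2_set f I * L2_set g I" by (rule L2_set_mult_ineq)
  finally show ?thesis by (simp add: L2_set_def)
qed

text \<open>Cauchy-Schwarz for the Frobenius inner product, where each of the p rows of S has length
  at most c. If the first factor is o(sqrt p), the bound is o(p).\<close>

lemma trace_product_bound:
  assumes sym: "\<And>i j. i < p \<Longrightarrow> j < p \<Longrightarrow> S i j = S j i" and psd: "\<And>x. qf p S x x \<ge> 0"
    and le: "\<And>x. qf p S x x \<le> c * (\<Sum>i<p. (x i)\<^sup>2)" and c: "c \<ge> 0"
  shows "\<bar>\<Sum>i<p. \<Sum>j<p. A i j * S i j\<bar> \<le> sqrt (\<Sum>i<p. \<Sum>j<p. (A i j)\<^sup>2) * (sqrt (real p) * c)"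
proof -
  have "\<bar>\<Sum>i<p. \<Sum>j<p. A i j * S i j\<bar> = \<bar>\<Sum>z\<in>{..<p} \<times> {..<p}. (\<lambda>(i, j). A i j) z * (\<lambda>(i, j). S i j) z\<bar>"
    by (simp add: sum.cartesian_product split_beta')
  also have "\<dots> \<le> sqrt (\<Sum>z\<in>{..<p} \<times> {..<p}. ((\<lambda>(i, j). A i j) z)\<^sup>2) * sqrt (\<Sum>z\<in>{..<p} \<times> {..<p}. ((\<lambda>(i, j). S i j) z)\<^sup>2)"
    by (rule sum_mult_le_sqrt)
  also have "\<dots> = sqrt (\<Sum>i<p. \<Sum>j<p. (A i j)\<^sup>2) * sqrt (\<Sum>i<p. \<Sum>j<p. (S i j)\<^sup>2)"
    by (simp add: sum.cartesian_product split_beta')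
  also have "sqrt (\<Sum>i<p. \<Sum>j<p. (S i j)\<^sup>2) \<le> sqrt (real p * c\<^sup>2)"
  proof (rule real_sqrt_le_mono)
    have "(\<Sum>i<p. \<Sum>j<p. (S i j)\<^sup>2) \<le> (\<Sum>i<p. c\<^sup>2)"
      by (intro sum_mono qf_row_bound[OF sym psd le c]) auto
    thus "(\<Sum>i<p. \<Sum>j<p. (S i j)\<^sup>2) \<le> real p * c\<^sup>2" by simp
  qed
  also have "sqrt (real p * c\<^sup>2) = sqrt (real p) * c" using c by (simp add: real_sqrt_mult)
  finally show ?thesis by (simp add: mult_left_mono sum_nonneg)
qed

text \<open>Polarization: the difference of the two values is the bilinear form at (x - y, x +
  y).\<close>

lemma qf_diff_bound:
  assumes sym: "\<And>i j. i < p \<Longrightarrow> j < p \<Longrightarrow> S i j = S j i" and psd: "\<And>x. qf p S x x \<ge> 0"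
    and le: "\<And>x. qf p S x x \<le> c * (\<Sum>i<p. (x i)\<^sup>2)" and c: "c \<ge> 0"
  shows "\<bar>qf p S x x - qf p S y y\<bar> \<le> c * sqrt (\<Sum>i<p. (x i - y i)\<^sup>2) * sqrt (\<Sum>i<p. (x i + y i)\<^sup>2)"
proof -
  let ?d = "\<lambda>i. x i - y i" and ?s = "\<lambda>i. x i + y i"
  have d: "?d = (\<lambda>i. x i + (-1) * y i)" by simp
  have "qf p S ?d ?s = qf p S x x - qf p S y y"
    unfolding d qf_add_left qf_add_right qf_scale_left using qf_sym[of p S x y, OF sym] by simp
  moreover have "(qf p S ?d ?s)\<^sup>2 \<le> (c * sqrt (\<Sum>i<p. (x i - y i)\<^sup>2) * sqrt (\<Sum>i<p. (x i + y i)\<^sup>2))\<^sup>2"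
  proof -
    have "(qf p S ?d ?s)\<^sup>2 \<le> qf p S ?d ?d * qf p S ?s ?s" by (rule qf_cauchy_schwarz[OF sym psd])
    also have "\<dots> \<le> (c * (\<Sum>i<p. (?d i)\<^sup>2)) * (c * (\<Sum>i<p. (?s i)\<^sup>2))"
      by (intro mult_mono le) (auto simp: psd c sum_nonneg)
    also have "\<dots> = (c * sqrt (\<Sum>i<p. (x i - y i)\<^sup>2) * sqrt (\<Sum>i<p. (x i + y i)\<^sup>2))\<^sup>2"
      by (simp add: power_mult_distrib sum_nonneg power2_eq_square[of c])
    finally show ?thesis .
  qed
  hence "\<bar>qf p S ?d ?s\<bar> \<le> \<bar>c * sqrt (\<Sum>i<p. (x i - y i)\<^sup>2) * sqrt (\<Sum>i<p. (x i + y i)\<^sup>2)\<bar>"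
    by (simp only: abs_le_square_iff)
  moreover have "0 \<le> c * sqrt (\<Sum>i<p. (x i - y i)\<^sup>2) * sqrt (\<Sum>i<p. (x i + y i)\<^sup>2)"
    using c by (intro mult_nonneg_nonneg) (auto simp: sum_nonneg)
  ultimately show ?thesis by (simp only: abs_of_nonneg)
qed

text \<open>Crude on purpose: it only provides a finite lower bound for an infimum and a finite
  bound for the form of an inverse.\<close>

lemma qf_abs_bound: "\<bar>qf p S x x\<bar> \<le> (\<Sum>i<p. \<Sum>j<p. \<bar>S i j\<bar>) * (\<Sum>i<p. (x i)\<^sup>2)"
proof -
  let ?n = "\<Sum>i<p. (x i)\<^sup>2"
  have xn: "\<bar>x i * x j\<bar> \<le> ?n" if "i < p" "j < p" for i j
  proof -
    have "\<bar>x i * x j\<bar> \<le> max ((x i)\<^sup>2) ((x j)\<^sup>2)"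
      using sum_squares_bound[of "\<bar>x i\<bar>" "\<bar>x j\<bar>"] by (simp add: abs_mult power2_eq_square max_def)
    also have "\<dots> \<le> ?n" using that by (intro max.boundedI member_le_sum) auto
    finally show ?thesis .
  qed
  have "\<bar>qf p S x x\<bar> \<le> (\<Sum>i<p. \<Sum>j<p. \<bar>S i j\<bar> * \<bar>x i * x j\<bar>)"
    unfolding qf_def
    by (intro order_trans[OF sum_abs] sum_mono order_trans[OF sum_abs]) (simp add: abs_mult mult_ac)
  also have "\<dots> \<le> (\<Sum>i<p. \<Sum>j<p. \<bar>S i j\<bar> * ?n)" by (intro sum_mono mult_left_mono xn) auto
  finally show ?thesis by (simp add: sum_distrib_right)
qed

lemma qf_eq_scalar_prod:
  assumes M: "M \<in> carrier_mat p p" and x: "x \<in> carrier_vec p" and y: "y \<in> carrier_vec p"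
  shows "x \<bullet> (M *\<^sub>v y) = qf p (\<lambda>i j. M $$ (i, j)) (($) x) (($) y)"
proof -
  have "x \<bullet> (M *\<^sub>v y) = (\<Sum>i<p. x $ i * (\<Sum>j<p. M $$ (i, j) * y $ j))"
    using assms by (simp add: scalar_prod_def lessThan_atLeast0 row_def)
  thus ?thesis by (simp add: qf_def sum_distrib_left mult_ac)
qed

lemma qf_cong: "(\<And>i j. i < p \<Longrightarrow> j < p \<Longrightarrow> S i j = S' i j) \<Longrightarrow> (\<And>i. i < p \<Longrightarrow> x i = x' i) \<Longrightarrow> (\<And>i. i < p \<Longrightarrow> y i = y' i)
  \<Longrightarrow> qf p S x y = qf p S' x' y'"
  unfolding qf_def by (intro sum.cong refl) auto

text \<open>Rayleigh quotients. If the infimum \<open>l\<close> of the quadratic form over the unit sphere were not an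
  eigenvalue, \<open>M - l\<close> would be invertible and positive semidefinite, hence bounded below by a
  positive multiple of the identity by the Cauchy-Schwarz inequality, a contradiction.\<close>

lemma exists_extreme_eigenvalue:
  assumes M: "M \<in> carrier_mat p p" and sym: "\<And>i j. i < p \<Longrightarrow> j < p \<Longrightarrow> M $$ (i, j) = M $$ (j, i)" and p: "p > 0"
    and s: "s = 1 \<or> s = (-1::real)"
  shows "\<exists>l. eigenvalue M l \<and> (\<forall>x. s * qf p (\<lambda>i j. M $$ (i, j)) x x \<ge> s * l * (\<Sum>i<p. (x i)\<^sup>2))"
proof -
  let ?q = "\<lambda>x. qf p (\<lambda>i j. M $$ (i, j)) x x" and ?n = "\<lambda>x::nat\<Rightarrow>real. \<Sum>i<p. (x i)\<^sup>2"
  define V where "V = {s * ?q x | x. ?n x = 1}"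
  define K where "K = (\<Sum>i<p. \<Sum>j<p. \<bar>M $$ (i, j)\<bar>)"
  have ss: "s * s = 1" "\<bar>s\<bar> = 1" using s by auto
  have Vb: "bdd_below V"
  proof (rule bdd_belowI[of _ "- K"])
    fix v assume "v \<in> V"
    then obtain x where x: "v = s * ?q x" "?n x = 1" by (auto simp: V_def)
    have "\<bar>s * ?q x\<bar> \<le> K" using qf_abs_bound[of p "\<lambda>i j. M $$ (i, j)" x] x ss unfolding abs_mult K_def by simp
    thus "- K \<le> v" using x by simp
  qed
  have Vne: "V \<noteq> {}"
  proof -
    have "?n (\<lambda>i. if i = 0 then 1 else 0) = (\<Sum>i<p. if i = 0 then 1 else 0)" by (intro sum.cong) auto
    also have "\<dots> = 1" using p by (simp add: sum.delta)
    finally have "?n (\<lambda>i. if i = 0 then 1 else 0) = 1" .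
    hence "s * ?q (\<lambda>i. if i = 0 then 1 else 0) \<in> V"
      unfolding V_def mem_Collect_eq by (intro exI[of _ "\<lambda>i. if i = 0 then 1 else 0"] conjI refl)
    thus ?thesis by (metis empty_iff)
  qed
  define m where "m = Inf V"
  have ge: "s * ?q x \<ge> m * ?n x" for x
  proof (cases "?n x = 0")
    case True
    hence "\<And>i. i < p \<Longrightarrow> x i = 0" by (simp add: sum_nonneg_eq_0_iff)
    hence "?q x = 0" by (simp add: qf_def)
    thus ?thesis using True by simp
  next
    case False
    hence n: "?n x > 0" by (metis less_eq_real_def sum_nonneg zero_le_power2)
    define y where "y i = (1 / sqrt (?n x)) * x i" for i
    have "?n y = (1 / sqrt (?n x))\<^sup>2 * ?n x"
      unfolding y_def power_mult_distrib by (rule sum_distrib_left[symmetric])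
    also have "\<dots> = 1" using n by (simp add: power_divide)
    finally have "s * ?q y \<in> V" by (auto simp: V_def)
    hence "m \<le> s * ?q y" unfolding m_def by (rule cInf_lower[OF _ Vb])
    also have "?q y = ?q x / ?n x"
      unfolding y_def qf_scale_left qf_scale_right using n by (simp add: field_simps)
    finally show ?thesis using n by (simp add: field_simps)
  qed
  define l where "l = s * m"
  have sl: "s * l = m" using ss by (simp add: l_def mult.assoc[symmetric])
  have "eigenvalue M l"
  proof (rule ccontr)
    assume ne: "\<not> eigenvalue M l"
    \<comment> \<open>The matrix s * (M - l), positive semidefinite by the choice of l. The sign
      \<open>s = 1\<close> leads to the least eigenvalue, \<open>s = -1\<close> to the
      greatest.\<close>
    define N where "N = s \<cdot>\<^sub>m char_matrix M l"
    have cm: "char_matrix M l \<in> carrier_mat p p" using M by (simp add: char_matrix_def)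
    have N: "N \<in> carrier_mat p p" using cm by (simp add: N_def)
    have "det (char_matrix M l) \<noteq> 0" using ne eigenvalue_det[OF M] by simp
    then obtain B where B: "B \<in> carrier_mat p p" "B * char_matrix M l = 1\<^sub>m p" "char_matrix M l * B = 1\<^sub>m p"
      using det_non_zero_imp_unit[OF cm] unfolding Units_def ring_mat_def by auto
    have Nij: "N $$ (i, j) = s * (M $$ (i, j) - (if i = j then l else 0))" if "i < p" "j < p" for i j
      using that M by (auto simp: N_def char_matrix_def)
    let ?Q = "\<lambda>x y. qf p (\<lambda>i j. N $$ (i, j)) x y"
    have QN: "?Q x x = s * ?q x - m * ?n x" for x
    proof -
      have "?Q x x = (\<Sum>i<p. \<Sum>j<p. s * (M $$ (i, j) * x i * x j) - (if i = j then m * (x i)\<^sup>2 else 0))"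
        unfolding qf_def using sl by (intro sum.cong refl) (auto simp: Nij algebra_simps power2_eq_square)
      also have "\<dots> = s * ?q x - (\<Sum>i<p. m * (x i)\<^sup>2)"
        by (simp add: sum_subtractf qf_def sum_distrib_left)
      finally show ?thesis by (simp add: sum_distrib_left)
    qed
    have psd: "?Q x x \<ge> 0" for x using ge[of x] by (simp add: QN)
    have symN: "N $$ (i, j) = N $$ (j, i)" if "i < p" "j < p" for i j using sym[OF that] that by (simp add: Nij)
    define L where "L = (\<Sum>i<p. \<Sum>j<p. \<bar>(s \<cdot>\<^sub>m B) $$ (i, j)\<bar>) + 1"
    have L: "L > 0" unfolding L_def by (simp add: sum_nonneg add_nonneg_pos)
    \<comment> \<open>For the solution Y of N Y = x, the squared norm of x is the form N at (x, Y).
      Cauchy-Schwarz bounds its square by Q(x, x) * Q(Y, Y), and Q(Y, Y) is the form of the inverse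
      at x, hence at most \<open>L\<close> times the squared norm.\<close>
    have bound: "?n x \<le> L * ?Q x x" for x
    proof -
      define X where "X = vec p x"
      define Y where "Y = (s \<cdot>\<^sub>m B) *\<^sub>v X"
      have sB: "s \<cdot>\<^sub>m B \<in> carrier_mat p p" using B(1) by simp
      have X: "X \<in> carrier_vec p" by (simp add: X_def)
      have Y: "Y \<in> carrier_vec p" unfolding Y_def by (rule mult_mat_vec_carrier[OF sB X])
      have NY: "N *\<^sub>v Y = X"
      proof -
        have "N * (s \<cdot>\<^sub>m B) = s \<cdot>\<^sub>m (s \<cdot>\<^sub>m (char_matrix M l * B))"
          unfolding N_def mult_smult_assoc_mat[OF cm sB] mult_smult_distrib[OF cm B(1)] ..
        also have "\<dots> = 1\<^sub>m p" using B ss by (auto intro!: eq_matI)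
        finally have "N * (s \<cdot>\<^sub>m B) = 1\<^sub>m p" .
        thus ?thesis unfolding Y_def using N B(1) X assoc_mult_mat_vec[OF N _ X, of "s \<cdot>\<^sub>m B"] by simp
      qed
      have xX: "($) X i = x i" if "i < p" for i using that by (simp add: X_def)
      have n1: "?n x = ?Q x (($) Y)"
      proof -
        have "?n x = X \<bullet> X" by (simp add: X_def scalar_prod_def lessThan_atLeast0 power2_eq_square)
        also have "\<dots> = X \<bullet> (N *\<^sub>v Y)" by (simp add: NY)
        also have "\<dots> = ?Q (($) X) (($) Y)" by (rule qf_eq_scalar_prod[OF N X Y])
        also have "\<dots> = ?Q x (($) Y)" by (rule qf_cong) (auto simp: xX)
        finally show ?thesis .
      qed
      have n2: "?Q (($) Y) (($) Y) \<le> L * ?n x"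
      proof -
        have "?Q (($) Y) (($) Y) = Y \<bullet> (N *\<^sub>v Y)" by (rule qf_eq_scalar_prod[OF N Y Y, symmetric])
        also have "\<dots> = X \<bullet> ((s \<cdot>\<^sub>m B) *\<^sub>v X)" unfolding NY Y_def[symmetric] by (rule comm_scalar_prod[OF Y X])
        also have "\<dots> = qf p (\<lambda>i j. (s \<cdot>\<^sub>m B) $$ (i, j)) (($) X) (($) X)"
          by (rule qf_eq_scalar_prod) (use B X in auto)
        also have "\<dots> = qf p (\<lambda>i j. (s \<cdot>\<^sub>m B) $$ (i, j)) x x" by (rule qf_cong) (auto simp: xX)
        also have "\<dots> \<le> (\<Sum>i<p. \<Sum>j<p. \<bar>(s \<cdot>\<^sub>m B) $$ (i, j)\<bar>) * ?n x"
          using qf_abs_bound[of p "\<lambda>i j. (s \<cdot>\<^sub>m B) $$ (i, j)" x] by linarith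
        also have "\<dots> \<le> L * ?n x" unfolding L_def by (intro mult_right_mono) (auto simp: sum_nonneg)
        finally show ?thesis .
      qed
      have "(?n x)\<^sup>2 \<le> ?Q x x * ?Q (($) Y) (($) Y)" unfolding n1 by (rule qf_cauchy_schwarz[OF symN psd])
      also have "\<dots> \<le> ?Q x x * (L * ?n x)" by (intro mult_left_mono n2 psd)
      finally have h: "?n x * ?n x \<le> (L * ?Q x x) * ?n x" by (simp add: power2_eq_square mult_ac)
      show ?thesis
      proof (cases "?n x = 0")
        case True thus ?thesis using psd[of x] L by simp
      next
        case False
        hence "?n x > 0" by (metis less_eq_real_def sum_nonneg zero_le_power2)
        thus ?thesis using h by (simp add: mult_le_cancel_right)
      qed
    qed
    \<comment> \<open>On the whole sphere the form exceeds m by at least 1 / L, against the choice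
      of m as an infimum.\<close>
    have "m + 1 / L \<le> Inf V"
    proof (rule cInf_greatest[OF Vne])
      fix v assume "v \<in> V"
      then obtain x where x: "v = s * ?q x" "?n x = 1" by (auto simp: V_def)
      have "1 \<le> L * (v - m)" using bound[of x] x by (simp add: QN)
      thus "m + 1 / L \<le> v" using L by (simp add: field_simps)
    qed
    thus False using L by (simp add: m_def)
  qed
  moreover have "\<forall>x. s * ?q x \<ge> s * l * ?n x" using ge sl by simp
  ultimately show ?thesis by blast
qed

lemma lambda_bounds:
  assumes M: "M \<in> carrier_mat p p" and sym: "\<And>i j. i < p \<Longrightarrow> j < p \<Longrightarrow> M $$ (i, j) = M $$ (j, i)" and p: "p > 0"
  shows "lambda_min M * (\<Sum>i<p. (x i)\<^sup>2) \<le> qf p (\<lambda>i j. M $$ (i, j)) x x"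
    and "qf p (\<lambda>i j. M $$ (i, j)) x x \<le> lambda_max M * (\<Sum>i<p. (x i)\<^sup>2)"
proof -
  have fin: "finite (spectrum M)" by (rule card_finite_spectrum(1)[OF M])
  obtain l where l: "eigenvalue M l" "\<And>x. qf p (\<lambda>i j. M $$ (i, j)) x x \<ge> l * (\<Sum>i<p. (x i)\<^sup>2)"
    using exists_extreme_eigenvalue[OF M sym p, of 1] by auto
  have "lambda_min M \<le> l" unfolding lambda_min_def using l(1) fin by (intro Min_le) (auto simp: spectrum_def)
  thus "lambda_min M * (\<Sum>i<p. (x i)\<^sup>2) \<le> qf p (\<lambda>i j. M $$ (i, j)) x x"
    using l(2)[of x] by (meson mult_right_mono order_trans sum_nonneg zero_le_power2)
  obtain u where u: "eigenvalue M u" "\<And>x. qf p (\<lambda>i j. M $$ (i, j)) x x \<le> u * (\<Sum>i<p. (x i)\<^sup>2)"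
    using exists_extreme_eigenvalue[OF M sym p, of "-1"] by auto
  have "u \<le> lambda_max M" unfolding lambda_max_def using u(1) fin by (intro Max_ge) (auto simp: spectrum_def)
  thus "qf p (\<lambda>i j. M $$ (i, j)) x x \<le> lambda_max M * (\<Sum>i<p. (x i)\<^sup>2)"
    using u(2)[of x] by (meson mult_right_mono order_trans sum_nonneg zero_le_power2)
qed

section \<open>The joint law and the posterior\<close>

text \<open>Completing the square. With the centred Gaussian as reference, the laws of y for all
  \<beta> are dominated by one measure, with densities of exponential form.\<close>

lemma normal_shift:
  assumes \<sigma>: "\<sigma> > 0"
  shows "distr (density lborel (normal_density 0 \<sigma>)) borel (\<lambda>x. m + x)
    = density (density lborel (normal_density 0 \<sigma>)) (\<lambda>x. ennreal (exp ((m * x - m\<^sup>2 / 2) / \<sigma>\<^sup>2)))"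
proof -
  have e: "normal_density 0 \<sigma> x * exp ((m * x - m\<^sup>2 / 2) / \<sigma>\<^sup>2) = normal_density m \<sigma> x" for x
  proof -
    have "- (x - 0)\<^sup>2 / (2 * \<sigma>\<^sup>2) + (m * x - m\<^sup>2 / 2) / \<sigma>\<^sup>2 = - (x - m)\<^sup>2 / (2 * \<sigma>\<^sup>2)"
      using \<sigma> by (simp add: field_simps power2_eq_square)
    thus ?thesis unfolding normal_density_def by (simp add: mult.assoc exp_add[symmetric])
  qed
  have "density (density lborel (normal_density 0 \<sigma>)) (\<lambda>x. ennreal (exp ((m * x - m\<^sup>2 / 2) / \<sigma>\<^sup>2)))
     = density lborel (\<lambda>x. ennreal (normal_density 0 \<sigma> x) * ennreal (exp ((m * x - m\<^sup>2 / 2) / \<sigma>\<^sup>2)))"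
    by (rule density_density_eq) auto
  also have "\<dots> = density lborel (normal_density m \<sigma>)"
    by (rule arg_cong[where f = "density lborel"]) (simp add: fun_eq_iff ennreal_mult'[symmetric] e)
  also have "\<dots> = density (distr lborel borel ((+) m)) (normal_density m \<sigma>)" by (simp add: lborel_distr_plus)
  also have "\<dots> = distr (density lborel (\<lambda>x. normal_density m \<sigma> (m + x))) borel ((+) m)"
    by (subst density_distr) (auto simp: comp_def)
  also have "(\<lambda>x. ennreal (normal_density m \<sigma> (m + x))) = (\<lambda>x. ennreal (normal_density 0 \<sigma> x))"
    by (simp add: normal_density_def)
  finally show ?thesis by (simp add: comp_def)
qed

locale regression =
  fixes X :: "real mat" and n p :: nat and \<sigma> :: real and \<mu> :: "real measure"
  assumes \<sigma>: "\<sigma> > 0" and X: "X \<in> carrier_mat n p" and law: "unit_law \<mu>"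
begin

abbreviation "noise1 \<equiv> density lborel (normal_density 0 \<sigma>)"
abbreviation "noise \<equiv> PiM {..<n} (\<lambda>_. noise1)"
abbreviation "prior \<equiv> PiM {..<p} (\<lambda>_. \<mu>)"
abbreviation "J \<equiv> joint_law X \<sigma> \<mu>"

definition S :: "nat \<Rightarrow> nat \<Rightarrow> real" where
  "S i j = (\<Sum>k<n. X $$ (k, i) * X $$ (k, j)) / \<sigma>\<^sup>2"

definition fit :: "(nat \<Rightarrow> real) \<Rightarrow> nat \<Rightarrow> real" where
  "fit \<beta> k = (\<Sum>i<p. X $$ (k, i) * \<beta> i)"

definition w :: "(nat \<Rightarrow> real) \<Rightarrow> nat \<Rightarrow> real" where
  "w y i = (\<Sum>k<n. X $$ (k, i) * y k) / \<sigma>\<^sup>2"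

text \<open>Clipping keeps the Hamiltonian bounded everywhere; it changes nothing almost surely.\<close>

definition clip :: "(nat \<Rightarrow> real) \<Rightarrow> nat \<Rightarrow> real" where
  "clip \<beta> i = max (- 1) (min 1 (\<beta> i))"

text \<open>For v = \<open>w y\<close> this is the log-likelihood ratio of the model at \<beta>
  against pure noise; the data enter only through v.\<close>

definition ham :: "(nat \<Rightarrow> real) \<Rightarrow> (nat \<Rightarrow> real) \<Rightarrow> real" where
  "ham v \<beta> = (\<Sum>i<p. v i * \<beta> i) - qf p S \<beta> \<beta> / 2"

sublocale \<mu>: unit_law \<mu> by (rule law)

lemma clip_bound: "\<bar>clip \<beta> i\<bar> \<le> 1" by (auto simp: clip_def)

lemma S_sym: "S i j = S j i" by (simp add: S_def mult.commute)

lemma qf_S: "qf p S x y = (\<Sum>k<n. fit x k * fit y k) / \<sigma>\<^sup>2"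
proof -
  have "qf p S x y = (\<Sum>i<p. \<Sum>j<p. \<Sum>k<n. (X $$ (k, i) * x i) * (X $$ (k, j) * y j) / \<sigma>\<^sup>2)"
    unfolding qf_def S_def by (intro sum.cong refl) (simp add: sum_distrib_right sum_distrib_left sum_divide_distrib mult_ac)
  also have "\<dots> = (\<Sum>i<p. \<Sum>k<n. \<Sum>j<p. (X $$ (k, i) * x i) * (X $$ (k, j) * y j) / \<sigma>\<^sup>2)"
    by (intro sum.cong refl sum.swap)
  also have "\<dots> = (\<Sum>k<n. \<Sum>i<p. \<Sum>j<p. (X $$ (k, i) * x i) * (X $$ (k, j) * y j) / \<sigma>\<^sup>2)"
    by (rule sum.swap)
  also have "\<dots> = (\<Sum>k<n. fit x k * fit y k / \<sigma>\<^sup>2)"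
    unfolding fit_def sum_product sum_divide_distrib ..
  finally show ?thesis by (simp add: sum_divide_distrib)
qed

lemma qf_S_nonneg: "qf p S x x \<ge> 0"
  unfolding qf_S by (simp add: sum_nonneg)

lemma sum_w: "(\<Sum>i<p. w y i * \<beta> i) = (\<Sum>k<n. fit \<beta> k * y k) / \<sigma>\<^sup>2"
proof -
  have "(\<Sum>i<p. w y i * \<beta> i) = (\<Sum>i<p. \<Sum>k<n. X $$ (k, i) * \<beta> i * y k / \<sigma>\<^sup>2)"
    unfolding w_def by (intro sum.cong refl) (simp add: sum_distrib_right sum_distrib_left sum_divide_distrib mult_ac)
  also have "\<dots> = (\<Sum>k<n. \<Sum>i<p. X $$ (k, i) * \<beta> i * y k / \<sigma>\<^sup>2)" by (rule sum.swap)
  finally show ?thesis by (simp add: fit_def sum_distrib_right sum_divide_distrib)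
qed

lemma prob_noise1: "prob_space noise1"
  by (rule prob_space_normal_density[OF \<sigma>])

lemma prob_noise: "prob_space noise" by (intro prob_space_PiM prob_noise1)
lemma prob_prior: "prob_space prior" by (intro prob_space_PiM \<mu>.prob_space_axioms)

lemma sets_noise [measurable_cong]: "sets noise = sets (rspace n)"
  by (intro sets_PiM_cong) auto
lemma sets_prior [measurable_cong]: "sets prior = sets (rspace p)"
  by (intro sets_PiM_cong) auto

lemma space_noise: "space noise = space (rspace n)" by (rule sets_eq_imp_space_eq[OF sets_noise])
lemma space_prior: "space prior = space (rspace p)" by (rule sets_eq_imp_space_eq[OF sets_prior])

lemma m_coord [measurable]: "i < k \<Longrightarrow> (\<lambda>x. x i) \<in> borel_measurable (rspace k)"
  by (rule measurable_component_singleton[of i "{..<k}" "\<lambda>_. borel"]) simp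

lemma AE_prior: "AE \<beta> in prior. \<forall>i<p. \<bar>\<beta> i\<bar> \<le> 1"
proof -
  have "AE \<beta> in prior. \<bar>\<beta> i\<bar> \<le> 1" if "i < p" for i
    using AE_PiM_component[of "{..<p}" "\<lambda>_. \<mu>" i "\<lambda>x. \<bar>x\<bar> \<le> 1"] \<mu>.prob_space_axioms \<mu>.bounded that by simp
  hence "AE \<beta> in prior. \<forall>i\<in>{..<p}. \<bar>\<beta> i\<bar> \<le> 1" by (subst AE_finite_all) auto
  thus ?thesis by (rule eventually_mono) auto
qed

lemma clip_eq: "\<bar>\<beta> i\<bar> \<le> 1 \<Longrightarrow> clip \<beta> i = \<beta> i" by (auto simp: clip_def abs_le_iff)

lemma ham_clip: "\<forall>i<p. \<bar>\<beta> i\<bar> \<le> 1 \<Longrightarrow> ham v (clip \<beta>) = ham v \<beta>"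
  unfolding ham_def by (intro arg_cong2[where f = "(-)"] arg_cong[where f = "\<lambda>x. x / 2"] qf_cong sum.cong refl) (auto simp: clip_eq)

lemma m_fit [measurable]: "(\<lambda>\<beta>. fit \<beta> k) \<in> borel_measurable (rspace p)"
  unfolding fit_def by measurable

lemma m_w [measurable]: "(\<lambda>y. w y i) \<in> borel_measurable (rspace n)"
  unfolding w_def by measurable

lemma m_clip [measurable]: "i < p \<Longrightarrow> (\<lambda>\<beta>. clip \<beta> i) \<in> borel_measurable (rspace p)"
  unfolding clip_def by measurable

lemma m_ham: "(\<lambda>(y, \<beta>). ham (w y) (clip \<beta>)) \<in> borel_measurable (rspace n \<Otimes>\<^sub>M rspace p)"
proof -
  have "(\<lambda>z. w (fst z) i) \<in> borel_measurable (rspace n \<Otimes>\<^sub>M rspace p)" for i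
    by (rule measurable_compose[OF measurable_fst m_w])
  moreover have "(\<lambda>z. clip (snd z) i) \<in> borel_measurable (rspace n \<Otimes>\<^sub>M rspace p)" if "i < p" for i
    by (rule measurable_compose[OF measurable_snd m_clip[OF that]])
  ultimately show ?thesis
    unfolding split_beta' ham_def qf_def
    by (intro borel_measurable_diff borel_measurable_divide borel_measurable_sum borel_measurable_times borel_measurable_const) auto
qed

lemma m_ham' [measurable]: "(\<lambda>\<beta>. ham v (clip \<beta>)) \<in> borel_measurable (rspace p)"
  unfolding ham_def qf_def by measurable

lemma ham_bound: "\<bar>ham v (clip \<beta>)\<bar> \<le> (\<Sum>i<p. \<bar>v i\<bar>) + (\<Sum>i<p. \<Sum>j<p. \<bar>S i j\<bar>) / 2"
proof -
  have "\<bar>\<Sum>i<p. v i * clip \<beta> i\<bar> \<le> (\<Sum>i<p. \<bar>v i\<bar>)"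
    by (intro order_trans[OF sum_abs] sum_mono) (simp add: abs_mult mult_left_le clip_bound)
  moreover have "\<bar>qf p S (clip \<beta>) (clip \<beta>)\<bar> \<le> (\<Sum>i<p. \<Sum>j<p. \<bar>S i j\<bar>)"
  proof -
    have "\<bar>S i j * clip \<beta> i * clip \<beta> j\<bar> \<le> \<bar>S i j\<bar>" for i j
    proof -
      have "\<bar>clip \<beta> i\<bar> * \<bar>clip \<beta> j\<bar> \<le> 1" using clip_bound by (simp add: mult_le_one)
      thus ?thesis by (simp add: abs_mult mult.assoc mult_left_le)
    qed
    thus ?thesis unfolding qf_def by (intro order_trans[OF sum_abs] sum_mono)
  qed
  ultimately show ?thesis unfolding ham_def by linarith
qed

text \<open>The coordinatewise shift densities multiply, and their exponents sum to
  \<open>ham\<close>, since \<open>sum_w\<close> and \<open>qf_S\<close> express both of its terms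
  through the fitted values.\<close>

lemma shift_law:
  "distr noise (rspace n) (\<lambda>\<epsilon>. \<lambda>i\<in>{..<n}. fit \<beta> i + \<epsilon> i) = density noise (\<lambda>y. ennreal (exp (ham (w y) \<beta>)))"
proof -
  let ?f = "\<lambda>i x. ennreal (exp ((fit \<beta> i * x - (fit \<beta> i)\<^sup>2 / 2) / \<sigma>\<^sup>2))"
  have "distr noise (rspace n) (\<lambda>\<epsilon>. \<lambda>i\<in>{..<n}. fit \<beta> i + \<epsilon> i) = PiM {..<n} (\<lambda>i. distr noise1 borel (\<lambda>x. fit \<beta> i + x))"
    by (rule distr_PiM_maps) (auto simp: prob_noise1)
  also have "\<dots> = PiM {..<n} (\<lambda>i. density noise1 (?f i))" by (simp add: normal_shift[OF \<sigma>])
  also have "\<dots> = density noise (\<lambda>y. \<Prod>i<n. ?f i (y i))"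
  proof (rule PiM_density)
    fix i
    have "prob_space (distr noise1 borel (\<lambda>x. fit \<beta> i + x))"
      by (rule prob_space.prob_space_distr[OF prob_noise1]) simp
    thus "prob_space (density noise1 (?f i))" by (simp add: normal_shift[OF \<sigma>])
  qed (auto simp: prob_noise1)
  also have "(\<lambda>y. \<Prod>i<n. ?f i (y i)) = (\<lambda>y. ennreal (exp (ham (w y) \<beta>)))"
  proof
    fix y
    have "(\<Prod>i<n. ?f i (y i)) = ennreal (exp (\<Sum>i<n. (fit \<beta> i * y i - (fit \<beta> i)\<^sup>2 / 2) / \<sigma>\<^sup>2))"
      by (simp add: prod_ennreal exp_sum)
    also have "(\<Sum>i<n. (fit \<beta> i * y i - (fit \<beta> i)\<^sup>2 / 2) / \<sigma>\<^sup>2) = ham (w y) \<beta>"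
      unfolding ham_def sum_w qf_S
      by (simp add: diff_divide_distrib sum_subtractf sum_divide_distrib power2_eq_square mult.commute)
    finally show "(\<Prod>i<n. ?f i (y i)) = ennreal (exp (ham (w y) \<beta>))" .
  qed
  finally show ?thesis .
qed

lemma sets_J: "sets J = sets (rspace n \<Otimes>\<^sub>M rspace p)"
  using X by (simp add: joint_law_def)

lemma sigma_finite_noise: "sigma_finite_measure noise" and sigma_finite_prior: "sigma_finite_measure prior"
  using prob_noise prob_prior by (auto intro: prob_space_imp_sigma_finite)

definition obs :: "(nat \<Rightarrow> real) \<times> (nat \<Rightarrow> real) \<Rightarrow> (nat \<Rightarrow> real) \<times> (nat \<Rightarrow> real)" where
  "obs = (\<lambda>(\<epsilon>, \<beta>). (\<lambda>i\<in>{..<n}. fit \<beta> i + \<epsilon> i, \<beta>))"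

lemma m_obs: "obs \<in> noise \<Otimes>\<^sub>M prior \<rightarrow>\<^sub>M rspace n \<Otimes>\<^sub>M rspace p"
proof -
  have "(\<lambda>z. \<lambda>i\<in>{..<n}. fit (snd z) i + fst z i) \<in> rspace n \<Otimes>\<^sub>M rspace p \<rightarrow>\<^sub>M rspace n"
    by (intro measurable_restrict borel_measurable_add measurable_compose[OF measurable_snd m_fit] measurable_compose[OF measurable_fst m_coord]) auto
  hence "obs \<in> rspace n \<Otimes>\<^sub>M rspace p \<rightarrow>\<^sub>M rspace n \<Otimes>\<^sub>M rspace p"
    unfolding obs_def split_beta' by (intro measurable_Pair) auto
  moreover have "sets (noise \<Otimes>\<^sub>M prior) = sets (rspace n \<Otimes>\<^sub>M rspace p)"
    by (intro sets_pair_measure_cong sets_noise sets_prior)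
  ultimately show ?thesis using measurable_cong_sets by blast
qed

lemma J_eq_distr: "J = distr (noise \<Otimes>\<^sub>M prior) (rspace n \<Otimes>\<^sub>M rspace p) obs"
proof -
  have d: "dim_row X = n" "dim_col X = p" using X by auto
  have e: "(\<lambda>i\<in>{..<n}. (X *\<^sub>v vec p \<beta>) $ i + \<epsilon> i) = (\<lambda>i\<in>{..<n}. fit \<beta> i + \<epsilon> i)" for \<beta> \<epsilon>
    using X by (intro restrict_ext) (simp add: fit_def scalar_prod_def lessThan_atLeast0 row_def)
  show ?thesis unfolding joint_law_def d e obs_def ..
qed

lemma prob_J: "prob_space J"
proof -
  interpret pair_prob_space noise prior
    unfolding pair_prob_space_def pair_sigma_finite_def
    using prob_noise prob_prior sigma_finite_noise sigma_finite_prior by auto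
  show ?thesis unfolding J_eq_distr by (rule prob_space_distr[OF m_obs])
qed

text \<open>Bayes' formula before normalization: y under pure noise, \<beta> under the prior,
  weighted by the likelihood ratio. Clipping is harmless because the prior sits on the cube; Fubini
  puts \<beta> inside, as a conditional law given y requires.\<close>

lemma nn_integral_J:
  assumes F [measurable]: "F \<in> borel_measurable (rspace n \<Otimes>\<^sub>M rspace p)"
  shows "(\<integral>\<^sup>+\<omega>. F \<omega> \<partial>J) = (\<integral>\<^sup>+y. (\<integral>\<^sup>+\<beta>. ennreal (exp (ham (w y) (clip \<beta>))) * F (y, \<beta>) \<partial>prior) \<partial>noise)"
proof -
  interpret pair_sigma_finite noise prior
    unfolding pair_sigma_finite_def using sigma_finite_noise sigma_finite_prior by auto
  have sp: "sets (noise \<Otimes>\<^sub>M prior) = sets (rspace n \<Otimes>\<^sub>M rspace p)"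
    by (intro sets_pair_measure_cong sets_noise sets_prior)
  have mFo: "(\<lambda>z. F (obs z)) \<in> borel_measurable (noise \<Otimes>\<^sub>M prior)"
    by (rule measurable_compose[OF m_obs F])
  have mham: "(\<lambda>(y, \<beta>). ennreal (exp (ham (w y) (clip \<beta>))) * F (y, \<beta>)) \<in> borel_measurable (noise \<Otimes>\<^sub>M prior)"
    unfolding measurable_cong_sets[OF sp refl] using m_ham F by (simp add: split_beta')
  have "(\<integral>\<^sup>+\<omega>. F \<omega> \<partial>J) = (\<integral>\<^sup>+z. F (obs z) \<partial>(noise \<Otimes>\<^sub>M prior))"
    unfolding J_eq_distr by (rule nn_integral_distr[OF m_obs]) simp
  also have "\<dots> = (\<integral>\<^sup>+\<beta>. (\<integral>\<^sup>+\<epsilon>. F (obs (\<epsilon>, \<beta>)) \<partial>noise) \<partial>prior)"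
    by (rule nn_integral_snd[symmetric, where f = "\<lambda>z. F (obs z)", OF mFo])
  also have "\<dots> = (\<integral>\<^sup>+\<beta>. (\<integral>\<^sup>+y. ennreal (exp (ham (w y) (clip \<beta>))) * F (y, \<beta>) \<partial>noise) \<partial>prior)"
  proof (rule nn_integral_cong_AE)
    show "AE \<beta> in prior. (\<integral>\<^sup>+\<epsilon>. F (obs (\<epsilon>, \<beta>)) \<partial>noise)
       = (\<integral>\<^sup>+y. ennreal (exp (ham (w y) (clip \<beta>))) * F (y, \<beta>) \<partial>noise)"
      using AE_prior AE_space
    proof eventually_elim
      case (elim \<beta>)
      have \<beta>: "\<beta> \<in> space (rspace p)" using elim(2) space_prior by simp
      have mF: "(\<lambda>y. F (y, \<beta>)) \<in> borel_measurable (rspace n)"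
        using \<beta> by measurable
      have ms: "(\<lambda>\<epsilon>. \<lambda>i\<in>{..<n}. fit \<beta> i + \<epsilon> i) \<in> noise \<rightarrow>\<^sub>M rspace n"
        unfolding measurable_cong_sets[OF sets_noise refl]
        by (intro measurable_restrict borel_measurable_add m_coord borel_measurable_const) auto
      have "(\<integral>\<^sup>+\<epsilon>. F (obs (\<epsilon>, \<beta>)) \<partial>noise) = (\<integral>\<^sup>+y. F (y, \<beta>) \<partial>distr noise (rspace n) (\<lambda>\<epsilon>. \<lambda>i\<in>{..<n}. fit \<beta> i + \<epsilon> i))"
        unfolding obs_def prod.case by (rule nn_integral_distr[symmetric, OF ms]) (use mF in simp)
      also have "\<dots> = (\<integral>\<^sup>+y. ennreal (exp (ham (w y) \<beta>)) * F (y, \<beta>) \<partial>noise)"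
        unfolding shift_law
      proof (rule nn_integral_density)
        show "(\<lambda>y. ennreal (exp (ham (w y) \<beta>))) \<in> borel_measurable noise"
          unfolding measurable_cong_sets[OF sets_noise refl] ham_def by measurable
        show "(\<lambda>y. F (y, \<beta>)) \<in> borel_measurable noise"
          unfolding measurable_cong_sets[OF sets_noise refl] by (rule mF)
      qed
      finally show ?case using ham_clip[OF elim(1)] by simp
    qed
  qed
  also have "\<dots> = (\<integral>\<^sup>+y. (\<integral>\<^sup>+\<beta>. ennreal (exp (ham (w y) (clip \<beta>))) * F (y, \<beta>) \<partial>prior) \<partial>noise)"
    using Fubini'[OF mham] by simp
  finally show ?thesis .
qed

end

section \<open>Almost sure uniqueness of conditional laws\<close>

definition rays :: "real set set" where
  "rays = insert UNIV (range (\<lambda>q::rat. {..real_of_rat q}))"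

lemma countable_rays: "countable rays"
  by (simp add: rays_def)

lemma Int_rays: "a \<in> rays \<Longrightarrow> b \<in> rays \<Longrightarrow> a \<inter> b \<in> rays"
proof -
  have "{..real_of_rat q} \<inter> {..real_of_rat r} = {..real_of_rat (min q r)}" for q r
    by (auto simp: min_def of_rat_less_eq)
  thus "a \<in> rays \<Longrightarrow> b \<in> rays \<Longrightarrow> a \<inter> b \<in> rays" unfolding rays_def by auto
qed

text \<open>A countable generator closed under intersection is the point: equality of kernels is
  first known almost everywhere for each set separately, and countably many null sets can be
  discarded. The member UNIV provides a cover of the space.\<close>

lemma borel_eq_rays: "borel = sigma UNIV rays"
proof -
  define F where "F z = (case z of None \<Rightarrow> UNIV | Some q \<Rightarrow> {..real_of_rat q})" for z
  have r: "rays = F ` UNIV"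
  proof (intro equalityI subsetI)
    fix x assume "x \<in> rays"
    thus "x \<in> F ` UNIV"
    proof (unfold rays_def, elim insertE imageE)
      assume "x = UNIV" thus ?thesis by (intro image_eqI[of _ _ None]) (auto simp: F_def)
    next
      fix q assume "x = {..real_of_rat q}" thus ?thesis by (intro image_eqI[of _ _ "Some q"]) (auto simp: F_def)
    qed
  qed (auto simp: rays_def F_def split: option.splits)
  show ?thesis unfolding r
  proof (rule borel_eq_sigmaI1[OF borel_eq_atMost])
    fix x :: "real set" assume "x \<in> range (\<lambda>a. {..a})"
    then obtain a where x: "x = {..a}" by auto
    have "x = (\<Inter>q\<in>{q::rat. real_of_rat q > a}. {..real_of_rat q})"
    proof (intro equalityI subsetI)
      fix y assume "y \<in> (\<Inter>q\<in>{q::rat. real_of_rat q > a}. {..real_of_rat q})"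
      hence y: "\<And>q. real_of_rat q > a \<Longrightarrow> y \<le> real_of_rat q" by auto
      have "y \<le> a"
      proof (rule ccontr)
        assume "\<not> y \<le> a"
        then obtain q where "a < real_of_rat q" "real_of_rat q < y" using of_rat_dense[of a y] by auto
        thus False using y[of q] by simp
      qed
      thus "y \<in> x" by (simp add: x)
    qed (auto simp: x)
    also have "\<dots> \<in> sets (sigma UNIV (F ` UNIV))"
    proof (rule sets.countable_INT'')
      show "countable {q::rat. real_of_rat q > a}" by simp
      show "UNIV \<in> sets (sigma UNIV (F ` UNIV))" by (metis UNIV_I sets.top space_measure_of_conv)
      fix q :: rat
      have "{..real_of_rat q} = F (Some q)" by (simp add: F_def)
      thus "{..real_of_rat q} \<in> sets (sigma UNIV (F ` UNIV))" by (auto intro!: in_measure_of)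
    qed
    finally show "x \<in> sets (sigma UNIV (F ` UNIV))" .
  qed (auto simp: F_def split: option.splits)
qed

lemma sets_rspace_rays:
  "sets (rspace p) = sigma_sets (space (rspace p)) (Pi\<^sub>E {..<p} ` (\<Pi>\<^sub>E i\<in>{..<p}. rays))"
proof -
  let ?P = "{{f \<in> (\<Pi>\<^sub>E i\<in>{..<p}. UNIV). \<forall>i\<in>j. f i \<in> A i} | A j. j \<in> {{..<p}} \<and> A \<in> Pi j (\<lambda>_. rays)}"
  have P: "?P = Pi\<^sub>E {..<p} ` (\<Pi>\<^sub>E i\<in>{..<p}. rays)"
  proof (intro equalityI subsetI)
    fix Y assume "Y \<in> ?P"
    then obtain A where A: "A \<in> Pi {..<p} (\<lambda>_. rays)" "Y = {f \<in> (\<Pi>\<^sub>E i\<in>{..<p}. UNIV). \<forall>i\<in>{..<p}. f i \<in> A i}" by auto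
    have "Y = Pi\<^sub>E {..<p} (restrict A {..<p})" unfolding A(2) by (rule Set.set_eqI) (simp add: PiE_iff; blast)
    moreover have "restrict A {..<p} \<in> (\<Pi>\<^sub>E i\<in>{..<p}. rays)" using A(1) by auto
    ultimately show "Y \<in> Pi\<^sub>E {..<p} ` (\<Pi>\<^sub>E i\<in>{..<p}. rays)" by blast
  next
    fix Y assume "Y \<in> Pi\<^sub>E {..<p} ` (\<Pi>\<^sub>E i\<in>{..<p}. rays)"
    then obtain A where A: "A \<in> (\<Pi>\<^sub>E i\<in>{..<p}. rays)" "Y = Pi\<^sub>E {..<p} A" by auto
    have "Y = {f \<in> (\<Pi>\<^sub>E i\<in>{..<p}. UNIV). \<forall>i\<in>{..<p}. f i \<in> A i}"
      unfolding A(2) by (rule Set.set_eqI) (simp add: PiE_iff; blast)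
    moreover have "A \<in> Pi {..<p} (\<lambda>_. rays)" using A(1) by auto
    ultimately show "Y \<in> ?P" by blast
  qed
  have "sets (\<Pi>\<^sub>M i\<in>{..<p}. sigma UNIV rays) = sets (sigma (\<Pi>\<^sub>E i\<in>{..<p}. UNIV) ?P)"
  proof (rule sets_PiM_sigma)
    show "\<exists>S\<subseteq>rays. countable S \<and> UNIV = \<Union>S" by (intro exI[of _ "{UNIV}"]) (auto simp: rays_def)
  qed auto
  also have "(\<Pi>\<^sub>M i\<in>{..<p}. sigma UNIV rays) = rspace p" by (simp add: borel_eq_rays[symmetric])
  also have "sets (sigma (\<Pi>\<^sub>E i\<in>{..<p}. UNIV) ?P) = sigma_sets (\<Pi>\<^sub>E i\<in>{..<p}. UNIV) (Pi\<^sub>E {..<p} ` (\<Pi>\<^sub>E i\<in>{..<p}. rays))"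
    unfolding P by (rule sets_measure_of) (auto simp: PiE_iff)
  also have "(\<Pi>\<^sub>E i\<in>{..<p}. UNIV) = space (rspace p)" by (simp add: space_PiM)
  finally show ?thesis .
qed

text \<open>On each rectangle of rational rays the two kernel values are densities of the same
  measure, hence equal almost everywhere. Off one null set they agree on all these rectangles, which
  form a generating \<pi>-system.\<close>

lemma kernels_eq_AE:
  assumes M: "sigma_finite_measure M"
    and K: "\<And>y. y \<in> space M \<Longrightarrow> prob_space (K y) \<and> sets (K y) = sets (rspace p)"
    and G: "\<And>y. y \<in> space M \<Longrightarrow> prob_space (G y) \<and> sets (G y) = sets (rspace p)"
    and mK: "\<And>C. C \<in> sets (rspace p) \<Longrightarrow> (\<lambda>y. emeasure (K y) C) \<in> borel_measurable M"
    and mG: "\<And>C. C \<in> sets (rspace p) \<Longrightarrow> (\<lambda>y. emeasure (G y) C) \<in> borel_measurable M"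
    and eq: "\<And>B C. B \<in> sets M \<Longrightarrow> C \<in> sets (rspace p) \<Longrightarrow>
      (\<integral>\<^sup>+y\<in>B. emeasure (K y) C \<partial>M) = (\<integral>\<^sup>+y\<in>B. emeasure (G y) C \<partial>M)"
  shows "AE y in M. K y = G y"
proof -
  interpret sigma_finite_measure M by fact
  let ?\<C> = "Pi\<^sub>E {..<p} ` (\<Pi>\<^sub>E i\<in>{..<p}. rays)"
  have cnt: "countable ?\<C>" by (intro countable_image countable_PiE countable_rays) auto
  have C: "C \<in> sets (rspace p)" if "C \<in> ?\<C>" for C
    unfolding sets_rspace_rays using that by (rule sigma_sets.Basic)
  have "AE y in M. emeasure (K y) C = emeasure (G y) C" if "C \<in> ?\<C>" for C
  proof (rule density_unique[OF mK[OF C[OF that]] mG[OF C[OF that]]])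
    show "density M (\<lambda>y. emeasure (K y) C) = density M (\<lambda>y. emeasure (G y) C)"
      by (rule measure_eqI) (auto simp: emeasure_density mK[OF C[OF that]] mG[OF C[OF that]] eq[OF _ C[OF that]])
  qed
  hence "AE y in M. \<forall>C\<in>?\<C>. emeasure (K y) C = emeasure (G y) C"
    unfolding AE_ball_countable[OF cnt] by blast
  thus ?thesis using AE_space
  proof eventually_elim
    case (elim y)
    interpret K: prob_space "K y" using K elim(2) by blast
    show "K y = G y"
    proof (rule measure_eqI_generator_eq[where E = ?\<C> and \<Omega> = "space (rspace p)" and A = "\<lambda>_. Pi\<^sub>E {..<p} (\<lambda>i\<in>{..<p}. UNIV)"])
      show "Int_stable ?\<C>"
      proof (rule Int_stableI)
        fix a b assume "a \<in> ?\<C>" "b \<in> ?\<C>"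
        then obtain A B where AB: "A \<in> (\<Pi>\<^sub>E i\<in>{..<p}. rays)" "B \<in> (\<Pi>\<^sub>E i\<in>{..<p}. rays)" "a = Pi\<^sub>E {..<p} A" "b = Pi\<^sub>E {..<p} B" by blast
        have "a \<inter> b = Pi\<^sub>E {..<p} (\<lambda>i\<in>{..<p}. A i \<inter> B i)"
          unfolding AB(3,4) by (rule Set.set_eqI) (simp add: PiE_iff; blast)
        moreover have "(\<lambda>i\<in>{..<p}. A i \<inter> B i) \<in> (\<Pi>\<^sub>E i\<in>{..<p}. rays)" using AB(1,2) by (auto intro!: Int_rays)
        ultimately show "a \<inter> b \<in> ?\<C>" by blast
      qed
      show "?\<C> \<subseteq> Pow (space (rspace p))" by (auto simp: space_PiM PiE_iff)
      show "emeasure (K y) C = emeasure (G y) C" if "C \<in> ?\<C>" for C using elim(1) that by blast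
      show "sets (K y) = sigma_sets (space (rspace p)) ?\<C>" "sets (G y) = sigma_sets (space (rspace p)) ?\<C>"
        using K[OF elim(2)] G[OF elim(2)] sets_rspace_rays by auto
      have "Pi\<^sub>E {..<p} (\<lambda>i\<in>{..<p}. UNIV) \<in> ?\<C>" by (intro imageI) (auto simp: rays_def)
      thus "range (\<lambda>_::nat. Pi\<^sub>E {..<p} (\<lambda>i\<in>{..<p}. UNIV)) \<subseteq> ?\<C>" by blast
      show "(\<Union>i::nat. Pi\<^sub>E {..<p} (\<lambda>i\<in>{..<p}. UNIV)) = space (rspace p)"
        unfolding space_PiM by (rule Set.set_eqI) (simp add: PiE_iff; blast)
    qed simp
  qed
qed

section \<open>The Gibbs form of the posterior\<close>

context regression
begin

definition Z :: "(nat \<Rightarrow> real) \<Rightarrow> real" where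
  "Z v = (\<integral>\<beta>. exp (ham v (clip \<beta>)) \<partial>prior)"

text \<open>An explicit, everywhere defined version of the posterior, indexed by v because the
  posterior depends on y only through \<open>w y\<close>.\<close>

definition gibbs :: "(nat \<Rightarrow> real) \<Rightarrow> (nat \<Rightarrow> real) measure" where
  "gibbs v = density prior (\<lambda>\<beta>. ennreal (exp (ham v (clip \<beta>)) / Z v))"

sublocale prior: prob_space prior by (rule prob_prior)
sublocale noise: prob_space noise by (rule prob_noise)
sublocale J: prob_space J by (rule prob_J)

definition hbound :: "(nat \<Rightarrow> real) \<Rightarrow> real" where
  "hbound v = (\<Sum>i<p. \<bar>v i\<bar>) + (\<Sum>i<p. \<Sum>j<p. \<bar>S i j\<bar>) / 2"

lemma m_prior: "f \<in> borel_measurable (rspace p) \<Longrightarrow> f \<in> borel_measurable prior"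
  by (simp add: measurable_cong_sets[OF sets_prior refl])

lemma exp_ham_bounds: "exp (- hbound v) \<le> exp (ham v (clip \<beta>))" "exp (ham v (clip \<beta>)) \<le> exp (hbound v)"
  using ham_bound[of v \<beta>] by (auto simp: hbound_def abs_le_iff)

lemma integrable_exp_ham: "integrable prior (\<lambda>\<beta>. exp (ham v (clip \<beta>)))"
proof (rule prior.integrable_const_bound[where B = "exp (hbound v)"])
  show "AE \<beta> in prior. norm (exp (ham v (clip \<beta>))) \<le> exp (hbound v)" using exp_ham_bounds by simp
  show "(\<lambda>\<beta>. exp (ham v (clip \<beta>))) \<in> borel_measurable prior" by (rule m_prior) measurable
qed

lemma Z_bounds: "exp (- hbound v) \<le> Z v" "Z v \<le> exp (hbound v)"
  unfolding Z_def using integrable_exp_ham exp_ham_bounds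
  by (auto intro!: prior.integral_ge_const prior.integral_le_const)

lemma Z_pos: "Z v > 0" by (rule less_le_trans[OF exp_gt_zero Z_bounds(1)])

lemma ennreal_Z: "ennreal (Z v) = (\<integral>\<^sup>+\<beta>. ennreal (exp (ham v (clip \<beta>))) \<partial>prior)"
  unfolding Z_def by (rule nn_integral_eq_integral[symmetric, OF integrable_exp_ham]) simp

lemma sets_gibbs [measurable_cong]: "sets (gibbs v) = sets (rspace p)"
  using sets_prior by (simp add: gibbs_def)

lemma m_gibbs_density: "(\<lambda>\<beta>. exp (ham v (clip \<beta>)) / Z v) \<in> borel_measurable (rspace p)"
  by measurable

lemma nn_integral_gibbs:
  assumes "F \<in> borel_measurable (rspace p)"
  shows "ennreal (Z v) * (\<integral>\<^sup>+\<beta>. F \<beta> \<partial>gibbs v) = (\<integral>\<^sup>+\<beta>. ennreal (exp (ham v (clip \<beta>))) * F \<beta> \<partial>prior)"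
proof -
  note mF = m_prior[OF assms]
  have mg: "(\<lambda>\<beta>. ennreal (exp (ham v (clip \<beta>)) / Z v)) \<in> borel_measurable prior"
    by (rule measurable_compose[OF m_prior[OF m_gibbs_density] measurable_ennreal])
  have "ennreal (Z v) * (\<integral>\<^sup>+\<beta>. F \<beta> \<partial>gibbs v) = ennreal (Z v) * (\<integral>\<^sup>+\<beta>. ennreal (exp (ham v (clip \<beta>)) / Z v) * F \<beta> \<partial>prior)"
    unfolding gibbs_def by (simp add: nn_integral_density[OF mg mF])
  also have "\<dots> = (\<integral>\<^sup>+\<beta>. ennreal (Z v) * (ennreal (exp (ham v (clip \<beta>)) / Z v) * F \<beta>) \<partial>prior)"
    by (rule nn_integral_cmult[symmetric]) (use mg mF in measurable)
  also have "\<dots> = (\<integral>\<^sup>+\<beta>. ennreal (exp (ham v (clip \<beta>))) * F \<beta> \<partial>prior)"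
    using Z_pos[of v] by (intro nn_integral_cong) (simp add: mult.assoc[symmetric] ennreal_mult'[symmetric])
  finally show ?thesis .
qed

lemma prob_gibbs: "prob_space (gibbs v)"
proof (rule prob_spaceI)
  have "ennreal (Z v) * (\<integral>\<^sup>+\<beta>. 1 \<partial>gibbs v) = ennreal (Z v)"
    by (subst nn_integral_gibbs) (simp_all add: ennreal_Z)
  hence "ennreal (Z v) * emeasure (gibbs v) (space (gibbs v)) = ennreal (Z v) * 1" by simp
  thus "emeasure (gibbs v) (space (gibbs v)) = 1"
    using Z_pos[of v] by (subst (asm) ennreal_mult_cancel_left) auto
qed

lemma AE_gibbs_iff:
  assumes "Measurable.pred (rspace p) P"
  shows "(AE \<beta> in gibbs v. P \<beta>) \<longleftrightarrow> (AE \<beta> in prior. P \<beta>)"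
proof -
  have mg: "(\<lambda>\<beta>. ennreal (exp (ham v (clip \<beta>)) / Z v)) \<in> borel_measurable prior"
    by (rule measurable_compose[OF m_prior[OF m_gibbs_density] measurable_ennreal])
  show ?thesis unfolding gibbs_def by (subst AE_density[OF mg]) (simp add: Z_pos)
qed

lemma AE_gibbs: "AE \<beta> in gibbs v. \<forall>i<p. \<bar>\<beta> i\<bar> \<le> 1"
proof -
  have "Measurable.pred (rspace p) (\<lambda>\<beta>. \<forall>i<p. \<bar>\<beta> i\<bar> \<le> 1)"
  proof -
    have "Measurable.pred (rspace p) (\<lambda>\<beta>. \<forall>i\<in>{..<p}. \<bar>\<beta> i\<bar> \<le> 1)"
      by (rule pred_intros_finite) auto
    moreover have "(\<lambda>\<beta>::nat \<Rightarrow> real. \<forall>i\<in>{..<p}. \<bar>\<beta> i\<bar> \<le> 1) = (\<lambda>\<beta>. \<forall>i<p. \<bar>\<beta> i\<bar> \<le> 1)" by auto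
    ultimately show ?thesis by simp
  qed
  thus ?thesis using AE_prior by (subst AE_gibbs_iff)
qed

lemma m_exp_ham2: "(\<lambda>z. ennreal (exp (ham (w (fst z)) (clip (snd z))))) \<in> borel_measurable (rspace n \<Otimes>\<^sub>M rspace p)"
  using m_ham by (simp add: split_beta')

lemma m_Z: "(\<lambda>y. Z (w y)) \<in> borel_measurable (rspace n)"
  unfolding Z_def
  by (rule prior.borel_measurable_lebesgue_integral)
     (use m_ham in \<open>simp add: split_beta' measurable_cong_sets[OF sets_pair_measure_cong[OF refl sets_prior] refl]\<close>)

lemma m_noise: "f \<in> borel_measurable (rspace n) \<Longrightarrow> f \<in> borel_measurable noise"
  by (simp add: measurable_cong_sets[OF sets_noise refl])

lemma m_nn_gibbs:
  assumes F: "F \<in> borel_measurable (rspace n \<Otimes>\<^sub>M rspace p)"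
  shows "(\<lambda>y. \<integral>\<^sup>+\<beta>. F (y, \<beta>) \<partial>gibbs (w y)) \<in> borel_measurable (rspace n)"
proof -
  have "(\<lambda>y. (\<integral>\<^sup>+\<beta>. ennreal (exp (ham (w y) (clip \<beta>))) * F (y, \<beta>) \<partial>prior) / ennreal (Z (w y))) \<in> borel_measurable (rspace n)"
  proof (intro borel_measurable_divide_ennreal)
    show "(\<lambda>y. \<integral>\<^sup>+\<beta>. ennreal (exp (ham (w y) (clip \<beta>))) * F (y, \<beta>) \<partial>prior) \<in> borel_measurable (rspace n)"
      by (rule prior.borel_measurable_nn_integral)
         (use m_exp_ham2 F in \<open>simp add: split_beta' measurable_cong_sets[OF sets_pair_measure_cong[OF refl sets_prior] refl]\<close>)
    show "(\<lambda>y. ennreal (Z (w y))) \<in> borel_measurable (rspace n)" using m_Z by simp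
  qed
  moreover have "(\<integral>\<^sup>+\<beta>. ennreal (exp (ham (w y) (clip \<beta>))) * F (y, \<beta>) \<partial>prior) / ennreal (Z (w y)) = (\<integral>\<^sup>+\<beta>. F (y, \<beta>) \<partial>gibbs (w y))"
    if "y \<in> space (rspace n)" for y
  proof -
    have "(\<lambda>\<beta>. F (y, \<beta>)) \<in> borel_measurable (rspace p)" using that F by simp
    from nn_integral_gibbs[OF this, of "w y", symmetric] show ?thesis
      using Z_pos[of "w y"] by (simp add: ennreal_times_divide mult.commute[of "ennreal (Z (w y))"] mult_divide_eq_ennreal)
  qed
  ultimately show ?thesis by (subst measurable_cong) (auto)
qed

lemma nn_integral_J_gibbs:
  assumes F: "F \<in> borel_measurable (rspace n \<Otimes>\<^sub>M rspace p)"
  shows "(\<integral>\<^sup>+\<omega>. F \<omega> \<partial>J) = (\<integral>\<^sup>+y. ennreal (Z (w y)) * (\<integral>\<^sup>+\<beta>. F (y, \<beta>) \<partial>gibbs (w y)) \<partial>noise)"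
  unfolding nn_integral_J[OF F]
proof (rule nn_integral_cong)
  fix y assume "y \<in> space noise"
  hence "y \<in> space (rspace n)" by (simp add: space_noise)
  hence "(\<lambda>\<beta>. F (y, \<beta>)) \<in> borel_measurable (rspace p)" using F by simp
  from nn_integral_gibbs[OF this, of "w y", symmetric]
  show "(\<integral>\<^sup>+\<beta>. ennreal (exp (ham (w y) (clip \<beta>))) * F (y, \<beta>) \<partial>prior) = ennreal (Z (w y)) * (\<integral>\<^sup>+\<beta>. F (y, \<beta>) \<partial>gibbs (w y))" .
qed

text \<open>As \<open>gibbs\<close> has total mass 1, the normalizer \<open>Z (w y)\<close> is the
  density of the data against pure noise.\<close>

lemma nn_integral_J_fst:
  assumes f: "f \<in> borel_measurable (rspace n)"
  shows "(\<integral>\<^sup>+\<omega>. f (fst \<omega>) \<partial>J) = (\<integral>\<^sup>+y. ennreal (Z (w y)) * f y \<partial>noise)"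
proof -
  have "(\<lambda>\<omega>. f (fst \<omega>)) \<in> borel_measurable (rspace n \<Otimes>\<^sub>M rspace p)"
    by (rule measurable_compose[OF measurable_fst f])
  from nn_integral_J_gibbs[OF this] show ?thesis
    by (simp add: prob_space.emeasure_space_1[OF prob_gibbs])
qed

lemma nn_integral_J_disintegrate:
  assumes F: "F \<in> borel_measurable (rspace n \<Otimes>\<^sub>M rspace p)"
  shows "(\<integral>\<^sup>+\<omega>. F \<omega> \<partial>J) = (\<integral>\<^sup>+\<omega>. (\<integral>\<^sup>+\<beta>. F (fst \<omega>, \<beta>) \<partial>gibbs (w (fst \<omega>))) \<partial>J)"
  unfolding nn_integral_J_gibbs[OF F] by (rule nn_integral_J_fst[OF m_nn_gibbs[OF F], symmetric])

lemma m_fst_J: "fst \<in> J \<rightarrow>\<^sub>M rspace n"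
  by (simp add: measurable_cong_sets[OF sets_J refl])

text \<open>The theorem speaks of an arbitrary version of the posterior; off a null set every
  statement about it reduces to the explicit one.\<close>

lemma posterior_eq_gibbs:
  assumes post: "is_posterior X \<sigma> \<mu> K"
  shows "AE \<omega> in J. K (fst \<omega>) = gibbs (w (fst \<omega>))"
proof -
  have d: "dim_row X = n" "dim_col X = p" using X by auto
  let ?M = "distr J (rspace n) fst"
  have K: "K \<in> rspace n \<rightarrow>\<^sub>M prob_algebra (rspace p)"
    and eq: "\<And>B C. B \<in> sets (rspace n) \<Longrightarrow> C \<in> sets (rspace p) \<Longrightarrow> emeasure J (B \<times> C) = (\<integral>\<^sup>+y\<in>B. emeasure (K y) C \<partial>?M)"
    using post unfolding is_posterior_def d by auto
  interpret M: prob_space ?M by (rule J.prob_space_distr[OF m_fst_J])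
  have "AE y in ?M. K y = gibbs (w y)"
  proof (rule kernels_eq_AE)
    show "sigma_finite_measure ?M" by (rule M.sigma_finite_measure_axioms)
    show "prob_space (K y) \<and> sets (K y) = sets (rspace p)" if "y \<in> space ?M" for y
      using measurable_space[OF K, of y] that by (simp add: space_prob_algebra)
    show "prob_space (gibbs (w y)) \<and> sets (gibbs (w y)) = sets (rspace p)" for y
      using prob_gibbs sets_gibbs by blast
    fix C assume C: "C \<in> sets (rspace p)"
    show "(\<lambda>y. emeasure (K y) C) \<in> borel_measurable ?M"
      using measurable_emeasure_kernel[OF measurable_prob_algebraD[OF K] C] by simp
    have mI: "(\<lambda>z. indicator C (snd z) :: ennreal) \<in> borel_measurable (rspace n \<Otimes>\<^sub>M rspace p)"
      by (rule measurable_compose[OF measurable_snd borel_measurable_indicator[OF C]])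
    have e: "(\<integral>\<^sup>+\<beta>. indicator C \<beta> \<partial>gibbs (w y)) = emeasure (gibbs (w y)) C" for y
      using C sets_gibbs by simp
    have mG: "(\<lambda>y. emeasure (gibbs (w y)) C) \<in> borel_measurable (rspace n)"
      using m_nn_gibbs[OF mI] by (simp add: e)
    thus "(\<lambda>y. emeasure (gibbs (w y)) C) \<in> borel_measurable ?M" by simp
    fix B assume "B \<in> sets ?M"
    hence B: "B \<in> sets (rspace n)" by simp
    have BC: "B \<times> C \<in> sets J" unfolding sets_J using B C by simp
    have "(\<integral>\<^sup>+y\<in>B. emeasure (K y) C \<partial>?M) = emeasure J (B \<times> C)" by (rule eq[OF B C, symmetric])
    also have "\<dots> = (\<integral>\<^sup>+\<omega>. indicator (B \<times> C) \<omega> \<partial>J)" using BC by simp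
    also have "\<dots> = (\<integral>\<^sup>+\<omega>. (\<integral>\<^sup>+\<beta>. indicator (B \<times> C) (fst \<omega>, \<beta>) \<partial>gibbs (w (fst \<omega>))) \<partial>J)"
      by (rule nn_integral_J_disintegrate) (use B C in auto)
    also have "\<dots> = (\<integral>\<^sup>+\<omega>. (\<lambda>y. emeasure (gibbs (w y)) C * indicator B y) (fst \<omega>) \<partial>J)"
      by (intro nn_integral_cong) (auto simp: indicator_times e split: split_indicator)
    also have "\<dots> = (\<integral>\<^sup>+y\<in>B. emeasure (gibbs (w y)) C \<partial>?M)"
      by (rule nn_integral_distr[symmetric, OF m_fst_J]) (use mG B in simp)
    finally show "(\<integral>\<^sup>+y\<in>B. emeasure (K y) C \<partial>?M) = (\<integral>\<^sup>+y\<in>B. emeasure (gibbs (w y)) C \<partial>?M)" .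
  qed
  thus ?thesis by (rule AE_distrD[OF m_fst_J])
qed

section \<open>The posterior covariance\<close>

lemma noise1_second_moment:
  "(\<integral>\<^sup>+x. ennreal ((c + b * x)\<^sup>2) \<partial>noise1) = ennreal (c\<^sup>2 + b\<^sup>2 * \<sigma>\<^sup>2)"
proof -
  have 0: "has_bochner_integral lborel (\<lambda>x. normal_density 0 \<sigma> x) 1"
    using normal_moment_even[OF \<sigma>, of 0 0] by simp
  have 1: "has_bochner_integral lborel (\<lambda>x. normal_density 0 \<sigma> x * x) 0"
    using normal_moment_odd[OF \<sigma>, of 0 0] by simp
  have 2: "has_bochner_integral lborel (\<lambda>x. normal_density 0 \<sigma> x * x\<^sup>2) (\<sigma>\<^sup>2)"
    using normal_moment_even[OF \<sigma>, of 0 1] by (simp add: fact_2)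
  have "has_bochner_integral lborel (\<lambda>x. c\<^sup>2 * normal_density 0 \<sigma> x + (2 * c * b) * (normal_density 0 \<sigma> x * x) + b\<^sup>2 * (normal_density 0 \<sigma> x * x\<^sup>2))
      (c\<^sup>2 * 1 + (2 * c * b) * 0 + b\<^sup>2 * \<sigma>\<^sup>2)"
    by (intro has_bochner_integral_add has_bochner_integral_mult_right 0 1 2)
  also have "(\<lambda>x. c\<^sup>2 * normal_density 0 \<sigma> x + (2 * c * b) * (normal_density 0 \<sigma> x * x) + b\<^sup>2 * (normal_density 0 \<sigma> x * x\<^sup>2))
     = (\<lambda>x. normal_density 0 \<sigma> x * (c + b * x)\<^sup>2)"
    by (simp add: fun_eq_iff power2_eq_square algebra_simps)
  finally have h: "has_bochner_integral lborel (\<lambda>x. normal_density 0 \<sigma> x * (c + b * x)\<^sup>2) (c\<^sup>2 + b\<^sup>2 * \<sigma>\<^sup>2)" by simp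
  have "(\<integral>\<^sup>+x. ennreal ((c + b * x)\<^sup>2) \<partial>noise1) = (\<integral>\<^sup>+x. ennreal (normal_density 0 \<sigma> x) * ennreal ((c + b * x)\<^sup>2) \<partial>lborel)"
    by (rule nn_integral_density) auto
  also have "\<dots> = (\<integral>\<^sup>+x. ennreal (normal_density 0 \<sigma> x * (c + b * x)\<^sup>2) \<partial>lborel)"
    by (simp add: ennreal_mult')
  also have "\<dots> = ennreal (c\<^sup>2 + b\<^sup>2 * \<sigma>\<^sup>2)"
    using h by (subst nn_integral_eq_integral) (auto simp: has_bochner_integral_iff)
  finally show ?thesis .
qed

text \<open>Induction on the number of coordinates; the mixed terms vanish because the noise is
  centred.\<close>

lemma noise_quadratic:
  fixes k :: nat
  shows "(\<integral>\<^sup>+\<epsilon>. ennreal ((\<Sum>i<k. b i * \<epsilon> i)\<^sup>2) \<partial>PiM {..<k} (\<lambda>_. noise1)) = ennreal (\<sigma>\<^sup>2 * (\<Sum>i<k. (b i)\<^sup>2))"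
proof (induction k)
  case 0
  interpret prob_space "PiM {..<0::nat} (\<lambda>_. noise1)" by (intro prob_space_PiM prob_noise1)
  show ?case using emeasure_space_1 by simp
next
  case (Suc k)
  interpret Pk: prob_space "PiM {..<k} (\<lambda>_. noise1)" by (intro prob_space_PiM prob_noise1)
  interpret N: product_prob_space "\<lambda>_::nat. noise1" "{..<k}" by (intro product_prob_spaceI prob_noise1)
  have sk: "sets (PiM {..<m} (\<lambda>_. noise1)) = sets (rspace m)" for m
    by (intro sets_PiM_cong) auto
  have m: "(\<lambda>\<epsilon>. ennreal ((\<Sum>i<m. b i * \<epsilon> i)\<^sup>2)) \<in> borel_measurable (PiM {..<m} (\<lambda>_. noise1))" for m
    unfolding measurable_cong_sets[OF sk refl] by measurable
  have "(\<integral>\<^sup>+\<epsilon>. ennreal ((\<Sum>i<Suc k. b i * \<epsilon> i)\<^sup>2) \<partial>PiM {..<Suc k} (\<lambda>_. noise1))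
     = (\<integral>\<^sup>+\<epsilon>. (\<integral>\<^sup>+z. ennreal ((\<Sum>i<Suc k. b i * (\<epsilon>(k := z)) i)\<^sup>2) \<partial>noise1) \<partial>PiM {..<k} (\<lambda>_. noise1))"
    unfolding lessThan_Suc
    by (rule N.product_nn_integral_insert) (use m[of "Suc k"] in \<open>auto simp: lessThan_Suc\<close>)
  also have "\<dots> = (\<integral>\<^sup>+\<epsilon>. ennreal ((\<Sum>i<k. b i * \<epsilon> i)\<^sup>2) + ennreal ((b k)\<^sup>2 * \<sigma>\<^sup>2) \<partial>PiM {..<k} (\<lambda>_. noise1))"
  proof (rule nn_integral_cong)
    fix \<epsilon> :: "nat \<Rightarrow> real"
    have "(\<Sum>i<Suc k. b i * (\<epsilon>(k := z)) i) = (\<Sum>i<k. b i * \<epsilon> i) + b k * z" for z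
    proof -
      have "(\<Sum>i<k. b i * (\<epsilon>(k := z)) i) = (\<Sum>i<k. b i * \<epsilon> i)" by (intro sum.cong) auto
      thus ?thesis by simp
    qed
    thus "(\<integral>\<^sup>+z. ennreal ((\<Sum>i<Suc k. b i * (\<epsilon>(k := z)) i)\<^sup>2) \<partial>noise1) = ennreal ((\<Sum>i<k. b i * \<epsilon> i)\<^sup>2) + ennreal ((b k)\<^sup>2 * \<sigma>\<^sup>2)"
      by (simp only: noise1_second_moment) (simp add: ennreal_plus)
  qed
  also have "\<dots> = ennreal (\<sigma>\<^sup>2 * (\<Sum>i<k. (b i)\<^sup>2)) + ennreal ((b k)\<^sup>2 * \<sigma>\<^sup>2)"
    by (subst nn_integral_add[OF m]) (simp_all add: Suc.IH Pk.emeasure_space_1)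
  also have "\<dots> = ennreal (\<sigma>\<^sup>2 * (\<Sum>i<Suc k. (b i)\<^sup>2))"
    by (subst ennreal_plus[symmetric]) (auto simp: sum_nonneg algebra_simps)
  finally show ?case .
qed

text \<open>Conditions on \<beta> first, the opposite order to
  \<open>nn_integral_J_disintegrate\<close>. Using both orders compares the posterior error with the
  least squares error.\<close>

lemma nn_integral_J_prior:
  assumes F: "F \<in> borel_measurable (rspace n \<Otimes>\<^sub>M rspace p)"
  shows "(\<integral>\<^sup>+\<omega>. F \<omega> \<partial>J) = (\<integral>\<^sup>+\<beta>. (\<integral>\<^sup>+\<epsilon>. F (obs (\<epsilon>, \<beta>)) \<partial>noise) \<partial>prior)"
proof -
  interpret pair_sigma_finite noise prior
    unfolding pair_sigma_finite_def using sigma_finite_noise sigma_finite_prior by auto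
  have mFo: "(\<lambda>z. F (obs z)) \<in> borel_measurable (noise \<Otimes>\<^sub>M prior)"
    by (rule measurable_compose[OF m_obs F])
  have "(\<integral>\<^sup>+\<omega>. F \<omega> \<partial>J) = (\<integral>\<^sup>+z. F (obs z) \<partial>(noise \<Otimes>\<^sub>M prior))"
    unfolding J_eq_distr by (rule nn_integral_distr[OF m_obs]) (use F in simp)
  also have "\<dots> = (\<integral>\<^sup>+\<beta>. (\<integral>\<^sup>+\<epsilon>. F (obs (\<epsilon>, \<beta>)) \<partial>noise) \<partial>prior)"
    by (rule nn_integral_snd[symmetric, where f = "\<lambda>z. F (obs z)", OF mFo])
  finally show ?thesis .
qed

text \<open>The witness is the least squares functional \<open>b = X (X\<^sup>T X)\<^sup>-\<^sup>1 a\<close>.\<close>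

lemma exists_unbiased_estimator:
  assumes c: "c > 0" and lower: "\<And>x. c * (\<Sum>i<p. (x i)\<^sup>2) \<le> qf p S x x"
  shows "\<exists>b. (\<forall>i<p. (\<Sum>k<n. X $$ (k, i) * b k) = a i) \<and> \<sigma>\<^sup>2 * (\<Sum>k<n. (b k)\<^sup>2) \<le> (\<Sum>i<p. (a i)\<^sup>2) / c"
proof -
  define M where "M = mat p p (\<lambda>(i, j). S i j)"
  have M: "M \<in> carrier_mat p p" by (simp add: M_def)
  have qM: "qf p (\<lambda>i j. M $$ (i, j)) x y = qf p S x y" for x y by (rule qf_cong) (auto simp: M_def)
  have "det M \<noteq> 0"
  proof
    assume "det M = 0"
    then obtain v where v: "v \<in> carrier_vec p" "v \<noteq> 0\<^sub>v p" "M *\<^sub>v v = 0\<^sub>v p"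
      using det_0_iff_vec_prod_zero[OF M] by auto
    have "qf p S (($) v) (($) v) = v \<bullet> (M *\<^sub>v v)" using qf_eq_scalar_prod[OF M v(1) v(1)] by (simp add: qM)
    also have "\<dots> = 0" using v by simp
    finally have "c * (\<Sum>i<p. (v $ i)\<^sup>2) \<le> 0" using lower[of "($) v"] by simp
    hence "(\<Sum>i<p. (v $ i)\<^sup>2) = 0" using c by (metis antisym_conv mult_le_0_iff not_less sum_nonneg zero_le_power2)
    hence "\<forall>i<p. v $ i = 0" by (simp add: sum_nonneg_eq_0_iff)
    hence "v = 0\<^sub>v p" using v(1) by (intro eq_vecI) auto
    thus False using v(2) by simp
  qed
  then obtain B where B: "B \<in> carrier_mat p p" "M * B = 1\<^sub>m p"
    using det_non_zero_imp_unit[OF M] unfolding Units_def ring_mat_def by auto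
  define x where "x = B *\<^sub>v vec p a"
  have x: "x \<in> carrier_vec p" unfolding x_def by (rule mult_mat_vec_carrier[OF B(1)]) simp
  have Mx: "M *\<^sub>v x = vec p a"
    unfolding x_def using assoc_mult_mat_vec[OF M B(1), of "vec p a"] B(2) by simp
  have Sx: "(\<Sum>j<p. S i j * x $ j) = a i" if i: "i < p" for i
  proof -
    have "a i = (M *\<^sub>v x) $ i" using i by (simp add: Mx)
    also have "\<dots> = (\<Sum>j<p. S i j * x $ j)"
      using i M x by (simp add: scalar_prod_def lessThan_atLeast0 row_def M_def)
    finally show ?thesis ..
  qed
  define b where "b k = fit (($) x) k / \<sigma>\<^sup>2" for k
  define q where "q = qf p S (($) x) (($) x)"
  have b1: "(\<Sum>k<n. X $$ (k, i) * b k) = a i" if i: "i < p" for i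
  proof -
    have "(\<Sum>k<n. X $$ (k, i) * b k) = (\<Sum>k<n. \<Sum>j<p. X $$ (k, i) * X $$ (k, j) * x $ j / \<sigma>\<^sup>2)"
      by (simp add: b_def fit_def sum_distrib_left sum_divide_distrib mult.assoc)
    also have "\<dots> = (\<Sum>j<p. \<Sum>k<n. X $$ (k, i) * X $$ (k, j) * x $ j / \<sigma>\<^sup>2)" by (rule sum.swap)
    also have "\<dots> = (\<Sum>j<p. S i j * x $ j)" by (simp add: S_def sum_distrib_right sum_divide_distrib)
    finally show ?thesis using Sx[OF i] by simp
  qed
  have b2: "\<sigma>\<^sup>2 * (\<Sum>k<n. (b k)\<^sup>2) = q"
  proof -
    have "s * (x / s\<^sup>2) = x / s" if "s \<noteq> 0" for s x :: real using that by (simp add: power2_eq_square)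
    hence "\<sigma>\<^sup>2 * (x / (\<sigma>\<^sup>2)\<^sup>2) = x / \<sigma>\<^sup>2" for x using \<sigma> by (metis less_irrefl zero_eq_power2)
    moreover have "(\<Sum>k<n. (b k)\<^sup>2) = (\<Sum>k<n. (fit (($) x) k)\<^sup>2) / (\<sigma>\<^sup>2)\<^sup>2"
      unfolding b_def power_divide sum_divide_distrib ..
    moreover have "q = (\<Sum>k<n. (fit (($) x) k)\<^sup>2) / \<sigma>\<^sup>2" unfolding q_def qf_S power2_eq_square ..
    ultimately show ?thesis by (simp only:)
  qed
  \<comment> \<open>q is both \<sigma>^2 times the squared length of b and the pairing of the
    solution x with a. Cauchy-Schwarz and coercivity give
    \<open>q\<^sup>2 \<le> (q / c) * (\<Sum>i<p. (a i)\<^sup>2)\<close>, and one factor q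
    cancels.\<close>
  have q: "q = (\<Sum>i<p. x $ i * a i)"
    unfolding q_def qf_def by (intro sum.cong refl) (simp add: Sx[symmetric] sum_distrib_left mult_ac)
  have q0: "q \<ge> 0" unfolding q_def by (rule qf_S_nonneg)
  have "q\<^sup>2 \<le> (\<Sum>i<p. (x $ i)\<^sup>2) * (\<Sum>i<p. (a i)\<^sup>2)" unfolding q by (rule Cauchy_Schwarz_ineq_sum)
  also have "\<dots> \<le> (q / c) * (\<Sum>i<p. (a i)\<^sup>2)"
    using lower[of "($) x"] c by (intro mult_right_mono) (auto simp: q_def field_simps sum_nonneg)
  finally have h: "q * q \<le> q * ((\<Sum>i<p. (a i)\<^sup>2) / c)" by (simp add: power2_eq_square)
  have "q \<le> (\<Sum>i<p. (a i)\<^sup>2) / c"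
  proof (cases "q = 0")
    case True thus ?thesis using c by (simp add: sum_nonneg)
  next
    case False
    show ?thesis by (rule mult_left_le_imp_le[OF h]) (use False q0 in simp)
  qed
  thus ?thesis using b1 b2 by (intro exI[of _ b]) auto
qed

definition pmean :: "(nat \<Rightarrow> real) \<Rightarrow> nat \<Rightarrow> real" where
  "pmean v i = (\<integral>\<beta>. \<beta> i \<partial>gibbs v)"

definition pcov :: "(nat \<Rightarrow> real) \<Rightarrow> nat \<Rightarrow> nat \<Rightarrow> real" where
  "pcov v i j = (\<integral>\<beta>. \<beta> i * \<beta> j \<partial>gibbs v) - pmean v i * pmean v j"

definition A :: "nat \<Rightarrow> nat \<Rightarrow> real" where "A i j = (if i = j then 0 else S i j)"

definition trcov :: "(nat \<Rightarrow> real) \<Rightarrow> real" where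
  "trcov v = (\<Sum>i<p. \<Sum>j<p. A i j * pcov v i j)"

lemma m_gibbs: "f \<in> borel_measurable (rspace p) \<Longrightarrow> f \<in> borel_measurable (gibbs v)"
  by (simp add: measurable_cong_sets[OF sets_gibbs refl])

lemma integrable_gibbs:
  assumes "(f :: _ \<Rightarrow> real) \<in> borel_measurable (rspace p)" "\<And>\<beta>. \<forall>i<p. \<bar>\<beta> i\<bar> \<le> 1 \<Longrightarrow> \<bar>f \<beta>\<bar> \<le> B"
  shows "integrable (gibbs v) f"
proof -
  interpret G: prob_space "gibbs v" by (rule prob_gibbs)
  show ?thesis
  proof (rule G.integrable_const_bound[where B = B])
    show "AE \<beta> in gibbs v. norm (f \<beta>) \<le> B" using AE_gibbs by eventually_elim (use assms in simp)
  qed (rule m_gibbs[OF assms(1)])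
qed

lemma abs_integral_gibbs_le:
  assumes "(f :: _ \<Rightarrow> real) \<in> borel_measurable (rspace p)" "\<And>\<beta>. \<forall>i<p. \<bar>\<beta> i\<bar> \<le> 1 \<Longrightarrow> \<bar>f \<beta>\<bar> \<le> B"
  shows "\<bar>\<integral>\<beta>. f \<beta> \<partial>gibbs v\<bar> \<le> B"
proof -
  interpret G: prob_space "gibbs v" by (rule prob_gibbs)
  note i = integrable_gibbs[OF assms]
  have "\<bar>\<integral>\<beta>. f \<beta> \<partial>gibbs v\<bar> \<le> (\<integral>\<beta>. \<bar>f \<beta>\<bar> \<partial>gibbs v)" by (rule integral_abs_bound)
  also have "\<dots> \<le> B"
  proof (rule G.integral_le_const)
    show "AE \<beta> in gibbs v. \<bar>f \<beta>\<bar> \<le> B" using AE_gibbs by eventually_elim (use assms in simp)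
  qed (use i in auto)
  finally show ?thesis .
qed

lemma integrable_coord: "i < p \<Longrightarrow> integrable (gibbs v) (\<lambda>\<beta>. \<beta> i)"
  by (rule integrable_gibbs[where B = 1]) auto

lemma integrable_coord2: "i < p \<Longrightarrow> j < p \<Longrightarrow> integrable (gibbs v) (\<lambda>\<beta>. \<beta> i * \<beta> j)"
  by (rule integrable_gibbs[where B = 1]) (auto simp: abs_mult mult_le_one)

lemma pmean_bound: "i < p \<Longrightarrow> \<bar>pmean v i\<bar> \<le> 1"
  unfolding pmean_def by (rule abs_integral_gibbs_le) auto

lemma pcov_bound: "i < p \<Longrightarrow> j < p \<Longrightarrow> \<bar>pcov v i j\<bar> \<le> 2"
proof -
  assume ij: "i < p" "j < p"
  have "\<bar>\<integral>\<beta>. \<beta> i * \<beta> j \<partial>gibbs v\<bar> \<le> 1"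
    by (rule abs_integral_gibbs_le) (use ij in \<open>auto simp: abs_mult mult_le_one\<close>)
  moreover have "\<bar>pmean v i * pmean v j\<bar> \<le> 1"
    using pmean_bound[OF ij(1), of v] pmean_bound[OF ij(2), of v] by (simp add: abs_mult mult_le_one)
  ultimately show ?thesis unfolding pcov_def by linarith
qed

lemma pcov_sym: "pcov v i j = pcov v j i"
  by (simp add: pcov_def mult.commute)

lemma m_integral_gibbs:
  assumes f: "(f :: _ \<Rightarrow> real) \<in> borel_measurable (rspace p)"
  shows "(\<lambda>y. \<integral>\<beta>. f \<beta> \<partial>gibbs (w y)) \<in> borel_measurable (rspace n)"
proof -
  have e: "(\<integral>\<beta>. f \<beta> \<partial>gibbs v) = (\<integral>\<beta>. (exp (ham v (clip \<beta>)) / Z v) *\<^sub>R f \<beta> \<partial>prior)" for v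
    unfolding gibbs_def
    by (rule integral_density) (use Z_pos[of v] m_prior[OF f] m_prior[OF m_gibbs_density] in \<open>auto intro!: AE_I2 divide_nonneg_pos\<close>)
  have "(\<lambda>y. \<integral>\<beta>. (exp (ham (w y) (clip \<beta>)) / Z (w y)) *\<^sub>R f \<beta> \<partial>prior) \<in> borel_measurable (rspace n)"
  proof (rule prior.borel_measurable_lebesgue_integral)
    have "(\<lambda>z. (exp (ham (w (fst z)) (clip (snd z))) / Z (w (fst z))) *\<^sub>R f (snd z)) \<in> borel_measurable (rspace n \<Otimes>\<^sub>M rspace p)"
    proof -
      have [measurable]: "(\<lambda>z. ham (w (fst z)) (clip (snd z))) \<in> borel_measurable (rspace n \<Otimes>\<^sub>M rspace p)"
        using m_ham by (simp add: split_beta')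
      have [measurable]: "(\<lambda>z. Z (w (fst z))) \<in> borel_measurable (rspace n \<Otimes>\<^sub>M rspace p)"
        by (rule measurable_compose[OF measurable_fst m_Z])
      have [measurable]: "(\<lambda>z. f (snd z)) \<in> borel_measurable (rspace n \<Otimes>\<^sub>M rspace p)"
        by (rule measurable_compose[OF measurable_snd f])
      show ?thesis by measurable
    qed
    thus "(\<lambda>(y, \<beta>). (exp (ham (w y) (clip \<beta>)) / Z (w y)) *\<^sub>R f \<beta>) \<in> borel_measurable (rspace n \<Otimes>\<^sub>M prior)"
      by (simp add: split_beta' measurable_cong_sets[OF sets_pair_measure_cong[OF refl sets_prior] refl])
  qed
  thus ?thesis by (simp add: e)
qed

lemma m_pcov: "i < p \<Longrightarrow> j < p \<Longrightarrow> (\<lambda>y. pcov (w y) i j) \<in> borel_measurable (rspace n)"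
  unfolding pcov_def pmean_def by (intro borel_measurable_diff borel_measurable_times m_integral_gibbs) auto

lemma m_J: "f \<in> borel_measurable (rspace n) \<Longrightarrow> (\<lambda>\<omega>. f (fst \<omega>)) \<in> borel_measurable J"
  by (rule measurable_compose[OF m_fst_J])

lemma m_trcov: "(\<lambda>\<omega>. trcov (w (fst \<omega>))) \<in> borel_measurable J"
  by (rule m_J) (unfold trcov_def, intro borel_measurable_sum borel_measurable_times m_pcov borel_measurable_const, auto)

lemma integrable_pcov: "i < p \<Longrightarrow> j < p \<Longrightarrow> integrable J (\<lambda>\<omega>. pcov (w (fst \<omega>)) i j)"
  by (rule J.integrable_const_bound[where B = 2]) (use pcov_bound m_J[OF m_pcov] in auto)

lemma integrable_trcov: "integrable J (\<lambda>\<omega>. trcov (w (fst \<omega>)))"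
  unfolding trcov_def by (intro Bochner_Integration.integrable_sum integrable_mult_right integrable_pcov) auto

text \<open>Bias-variance decomposition of the linear functional a around an arbitrary centre c;
  later c is a linear estimator, constant once y is fixed.\<close>

lemma qf_pcov:
  fixes a :: "nat \<Rightarrow> real"
  shows "qf p (pcov v) a a = (\<integral>\<beta>. ((\<Sum>i<p. a i * \<beta> i) - c)\<^sup>2 \<partial>gibbs v) - ((\<Sum>i<p. a i * pmean v i) - c)\<^sup>2"
proof -
  interpret G: prob_space "gibbs v" by (rule prob_gibbs)
  have e: "((\<Sum>i<p. a i * \<beta> i) - c)\<^sup>2 = (\<Sum>i<p. \<Sum>j<p. a i * a j * (\<beta> i * \<beta> j)) + (- 2 * c) * (\<Sum>i<p. a i * \<beta> i) + c\<^sup>2" for \<beta> :: "nat \<Rightarrow> real"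
  proof -
    have "(\<Sum>i<p. a i * \<beta> i) * (\<Sum>i<p. a i * \<beta> i) = (\<Sum>i<p. \<Sum>j<p. a i * a j * (\<beta> i * \<beta> j))"
      unfolding sum_product by (intro sum.cong refl) (simp add: mult_ac)
    thus ?thesis by (simp add: power2_eq_square algebra_simps)
  qed
  have i1: "integrable (gibbs v) (\<lambda>\<beta>. \<Sum>i<p. \<Sum>j<p. a i * a j * (\<beta> i * \<beta> j))"
    by (intro Bochner_Integration.integrable_sum integrable_mult_right integrable_coord2) auto
  have i2: "integrable (gibbs v) (\<lambda>\<beta>. \<Sum>i<p. a i * \<beta> i)"
    by (intro Bochner_Integration.integrable_sum integrable_mult_right integrable_coord) auto
  have s1: "(\<integral>\<beta>. (\<Sum>i<p. \<Sum>j<p. a i * a j * (\<beta> i * \<beta> j)) \<partial>gibbs v) = (\<Sum>i<p. \<Sum>j<p. a i * a j * (\<integral>\<beta>. \<beta> i * \<beta> j \<partial>gibbs v))"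
    by (subst Bochner_Integration.integral_sum; (intro Bochner_Integration.integrable_sum integrable_mult_right integrable_coord2)?; simp?)
       (intro sum.cong refl, subst Bochner_Integration.integral_sum, auto intro!: integrable_mult_right integrable_coord2)
  have s2: "(\<integral>\<beta>. (\<Sum>i<p. a i * \<beta> i) \<partial>gibbs v) = (\<Sum>i<p. a i * pmean v i)"
    unfolding pmean_def by (subst Bochner_Integration.integral_sum) (auto intro!: integrable_mult_right integrable_coord)
  have "(\<integral>\<beta>. ((\<Sum>i<p. a i * \<beta> i) - c)\<^sup>2 \<partial>gibbs v)
     = (\<Sum>i<p. \<Sum>j<p. a i * a j * (\<integral>\<beta>. \<beta> i * \<beta> j \<partial>gibbs v)) + (- 2 * c) * (\<Sum>i<p. a i * pmean v i) + c\<^sup>2"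
    unfolding e using i1 i2 by (simp add: s1 s2 G.prob_space)
  moreover have "((\<Sum>i<p. a i * pmean v i) - c)\<^sup>2
     = (\<Sum>i<p. \<Sum>j<p. a i * a j * (pmean v i * pmean v j)) + (- 2 * c) * (\<Sum>i<p. a i * pmean v i) + c\<^sup>2"
    by (rule e)
  moreover have "qf p (pcov v) a a = (\<Sum>i<p. \<Sum>j<p. a i * a j * (\<integral>\<beta>. \<beta> i * \<beta> j \<partial>gibbs v)) - (\<Sum>i<p. \<Sum>j<p. a i * a j * (pmean v i * pmean v j))"
    unfolding qf_def pcov_def by (simp add: left_diff_distrib right_diff_distrib sum_subtractf mult_ac)
  ultimately show ?thesis by linarith
qed

lemma qf_pcov_nonneg: "qf p (pcov v) a a \<ge> 0"
  using qf_pcov[of v a "\<Sum>i<p. a i * pmean v i"] by simp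

lemma qf_pcov_le: "qf p (pcov v) a a \<le> (\<integral>\<beta>. ((\<Sum>i<p. a i * \<beta> i) - c)\<^sup>2 \<partial>gibbs v)"
  using qf_pcov[of v a c] by simp

text \<open>The posterior mean predicts \<open>a \<cdot> \<beta>\<close> at least as well as the least squares estimator does.\<close>

lemma expected_qf_pcov_le:
  assumes c: "c > 0" and lower: "\<And>x. c * (\<Sum>i<p. (x i)\<^sup>2) \<le> qf p S x x"
  shows "(\<integral>\<omega>. qf p (pcov (w (fst \<omega>))) a a \<partial>J) \<le> 1 / c * (\<Sum>i<p. (a i)\<^sup>2)"
proof -
  obtain b where b: "\<And>i. i < p \<Longrightarrow> (\<Sum>k<n. X $$ (k, i) * b k) = a i" "\<sigma>\<^sup>2 * (\<Sum>k<n. (b k)\<^sup>2) \<le> (\<Sum>i<p. (a i)\<^sup>2) / c"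
    using exists_unbiased_estimator[OF c lower] by blast
  have bf: "(\<Sum>k<n. b k * fit \<beta> k) = (\<Sum>i<p. a i * \<beta> i)" for \<beta>
  proof -
    have "(\<Sum>k<n. b k * fit \<beta> k) = (\<Sum>k<n. \<Sum>i<p. X $$ (k, i) * b k * \<beta> i)"
      unfolding fit_def by (simp add: sum_distrib_left mult_ac)
    also have "\<dots> = (\<Sum>i<p. \<Sum>k<n. X $$ (k, i) * b k * \<beta> i)" by (rule sum.swap)
    also have "\<dots> = (\<Sum>i<p. a i * \<beta> i)" by (simp add: sum_distrib_right[symmetric] b(1))
    finally show ?thesis .
  qed
  let ?F = "\<lambda>z. ennreal (((\<Sum>i<p. a i * snd z i) - (\<Sum>k<n. b k * fst z k))\<^sup>2)"
  have mF: "?F \<in> borel_measurable (rspace n \<Otimes>\<^sub>M rspace p)"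
  proof -
    have "(\<lambda>z. snd z i) \<in> borel_measurable (rspace n \<Otimes>\<^sub>M rspace p)" if "i < p" for i
      by (rule measurable_compose[OF measurable_snd m_coord[OF that]])
    moreover have "(\<lambda>z. fst z k) \<in> borel_measurable (rspace n \<Otimes>\<^sub>M rspace p)" if "k < n" for k
      by (rule measurable_compose[OF measurable_fst m_coord[OF that]])
    ultimately show ?thesis by (intro measurable_compose[OF _ measurable_ennreal] borel_measurable_power borel_measurable_diff borel_measurable_sum borel_measurable_times borel_measurable_const) auto
  qed
  have iq: "integrable J (\<lambda>\<omega>. qf p (pcov (w (fst \<omega>))) a a)"
    unfolding qf_def by (intro Bochner_Integration.integrable_sum integrable_mult_left integrable_pcov) auto
  have "ennreal (\<integral>\<omega>. qf p (pcov (w (fst \<omega>))) a a \<partial>J) = (\<integral>\<^sup>+\<omega>. ennreal (qf p (pcov (w (fst \<omega>))) a a) \<partial>J)"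
    by (rule nn_integral_eq_integral[symmetric, OF iq]) (simp add: qf_pcov_nonneg)
  also have "\<dots> \<le> (\<integral>\<^sup>+\<omega>. (\<integral>\<^sup>+\<beta>. ?F (fst \<omega>, \<beta>) \<partial>gibbs (w (fst \<omega>))) \<partial>J)"
  proof (rule nn_integral_mono)
    fix \<omega>
    let ?c = "\<Sum>k<n. b k * fst \<omega> k"
    have i: "integrable (gibbs v) (\<lambda>\<beta>. ((\<Sum>i<p. a i * \<beta> i) - ?c)\<^sup>2)" for v
    proof (rule integrable_gibbs[where B = "((\<Sum>i<p. \<bar>a i\<bar>) + \<bar>?c\<bar>)\<^sup>2"])
      fix \<beta> :: "nat \<Rightarrow> real" assume "\<forall>i<p. \<bar>\<beta> i\<bar> \<le> 1"
      hence "\<bar>\<Sum>i<p. a i * \<beta> i\<bar> \<le> (\<Sum>i<p. \<bar>a i\<bar>)"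
        by (intro order_trans[OF sum_abs] sum_mono) (auto simp: abs_mult mult_left_le)
      hence "\<bar>(\<Sum>i<p. a i * \<beta> i) - ?c\<bar> \<le> \<bar>(\<Sum>i<p. \<bar>a i\<bar>) + \<bar>?c\<bar>\<bar>" by linarith
      hence "((\<Sum>i<p. a i * \<beta> i) - ?c)\<^sup>2 \<le> ((\<Sum>i<p. \<bar>a i\<bar>) + \<bar>?c\<bar>)\<^sup>2" by (simp only: abs_le_square_iff)
      thus "\<bar>((\<Sum>i<p. a i * \<beta> i) - ?c)\<^sup>2\<bar> \<le> ((\<Sum>i<p. \<bar>a i\<bar>) + \<bar>?c\<bar>)\<^sup>2" by simp
    qed measurable
    have "ennreal (qf p (pcov (w (fst \<omega>))) a a) \<le> ennreal (\<integral>\<beta>. ((\<Sum>i<p. a i * \<beta> i) - ?c)\<^sup>2 \<partial>gibbs (w (fst \<omega>)))"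
      by (rule ennreal_leI[OF qf_pcov_le])
    also have "\<dots> = (\<integral>\<^sup>+\<beta>. ?F (fst \<omega>, \<beta>) \<partial>gibbs (w (fst \<omega>)))"
      using nn_integral_eq_integral[OF i] by simp
    finally show "ennreal (qf p (pcov (w (fst \<omega>))) a a) \<le> (\<integral>\<^sup>+\<beta>. ?F (fst \<omega>, \<beta>) \<partial>gibbs (w (fst \<omega>)))" .
  qed
  \<comment> \<open>The averaged posterior error of the linear estimator is its error under the
    joint law; conditioning on \<beta> instead of y then leaves pure noise, because b is
    unbiased.\<close>
  also have "\<dots> = (\<integral>\<^sup>+\<omega>. ?F \<omega> \<partial>J)" by (rule nn_integral_J_disintegrate[OF mF, symmetric])
  also have "\<dots> = (\<integral>\<^sup>+\<beta>. (\<integral>\<^sup>+\<epsilon>. ?F (obs (\<epsilon>, \<beta>)) \<partial>noise) \<partial>prior)" by (rule nn_integral_J_prior[OF mF])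
  also have "\<dots> = (\<integral>\<^sup>+\<beta>. ennreal (\<sigma>\<^sup>2 * (\<Sum>k<n. (b k)\<^sup>2)) \<partial>prior)"
  proof (rule nn_integral_cong)
    fix \<beta> :: "nat \<Rightarrow> real"
    have "(\<Sum>i<p. a i * \<beta> i) - (\<Sum>k<n. b k * (fit \<beta> k + \<epsilon> k)) = - (\<Sum>k<n. b k * \<epsilon> k)" for \<epsilon>
      by (simp add: distrib_left sum.distrib bf)
    hence "?F (obs (\<epsilon>, \<beta>)) = ennreal ((\<Sum>k<n. b k * \<epsilon> k)\<^sup>2)" for \<epsilon> by (simp add: obs_def)
    thus "(\<integral>\<^sup>+\<epsilon>. ?F (obs (\<epsilon>, \<beta>)) \<partial>noise) = ennreal (\<sigma>\<^sup>2 * (\<Sum>k<n. (b k)\<^sup>2))" by (simp only: noise_quadratic)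
  qed
  also have "\<dots> = ennreal (\<sigma>\<^sup>2 * (\<Sum>k<n. (b k)\<^sup>2))" by (simp add: prior.emeasure_space_1)
  finally have "(\<integral>\<omega>. qf p (pcov (w (fst \<omega>))) a a \<partial>J) \<le> \<sigma>\<^sup>2 * (\<Sum>k<n. (b k)\<^sup>2)"
    by (subst (asm) ennreal_le_iff) (auto simp: sum_nonneg)
  thus ?thesis using b(2) by simp
qed

text \<open>The trace is linear in the covariance, so the expectation is taken first and the
  operator bound is applied to the averaged covariance \<Gamma>, for which the least squares
  comparison provides it.\<close>

lemma expected_trcov:
  assumes c: "c > 0" and lower: "\<And>x. c * (\<Sum>i<p. (x i)\<^sup>2) \<le> qf p S x x"
  shows "\<bar>\<integral>\<omega>. trcov (w (fst \<omega>)) \<partial>J\<bar> \<le> sqrt (\<Sum>i<p. \<Sum>j<p. (A i j)\<^sup>2) * (sqrt (real p) * (1 / c))"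
proof -
  define \<Gamma> where "\<Gamma> i j = (\<integral>\<omega>. pcov (w (fst \<omega>)) i j \<partial>J)" for i j
  have q: "qf p \<Gamma> a a = (\<integral>\<omega>. qf p (pcov (w (fst \<omega>))) a a \<partial>J)" for a
  proof -
    have "(\<integral>\<omega>. qf p (pcov (w (fst \<omega>))) a a \<partial>J) = (\<Sum>i<p. \<integral>\<omega>. (\<Sum>j<p. pcov (w (fst \<omega>)) i j * a i * a j) \<partial>J)"
      unfolding qf_def by (intro Bochner_Integration.integral_sum Bochner_Integration.integrable_sum integrable_mult_left integrable_pcov) auto
    also have "\<dots> = (\<Sum>i<p. \<Sum>j<p. \<integral>\<omega>. pcov (w (fst \<omega>)) i j * a i * a j \<partial>J)"
      by (intro sum.cong refl Bochner_Integration.integral_sum integrable_mult_left integrable_pcov) auto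
    also have "\<dots> = qf p \<Gamma> a a" unfolding qf_def \<Gamma>_def by simp
    finally show ?thesis ..
  qed
  have "(\<integral>\<omega>. trcov (w (fst \<omega>)) \<partial>J) = (\<Sum>i<p. \<integral>\<omega>. (\<Sum>j<p. A i j * pcov (w (fst \<omega>)) i j) \<partial>J)"
    unfolding trcov_def by (intro Bochner_Integration.integral_sum Bochner_Integration.integrable_sum integrable_mult_right integrable_pcov) auto
  also have "\<dots> = (\<Sum>i<p. \<Sum>j<p. \<integral>\<omega>. A i j * pcov (w (fst \<omega>)) i j \<partial>J)"
    by (intro sum.cong refl Bochner_Integration.integral_sum integrable_mult_right integrable_pcov) auto
  also have "\<dots> = (\<Sum>i<p. \<Sum>j<p. A i j * \<Gamma> i j)" unfolding \<Gamma>_def by simp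
  finally have "\<bar>\<integral>\<omega>. trcov (w (fst \<omega>)) \<partial>J\<bar> = \<bar>\<Sum>i<p. \<Sum>j<p. A i j * \<Gamma> i j\<bar>" by simp
  also have "\<dots> \<le> sqrt (\<Sum>i<p. \<Sum>j<p. (A i j)\<^sup>2) * (sqrt (real p) * (1 / c))"
  proof (rule trace_product_bound)
    show "\<Gamma> i j = \<Gamma> j i" for i j unfolding \<Gamma>_def by (simp add: pcov_sym)
    show "0 \<le> qf p \<Gamma> x x" for x unfolding q by (rule integral_nonneg_AE) (simp add: qf_pcov_nonneg)
    show "qf p \<Gamma> x x \<le> 1 / c * (\<Sum>i<p. (x i)\<^sup>2)" for x unfolding q by (rule expected_qf_pcov_le[OF c lower])
  qed (use c in simp)
  finally show ?thesis .
qed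

text \<open>A bound on the form becomes a bound on the operator by Cauchy-Schwarz between S x and
  x.\<close>

lemma row_sq_bound:
  assumes upper: "\<And>x. qf p S x x \<le> C * (\<Sum>i<p. (x i)\<^sup>2)" and C: "C \<ge> 0"
  shows "(\<Sum>i<p. (\<Sum>j<p. S i j * x j)\<^sup>2) \<le> C\<^sup>2 * (\<Sum>i<p. (x i)\<^sup>2)"
proof -
  define z where "z i = (\<Sum>j<p. S i j * x j)" for i
  define N where "N = (\<Sum>i<p. (z i)\<^sup>2)"
  have "qf p S z x = N"
    unfolding qf_def N_def z_def by (simp add: power2_eq_square sum_distrib_left mult_ac)
  hence "N\<^sup>2 \<le> qf p S z z * qf p S x x" using qf_cauchy_schwarz[of p S z x] S_sym qf_S_nonneg by simp
  also have "\<dots> \<le> (C * N) * (C * (\<Sum>i<p. (x i)\<^sup>2))"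
    unfolding N_def by (intro mult_mono upper) (auto simp: C sum_nonneg qf_S_nonneg)
  finally have h: "N * N \<le> N * (C\<^sup>2 * (\<Sum>i<p. (x i)\<^sup>2))" by (simp add: power2_eq_square mult_ac)
  have N0: "N \<ge> 0" by (simp add: N_def sum_nonneg)
  have "N \<le> C\<^sup>2 * (\<Sum>i<p. (x i)\<^sup>2)"
  proof (cases "N = 0")
    case True thus ?thesis by (simp add: sum_nonneg)
  next
    case False thus ?thesis using h N0 by (simp add: mult_le_cancel_left)
  qed
  thus ?thesis by (simp add: N_def z_def)
qed

lemma S_diag_bound:
  assumes upper: "\<And>x. qf p S x x \<le> C * (\<Sum>i<p. (x i)\<^sup>2)" and i: "i < p" shows "S i i \<le> C" "S i i \<ge> 0"
proof -
  define e where "e j = (if j = i then 1 else 0 :: real)" for j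
  have "qf p S e e = (\<Sum>k<p. if k = i then (\<Sum>j<p. if j = i then S k j else 0) else 0)"
    unfolding qf_def
  proof (intro sum.cong refl)
    fix k
    have "(\<Sum>j<p. S k j * e k * e j) = (\<Sum>j<p. if k = i then if j = i then S k j else 0 else 0)"
      unfolding e_def by (intro sum.cong refl) auto
    thus "(\<Sum>j<p. S k j * e k * e j) = (if k = i then (\<Sum>j<p. if j = i then S k j else 0) else 0)" by simp
  qed
  also have "\<dots> = S i i" using i by (simp add: sum.delta)
  finally have q: "qf p S e e = S i i" .
  have "(\<Sum>j<p. (e j)\<^sup>2) = (\<Sum>j<p. if j = i then 1 else 0)" unfolding e_def by (intro sum.cong) auto
  hence "(\<Sum>j<p. (e j)\<^sup>2) = 1" using i by (simp add: sum.delta)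
  thus "S i i \<le> C" "S i i \<ge> 0" using upper[of e] qf_S_nonneg[of e] q by simp_all
qed

text \<open>Given \<beta>, w is S \<beta> plus centred noise with coordinate variances
  \<open>S i i\<close>. A bound of order p is what controls the linear term of the
  objective.\<close>

lemma expected_w_sq:
  assumes upper: "\<And>x. qf p S x x \<le> C * (\<Sum>i<p. (x i)\<^sup>2)" and C: "C \<ge> 0"
  shows "(\<integral>\<^sup>+\<omega>. ennreal (\<Sum>i<p. (w (fst \<omega>) i)\<^sup>2) \<partial>J) \<le> ennreal (2 * (C\<^sup>2 + C) * real p)"
proof -
  have mF: "(\<lambda>z. ennreal (\<Sum>i<p. (w (fst z) i)\<^sup>2)) \<in> borel_measurable (rspace n \<Otimes>\<^sub>M rspace p)"
    by (intro measurable_compose[OF _ measurable_ennreal] borel_measurable_sum borel_measurable_power measurable_compose[OF measurable_fst m_w])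
  have wo: "w (fst (obs (\<epsilon>, \<beta>))) i = (\<Sum>j<p. S i j * \<beta> j) + (\<Sum>k<n. X $$ (k, i) / \<sigma>\<^sup>2 * \<epsilon> k)" for \<epsilon> \<beta> i
  proof -
    have "(\<Sum>k<n. X $$ (k, i) * fit \<beta> k) = (\<Sum>j<p. \<Sum>k<n. X $$ (k, i) * X $$ (k, j) * \<beta> j)"
      unfolding fit_def sum_distrib_left by (subst sum.swap) (simp add: mult.assoc)
    thus ?thesis unfolding w_def S_def obs_def
      by (simp add: distrib_left sum.distrib add_divide_distrib sum_distrib_right sum_divide_distrib)
  qed
  have me: "(\<lambda>\<epsilon>. ennreal ((\<Sum>k<n. X $$ (k, i) / \<sigma>\<^sup>2 * \<epsilon> k)\<^sup>2)) \<in> borel_measurable noise" for i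
    by (rule m_noise) measurable
  have eS: "\<sigma>\<^sup>2 * (\<Sum>k<n. (X $$ (k, i) / \<sigma>\<^sup>2)\<^sup>2) = S i i" for i
    using \<sigma> by (simp add: S_def power_divide sum_divide_distrib[symmetric] power2_eq_square)
  have "(\<integral>\<^sup>+\<omega>. ennreal (\<Sum>i<p. (w (fst \<omega>) i)\<^sup>2) \<partial>J) = (\<integral>\<^sup>+\<beta>. (\<integral>\<^sup>+\<epsilon>. ennreal (\<Sum>i<p. (w (fst (obs (\<epsilon>, \<beta>))) i)\<^sup>2) \<partial>noise) \<partial>prior)"
    by (rule nn_integral_J_prior[OF mF])
  also have "\<dots> \<le> (\<integral>\<^sup>+\<beta>. ennreal (2 * (C\<^sup>2 + C) * real p) \<partial>prior)"
  proof (rule nn_integral_mono_AE)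
    show "AE \<beta> in prior. (\<integral>\<^sup>+\<epsilon>. ennreal (\<Sum>i<p. (w (fst (obs (\<epsilon>, \<beta>))) i)\<^sup>2) \<partial>noise) \<le> ennreal (2 * (C\<^sup>2 + C) * real p)"
      using AE_prior
    proof eventually_elim
      case (elim \<beta>)
      have bs: "(\<Sum>i<p. (\<beta> i)\<^sup>2) \<le> real p"
        using sum_mono[of "{..<p}" "\<lambda>i. (\<beta> i)\<^sup>2" "\<lambda>_. 1"] elim by (simp add: abs_square_le_1)
      have "(\<integral>\<^sup>+\<epsilon>. ennreal (\<Sum>i<p. (w (fst (obs (\<epsilon>, \<beta>))) i)\<^sup>2) \<partial>noise)
         \<le> (\<integral>\<^sup>+\<epsilon>. ennreal (2 * C\<^sup>2 * real p) + (\<Sum>i<p. 2 * ennreal ((\<Sum>k<n. X $$ (k, i) / \<sigma>\<^sup>2 * \<epsilon> k)\<^sup>2)) \<partial>noise)"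
      proof (rule nn_integral_mono)
        fix \<epsilon> :: "nat \<Rightarrow> real"
        let ?e = "\<lambda>i. \<Sum>k<n. X $$ (k, i) / \<sigma>\<^sup>2 * \<epsilon> k"
        have "(\<Sum>i<p. (w (fst (obs (\<epsilon>, \<beta>))) i)\<^sup>2) \<le> (\<Sum>i<p. 2 * (\<Sum>j<p. S i j * \<beta> j)\<^sup>2 + 2 * (?e i)\<^sup>2)"
        proof (rule sum_mono)
          fix i
          have "(x + y)\<^sup>2 \<le> 2 * x\<^sup>2 + 2 * y\<^sup>2" for x y :: real
            using sum_squares_bound[of x y] by (simp add: power2_eq_square algebra_simps)
          thus "(w (fst (obs (\<epsilon>, \<beta>))) i)\<^sup>2 \<le> 2 * (\<Sum>j<p. S i j * \<beta> j)\<^sup>2 + 2 * (?e i)\<^sup>2" unfolding wo .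
        qed
        also have "\<dots> = 2 * (\<Sum>i<p. (\<Sum>j<p. S i j * \<beta> j)\<^sup>2) + (\<Sum>i<p. 2 * (?e i)\<^sup>2)"
          by (simp add: sum.distrib sum_distrib_left)
        also have "(\<Sum>i<p. (\<Sum>j<p. S i j * \<beta> j)\<^sup>2) \<le> C\<^sup>2 * real p"
          using row_sq_bound[OF upper C, of \<beta>] mult_left_mono[OF bs, of "C\<^sup>2"] by simp
        finally have "(\<Sum>i<p. (w (fst (obs (\<epsilon>, \<beta>))) i)\<^sup>2) \<le> 2 * C\<^sup>2 * real p + (\<Sum>i<p. 2 * (?e i)\<^sup>2)" by simp
        hence "ennreal (\<Sum>i<p. (w (fst (obs (\<epsilon>, \<beta>))) i)\<^sup>2) \<le> ennreal (2 * C\<^sup>2 * real p + (\<Sum>i<p. 2 * (?e i)\<^sup>2))"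
          by (rule ennreal_leI)
        also have "\<dots> = ennreal (2 * C\<^sup>2 * real p) + (\<Sum>i<p. 2 * ennreal ((?e i)\<^sup>2))"
          by (simp add: sum_nonneg ennreal_plus sum_ennreal[symmetric] ennreal_mult' del: sum_ennreal)
        finally show "ennreal (\<Sum>i<p. (w (fst (obs (\<epsilon>, \<beta>))) i)\<^sup>2) \<le> ennreal (2 * C\<^sup>2 * real p) + (\<Sum>i<p. 2 * ennreal ((?e i)\<^sup>2))" .
      qed
      also have "\<dots> = ennreal (2 * C\<^sup>2 * real p) + (\<Sum>i<p. 2 * ennreal (S i i))"
      proof -
        have "(\<integral>\<^sup>+\<epsilon>. (\<Sum>i<p. 2 * ennreal ((\<Sum>k<n. X $$ (k, i) / \<sigma>\<^sup>2 * \<epsilon> k)\<^sup>2)) \<partial>noise) = (\<Sum>i<p. 2 * ennreal (S i i))"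
        proof -
          have "(\<integral>\<^sup>+\<epsilon>. (\<Sum>i<p. 2 * ennreal ((\<Sum>k<n. X $$ (k, i) / \<sigma>\<^sup>2 * \<epsilon> k)\<^sup>2)) \<partial>noise)
             = (\<Sum>i<p. \<integral>\<^sup>+\<epsilon>. 2 * ennreal ((\<Sum>k<n. X $$ (k, i) / \<sigma>\<^sup>2 * \<epsilon> k)\<^sup>2) \<partial>noise)"
            by (rule nn_integral_sum) (use me in simp)
          also have "\<dots> = (\<Sum>i<p. 2 * (\<integral>\<^sup>+\<epsilon>. ennreal ((\<Sum>k<n. X $$ (k, i) / \<sigma>\<^sup>2 * \<epsilon> k)\<^sup>2) \<partial>noise))"
            by (intro sum.cong refl nn_integral_cmult me)
          finally show ?thesis by (simp only: noise_quadratic eS)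
        qed
        thus ?thesis using me by (subst nn_integral_add) (auto simp: noise.emeasure_space_1)
      qed
      also have "\<dots> \<le> ennreal (2 * C\<^sup>2 * real p) + (\<Sum>i<p. 2 * ennreal C)"
        by (intro add_left_mono sum_mono mult_left_mono ennreal_leI S_diag_bound(1)[OF upper]) auto
      also have "\<dots> = ennreal (2 * (C\<^sup>2 + C) * real p)"
      proof -
        have "(\<Sum>i<p. 2 * ennreal C) = ennreal (2 * C * real p)"
          using C by (simp add: ennreal_mult' ennreal_of_nat_eq_real_of_nat mult.commute mult.left_commute)
        thus ?thesis using C by (simp add: ennreal_plus[symmetric] algebra_simps del: ennreal_plus)
      qed
      finally show ?case .
    qed
  qed
  also have "\<dots> = ennreal (2 * (C\<^sup>2 + C) * real p)" by (simp add: prior.emeasure_space_1)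
  finally show ?thesis .
qed

section \<open>Relative entropy to product measures\<close>

abbreviation tm :: "(nat \<Rightarrow> real) \<Rightarrow> nat \<Rightarrow> real" where
  "tm \<tau> i \<equiv> tmean \<mu> (\<tau> i) (S i i)"

definition ptilt :: "(nat \<Rightarrow> real) \<Rightarrow> (nat \<Rightarrow> real) measure" where
  "ptilt \<tau> = PiM {..<p} (\<lambda>i. tilt \<mu> (\<tau> i) (S i i))"

text \<open>The log-density of \<open>gibbs v\<close> against \<open>ptilt \<tau>\<close>, in a
  clipped form that is bounded everywhere.\<close>

definition lphi :: "(nat \<Rightarrow> real) \<Rightarrow> (nat \<Rightarrow> real) \<Rightarrow> (nat \<Rightarrow> real) \<Rightarrow> real" where
  "lphi v \<tau> \<beta> = - (1 / 2) * qf p A (clip \<beta>) (clip \<beta>) + (\<Sum>i<p. (v i - \<tau> i) * clip \<beta> i)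
     + ((\<Sum>i<p. cgf \<mu> (\<tau> i) (S i i)) - ln (Z v))"

text \<open>The log partition function relative to the product of the tilts with parameter 0, which
  are the reference laws of the divergences in the objective.\<close>

definition logZ :: "(nat \<Rightarrow> real) \<Rightarrow> real" where
  "logZ v = ln (Z v) - (\<Sum>i<p. cgf \<mu> 0 (S i i))"

text \<open>The mean field objective in terms of tilting parameters instead of means;
  \<open>quad_rates_eq_mfo\<close> translates.\<close>

definition mfo :: "(nat \<Rightarrow> real) \<Rightarrow> (nat \<Rightarrow> real) \<Rightarrow> real" where
  "mfo v \<tau> = - (1 / 2) * qf p A (tm \<tau>) (tm \<tau>) + (\<Sum>i<p. v i * tm \<tau> i) - (\<Sum>i<p. rate \<mu> (\<tau> i) (S i i))"

lemma qf_S_eq: "qf p S x x = qf p A x x + (\<Sum>i<p. S i i * (x i)\<^sup>2)"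
proof -
  have "qf p S x x = (\<Sum>i<p. \<Sum>j<p. A i j * x i * x j + (if i = j then S i i * (x i)\<^sup>2 else 0))"
    unfolding qf_def A_def by (intro sum.cong refl) (auto simp: power2_eq_square)
  thus ?thesis by (simp add: sum.distrib qf_def)
qed

lemma ul_tilt: "unit_law (tilt \<mu> \<gamma> d)" by (rule \<mu>.unit_law_tilt)

lemma prob_tilt: "prob_space (tilt \<mu> \<gamma> d)"
  using ul_tilt by (simp add: unit_law_def)

lemma prob_ptilt: "prob_space (ptilt \<tau>)"
  unfolding ptilt_def by (rule prob_space_PiM) (rule prob_tilt)

lemma sets_ptilt: "sets (ptilt \<tau>) = sets (rspace p)"
  unfolding ptilt_def by (rule sets_PiM_rspace) (rule unit_law.sets_eq[OF ul_tilt])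

lemma m_ptilt: "f \<in> borel_measurable (rspace p) \<Longrightarrow> f \<in> borel_measurable (ptilt \<tau>)"
  by (simp add: measurable_cong_sets[OF sets_ptilt refl])

lemma ptilt_density:
  "ptilt \<tau> = density prior (\<lambda>\<beta>. ennreal (exp (\<Sum>i<p. expo (\<tau> i) (S i i) (\<beta> i) - cgf \<mu> (\<tau> i) (S i i))))"
proof -
  have "ptilt \<tau> = density prior (\<lambda>\<beta>. \<Prod>i<p. ennreal (exp (expo (\<tau> i) (S i i) (\<beta> i) - cgf \<mu> (\<tau> i) (S i i))))"
    unfolding ptilt_def tilt_def
    by (rule PiM_density) (use prob_tilt[unfolded tilt_def] \<mu>.prob_space_axioms in auto)
  also have "(\<lambda>\<beta>. \<Prod>i<p. ennreal (exp (expo (\<tau> i) (S i i) (\<beta> i) - cgf \<mu> (\<tau> i) (S i i))))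
     = (\<lambda>\<beta>. ennreal (exp (\<Sum>i<p. expo (\<tau> i) (S i i) (\<beta> i) - cgf \<mu> (\<tau> i) (S i i))))"
    by (simp add: prod_ennreal exp_sum)
  finally show ?thesis .
qed

lemma m_lphi: "lphi v \<tau> \<in> borel_measurable (rspace p)"
  unfolding lphi_def qf_def by measurable

lemma lphi_bound: "\<exists>B. \<forall>\<beta>. \<bar>lphi v \<tau> \<beta>\<bar> \<le> B"
proof (intro exI allI)
  fix \<beta>
  let ?c = "(\<Sum>i<p. cgf \<mu> (\<tau> i) (S i i)) - ln (Z v)"
  have "\<bar>qf p A (clip \<beta>) (clip \<beta>)\<bar> \<le> (\<Sum>i<p. \<Sum>j<p. \<bar>A i j\<bar>)"
    unfolding qf_def
  proof (intro order_trans[OF sum_abs] sum_mono)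
    fix i j
    have "\<bar>clip \<beta> i\<bar> * \<bar>clip \<beta> j\<bar> \<le> 1" using clip_bound by (simp add: mult_le_one)
    thus "\<bar>A i j * clip \<beta> i * clip \<beta> j\<bar> \<le> \<bar>A i j\<bar>" by (simp add: abs_mult mult.assoc mult_left_le)
  qed
  moreover have "\<bar>\<Sum>i<p. (v i - \<tau> i) * clip \<beta> i\<bar> \<le> (\<Sum>i<p. \<bar>v i - \<tau> i\<bar>)"
    by (intro order_trans[OF sum_abs] sum_mono) (simp add: abs_mult mult_left_le clip_bound)
  ultimately show "\<bar>lphi v \<tau> \<beta>\<bar> \<le> (\<Sum>i<p. \<Sum>j<p. \<bar>A i j\<bar>) + (\<Sum>i<p. \<bar>v i - \<tau> i\<bar>) + \<bar>?c\<bar>"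
    unfolding lphi_def by linarith
qed

lemma gibbs_eq_density_ptilt: "gibbs v = density (ptilt \<tau>) (\<lambda>\<beta>. ennreal (exp (lphi v \<tau> \<beta>)))"
proof -
  let ?\<pi> = "\<lambda>\<beta>. \<Sum>i<p. expo (\<tau> i) (S i i) (\<beta> i) - cgf \<mu> (\<tau> i) (S i i)"
  have m\<pi>: "?\<pi> \<in> borel_measurable (rspace p)" by measurable
  have m1: "(\<lambda>\<beta>. ennreal (exp (?\<pi> \<beta>))) \<in> borel_measurable prior"
    by (rule m_prior) (use m\<pi> in measurable)
  have m2: "(\<lambda>\<beta>. ennreal (exp (lphi v \<tau> \<beta>))) \<in> borel_measurable prior"
    by (rule m_prior) (use m_lphi in measurable)
  have "density (ptilt \<tau>) (\<lambda>\<beta>. ennreal (exp (lphi v \<tau> \<beta>)))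
     = density prior (\<lambda>\<beta>. ennreal (exp (?\<pi> \<beta>)) * ennreal (exp (lphi v \<tau> \<beta>)))"
    unfolding ptilt_density by (rule density_density_eq[OF m1 m2])
  also have "\<dots> = gibbs v" unfolding gibbs_def
  proof (rule density_cong)
    show "(\<lambda>\<beta>. ennreal (exp (?\<pi> \<beta>)) * ennreal (exp (lphi v \<tau> \<beta>))) \<in> borel_measurable prior"
      using m1 m2 by measurable
    show "(\<lambda>\<beta>. ennreal (exp (ham v (clip \<beta>)) / Z v)) \<in> borel_measurable prior"
      by (rule measurable_compose[OF m_prior[OF m_gibbs_density] measurable_ennreal])
    show "AE \<beta> in prior. ennreal (exp (?\<pi> \<beta>)) * ennreal (exp (lphi v \<tau> \<beta>)) = ennreal (exp (ham v (clip \<beta>)) / Z v)"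
      using AE_prior
    proof eventually_elim
      case (elim \<beta>)
      have e: "(\<Sum>i<p. f (clip \<beta> i) i) = (\<Sum>i<p. f (\<beta> i) i)" for f :: "real \<Rightarrow> nat \<Rightarrow> real"
        using elim by (intro sum.cong) (auto simp: clip_eq)
      have qA: "qf p A (clip \<beta>) (clip \<beta>) = qf p A \<beta> \<beta>" by (rule qf_cong) (use elim in \<open>auto simp: clip_eq\<close>)
      have "?\<pi> \<beta> = (\<Sum>i<p. \<tau> i * \<beta> i) - (\<Sum>i<p. S i i * (\<beta> i)\<^sup>2) / 2 - (\<Sum>i<p. cgf \<mu> (\<tau> i) (S i i))"
        by (simp add: sum_subtractf sum_divide_distrib)
      hence "?\<pi> \<beta> + lphi v \<tau> \<beta> = ham v \<beta> - ln (Z v)"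
        unfolding lphi_def ham_def qA qf_S_eq using e[of "\<lambda>x i. (v i - \<tau> i) * x"]
        by (simp add: left_diff_distrib sum_subtractf add_divide_distrib)
      hence "exp (?\<pi> \<beta>) * exp (lphi v \<tau> \<beta>) = exp (ham v (clip \<beta>)) / Z v"
        using ham_clip[OF elim] Z_pos[of v] by (simp add: exp_add[symmetric] exp_diff)
      thus ?case by (simp add: ennreal_mult'[symmetric])
    qed
  qed
  finally show ?thesis ..
qed

lemma integral_lphi_gibbs:
  "(\<integral>\<beta>. lphi v \<tau> \<beta> \<partial>gibbs v) = - (1 / 2) * (\<Sum>i<p. \<Sum>j<p. A i j * (\<integral>\<beta>. \<beta> i * \<beta> j \<partial>gibbs v))
     + (\<Sum>i<p. (v i - \<tau> i) * pmean v i) + ((\<Sum>i<p. cgf \<mu> (\<tau> i) (S i i)) - ln (Z v))"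
proof -
  interpret G: prob_space "gibbs v" by (rule prob_gibbs)
  have "(\<integral>\<beta>. lphi v \<tau> \<beta> \<partial>gibbs v)
     = (\<integral>\<beta>. - (1 / 2) * (\<Sum>i<p. \<Sum>j<p. A i j * (\<beta> i * \<beta> j)) + (\<Sum>i<p. (v i - \<tau> i) * \<beta> i)
         + ((\<Sum>i<p. cgf \<mu> (\<tau> i) (S i i)) - ln (Z v)) \<partial>gibbs v)"
  proof (rule integral_cong_AE)
    show "AE \<beta> in gibbs v. lphi v \<tau> \<beta> = - (1 / 2) * (\<Sum>i<p. \<Sum>j<p. A i j * (\<beta> i * \<beta> j)) + (\<Sum>i<p. (v i - \<tau> i) * \<beta> i)
         + ((\<Sum>i<p. cgf \<mu> (\<tau> i) (S i i)) - ln (Z v))"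
      using AE_gibbs
    proof eventually_elim
      case (elim \<beta>)
      have "qf p A (clip \<beta>) (clip \<beta>) = qf p A \<beta> \<beta>" by (rule qf_cong) (use elim in \<open>auto simp: clip_eq\<close>)
      moreover have "(\<Sum>i<p. (v i - \<tau> i) * clip \<beta> i) = (\<Sum>i<p. (v i - \<tau> i) * \<beta> i)"
        using elim by (intro sum.cong) (auto simp: clip_eq)
      ultimately show ?case by (simp add: lphi_def qf_def mult.assoc)
    qed
    show "lphi v \<tau> \<in> borel_measurable (gibbs v)" by (rule m_gibbs[OF m_lphi])
    show "(\<lambda>\<beta>. - (1 / 2) * (\<Sum>i<p. \<Sum>j<p. A i j * (\<beta> i * \<beta> j)) + (\<Sum>i<p. (v i - \<tau> i) * \<beta> i)
         + ((\<Sum>i<p. cgf \<mu> (\<tau> i) (S i i)) - ln (Z v))) \<in> borel_measurable (gibbs v)"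
      by (rule m_gibbs) measurable
  qed
  also have "\<dots> = - (1 / 2) * (\<integral>\<beta>. (\<Sum>i<p. \<Sum>j<p. A i j * (\<beta> i * \<beta> j)) \<partial>gibbs v)
     + (\<integral>\<beta>. (\<Sum>i<p. (v i - \<tau> i) * \<beta> i) \<partial>gibbs v) + ((\<Sum>i<p. cgf \<mu> (\<tau> i) (S i i)) - ln (Z v))"
  proof -
    have i1: "integrable (gibbs v) (\<lambda>\<beta>. \<Sum>i<p. \<Sum>j<p. A i j * (\<beta> i * \<beta> j))"
      by (intro Bochner_Integration.integrable_sum integrable_mult_right integrable_coord2) auto
    have i2: "integrable (gibbs v) (\<lambda>\<beta>. \<Sum>i<p. (v i - \<tau> i) * \<beta> i)"
      by (intro Bochner_Integration.integrable_sum integrable_mult_right integrable_coord) auto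
    show ?thesis
      by (subst Bochner_Integration.integral_add) (use i1 i2 in \<open>auto simp: G.prob_space\<close>)
  qed
  also have "(\<integral>\<beta>. (\<Sum>i<p. \<Sum>j<p. A i j * (\<beta> i * \<beta> j)) \<partial>gibbs v) = (\<Sum>i<p. \<integral>\<beta>. (\<Sum>j<p. A i j * (\<beta> i * \<beta> j)) \<partial>gibbs v)"
    by (intro Bochner_Integration.integral_sum Bochner_Integration.integrable_sum integrable_mult_right integrable_coord2) auto
  also have "\<dots> = (\<Sum>i<p. \<Sum>j<p. \<integral>\<beta>. A i j * (\<beta> i * \<beta> j) \<partial>gibbs v)"
    by (intro sum.cong refl Bochner_Integration.integral_sum integrable_mult_right integrable_coord2) auto
  also have "(\<integral>\<beta>. (\<Sum>i<p. (v i - \<tau> i) * \<beta> i) \<partial>gibbs v) = (\<Sum>i<p. \<integral>\<beta>. (v i - \<tau> i) * \<beta> i \<partial>gibbs v)"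
    by (intro Bochner_Integration.integral_sum integrable_mult_right integrable_coord) auto
  finally show ?thesis unfolding pmean_def by simp
qed

lemma AE_ptilt: "AE \<beta> in ptilt \<tau>. \<forall>i<p. \<bar>\<beta> i\<bar> \<le> 1"
proof -
  have "AE \<beta> in ptilt \<tau>. \<bar>\<beta> i\<bar> \<le> 1" if "i < p" for i
    unfolding ptilt_def
    using AE_PiM_component[of "{..<p}" "\<lambda>i. tilt \<mu> (\<tau> i) (S i i)" i "\<lambda>x. \<bar>x\<bar> \<le> 1"] prob_tilt unit_law.bounded[OF ul_tilt] that by simp
  hence "AE \<beta> in ptilt \<tau>. \<forall>i\<in>{..<p}. \<bar>\<beta> i\<bar> \<le> 1" by (subst AE_finite_all) auto
  thus ?thesis by (rule eventually_mono) auto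
qed

lemma integrable_ptilt:
  assumes "(f :: _ \<Rightarrow> real) \<in> borel_measurable (rspace p)" "\<And>\<beta>. \<forall>i<p. \<bar>\<beta> i\<bar> \<le> 1 \<Longrightarrow> \<bar>f \<beta>\<bar> \<le> B"
  shows "integrable (ptilt \<tau>) f"
proof -
  interpret P: prob_space "ptilt \<tau>" by (rule prob_ptilt)
  show ?thesis
  proof (rule P.integrable_const_bound[where B = B])
    show "AE \<beta> in ptilt \<tau>. norm (f \<beta>) \<le> B" using AE_ptilt by eventually_elim (use assms in simp)
  qed (rule m_ptilt[OF assms(1)])
qed

lemma integral_ptilt_coord:
  assumes i: "i < p" shows "(\<integral>\<beta>. \<beta> i \<partial>ptilt \<tau>) = tm \<tau> i"
proof -
  have "distr (ptilt \<tau>) (tilt \<mu> (\<tau> i) (S i i)) (\<lambda>\<beta>. \<beta> i) = tilt \<mu> (\<tau> i) (S i i)"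
    unfolding ptilt_def by (rule distr_PiM_component) (use i prob_tilt in auto)
  hence "tm \<tau> i = (\<integral>x. x \<partial>distr (ptilt \<tau>) (tilt \<mu> (\<tau> i) (S i i)) (\<lambda>\<beta>. \<beta> i))" by (simp add: tmean_def)
  also have "\<dots> = (\<integral>\<beta>. \<beta> i \<partial>ptilt \<tau>)"
  proof (rule integral_distr)
    show "(\<lambda>\<beta>. \<beta> i) \<in> ptilt \<tau> \<rightarrow>\<^sub>M tilt \<mu> (\<tau> i) (S i i)"
      unfolding ptilt_def by (rule measurable_component_singleton) (use i in simp)
    show "(\<lambda>x. x) \<in> borel_measurable (tilt \<mu> (\<tau> i) (S i i))"
      by (rule measurable_ident_sets) (rule unit_law.sets_eq[OF ul_tilt])
  qed
  finally show ?thesis ..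
qed

lemma integral_ptilt_coord2:
  assumes ij: "i < p" "j < p" "i \<noteq> j" shows "(\<integral>\<beta>. \<beta> i * \<beta> j \<partial>ptilt \<tau>) = tm \<tau> i * tm \<tau> j"
proof -
  let ?M = "\<lambda>i. tilt \<mu> (\<tau> i) (S i i)"
  interpret P: product_prob_space ?M "{..<p}" by (intro product_prob_spaceI prob_tilt)
  define f where "f k x = (if k = i \<or> k = j then x else 1 :: real)" for k x
  have f: "integrable (?M k) (f k)" for k
    unfolding f_def
    by (cases "k = i \<or> k = j") (auto intro!: unit_law.integrable_bdd[OF ul_tilt, where B = 1])
  have "(\<integral>\<beta>. (\<Prod>k<p. f k (\<beta> k)) \<partial>ptilt \<tau>) = (\<Prod>k<p. \<integral>x. f k x \<partial>?M k)"
    unfolding ptilt_def by (rule P.product_integral_prod) (use f in auto)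
  moreover have "(\<Prod>k<p. g k) = g i * g j" if g: "\<And>k. k \<noteq> i \<Longrightarrow> k \<noteq> j \<Longrightarrow> g k = 1" for g :: "nat \<Rightarrow> real"
  proof -
    have "(\<Prod>k<p. g k) = (\<Prod>k\<in>{i, j}. g k)" by (rule prod.mono_neutral_right) (use ij g in auto)
    thus ?thesis using ij by simp
  qed
  note pr = this
  have "(\<Prod>k<p. f k (\<beta> k)) = \<beta> i * \<beta> j" for \<beta> by (subst pr) (auto simp: f_def)
  moreover have "(\<Prod>k<p. \<integral>x. f k x \<partial>?M k) = tm \<tau> i * tm \<tau> j"
  proof (subst pr)
    fix k assume "k \<noteq> i" "k \<noteq> j"
    thus "(\<integral>x. f k x \<partial>?M k) = 1" using prob_space.prob_space[OF prob_tilt] by (simp add: f_def)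
  next
    have "f i = (\<lambda>x. x)" "f j = (\<lambda>x. x)" by (auto simp: f_def)
    thus "(\<integral>x. f i x \<partial>?M i) * (\<integral>x. f j x \<partial>?M j) = tm \<tau> i * tm \<tau> j" by (simp add: tmean_def)
  qed
  ultimately show ?thesis by simp
qed

lemma integral_lphi_ptilt:
  "(\<integral>\<beta>. lphi v \<tau> \<beta> \<partial>ptilt \<tau>) = - (1 / 2) * qf p A (tm \<tau>) (tm \<tau>)
     + (\<Sum>i<p. (v i - \<tau> i) * tm \<tau> i) + ((\<Sum>i<p. cgf \<mu> (\<tau> i) (S i i)) - ln (Z v))"
proof -
  interpret P: prob_space "ptilt \<tau>" by (rule prob_ptilt)
  have ic: "integrable (ptilt \<tau>) (\<lambda>\<beta>. \<beta> i)" if "i < p" for i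
    by (rule integrable_ptilt[where B = 1]) (use that in auto)
  have ic2: "integrable (ptilt \<tau>) (\<lambda>\<beta>. \<beta> i * \<beta> j)" if "i < p" "j < p" for i j
    by (rule integrable_ptilt[where B = 1]) (use that in \<open>auto simp: abs_mult mult_le_one\<close>)
  have "(\<integral>\<beta>. lphi v \<tau> \<beta> \<partial>ptilt \<tau>)
     = (\<integral>\<beta>. - (1 / 2) * (\<Sum>i<p. \<Sum>j<p. A i j * (\<beta> i * \<beta> j)) + (\<Sum>i<p. (v i - \<tau> i) * \<beta> i)
         + ((\<Sum>i<p. cgf \<mu> (\<tau> i) (S i i)) - ln (Z v)) \<partial>ptilt \<tau>)"
  proof (rule integral_cong_AE)
    show "AE \<beta> in ptilt \<tau>. lphi v \<tau> \<beta> = - (1 / 2) * (\<Sum>i<p. \<Sum>j<p. A i j * (\<beta> i * \<beta> j)) + (\<Sum>i<p. (v i - \<tau> i) * \<beta> i)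
         + ((\<Sum>i<p. cgf \<mu> (\<tau> i) (S i i)) - ln (Z v))"
      using AE_ptilt
    proof eventually_elim
      case (elim \<beta>)
      have "qf p A (clip \<beta>) (clip \<beta>) = qf p A \<beta> \<beta>" by (rule qf_cong) (use elim in \<open>auto simp: clip_eq\<close>)
      moreover have "(\<Sum>i<p. (v i - \<tau> i) * clip \<beta> i) = (\<Sum>i<p. (v i - \<tau> i) * \<beta> i)"
        using elim by (intro sum.cong) (auto simp: clip_eq)
      ultimately show ?case by (simp add: lphi_def qf_def mult.assoc)
    qed
    show "lphi v \<tau> \<in> borel_measurable (ptilt \<tau>)" by (rule m_ptilt[OF m_lphi])
    show "(\<lambda>\<beta>. - (1 / 2) * (\<Sum>i<p. \<Sum>j<p. A i j * (\<beta> i * \<beta> j)) + (\<Sum>i<p. (v i - \<tau> i) * \<beta> i)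
         + ((\<Sum>i<p. cgf \<mu> (\<tau> i) (S i i)) - ln (Z v))) \<in> borel_measurable (ptilt \<tau>)"
      by (rule m_ptilt) measurable
  qed
  also have "\<dots> = - (1 / 2) * (\<integral>\<beta>. (\<Sum>i<p. \<Sum>j<p. A i j * (\<beta> i * \<beta> j)) \<partial>ptilt \<tau>)
     + (\<integral>\<beta>. (\<Sum>i<p. (v i - \<tau> i) * \<beta> i) \<partial>ptilt \<tau>) + ((\<Sum>i<p. cgf \<mu> (\<tau> i) (S i i)) - ln (Z v))"
  proof -
    have i1: "integrable (ptilt \<tau>) (\<lambda>\<beta>. \<Sum>i<p. \<Sum>j<p. A i j * (\<beta> i * \<beta> j))"
      by (intro Bochner_Integration.integrable_sum integrable_mult_right ic2) auto
    have i2: "integrable (ptilt \<tau>) (\<lambda>\<beta>. \<Sum>i<p. (v i - \<tau> i) * \<beta> i)"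
      by (intro Bochner_Integration.integrable_sum integrable_mult_right ic) auto
    show ?thesis
      by (subst Bochner_Integration.integral_add) (use i1 i2 in \<open>auto simp: P.prob_space\<close>)
  qed
  also have "(\<integral>\<beta>. (\<Sum>i<p. \<Sum>j<p. A i j * (\<beta> i * \<beta> j)) \<partial>ptilt \<tau>) = (\<Sum>i<p. \<integral>\<beta>. (\<Sum>j<p. A i j * (\<beta> i * \<beta> j)) \<partial>ptilt \<tau>)"
    by (intro Bochner_Integration.integral_sum Bochner_Integration.integrable_sum integrable_mult_right ic2) auto
  also have "\<dots> = (\<Sum>i<p. \<Sum>j<p. \<integral>\<beta>. A i j * (\<beta> i * \<beta> j) \<partial>ptilt \<tau>)"
    by (intro sum.cong refl Bochner_Integration.integral_sum integrable_mult_right ic2) auto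
  also have "\<dots> = qf p A (tm \<tau>) (tm \<tau>)"
    unfolding qf_def
  proof (intro sum.cong refl)
    fix i j assume "i \<in> {..<p}" "j \<in> {..<p}"
    \<comment> \<open>On the diagonal both sides vanish with A; off it the coordinates are
      independent.\<close>
    thus "(\<integral>\<beta>. A i j * (\<beta> i * \<beta> j) \<partial>ptilt \<tau>) = A i j * tm \<tau> i * tm \<tau> j"
      by (cases "i = j") (simp add: A_def, simp add: integral_ptilt_coord2 mult.assoc)
  qed
  also have "(\<integral>\<beta>. (\<Sum>i<p. (v i - \<tau> i) * \<beta> i) \<partial>ptilt \<tau>) = (\<Sum>i<p. \<integral>\<beta>. (v i - \<tau> i) * \<beta> i \<partial>ptilt \<tau>)"
    by (intro Bochner_Integration.integral_sum integrable_mult_right ic) auto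
  also have "\<dots> = (\<Sum>i<p. (v i - \<tau> i) * tm \<tau> i)" by (intro sum.cong refl) (simp add: integral_ptilt_coord)
  finally show ?thesis .
qed

lemma mfo_alt: "mfo v \<tau> - logZ v = (\<integral>\<beta>. lphi v \<tau> \<beta> \<partial>ptilt \<tau>)"
  unfolding integral_lphi_ptilt mfo_def logZ_def rate_def
  by (simp add: left_diff_distrib sum_subtractf sum.distrib)

lemma integrable_exp_lphi: "integrable (ptilt \<tau>) (\<lambda>\<beta>. exp (lphi v \<tau> \<beta>))"
  and integrable_lphi: "integrable (ptilt \<tau>) (lphi v \<tau>)"
  and integrable_ent_lphi: "integrable (ptilt \<tau>) (\<lambda>\<beta>. exp (lphi v \<tau> \<beta>) * ln (exp (lphi v \<tau> \<beta>)))"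
proof -
  obtain B where B: "\<And>\<beta>. \<bar>lphi v \<tau> \<beta>\<bar> \<le> B" using lphi_bound by blast
  have e: "exp (lphi v \<tau> \<beta>) \<le> exp B" for \<beta> using B[of \<beta>] by simp
  show "integrable (ptilt \<tau>) (lphi v \<tau>)" by (rule integrable_ptilt[OF m_lphi B])
  show "integrable (ptilt \<tau>) (\<lambda>\<beta>. exp (lphi v \<tau> \<beta>))"
    by (rule integrable_ptilt[where B = "exp B"]) (use m_lphi e in auto)
  show "integrable (ptilt \<tau>) (\<lambda>\<beta>. exp (lphi v \<tau> \<beta>) * ln (exp (lphi v \<tau> \<beta>)))"
  proof (rule integrable_ptilt[where B = "exp B * B"])
    show "(\<lambda>\<beta>. exp (lphi v \<tau> \<beta>) * ln (exp (lphi v \<tau> \<beta>))) \<in> borel_measurable (rspace p)" using m_lphi by simp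
    show "\<bar>exp (lphi v \<tau> \<beta>) * ln (exp (lphi v \<tau> \<beta>))\<bar> \<le> exp B * B" for \<beta>
      unfolding abs_mult using B[of \<beta>] e[of \<beta>] by (intro mult_mono) auto
  qed
qed

lemma integral_exp_lphi: "(\<integral>\<beta>. exp (lphi v \<tau> \<beta>) \<partial>ptilt \<tau>) = 1"
proof -
  have m: "(\<lambda>\<beta>. ennreal (exp (lphi v \<tau> \<beta>))) \<in> borel_measurable (ptilt \<tau>)"
    by (rule m_ptilt) (use m_lphi in measurable)
  have "emeasure (gibbs v) (space (gibbs v)) = (\<integral>\<^sup>+\<beta>. ennreal (exp (lphi v \<tau> \<beta>)) \<partial>ptilt \<tau>)"
    unfolding gibbs_eq_density_ptilt[of v \<tau>] by (subst emeasure_density[OF m]) auto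
  also have "\<dots> = ennreal (\<integral>\<beta>. exp (lphi v \<tau> \<beta>) \<partial>ptilt \<tau>)"
    by (rule nn_integral_eq_integral[OF integrable_exp_lphi]) simp
  finally have "ennreal (\<integral>\<beta>. exp (lphi v \<tau> \<beta>) \<partial>ptilt \<tau>) = 1"
    using prob_space.emeasure_space_1[OF prob_gibbs] by simp
  thus ?thesis by simp
qed

text \<open>Gibbs variational principle: \<open>t \<le> exp t - 1\<close> applied to the
  log-density, whose exponential integrates to 1.\<close>

lemma mfo_le_logZ: "mfo v \<tau> \<le> logZ v"
proof -
  interpret P: prob_space "ptilt \<tau>" by (rule prob_ptilt)
  have "(\<integral>\<beta>. lphi v \<tau> \<beta> \<partial>ptilt \<tau>) \<le> (\<integral>\<beta>. exp (lphi v \<tau> \<beta>) - 1 \<partial>ptilt \<tau>)"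
    using integrable_lphi integrable_exp_lphi
    by (intro integral_mono) (auto simp: le_diff_eq exp_ge_add_one_self add.commute)
  also have "\<dots> = 0" using integrable_exp_lphi by (simp add: integral_exp_lphi P.prob_space)
  finally show ?thesis using mfo_alt[of v \<tau>] by simp
qed

lemma entropy_eq: "(\<integral>\<beta>. exp (lphi v \<tau> \<beta>) * ln (exp (lphi v \<tau> \<beta>)) \<partial>ptilt \<tau>) = (\<integral>\<beta>. lphi v \<tau> \<beta> \<partial>gibbs v)"
proof -
  have "(\<integral>\<beta>. lphi v \<tau> \<beta> \<partial>gibbs v) = (\<integral>\<beta>. exp (lphi v \<tau> \<beta>) *\<^sub>R lphi v \<tau> \<beta> \<partial>ptilt \<tau>)"
    unfolding gibbs_eq_density_ptilt[of v \<tau>]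
    by (rule integral_density) (use m_ptilt[OF m_lphi] in auto)
  thus ?thesis by simp
qed

lemma KL_gibbs: "KL (gibbs v) (ptilt \<tau>) = (\<integral>\<beta>. lphi v \<tau> \<beta> \<partial>gibbs v)"
proof -
  interpret P: prob_space "ptilt \<tau>" by (rule prob_ptilt)
  have "KL (gibbs v) (ptilt \<tau>) = (\<integral>\<beta>. exp (lphi v \<tau> \<beta>) * log (exp 1) (exp (lphi v \<tau> \<beta>)) \<partial>ptilt \<tau>)"
    unfolding KL_def gibbs_eq_density_ptilt[of v \<tau>]
    by (rule P.KL_density) (use m_ptilt[OF m_lphi] in auto)
  also have "\<dots> = (\<integral>\<beta>. exp (lphi v \<tau> \<beta>) * ln (exp (lphi v \<tau> \<beta>)) \<partial>ptilt \<tau>)" by (simp add: log_def)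
  finally show ?thesis by (simp only: entropy_eq)
qed

lemma KL_gibbs_nonneg: "KL (gibbs v) (ptilt \<tau>) \<ge> 0"
proof -
  interpret P: prob_space "ptilt \<tau>" by (rule prob_ptilt)
  show ?thesis unfolding KL_gibbs entropy_eq[where v = v and \<tau> = \<tau>, symmetric]
    by (rule P.entropy_nonneg[OF integrable_exp_lphi integrable_ent_lphi _ integral_exp_lphi]) simp
qed

text \<open>The gap \<open>logZ v - mfo v \<tau>\<close> is the relative entropy of the product measure from the posterior.\<close>

lemma KL_gibbs_matched:
  assumes "\<And>i. i < p \<Longrightarrow> tm \<tau> i = pmean v i"
  shows "KL (gibbs v) (ptilt \<tau>) + (logZ v - mfo v \<tau>) = - trcov v / 2"
proof -
  \<comment> \<open>Matched means give every linear term the same value under the posterior and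
    under the product; together with the constants they drop out of the sum of the two
    divergences.\<close>
  have e: "(\<Sum>i<p. f i * pmean v i) = (\<Sum>i<p. f i * tm \<tau> i)" for f
    using assms by (intro sum.cong) auto
  have "trcov v = (\<Sum>i<p. \<Sum>j<p. A i j * (\<integral>\<beta>. \<beta> i * \<beta> j \<partial>gibbs v)) - (\<Sum>i<p. \<Sum>j<p. A i j * (pmean v i * pmean v j))"
    unfolding trcov_def pcov_def by (simp add: right_diff_distrib sum_subtractf)
  also have "(\<Sum>i<p. \<Sum>j<p. A i j * (pmean v i * pmean v j)) = qf p A (tm \<tau>) (tm \<tau>)"
    unfolding qf_def using assms by (intro sum.cong) (auto simp: mult.assoc)
  finally have t: "trcov v = (\<Sum>i<p. \<Sum>j<p. A i j * (\<integral>\<beta>. \<beta> i * \<beta> j \<partial>gibbs v)) - qf p A (tm \<tau>) (tm \<tau>)" .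
  have m: "logZ v - mfo v \<tau> = - (\<integral>\<beta>. lphi v \<tau> \<beta> \<partial>ptilt \<tau>)" using mfo_alt[of v \<tau>] by simp
  show ?thesis unfolding KL_gibbs m integral_lphi_gibbs integral_lphi_ptilt e t by simp
qed

text \<open>As for tilts: the posterior has the null sets of the prior, so a mean at an endpoint
  would make the prior a point mass. It ensures that \<open>hfun\<close> inverts at the posterior
  mean.\<close>

lemma pmean_in_interval:
  assumes nd: "\<not> degenerate \<mu>" and i: "i < p" shows "pmean v i \<in> supp_interval \<mu>"
proof -
  interpret G: prob_space "gibbs v" by (rule prob_gibbs)
  note ix = integrable_coord[OF i, of v]
  have mc: "(\<lambda>\<beta>. \<beta> i) \<in> borel_measurable (rspace p)" using i by simp
  have *: "(\<integral>\<beta>. s * (\<beta> i - c) \<partial>gibbs v) > 0" if ae: "AE x in \<mu>. s * (x - c) \<ge> 0" and s: "s \<noteq> 0" for s c :: real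
  proof (rule ccontr)
    assume n: "\<not> (\<integral>\<beta>. s * (\<beta> i - c) \<partial>gibbs v) > 0"
    have "AE \<beta> in prior. s * (\<beta> i - c) \<ge> 0"
      using AE_PiM_component[of "{..<p}" "\<lambda>_. \<mu>" i "\<lambda>x. s * (x - c) \<ge> 0"] \<mu>.prob_space_axioms ae i by simp
    hence ae': "AE \<beta> in gibbs v. s * (\<beta> i - c) \<ge> 0" using mc by (subst AE_gibbs_iff) auto
    have "(\<integral>\<beta>. s * (\<beta> i - c) \<partial>gibbs v) = 0" using integral_nonneg_AE[OF ae'] n by simp
    hence "AE \<beta> in gibbs v. s * (\<beta> i - c) = 0"
      by (subst (asm) integral_nonneg_eq_0_iff_AE) (use ae' ix in auto)
    hence "AE \<beta> in prior. s * (\<beta> i - c) = 0" using mc by (subst (asm) AE_gibbs_iff) auto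
    hence "AE x in distr prior \<mu> (\<lambda>\<beta>. \<beta> i). s * (x - c) = 0"
      using measurable_component_singleton[of i "{..<p}" "\<lambda>_. \<mu>"] i by (subst AE_distr_iff) auto
    moreover have "distr prior \<mu> (\<lambda>\<beta>. \<beta> i) = \<mu>" by (rule distr_PiM_component) (use i \<mu>.prob_space_axioms in auto)
    ultimately have "AE x in \<mu>. s * (x - c) = 0" by (simp only:)
    hence "AE x in \<mu>. x = c" by eventually_elim (use s in auto)
    thus False using nd \<mu>.degenerateI by blast
  qed
  have "AE x in \<mu>. 1 * (x - Inf (Supp \<mu>)) \<ge> 0" using \<mu>.AE_Supp_bounds by eventually_elim auto
  from *[OF this] have "Inf (Supp \<mu>) < pmean v i" using ix by (simp add: pmean_def G.prob_space)
  moreover have "AE x in \<mu>. -1 * (x - Sup (Supp \<mu>)) \<ge> 0" using \<mu>.AE_Supp_bounds by eventually_elim auto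
  from *[OF this] have "Sup (Supp \<mu>) > pmean v i" using ix by (simp add: pmean_def G.prob_space)
  ultimately show ?thesis by (simp add: supp_interval_def)
qed

lemma wasserstein1_gibbs:
  assumes Q': "\<And>i. unit_law (Q' i)" and s: "s > 0"
  shows "0 \<le> wasserstein1 p (gibbs v) (PiM {..<p} Q')"
    and "wasserstein1 p (gibbs v) (PiM {..<p} Q') \<le>
      2 * (KL (gibbs v) (ptilt \<tau>) / s + real p * s) + (\<Sum>i<p. qdist (tilt \<mu> (\<tau> i) (S i i)) (Q' i))"
proof -
  obtain B where B: "\<And>\<beta>. \<bar>lphi v \<tau> \<beta>\<bar> \<le> B" using lphi_bound by blast
  have b: "exp (- B) \<le> exp (lphi v \<tau> \<beta>) \<and> exp (lphi v \<tau> \<beta>) \<le> exp B" for \<beta>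
    using B[of \<beta>] by (auto simp: abs_le_iff)
  have m: "(\<lambda>\<beta>. exp (lphi v \<tau> \<beta>)) \<in> borel_measurable (rspace p)" using m_lphi by simp
  note W = wasserstein1_bounds[of "\<lambda>i. tilt \<mu> (\<tau> i) (S i i)" Q' s "\<lambda>\<beta>. exp (lphi v \<tau> \<beta>)" p "exp (- B)" "exp B" "gibbs v",
      OF ul_tilt Q' s m _ b integral_exp_lphi[where v = v and \<tau> = \<tau>, unfolded ptilt_def] gibbs_eq_density_ptilt[of v \<tau>, unfolded ptilt_def]]
  show "0 \<le> wasserstein1 p (gibbs v) (PiM {..<p} Q')" by (rule W(1)) simp
  have "wasserstein1 p (gibbs v) (PiM {..<p} Q') \<le>
      2 * ((\<integral>\<beta>. exp (lphi v \<tau> \<beta>) * ln (exp (lphi v \<tau> \<beta>)) \<partial>ptilt \<tau>) / s + real p * s) + (\<Sum>i<p. qdist (tilt \<mu> (\<tau> i) (S i i)) (Q' i))"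
    unfolding ptilt_def by (rule W(2)) simp
  thus "wasserstein1 p (gibbs v) (PiM {..<p} Q') \<le>
      2 * (KL (gibbs v) (ptilt \<tau>) / s + real p * s) + (\<Sum>i<p. qdist (tilt \<mu> (\<tau> i) (S i i)) (Q' i))"
    by (simp only: entropy_eq KL_gibbs)
qed

end

section \<open>Maximizers of the mean field objective\<close>

lemma sum_sq_le_abs:
  assumes "\<And>i. i < p \<Longrightarrow> \<bar>x i\<bar> \<le> 1" "\<And>i. i < p \<Longrightarrow> \<bar>y i\<bar> \<le> (1::real)"
  shows "(\<Sum>i<p. (x i - y i)\<^sup>2) \<le> 2 * (\<Sum>i<p. \<bar>x i - y i\<bar>)"
  unfolding sum_distrib_left
proof (rule sum_mono)
  fix i assume "i \<in> {..<p}"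
  hence "\<bar>x i - y i\<bar> \<le> 2" using assms[of i] by auto
  hence "\<bar>x i - y i\<bar> * \<bar>x i - y i\<bar> \<le> 2 * \<bar>x i - y i\<bar>" by (intro mult_right_mono) auto
  thus "(x i - y i)\<^sup>2 \<le> 2 * \<bar>x i - y i\<bar>" by (simp add: power2_eq_square)
qed

lemma sum_abs_le_sqrt:
  assumes "(\<Sum>i<p. (f i)\<^sup>2) \<le> c * real p" shows "(\<Sum>i<p. \<bar>f i\<bar> :: real) \<le> sqrt c * real p"
proof -
  have "(\<Sum>i<p. \<bar>f i\<bar>) = (\<Sum>i<p. \<bar>f i\<bar> * 1)" by simp
  also have "\<dots> \<le> sqrt (\<Sum>i<p. \<bar>f i\<bar>\<^sup>2) * sqrt (\<Sum>i<p. 1\<^sup>2)"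
    using sum_mult_le_sqrt[of "\<lambda>i. \<bar>f i\<bar>" "\<lambda>_. 1" "{..<p}"] by simp
  also have "\<dots> \<le> sqrt (c * real p) * sqrt (real p)" using assms order_trans[OF sum_nonneg assms] by (intro mult_mono) (auto simp: sum_nonneg)
  also have "\<dots> = sqrt c * real p" by (simp add: real_sqrt_mult mult.assoc)
  finally show ?thesis .
qed

text \<open>Modulus of continuity, per coordinate, of the prior-free part of the objective when v
  has squared norm at most K * p; \<eta> is the average l1 distance. The square root comes from
  bounding squared l2 distances by l1 distances on the cube.\<close>

definition quad_mod :: "real \<Rightarrow> real \<Rightarrow> real \<Rightarrow> real" where
  "quad_mod C K \<eta> = (C + sqrt K) * sqrt (2 * \<eta>) + C * \<eta>"

text \<open>Both expressions vanish continuously with \<epsilon>; they are the displacement and the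
  loss in \<open>near_maximizer\<close>.\<close>

lemma quad_mod_small:
  assumes e: "e > 0"
  shows "\<exists>\<epsilon>>0. \<epsilon> * (1 + quad_mod C K 2) \<le> e \<and>
    quad_mod C K (\<epsilon> * (1 + quad_mod C K 2)) + quad_mod C K \<epsilon> + 2 * \<epsilon> \<le> e"
proof -
  let ?q = "1 + quad_mod C K 2"
  let ?f = "\<lambda>x. x * ?q" and ?g = "\<lambda>x. quad_mod C K (x * ?q) + quad_mod C K x + 2 * x"
  have "isCont ?f 0" "isCont ?g 0" unfolding quad_mod_def by (intro continuous_intros)+
  hence "(?f \<longlongrightarrow> 0) (at 0)" "(?g \<longlongrightarrow> 0) (at 0)" unfolding isCont_def by (simp_all add: quad_mod_def)
  hence "(?f \<longlongrightarrow> 0) (at_right 0)" "(?g \<longlongrightarrow> 0) (at_right 0)" by (auto intro: tendsto_within_subset)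
  hence "\<forall>\<^sub>F x in at_right 0. ?f x < e" "\<forall>\<^sub>F x in at_right 0. ?g x < e" using e by (auto dest: order_tendstoD(2))
  hence "\<forall>\<^sub>F x in at_right 0. ?f x < e \<and> ?g x < e \<and> x > 0"
    by (intro eventually_conj) (auto simp: eventually_at_right_less)
  from eventually_happens'[OF _ this] obtain x where "?f x < e" "?g x < e" "x > 0" by auto
  thus ?thesis by (intro exI[of _ x]) auto
qed

section \<open>The objective in coordinates and its near-maximizers\<close>

context regression
begin

lemma gram: "i < p \<Longrightarrow> j < p \<Longrightarrow> (X\<^sup>T * X) $$ (i, j) = \<sigma>\<^sup>2 * S i j"
  using X \<sigma> by (simp add: scalar_prod_def S_def lessThan_atLeast0)

lemma gram_carrier: "X\<^sup>T * X \<in> carrier_mat p p"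
  using X by auto

lemma qf_gram: "qf p (\<lambda>i j. (X\<^sup>T * X) $$ (i, j)) x x = \<sigma>\<^sup>2 * qf p S x x"
  unfolding qf_def sum_distrib_left by (intro sum.cong refl) (simp add: gram mult.assoc del: index_mult_mat)

lemma S_lower:
  assumes "p > 0" "C1 \<le> lambda_min (X\<^sup>T * X) / \<sigma>\<^sup>2" shows "C1 * (\<Sum>i<p. (x i)\<^sup>2) \<le> qf p S x x"
proof -
  have "C1 * \<sigma>\<^sup>2 \<le> lambda_min (X\<^sup>T * X)" using assms(2) \<sigma> by (simp add: field_simps)
  hence "(C1 * \<sigma>\<^sup>2) * (\<Sum>i<p. (x i)\<^sup>2) \<le> lambda_min (X\<^sup>T * X) * (\<Sum>i<p. (x i)\<^sup>2)"
    by (intro mult_right_mono) (auto simp: sum_nonneg)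
  also have "\<dots> \<le> qf p (\<lambda>i j. (X\<^sup>T * X) $$ (i, j)) x x"
    by (rule lambda_bounds(1)[OF gram_carrier _ assms(1)]) (simp only: gram, simp add: S_sym)
  finally have "\<sigma>\<^sup>2 * (C1 * (\<Sum>i<p. (x i)\<^sup>2)) \<le> \<sigma>\<^sup>2 * qf p S x x" unfolding qf_gram by (simp add: mult_ac)
  thus ?thesis using \<sigma> by (simp add: mult_le_cancel_left)
qed

lemma S_upper:
  assumes "p > 0" "lambda_max (X\<^sup>T * X) / \<sigma>\<^sup>2 \<le> C2" shows "qf p S x x \<le> C2 * (\<Sum>i<p. (x i)\<^sup>2)"
proof -
  have "lambda_max (X\<^sup>T * X) \<le> C2 * \<sigma>\<^sup>2" using assms(2) \<sigma> by (simp add: field_simps)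
  hence "lambda_max (X\<^sup>T * X) * (\<Sum>i<p. (x i)\<^sup>2) \<le> (C2 * \<sigma>\<^sup>2) * (\<Sum>i<p. (x i)\<^sup>2)"
    by (intro mult_right_mono) (auto simp: sum_nonneg)
  moreover have "qf p (\<lambda>i j. (X\<^sup>T * X) $$ (i, j)) x x \<le> lambda_max (X\<^sup>T * X) * (\<Sum>i<p. (x i)\<^sup>2)"
    by (rule lambda_bounds(2)[OF gram_carrier _ assms(1)]) (simp only: gram, simp add: S_sym)
  ultimately have "\<sigma>\<^sup>2 * qf p S x x \<le> \<sigma>\<^sup>2 * (C2 * (\<Sum>i<p. (x i)\<^sup>2))" unfolding qf_gram by (simp add: mult_ac)
  thus ?thesis using \<sigma> by (simp add: mult_le_cancel_left)
qed

lemma dims: "dim_row X = n" "dim_col X = p" using X by auto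

lemma off_diag_A: "off_diag X \<sigma> \<in> carrier_mat p p" "i < p \<Longrightarrow> j < p \<Longrightarrow> off_diag X \<sigma> $$ (i, j) = A i j"
  using \<sigma> by (auto simp: off_diag_def dims A_def gram simp del: index_mult_mat)

lemma diag_coef_S: "i < p \<Longrightarrow> diag_coef X \<sigma> i = S i i"
  using \<sigma> by (simp add: diag_coef_def gram del: index_mult_mat)

lemma trace_off_diag: "mat_trace (off_diag X \<sigma> * off_diag X \<sigma>) = (\<Sum>i<p. \<Sum>j<p. (A i j)\<^sup>2)"
proof -
  have "mat_trace (off_diag X \<sigma> * off_diag X \<sigma>) = (\<Sum>i<p. \<Sum>j<p. A i j * A j i)"
    using off_diag_A by (simp add: mat_trace_def scalar_prod_def lessThan_atLeast0)
  also have "\<dots> = (\<Sum>i<p. \<Sum>j<p. (A i j)\<^sup>2)"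
    by (intro sum.cong refl) (simp add: A_def S_sym power2_eq_square)
  finally show ?thesis .
qed

lemma wvec_carrier: "wvec X \<sigma> y \<in> carrier_vec p"
  by (rule carrier_vecI) (simp add: wvec_def dims)

lemma wvec_w: "i < p \<Longrightarrow> wvec X \<sigma> y $ i = w y i"
  using X by (simp add: wvec_def w_def scalar_prod_def lessThan_atLeast0)

text \<open>The part of the objective that does not involve the prior; a change of prior affects
  \<open>rates\<close> only.\<close>

definition quad :: "(nat \<Rightarrow> real) \<Rightarrow> (nat \<Rightarrow> real) \<Rightarrow> real" where
  "quad v u = - (1 / 2) * qf p A u u + (\<Sum>i<p. v i * u i)"

definition rates :: "real measure \<Rightarrow> (nat \<Rightarrow> real) \<Rightarrow> real" where
  "rates \<nu> u = (\<Sum>i<p. rate \<nu> (hfun \<nu> (S i i) (u i)) (S i i))"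

definition in_box :: "real measure \<Rightarrow> (nat \<Rightarrow> real) \<Rightarrow> bool" where
  "in_box \<nu> u \<longleftrightarrow> (\<forall>i<p. u i \<in> supp_interval \<nu>)"

lemma mf_objective_eq:
  assumes \<nu>: "unit_law \<nu>" and u: "u \<in> carrier_vec p"
  shows "mf_objective X \<sigma> u (wvec X \<sigma> y) \<nu> = quad (w y) (($) u) - rates \<nu> (($) u)"
proof -
  have "u \<bullet> (off_diag X \<sigma> *\<^sub>v u) = qf p A (($) u) (($) u)"
    using qf_eq_scalar_prod[OF off_diag_A(1) u u] by (simp add: off_diag_A(2) cong: qf_cong)
  moreover have "u \<bullet> wvec X \<sigma> y = (\<Sum>i<p. w y i * u $ i)"
    using wvec_carrier[of y] by (simp add: scalar_prod_def lessThan_atLeast0 wvec_w mult.commute)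
  moreover have "(\<Sum>i<dim_col X. KL (tilt \<nu> (hfun \<nu> (diag_coef X \<sigma> i) (u $ i)) (diag_coef X \<sigma> i)) (tilt \<nu> 0 (diag_coef X \<sigma> i)))
      = rates \<nu> (($) u)"
    unfolding rates_def dims by (intro sum.cong refl) (simp add: diag_coef_S unit_law.KL_tilt[OF \<nu>])
  ultimately show ?thesis by (simp add: mf_objective_def quad_def)
qed

lemma supp_box_iff: "u \<in> supp_box p \<nu> \<longleftrightarrow> u \<in> carrier_vec p \<and> in_box \<nu> (($) u)"
  by (simp add: supp_box_def in_box_def)

lemma sq_dist_eq: "u \<in> carrier_vec p \<Longrightarrow> v \<in> carrier_vec p \<Longrightarrow> sq_dist u v = (\<Sum>i<p. (u $ i - v $ i)\<^sup>2)"
  by (simp add: sq_dist_def scalar_prod_def lessThan_atLeast0 power2_eq_square)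

lemma S_nonneg: "S i i \<ge> 0"
  by (simp add: S_def sum_nonneg)

lemma in_box_bounded: "unit_law \<nu> \<Longrightarrow> in_box \<nu> u \<Longrightarrow> i < p \<Longrightarrow> \<bar>u i\<bar> \<le> 1"
proof -
  assume "unit_law \<nu>" "in_box \<nu> u" "i < p"
  hence "u i \<in> {-1..1}" using unit_law.supp_interval_bounded[of \<nu>] unfolding in_box_def by blast
  thus ?thesis by auto
qed

text \<open>The parameter picked by \<open>hfun\<close> and the given \<tau> have equal means, so
  \<open>rate_cong\<close> identifies their rates.\<close>

lemma quad_rates_eq_mfo:
  assumes "\<And>i. i < p \<Longrightarrow> tm \<tau> i = u i"
    and "in_box \<mu> u"
  shows "quad v u - rates \<mu> u = mfo v \<tau>"
proof -
  have "qf p A u u = qf p A (tm \<tau>) (tm \<tau>)" by (rule qf_cong) (use assms(1) in auto)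
  moreover have "(\<Sum>i<p. v i * u i) = (\<Sum>i<p. v i * tm \<tau> i)" using assms(1) by (intro sum.cong) auto
  moreover have "rates \<mu> u = (\<Sum>i<p. rate \<mu> (\<tau> i) (S i i))"
    unfolding rates_def
  proof (intro sum.cong refl)
    fix i assume i: "i \<in> {..<p}"
    have "tmean \<mu> (hfun \<mu> (S i i) (u i)) (S i i) = tm \<tau> i"
      using \<mu>.tmean_hfun[of "u i" "S i i"] assms i S_nonneg by (simp add: in_box_def)
    thus "rate \<mu> (hfun \<mu> (S i i) (u i)) (S i i) = rate \<mu> (\<tau> i) (S i i)" by (rule \<mu>.rate_cong)
  qed
  ultimately show ?thesis by (simp add: quad_def mfo_def)
qed

lemma objective_le_logZ: "in_box \<mu> u \<Longrightarrow> quad v u - rates \<mu> u \<le> logZ v"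
  using quad_rates_eq_mfo[of "\<lambda>i. hfun \<mu> (S i i) (u i)" u v] mfo_le_logZ[of v "\<lambda>i. hfun \<mu> (S i i) (u i)"]
    \<mu>.tmean_hfun S_nonneg by (simp add: in_box_def)

definition tau_tilde :: "(nat \<Rightarrow> real) \<Rightarrow> nat \<Rightarrow> real" where
  "tau_tilde v i = hfun \<mu> (S i i) (pmean v i)"

lemma tm_tau_tilde: "\<not> degenerate \<mu> \<Longrightarrow> i < p \<Longrightarrow> tm (tau_tilde v) i = pmean v i"
  unfolding tau_tilde_def using \<mu>.tmean_hfun[OF pmean_in_interval] S_nonneg by auto

lemma in_box_pmean: "\<not> degenerate \<mu> \<Longrightarrow> in_box \<mu> (pmean v)"
  using pmean_in_interval by (simp add: in_box_def)

text \<open>Both terms of \<open>KL_gibbs_matched\<close> are nonnegative. Here the gap is dropped,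
  in \<open>objective_pmean\<close> the divergence.\<close>

lemma KL_le_trcov:
  assumes "\<not> degenerate \<mu>" shows "KL (gibbs v) (ptilt (tau_tilde v)) \<le> - trcov v / 2"
  using KL_gibbs_matched[of "tau_tilde v" v, OF tm_tau_tilde[OF assms]] mfo_le_logZ[of v "tau_tilde v"] by simp

lemma trcov_nonpos:
  assumes "\<not> degenerate \<mu>" shows "- trcov v / 2 \<ge> 0"
  using KL_le_trcov[OF assms, of v] KL_gibbs_nonneg[of v "tau_tilde v"] by linarith

text \<open>\<open>logZ\<close> bounds the objective from above everywhere, and at the posterior
  mean the objective falls short of it by at most the last term.\<close>

lemma objective_pmean:
  assumes "\<not> degenerate \<mu>" and u: "in_box \<mu> u"
  shows "quad v u - rates \<mu> u \<le> quad v (pmean v) - rates \<mu> (pmean v) - trcov v / 2"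
proof -
  have "quad v (pmean v) - rates \<mu> (pmean v) = mfo v (tau_tilde v)"
    by (rule quad_rates_eq_mfo[OF tm_tau_tilde[OF assms(1)] in_box_pmean[OF assms(1)]])
  moreover have "logZ v - mfo v (tau_tilde v) \<le> - trcov v / 2"
    using KL_gibbs_matched[of "tau_tilde v" v, OF tm_tau_tilde[OF assms(1)]] KL_gibbs_nonneg[of v "tau_tilde v"] by linarith
  ultimately show ?thesis using objective_le_logZ[OF u, of v] by linarith
qed

text \<open>A need not be semidefinite, so its form is written as that of S minus the diagonal part.
  The first is treated by polarization, the second coordinatewise, the linear term by
  Cauchy-Schwarz.\<close>

lemma quad_diff:
  assumes upper: "\<And>x. qf p S x x \<le> C * (\<Sum>i<p. (x i)\<^sup>2)" and C: "C \<ge> 0"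
    and v: "(\<Sum>i<p. (v i)\<^sup>2) \<le> K * real p"
    and u: "\<And>i. i < p \<Longrightarrow> \<bar>u i\<bar> \<le> 1" "\<And>i. i < p \<Longrightarrow> \<bar>u' i\<bar> \<le> 1"
    and close: "(\<Sum>i<p. \<bar>u i - u' i\<bar>) \<le> \<eta> * real p"
  shows "\<bar>quad v u - quad v u'\<bar> \<le> quad_mod C K \<eta> * real p"
proof -
  have sq: "(\<Sum>i<p. (u i - u' i)\<^sup>2) \<le> 2 * \<eta> * real p"
    using sum_sq_le_abs[of p u u'] u close by simp
  have sq2: "(\<Sum>i<p. (u i + u' i)\<^sup>2) \<le> 4 * real p"
  proof -
    have "(u i + u' i)\<^sup>2 \<le> 4" if "i < p" for i
    proof -
      have "\<bar>u i + u' i\<bar> \<le> 2" using u[OF that] by linarith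
      hence "(u i + u' i)\<^sup>2 \<le> 2\<^sup>2" by (metis abs_le_square_iff abs_numeral)
      thus ?thesis by simp
    qed
    thus ?thesis using sum_mono[of "{..<p}" "\<lambda>i. (u i + u' i)\<^sup>2" "\<lambda>_. 4"] by simp
  qed
  have a1: "\<bar>qf p S u u - qf p S u' u'\<bar> \<le> 2 * C * sqrt (2 * \<eta>) * real p"
  proof -
    have "\<bar>qf p S u u - qf p S u' u'\<bar> \<le> C * sqrt (\<Sum>i<p. (u i - u' i)\<^sup>2) * sqrt (\<Sum>i<p. (u i + u' i)\<^sup>2)"
      by (rule qf_diff_bound[OF S_sym qf_S_nonneg upper C])
    also have "\<dots> \<le> C * sqrt (2 * \<eta> * real p) * sqrt (4 * real p)"
      using sq sq2 C order_trans[OF sum_nonneg sq] by (intro mult_mono) (auto simp: sum_nonneg)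
    also have "\<dots> = 2 * C * sqrt (2 * \<eta>) * (sqrt (real p) * sqrt (real p))"
      unfolding real_sqrt_mult by simp
    finally show ?thesis by simp
  qed
  have a2: "\<bar>(\<Sum>i<p. S i i * (u i)\<^sup>2) - (\<Sum>i<p. S i i * (u' i)\<^sup>2)\<bar> \<le> 2 * C * \<eta> * real p"
  proof -
    have "\<bar>(\<Sum>i<p. S i i * (u i)\<^sup>2) - (\<Sum>i<p. S i i * (u' i)\<^sup>2)\<bar> \<le> (\<Sum>i<p. \<bar>S i i * (u i)\<^sup>2 - S i i * (u' i)\<^sup>2\<bar>)"
      unfolding sum_subtractf[symmetric] by (rule sum_abs)
    also have "\<dots> \<le> (\<Sum>i<p. 2 * C * \<bar>u i - u' i\<bar>)"
    proof (rule sum_mono)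
      fix i assume i: "i \<in> {..<p}"
      have "\<bar>u i + u' i\<bar> \<le> 2" using u[of i] i by auto
      moreover have "\<bar>S i i\<bar> \<le> C" using S_diag_bound[OF upper, of i] i by simp
      ultimately have "\<bar>S i i\<bar> * (\<bar>u i + u' i\<bar> * \<bar>u i - u' i\<bar>) \<le> C * (2 * \<bar>u i - u' i\<bar>)"
        using C by (intro mult_mono) auto
      thus "\<bar>S i i * (u i)\<^sup>2 - S i i * (u' i)\<^sup>2\<bar> \<le> 2 * C * \<bar>u i - u' i\<bar>"
        unfolding abs_mult[symmetric] by (simp add: power2_eq_square algebra_simps)
    qed
    also have "\<dots> = 2 * C * (\<Sum>i<p. \<bar>u i - u' i\<bar>)" by (simp add: sum_distrib_left)
    also have "\<dots> \<le> 2 * C * (\<eta> * real p)" using C by (intro mult_left_mono close) auto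
    finally show ?thesis by (simp add: mult.assoc)
  qed
  have a3: "\<bar>(\<Sum>i<p. v i * u i) - (\<Sum>i<p. v i * u' i)\<bar> \<le> sqrt K * sqrt (2 * \<eta>) * real p"
  proof -
    have "\<bar>(\<Sum>i<p. v i * u i) - (\<Sum>i<p. v i * u' i)\<bar> = \<bar>\<Sum>i<p. v i * (u i - u' i)\<bar>"
      by (simp add: sum_subtractf right_diff_distrib)
    also have "\<dots> \<le> sqrt (\<Sum>i<p. (v i)\<^sup>2) * sqrt (\<Sum>i<p. (u i - u' i)\<^sup>2)" by (rule sum_mult_le_sqrt)
    also have "\<dots> \<le> sqrt (K * real p) * sqrt (2 * \<eta> * real p)"
      using v sq order_trans[OF sum_nonneg v] by (intro mult_mono) (auto simp: sum_nonneg)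
    also have "\<dots> = sqrt K * sqrt (2 * \<eta>) * (sqrt (real p) * sqrt (real p))" unfolding real_sqrt_mult by simp
    finally show ?thesis by simp
  qed
  have eq: "quad v u - quad v u' = - (1 / 2) * (qf p S u u - qf p S u' u')
     + (1 / 2) * ((\<Sum>i<p. S i i * (u i)\<^sup>2) - (\<Sum>i<p. S i i * (u' i)\<^sup>2)) + ((\<Sum>i<p. v i * u i) - (\<Sum>i<p. v i * u' i))"
    unfolding quad_def qf_S_eq by (simp add: field_simps)
  have aux: "\<bar>x\<bar> \<le> (1 / 2) * Q + (1 / 2) * R + T"
    if "x = - (1 / 2) * q + (1 / 2) * r + t" "\<bar>q\<bar> \<le> Q" "\<bar>r\<bar> \<le> R" "\<bar>t\<bar> \<le> T" for x q r t Q R T :: real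
    using that by linarith
  have "\<bar>quad v u - quad v u'\<bar> \<le> (1 / 2) * (2 * C * sqrt (2 * \<eta>) * real p) + (1 / 2) * (2 * C * \<eta> * real p) + sqrt K * sqrt (2 * \<eta>) * real p"
    by (rule aux[OF eq a1 a2 a3])
  also have "\<dots> = quad_mod C K \<eta> * real p" by (simp add: quad_mod_def algebra_simps)
  finally show ?thesis .
qed

text \<open>The optimizer for \<nu> is pulled back to u, each competitor z is pushed forward to
  \<nu>, and optimality under \<nu> compares the images. Each direction costs one change of the
  prior-free part and \<epsilon> * p in the rates.\<close>

lemma near_maximizer:
  assumes upper: "\<And>x. qf p S x x \<le> C * (\<Sum>i<p. (x i)\<^sup>2)" and C: "C \<ge> 0"
    and v: "(\<Sum>i<p. (v i)\<^sup>2) \<le> K * real p" and \<nu>: "unit_law \<nu>" and nd: "\<not> degenerate \<mu>" "\<not> degenerate \<nu>" and \<epsilon>: "\<epsilon> > 0"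
    and pull: "\<And>d \<gamma>'. d \<in> {0..C} \<Longrightarrow> \<exists>\<gamma>. \<bar>tmean \<mu> \<gamma> d - tmean \<nu> \<gamma>' d\<bar> \<le> \<epsilon> * (1 + rate \<nu> \<gamma>' d) \<and> rate \<mu> \<gamma> d \<le> rate \<nu> \<gamma>' d + \<epsilon>"
    and push: "\<And>d \<gamma>. d \<in> {0..C} \<Longrightarrow> \<exists>\<gamma>'. \<bar>tmean \<mu> \<gamma> d - tmean \<nu> \<gamma>' d\<bar> \<le> \<epsilon> \<and> rate \<nu> \<gamma>' d \<le> rate \<mu> \<gamma> d + \<epsilon>"
    and u': "in_box \<nu> u'" and max: "\<And>z. in_box \<nu> z \<Longrightarrow> quad v z - rates \<nu> z \<le> quad v u' - rates \<nu> u'"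
  shows "\<exists>u. in_box \<mu> u \<and> (\<Sum>i<p. \<bar>u i - u' i\<bar>) \<le> \<epsilon> * (1 + quad_mod C K 2) * real p
    \<and> (\<forall>z. in_box \<mu> z \<longrightarrow> quad v z - rates \<mu> z \<le> quad v u - rates \<mu> u
         + (quad_mod C K (\<epsilon> * (1 + quad_mod C K 2)) + quad_mod C K \<epsilon> + 2 * \<epsilon>) * real p)"
proof -
  interpret N: unit_law \<nu> by fact
  let ?\<eta> = "\<epsilon> * (1 + quad_mod C K 2)"
  have d: "S i i \<in> {0..C}" if "i < p" for i using S_diag_bound[OF upper that] by simp
  have qd: "\<bar>quad v x - quad v x'\<bar> \<le> quad_mod C K e * real p"
    if "\<And>i. i < p \<Longrightarrow> \<bar>x i\<bar> \<le> 1" "\<And>i. i < p \<Longrightarrow> \<bar>x' i\<bar> \<le> 1" "(\<Sum>i<p. \<bar>x i - x' i\<bar>) \<le> e * real p" for x x' e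
    by (rule quad_diff[OF upper C v that])
  have rates_hfun: "rates \<nu>' x = (\<Sum>i<p. rate \<nu>' (g i) (S i i))"
    if "unit_law \<nu>'" "in_box \<nu>' x" "\<And>i. i < p \<Longrightarrow> tmean \<nu>' (g i) (S i i) = x i" for \<nu>' x g
    unfolding rates_def
  proof (intro sum.cong refl)
    fix i assume i: "i \<in> {..<p}"
    have "tmean \<nu>' (hfun \<nu>' (S i i) (x i)) (S i i) = tmean \<nu>' (g i) (S i i)"
      using unit_law.tmean_hfun[OF that(1), of "x i" "S i i"] that i S_nonneg by (simp add: in_box_def)
    thus "rate \<nu>' (hfun \<nu>' (S i i) (x i)) (S i i) = rate \<nu>' (g i) (S i i)" by (rule unit_law.rate_cong[OF that(1)])
  qed
  \<comment> \<open>A competitor with zero rate. Comparison with it bounds the total rate of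
    \<open>u'\<close> by a multiple of p, which makes the errors \<epsilon> * (1 + rate) of
    \<open>pull\<close> summable; the argument 2 of \<open>quad_mod\<close> is the diameter of
    [-1, 1].\<close>
  define z0 where "z0 i = tmean \<nu> 0 (S i i)" for i
  have z0: "in_box \<nu> z0" using N.tmean_in_interval[OF nd(2)] by (simp add: in_box_def z0_def)
  have "rates \<nu> z0 = (\<Sum>i<p. rate \<nu> 0 (S i i))"
    by (rule rates_hfun[OF \<nu> z0]) (simp add: z0_def)
  hence "rates \<nu> z0 = 0" by (simp add: rate_def)
  hence "rates \<nu> u' \<le> quad v u' - quad v z0" using max[OF z0] by simp
  also have "\<dots> \<le> \<bar>quad v u' - quad v z0\<bar>" by simp
  also have "\<dots> \<le> quad_mod C K 2 * real p"
  proof (rule qd)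
    have "(\<Sum>i<p. \<bar>u' i - z0 i\<bar>) \<le> (\<Sum>i<p. 2)"
    proof (rule sum_mono)
      fix i assume "i \<in> {..<p}"
      thus "\<bar>u' i - z0 i\<bar> \<le> 2" using in_box_bounded[OF \<nu> u', of i] in_box_bounded[OF \<nu> z0, of i] by auto
    qed
    thus "(\<Sum>i<p. \<bar>u' i - z0 i\<bar>) \<le> 2 * real p" by simp
  qed (use in_box_bounded[OF \<nu>] u' z0 in auto)
  finally have R: "rates \<nu> u' \<le> quad_mod C K 2 * real p" .
  define h where "h i = hfun \<nu> (S i i) (u' i)" for i
  have h: "tmean \<nu> (h i) (S i i) = u' i" if "i < p" for i
    unfolding h_def using N.tmean_hfun u' that S_nonneg by (simp add: in_box_def)
  have "\<forall>i. \<exists>\<gamma>. i < p \<longrightarrow> \<bar>tmean \<mu> \<gamma> (S i i) - tmean \<nu> (h i) (S i i)\<bar> \<le> \<epsilon> * (1 + rate \<nu> (h i) (S i i)) \<and> rate \<mu> \<gamma> (S i i) \<le> rate \<nu> (h i) (S i i) + \<epsilon>"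
    using pull[OF d] by blast
  then obtain g where g: "\<And>i. i < p \<Longrightarrow> \<bar>tmean \<mu> (g i) (S i i) - tmean \<nu> (h i) (S i i)\<bar> \<le> \<epsilon> * (1 + rate \<nu> (h i) (S i i))"
      "\<And>i. i < p \<Longrightarrow> rate \<mu> (g i) (S i i) \<le> rate \<nu> (h i) (S i i) + \<epsilon>" by metis
  define u where "u i = tmean \<mu> (g i) (S i i)" for i
  have u: "in_box \<mu> u" using \<mu>.tmean_in_interval[OF nd(1)] by (simp add: in_box_def u_def)
  have ratesu: "rates \<mu> u = (\<Sum>i<p. rate \<mu> (g i) (S i i))" by (rule rates_hfun[OF law u]) (simp add: u_def)
  have ratesu': "rates \<nu> u' = (\<Sum>i<p. rate \<nu> (h i) (S i i))" by (simp add: rates_def h_def)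
  have close: "(\<Sum>i<p. \<bar>u i - u' i\<bar>) \<le> ?\<eta> * real p"
  proof -
    have "(\<Sum>i<p. \<bar>u i - u' i\<bar>) \<le> (\<Sum>i<p. \<epsilon> * (1 + rate \<nu> (h i) (S i i)))"
      using g(1) h by (intro sum_mono) (simp add: u_def)
    also have "\<dots> = \<epsilon> * (real p + rates \<nu> u')" by (simp add: ratesu' sum_distrib_left[symmetric] sum.distrib)
    also have "\<dots> \<le> \<epsilon> * (real p + quad_mod C K 2 * real p)" using R \<epsilon> by (intro mult_left_mono) auto
    finally show ?thesis by (simp add: algebra_simps)
  qed
  have r1: "rates \<mu> u \<le> rates \<nu> u' + \<epsilon> * real p"
  proof -
    have "(\<Sum>i<p. rate \<mu> (g i) (S i i)) \<le> (\<Sum>i<p. rate \<nu> (h i) (S i i) + \<epsilon>)" using g(2) by (intro sum_mono) auto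
    thus ?thesis by (simp add: ratesu ratesu' sum.distrib mult.commute)
  qed
  have q1: "\<bar>quad v u - quad v u'\<bar> \<le> quad_mod C K ?\<eta> * real p"
    by (rule qd) (use close in_box_bounded[OF law u] in_box_bounded[OF \<nu> u'] in auto)
  have "quad v z - rates \<mu> z \<le> quad v u - rates \<mu> u + (quad_mod C K ?\<eta> + quad_mod C K \<epsilon> + 2 * \<epsilon>) * real p"
    if z: "in_box \<mu> z" for z
  proof -
    define k where "k i = hfun \<mu> (S i i) (z i)" for i
    have k: "tmean \<mu> (k i) (S i i) = z i" if "i < p" for i
      unfolding k_def using \<mu>.tmean_hfun z that S_nonneg by (simp add: in_box_def)
    have "\<forall>i. \<exists>\<gamma>'. i < p \<longrightarrow> \<bar>tmean \<mu> (k i) (S i i) - tmean \<nu> \<gamma>' (S i i)\<bar> \<le> \<epsilon> \<and> rate \<nu> \<gamma>' (S i i) \<le> rate \<mu> (k i) (S i i) + \<epsilon>"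
      using push[OF d] by blast
    then obtain m where m: "\<And>i. i < p \<Longrightarrow> \<bar>tmean \<mu> (k i) (S i i) - tmean \<nu> (m i) (S i i)\<bar> \<le> \<epsilon>"
      "\<And>i. i < p \<Longrightarrow> rate \<nu> (m i) (S i i) \<le> rate \<mu> (k i) (S i i) + \<epsilon>" by metis
    define z' where "z' i = tmean \<nu> (m i) (S i i)" for i
    have z': "in_box \<nu> z'" using N.tmean_in_interval[OF nd(2)] by (simp add: in_box_def z'_def)
    have rz': "rates \<nu> z' = (\<Sum>i<p. rate \<nu> (m i) (S i i))" by (rule rates_hfun[OF \<nu> z']) (simp add: z'_def)
    have rz: "rates \<mu> z = (\<Sum>i<p. rate \<mu> (k i) (S i i))" by (simp add: rates_def k_def)
    have r2: "rates \<nu> z' \<le> rates \<mu> z + \<epsilon> * real p"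
    proof -
      have "(\<Sum>i<p. rate \<nu> (m i) (S i i)) \<le> (\<Sum>i<p. rate \<mu> (k i) (S i i) + \<epsilon>)" using m(2) by (intro sum_mono) auto
      thus ?thesis by (simp add: rz rz' sum.distrib mult.commute)
    qed
    have "\<bar>quad v z - quad v z'\<bar> \<le> quad_mod C K \<epsilon> * real p"
    proof (rule qd)
      have "(\<Sum>i<p. \<bar>z i - z' i\<bar>) \<le> (\<Sum>i<p. \<epsilon>)" using m(1) k by (intro sum_mono) (simp add: z'_def)
      thus "(\<Sum>i<p. \<bar>z i - z' i\<bar>) \<le> \<epsilon> * real p" by (simp add: mult.commute)
    qed (use in_box_bounded[OF law z] in_box_bounded[OF \<nu> z'] in auto)
    thus ?thesis using r1 r2 q1 max[OF z'] by (simp add: algebra_simps)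
  qed
  thus ?thesis using u close by blast
qed

end

section \<open>Convergence in probability\<close>

text \<open>The exceptional set is measurable while \<Phi> need not be: this fits the outer measure
  in \<open>conv_in_prob\<close> and still allows union bounds.\<close>

definition holds_upto :: "'a measure \<Rightarrow> real \<Rightarrow> ('a \<Rightarrow> bool) \<Rightarrow> bool" where
  "holds_upto M \<eta> \<Phi> \<longleftrightarrow> (\<exists>B\<in>sets M. emeasure M B \<le> ennreal \<eta> \<and> (\<forall>\<omega>\<in>space M - B. \<Phi> \<omega>))"

lemma holds_upto_conj:
  assumes "holds_upto M a \<Phi>" "holds_upto M b \<Psi>" "0 \<le> a" "0 \<le> b"
  shows "holds_upto M (a + b) (\<lambda>\<omega>. \<Phi> \<omega> \<and> \<Psi> \<omega>)"
proof -
  obtain A B where A: "A \<in> sets M" "emeasure M A \<le> ennreal a" "\<forall>\<omega>\<in>space M - A. \<Phi> \<omega>"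
    and B: "B \<in> sets M" "emeasure M B \<le> ennreal b" "\<forall>\<omega>\<in>space M - B. \<Psi> \<omega>"
    using assms unfolding holds_upto_def by blast
  have "emeasure M (A \<union> B) \<le> emeasure M A + emeasure M B" by (rule emeasure_subadditive[OF A(1) B(1)])
  also have "\<dots> \<le> ennreal (a + b)" using A(2) B(2) assms(3,4) by (simp add: add_mono)
  finally show ?thesis unfolding holds_upto_def using A B by (intro bexI[of _ "A \<union> B"]) auto
qed

lemma holds_upto_mono:
  "holds_upto M a \<Phi> \<Longrightarrow> a \<le> b \<Longrightarrow> (\<And>\<omega>. \<omega> \<in> space M \<Longrightarrow> \<Phi> \<omega> \<Longrightarrow> \<Psi> \<omega>) \<Longrightarrow> holds_upto M b \<Psi>"
  unfolding holds_upto_def by (meson DiffD1 ennreal_leI order_trans)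

lemma holds_upto_AE: "AE \<omega> in M. \<Phi> \<omega> \<Longrightarrow> holds_upto M 0 \<Phi>"
proof -
  assume "AE \<omega> in M. \<Phi> \<omega>"
  then obtain N where N: "{\<omega> \<in> space M. \<not> \<Phi> \<omega>} \<subseteq> N" "emeasure M N = 0" "N \<in> sets M" by (rule AE_E)
  thus ?thesis unfolding holds_upto_def by (intro bexI[of _ N]) auto
qed

lemma holds_upto_Markov:
  assumes f: "f \<in> borel_measurable M" and a: "a > 0" and \<eta>: "\<eta> \<ge> 0"
    and le: "(\<integral>\<^sup>+\<omega>. ennreal (f \<omega>) \<partial>M) \<le> ennreal (a * \<eta>)"
  shows "holds_upto M \<eta> (\<lambda>\<omega>. f \<omega> \<le> a)"
proof -
  let ?B = "{\<omega> \<in> space M. a < f \<omega>}"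
  have B: "?B \<in> sets M" using f by measurable
  have "ennreal a * emeasure M ?B = (\<integral>\<^sup>+\<omega>. ennreal a * indicator ?B \<omega> \<partial>M)"
    by (rule nn_integral_cmult_indicator[symmetric, OF B])
  also have "\<dots> \<le> (\<integral>\<^sup>+\<omega>. ennreal (f \<omega>) \<partial>M)"
    by (intro nn_integral_mono) (auto simp: indicator_def ennreal_leI)
  also have "\<dots> \<le> ennreal a * ennreal \<eta>" using le a by (simp add: ennreal_mult')
  finally have "emeasure M ?B \<le> ennreal \<eta>" using a by (subst (asm) ennreal_mult_le_mult_iff) auto
  thus ?thesis unfolding holds_upto_def using B by (intro bexI[of _ ?B]) auto
qed

lemma conv_in_probI:
  assumes h: "\<And>\<epsilon> \<eta>. \<epsilon> > 0 \<Longrightarrow> \<eta> > 0 \<Longrightarrow> \<forall>\<^sub>F p in sequentially. holds_upto (P p) \<eta> (\<lambda>\<omega>. \<bar>Z p \<omega>\<bar> \<le> \<epsilon>)"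
  shows "conv_in_prob P Z 0"
  unfolding conv_in_prob_def
proof (intro allI impI)
  fix \<epsilon> :: real assume \<epsilon>: "\<epsilon> > 0"
  have key: "\<forall>\<^sub>F p in sequentially. outer_measure_of (P p) {\<omega> \<in> space (P p). \<bar>Z p \<omega> - 0\<bar> > \<epsilon>} \<le> ennreal \<eta>" if "\<eta> > 0" for \<eta>
    using h[OF \<epsilon> that]
  proof eventually_elim
    case (elim p)
    then obtain B where B: "B \<in> sets (P p)" "emeasure (P p) B \<le> ennreal \<eta>" "\<forall>\<omega>\<in>space (P p) - B. \<bar>Z p \<omega>\<bar> \<le> \<epsilon>"
      unfolding holds_upto_def by blast
    have sub: "{\<omega> \<in> space (P p). \<bar>Z p \<omega> - 0\<bar> > \<epsilon>} \<subseteq> B" using B(3) by force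
    have "outer_measure_of (P p) {\<omega> \<in> space (P p). \<bar>Z p \<omega> - 0\<bar> > \<epsilon>} \<le> emeasure (P p) B"
      unfolding outer_measure_of_def by (rule INF_lower) (use B sub in auto)
    thus ?case using B(2) by (rule order_trans)
  qed
  show "(\<lambda>p. outer_measure_of (P p) {\<omega> \<in> space (P p). \<bar>Z p \<omega> - 0\<bar> > \<epsilon>}) \<longlonglongrightarrow> 0"
  proof (rule order_tendstoI)
    fix a :: ennreal assume a: "0 < a"
    obtain \<eta> where \<eta>: "\<eta> > 0" "ennreal \<eta> < a"
    proof (cases a)
      case (real r)
      thus ?thesis using a that[of "r / 2"] by (auto simp: ennreal_less_iff)
    next
      case top thus ?thesis using that[of 1] by simp
    qed
    show "\<forall>\<^sub>F p in sequentially. outer_measure_of (P p) {\<omega> \<in> space (P p). \<bar>Z p \<omega> - 0\<bar> > \<epsilon>} < a"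
      using key[OF \<eta>(1)] by eventually_elim (rule le_less_trans[OF _ \<eta>(2)])
  qed auto
qed

text \<open>A point mass has zero variance, and the variance changes by at most 4 *
  \<open>qdist\<close>: 2 from the second moment, 2 from the squared mean.\<close>

lemma (in two_unit_laws) nondegenerate_transfer:
  assumes q: "4 * qdist \<mu> \<nu> < (\<integral>x. x\<^sup>2 \<partial>\<mu>) - (\<integral>x. x \<partial>\<mu>)\<^sup>2"
  shows "\<not> degenerate \<nu>"
proof
  assume "degenerate \<nu>"
  then obtain x where x: "\<nu> = return borel x" by (auto simp: degenerate_def)
  have ix: "(\<integral>y. y \<partial>\<nu>) = x" "(\<integral>y. y\<^sup>2 \<partial>\<nu>) = x\<^sup>2" unfolding x by (simp_all add: integral_return)
  have sq: "\<bar>(\<integral>y. y\<^sup>2 \<partial>\<mu>) - x\<^sup>2\<bar> \<le> 2 * qdist \<mu> \<nu>"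
    unfolding ix(2)[symmetric]
  proof (rule lipschitz_integral_diff)
    fix y z :: real assume yz: "\<bar>y\<bar> \<le> 1" "\<bar>z\<bar> \<le> 1"
    have "\<bar>y\<^sup>2 - z\<^sup>2\<bar> = \<bar>y + z\<bar> * \<bar>y - z\<bar>" unfolding abs_mult[symmetric] by (simp add: power2_eq_square algebra_simps)
    also have "\<dots> \<le> 2 * \<bar>y - z\<bar>" using yz by (intro mult_right_mono) auto
    finally show "\<bar>y\<^sup>2 - z\<^sup>2\<bar> \<le> 2 * \<bar>y - z\<bar>" .
  qed simp
  let ?m = "\<integral>y. y \<partial>\<mu>"
  have m: "\<bar>?m - x\<bar> \<le> qdist \<mu> \<nu>" using mean_diff ix by simp
  have m1: "\<bar>?m\<bar> \<le> 1" by (rule M.abs_integral_le) auto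
  have x1: "\<bar>x\<bar> \<le> 1" using N.abs_integral_le[of "\<lambda>y. y" 1] ix by simp
  have "\<bar>?m\<^sup>2 - x\<^sup>2\<bar> = \<bar>?m + x\<bar> * \<bar>?m - x\<bar>" unfolding abs_mult[symmetric] by (simp add: power2_eq_square algebra_simps)
  also have "\<dots> \<le> 2 * qdist \<mu> \<nu>" using m1 x1 m by (intro mult_mono) auto
  finally show False using sq q by linarith
qed

lemma (in unit_law) variance_pos:
  assumes nd: "\<not> degenerate \<mu>" shows "(\<integral>x. x\<^sup>2 \<partial>\<mu>) - (\<integral>x. x \<partial>\<mu>)\<^sup>2 > 0"
proof (rule ccontr)
  let ?m = "\<integral>x. x \<partial>\<mu>"
  have i1: "integrable \<mu> (\<lambda>x. x)" by (rule integrable_bdd[where B = 1]) auto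
  have i2: "integrable \<mu> (\<lambda>x. x\<^sup>2)" by (rule integrable_bdd[where B = 1]) (auto simp: abs_square_le_1)
  have e: "(x - ?m)\<^sup>2 = x\<^sup>2 + (- 2 * ?m) * x + ?m\<^sup>2" for x by (simp add: power2_eq_square algebra_simps)
  have "(\<integral>x. (x - ?m)\<^sup>2 \<partial>\<mu>) = (\<integral>x. x\<^sup>2 \<partial>\<mu>) - ?m\<^sup>2"
    unfolding e using i1 i2 by (simp add: power2_eq_square)
  moreover assume "\<not> (\<integral>x. x\<^sup>2 \<partial>\<mu>) - ?m\<^sup>2 > 0"
  moreover have "(\<integral>x. (x - ?m)\<^sup>2 \<partial>\<mu>) \<ge> 0" by simp
  ultimately have z: "(\<integral>x. (x - ?m)\<^sup>2 \<partial>\<mu>) = 0" by linarith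
  have "integrable \<mu> (\<lambda>x. (x - ?m)\<^sup>2)" unfolding e using i1 i2 by simp
  hence "AE x in \<mu>. (x - ?m)\<^sup>2 = 0" using z by (subst (asm) integral_nonneg_eq_0_iff_AE) auto
  hence "AE x in \<mu>. x = ?m" by eventually_elim simp
  thus False using nd degenerateI by blast
qed

section \<open>Asymptotics along the sequence of models\<close>

locale regression_sequence =
  fixes X :: "nat \<Rightarrow> real mat" and n :: "nat \<Rightarrow> nat" and \<sigma> C1 C2 :: real
    and \<mu> :: "real measure" and \<mu>s :: "nat \<Rightarrow> real measure"
    and ustar us :: "nat \<Rightarrow> (nat \<Rightarrow> real) \<times> (nat \<Rightarrow> real) \<Rightarrow> real vec"
    and post :: "nat \<Rightarrow> (nat \<Rightarrow> real) \<Rightarrow> (nat \<Rightarrow> real) measure"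
  assumes \<sigma>: "\<sigma> > 0" and X: "\<And>p. X p \<in> carrier_mat (n p) p"
    and law: "unit_law \<mu>" and nd: "\<not> degenerate \<mu>"
    and C1: "0 < C1" and C2: "0 \<le> C2"
    and eig_lower: "\<And>p. p \<ge> 1 \<Longrightarrow> C1 \<le> lambda_min ((X p)\<^sup>T * X p) / \<sigma>\<^sup>2"
    and eig_upper: "\<And>p. p \<ge> 1 \<Longrightarrow> lambda_max ((X p)\<^sup>T * X p) / \<sigma>\<^sup>2 \<le> C2"
    and trace: "(\<lambda>p. mat_trace (off_diag (X p) \<sigma> * off_diag (X p) \<sigma>)) \<in> o(\<lambda>p. real p)"
    and \<mu>s_law: "\<And>p. p \<ge> 1 \<Longrightarrow> unit_law (\<mu>s p)"
    and \<mu>s_lim: "weak_conv_m \<mu>s \<mu>"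
    and post: "\<And>p. p \<ge> 1 \<Longrightarrow> is_posterior (X p) \<sigma> \<mu> (post p)"
    and ustar: "well_separated_optimizer X \<sigma> \<mu> ustar"
    and us: "\<And>p \<omega>. p \<ge> 1 \<Longrightarrow> \<not> degenerate (\<mu>s p) \<Longrightarrow> \<omega> \<in> space (joint_law (X p) \<sigma> \<mu>) \<Longrightarrow>
       is_arg_max (\<lambda>u. mf_objective (X p) \<sigma> u (wvec (X p) \<sigma> (fst \<omega>)) (\<mu>s p))
         (\<lambda>u. u \<in> supp_box p (\<mu>s p)) (us p \<omega>)"
begin

sublocale R: regression "X p" "n p" p \<sigma> \<mu> for p
  by (rule regression.intro[OF _ _ law]) (use \<sigma> X in auto)

abbreviation "P p \<equiv> joint_law (X p) \<sigma> \<mu>"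
abbreviation "v p \<omega> \<equiv> R.w p (fst \<omega>)"
abbreviation "obj p \<nu> \<omega> u \<equiv> R.quad p (v p \<omega>) u - R.rates p \<nu> u"

lemma lower: "p \<ge> 1 \<Longrightarrow> C1 * (\<Sum>i<p. (x i)\<^sup>2) \<le> qf p (R.S p) x x"
  by (rule R.S_lower) (use eig_lower in auto)

lemma upper: "p \<ge> 1 \<Longrightarrow> qf p (R.S p) x x \<le> C2 * (\<Sum>i<p. (x i)\<^sup>2)"
  by (rule R.S_upper) (use eig_upper in auto)

lemma qdist_\<mu>s: "(\<lambda>p. qdist \<mu> (\<mu>s p)) \<longlonglongrightarrow> 0"
proof -
  \<comment> \<open>Nothing is known about \<open>\<mu>s 0\<close>, so the sequence is shifted by
    one.\<close>
  have "weak_conv_m (\<lambda>p. \<mu>s (Suc p)) \<mu>"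
    using \<mu>s_lim unfolding weak_conv_m_def weak_conv_def by (auto intro: LIMSEQ_Suc)
  hence "(\<lambda>p. qdist \<mu> (\<mu>s (Suc p))) \<longlonglongrightarrow> 0" by (intro qdist_tendsto_0 law \<mu>s_law) auto
  thus ?thesis by (rule LIMSEQ_imp_Suc)
qed

lemma eventually_qdist: "\<delta> > 0 \<Longrightarrow> \<forall>\<^sub>F p in sequentially. qdist \<mu> (\<mu>s p) < \<delta>"
  using qdist_\<mu>s by (rule order_tendstoD(2))

lemma eventually_ge_1: "\<forall>\<^sub>F p::nat in sequentially. p \<ge> 1"
  by (rule eventually_ge_at_top)

lemma eventually_nondegenerate: "\<forall>\<^sub>F p in sequentially. \<not> degenerate (\<mu>s p)"
proof -
  have "(\<integral>x. x\<^sup>2 \<partial>\<mu>) - (\<integral>x. x \<partial>\<mu>)\<^sup>2 > 0" by (rule unit_law.variance_pos[OF law nd])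
  hence "\<forall>\<^sub>F p in sequentially. qdist \<mu> (\<mu>s p) < ((\<integral>x. x\<^sup>2 \<partial>\<mu>) - (\<integral>x. x \<partial>\<mu>)\<^sup>2) / 4"
    by (intro eventually_qdist) simp
  thus ?thesis using eventually_ge_1
  proof eventually_elim
    case (elim p)
    interpret two_unit_laws \<mu> "\<mu>s p" unfolding two_unit_laws_def using law \<mu>s_law[OF elim(2)] by simp
    have "4 * qdist \<mu> (\<mu>s p) < (\<integral>x. x\<^sup>2 \<partial>\<mu>) - (\<integral>x. x \<partial>\<mu>)\<^sup>2" using elim(1) by simp
    thus ?case by (rule nondegenerate_transfer)
  qed
qed

text \<open>Markov's inequality for a nonnegative quantity whose expectation is at most sqrt (t p /
  p) * p / (2 * C1), with t p the trace of the square of A; hence the threshold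
  \<open>2 * C1 * e * \<eta>\<close>.\<close>

lemma trcov_small:
  assumes e: "e > 0" and \<eta>: "\<eta> > 0"
  shows "\<forall>\<^sub>F p in sequentially. holds_upto (P p) \<eta> (\<lambda>\<omega>. - R.trcov p (v p \<omega>) / 2 \<le> e * real p)"
proof -
  define t where "t p = (\<Sum>i<p. \<Sum>j<p. (R.A p i j)\<^sup>2)" for p

  have "(\<lambda>p. t p) \<in> o(\<lambda>p. real p)" using trace by (simp add: R.trace_off_diag t_def)
  hence "(\<lambda>p. t p / real p) \<longlonglongrightarrow> 0" by (rule smalloD_tendsto)
  hence "(\<lambda>p. sqrt (t p / real p)) \<longlonglongrightarrow> sqrt 0" by (rule tendsto_real_sqrt)
  hence "\<forall>\<^sub>F p in sequentially. sqrt (t p / real p) < 2 * C1 * e * \<eta>"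
    using C1 e \<eta> by (intro order_tendstoD(2)) auto
  thus ?thesis using eventually_ge_1
  proof eventually_elim
    case (elim p)
    have p: "real p > 0" using elim(2) by simp
    let ?f = "\<lambda>\<omega>. - R.trcov p (v p \<omega>) / 2"
    show ?case
    proof (rule holds_upto_Markov)
      have int: "integrable (P p) ?f" using R.integrable_trcov[of p] by simp
      have "(\<integral>\<^sup>+\<omega>. ennreal (?f \<omega>) \<partial>P p) = ennreal (\<integral>\<omega>. ?f \<omega> \<partial>P p)"
        by (rule nn_integral_eq_integral[OF int]) (use R.trcov_nonpos[OF nd] in simp)
      also have "\<dots> \<le> ennreal (e * real p * \<eta>)"
      proof (rule ennreal_leI)
        have "(\<integral>\<omega>. ?f \<omega> \<partial>P p) \<le> \<bar>\<integral>\<omega>. R.trcov p (v p \<omega>) \<partial>P p\<bar> / 2" by simp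
        also have "\<bar>\<integral>\<omega>. R.trcov p (v p \<omega>) \<partial>P p\<bar> \<le> sqrt (t p) * (sqrt (real p) * (1 / C1))"
          unfolding t_def by (rule R.expected_trcov[OF C1 lower[OF elim(2)]])
        also have "sqrt (t p) * (sqrt (real p) * (1 / C1)) / 2 = sqrt (t p / real p) * (real p / (2 * C1))"
        proof -
          define a b where "a = sqrt (t p / real p)" and "b = sqrt (real p)"
          have "sqrt (t p) = a * b" using p by (simp add: real_sqrt_divide a_def b_def)
          moreover have "real p = b * b" by (simp add: b_def)
          ultimately show ?thesis unfolding a_def[symmetric] b_def[symmetric] by simp
        qed
        also have "\<dots> \<le> (2 * C1 * e * \<eta>) * (real p / (2 * C1))"
          using elim(1) p C1 by (intro mult_right_mono) auto
        also have "\<dots> = e * real p * \<eta>" using C1 by simp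
        finally show "(\<integral>\<omega>. ?f \<omega> \<partial>P p) \<le> e * real p * \<eta>" by simp
      qed
      finally show "(\<integral>\<^sup>+\<omega>. ennreal (?f \<omega>) \<partial>P p) \<le> ennreal (e * real p * \<eta>)" .
      show "?f \<in> borel_measurable (P p)" using R.m_trcov[of p] by simp
    qed (use e p \<eta> in auto)
  qed
qed

text \<open>Markov's inequality for \<open>expected_w_sq\<close>; the added 1 keeps the level
  positive when \<open>C2 = 0\<close>.\<close>

lemma w_tight:
  assumes \<eta>: "\<eta> > 0"
  shows "\<forall>\<^sub>F p in sequentially. holds_upto (P p) \<eta> (\<lambda>\<omega>. (\<Sum>i<p. (v p \<omega> i)\<^sup>2) \<le> (2 * (C2\<^sup>2 + C2) + 1) / \<eta> * real p)"
  using eventually_ge_1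
proof eventually_elim
  case (elim p)
  have p: "real p > 0" using elim by simp
  show ?case
  proof (rule holds_upto_Markov)
    show "(\<lambda>\<omega>. \<Sum>i<p. (v p \<omega> i)\<^sup>2) \<in> borel_measurable (P p)"
      by (rule R.m_J[of "\<lambda>y. \<Sum>i<p. (R.w p y i)\<^sup>2"]) (intro borel_measurable_sum borel_measurable_power R.m_w)
    show "0 < (2 * (C2\<^sup>2 + C2) + 1) / \<eta> * real p" using \<eta> p C2 by (intro mult_pos_pos divide_pos_pos) (auto intro: add_nonneg_pos)
    have "(\<integral>\<^sup>+\<omega>. ennreal (\<Sum>i<p. (v p \<omega> i)\<^sup>2) \<partial>P p) \<le> ennreal (2 * (C2\<^sup>2 + C2) * real p)"
      by (rule R.expected_w_sq[OF upper[OF elim] C2])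
    also have "\<dots> \<le> ennreal ((2 * (C2\<^sup>2 + C2) + 1) / \<eta> * real p * \<eta>)"
    proof (rule ennreal_leI)
      have "2 * (C2\<^sup>2 + C2) * real p \<le> (2 * (C2\<^sup>2 + C2) + 1) * real p" by (intro mult_right_mono) auto
      thus "2 * (C2\<^sup>2 + C2) * real p \<le> (2 * (C2\<^sup>2 + C2) + 1) / \<eta> * real p * \<eta>" using \<eta> by simp
    qed
    finally show "(\<integral>\<^sup>+\<omega>. ennreal (\<Sum>i<p. (v p \<omega> i)\<^sup>2) \<partial>P p) \<le> ennreal ((2 * (C2\<^sup>2 + C2) + 1) / \<eta> * real p * \<eta>)" .
  qed (use \<eta> in auto)
qed

text \<open>Contrapositive form of the separation event at one sample point, free of suprema in
  \<open>ereal\<close>; \<epsilon> is the admissible loss per coordinate.\<close>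

definition separated :: "nat \<Rightarrow> real \<Rightarrow> real \<Rightarrow> (nat \<Rightarrow> real) \<times> (nat \<Rightarrow> real) \<Rightarrow> bool" where
  "separated p \<delta> \<epsilon> \<omega> \<longleftrightarrow> (\<forall>u. R.in_box p \<mu> u \<longrightarrow> (\<forall>z. R.in_box p \<mu> z \<longrightarrow> obj p \<mu> \<omega> z \<le> obj p \<mu> \<omega> u + \<epsilon> * real p)
     \<longrightarrow> (\<Sum>i<p. (u i - ustar p \<omega> $ i)\<^sup>2) \<le> \<delta> * real p)"

lemma ustar_box: "p \<ge> 1 \<Longrightarrow> \<omega> \<in> space (P p) \<Longrightarrow> ustar p \<omega> \<in> supp_box p \<mu>"
  using ustar by (simp add: well_separated_optimizer_def)

lemma eventually_separated:
  assumes \<delta>: "\<delta> > 0"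
  shows "\<exists>\<epsilon>>0. \<forall>\<eta>>0. \<forall>\<^sub>F p in sequentially. holds_upto (P p) \<eta> (separated p \<delta> \<epsilon>)"
proof -
  define M where "M p \<omega> u = mf_objective (X p) \<sigma> u (wvec (X p) \<sigma> (fst \<omega>)) \<mu>"
    for p u and \<omega> :: "(nat \<Rightarrow> real) \<times> (nat \<Rightarrow> real)"
  define E where "E p \<epsilon> = {\<omega> \<in> space (P p).
      (SUP u \<in> {u \<in> supp_box p \<mu>. sq_dist u (ustar p \<omega>) > real p * \<delta>}. ereal (M p \<omega> u))
        < (SUP u \<in> supp_box p \<mu>. ereal (M p \<omega> u)) - ereal (real p * \<epsilon>)}" for p \<epsilon>
  obtain \<epsilon> where \<epsilon>: "\<epsilon> > 0" and lim: "(\<lambda>p. measure (P p) (E p \<epsilon>)) \<longlonglongrightarrow> 1"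
    using ustar \<delta> unfolding well_separated_optimizer_def E_def M_def by blast
  have "\<forall>\<^sub>F p in sequentially. holds_upto (P p) \<eta> (separated p \<delta> \<epsilon>)" if \<eta>: "\<eta> > 0" for \<eta>
  proof -
    \<comment> \<open>The maximum with 0 matters: a set of positive \<open>measure\<close> is
      measurable, since \<open>measure\<close> is 0 on all other sets.\<close>
    have "\<forall>\<^sub>F p in sequentially. measure (P p) (E p \<epsilon>) > max (1 - \<eta>) 0"
      by (rule order_tendstoD(1)[OF lim]) (use \<eta> in simp)
    thus ?thesis using eventually_ge_1
    proof eventually_elim
      case (elim p)
      have sE: "E p \<epsilon> \<in> sets (P p)" using elim(1) measure_notin_sets[of "E p \<epsilon>" "P p"] by force
      have "emeasure (P p) (space (P p) - E p \<epsilon>) = ennreal (1 - measure (P p) (E p \<epsilon>))"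
        using R.J.prob_compl[OF sE] by (simp add: R.J.emeasure_eq_measure)
      also have "\<dots> \<le> ennreal \<eta>" using elim(1) by (intro ennreal_leI) simp
      finally have small: "emeasure (P p) (space (P p) - E p \<epsilon>) \<le> ennreal \<eta>" .
      have "separated p \<delta> \<epsilon> \<omega>" if \<omega>: "\<omega> \<in> E p \<epsilon>" for \<omega>
        unfolding separated_def
      proof (intro allI impI)
        fix u assume u: "R.in_box p \<mu> u" and near: "\<forall>z. R.in_box p \<mu> z \<longrightarrow> obj p \<mu> \<omega> z \<le> obj p \<mu> \<omega> u + \<epsilon> * real p"
        have sp: "\<omega> \<in> space (P p)" using \<omega> by (simp add: E_def)
        let ?u = "vec p u"
        have vb: "R.in_box p \<mu> (($) ?u)" using u by (simp add: R.in_box_def)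
        have ub: "?u \<in> supp_box p \<mu>" unfolding R.supp_box_iff using vb by simp
        have obj_vec: "obj p \<mu> \<omega> (($) ?u) = obj p \<mu> \<omega> u"
        proof -
          have "qf p (R.A p) (($) ?u) (($) ?u) = qf p (R.A p) u u" by (rule qf_cong) auto
          thus ?thesis by (simp add: R.quad_def R.rates_def)
        qed
        have Mz: "M p \<omega> z \<le> M p \<omega> ?u + real p * \<epsilon>" if z: "z \<in> supp_box p \<mu>" for z
        proof -
          have zc: "z \<in> carrier_vec p" "R.in_box p \<mu> (($) z)" using z unfolding R.supp_box_iff by auto
          have "M p \<omega> z = obj p \<mu> \<omega> (($) z)" unfolding M_def by (rule R.mf_objective_eq[OF law zc(1)])
          also have "\<dots> \<le> obj p \<mu> \<omega> u + \<epsilon> * real p" using near zc(2) by blast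
          also have "obj p \<mu> \<omega> u = M p \<omega> ?u"
            unfolding M_def obj_vec[symmetric] by (rule R.mf_objective_eq[OF law, symmetric]) simp
          finally show ?thesis by (simp add: mult.commute)
        qed
        have "sq_dist ?u (ustar p \<omega>) \<le> real p * \<delta>"
        proof (rule ccontr)
          assume far: "\<not> sq_dist ?u (ustar p \<omega>) \<le> real p * \<delta>"
          \<comment> \<open>A far near-maximizer would bring the supremum over far points within the
            separation gap of the full supremum.\<close>
          have "ereal (M p \<omega> ?u) \<le> (SUP u \<in> {u \<in> supp_box p \<mu>. sq_dist u (ustar p \<omega>) > real p * \<delta>}. ereal (M p \<omega> u))"
            by (rule SUP_upper) (use ub far in simp)
          also have "\<dots> < (SUP u \<in> supp_box p \<mu>. ereal (M p \<omega> u)) - ereal (real p * \<epsilon>)" using \<omega> by (simp add: E_def)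
          also have "\<dots> \<le> ereal (M p \<omega> ?u + real p * \<epsilon>) - ereal (real p * \<epsilon>)"
            by (intro ereal_minus_mono SUP_least) (use Mz in auto)
          finally show False by simp
        qed
        thus "(\<Sum>i<p. (u i - ustar p \<omega> $ i)\<^sup>2) \<le> \<delta> * real p"
          using R.sq_dist_eq[of ?u p "ustar p \<omega>"] ustar_box[OF elim(2) sp] by (simp add: supp_box_def mult.commute)
      qed
      thus ?case unfolding holds_upto_def using small sE
        by (intro bexI[of _ "space (P p) - E p \<epsilon>"]) auto
    qed
  qed
  thus ?thesis using \<epsilon> by blast
qed

abbreviation "utilde p \<omega> \<equiv> mean_vec p (post p (fst \<omega>))"

lemma post_gibbs: "p \<ge> 1 \<Longrightarrow> holds_upto (P p) 0 (\<lambda>\<omega>. post p (fst \<omega>) = R.gibbs p (v p \<omega>))"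
  by (rule holds_upto_AE) (rule R.posterior_eq_gibbs[OF post])

lemma mean_vec_gibbs: "mean_vec p (R.gibbs p w) = vec p (R.pmean p w)"
  by (simp add: mean_vec_def R.pmean_def[abs_def])

lemma product_tilt_eq: "product_tilt (X p) \<sigma> \<nu> \<tau> = PiM {..<p} (\<lambda>i. tilt \<nu> (\<tau> $ i) (R.S p i i))"
  unfolding product_tilt_def R.dims by (intro PiM_cong refl) (simp add: R.diag_coef_S)

lemma product_tilt_hvec:
  "product_tilt (X p) \<sigma> \<nu> (hvec (X p) \<sigma> \<nu> u) = PiM {..<p} (\<lambda>i. tilt \<nu> (hfun \<nu> (R.S p i i) (u $ i)) (R.S p i i))"
  unfolding product_tilt_eq by (intro PiM_cong refl) (simp add: hvec_def R.dims R.diag_coef_S)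

lemma product_tilt_tilde:
  "product_tilt (X p) \<sigma> \<mu> (hvec (X p) \<sigma> \<mu> (vec p (R.pmean p w))) = R.ptilt p (R.tau_tilde p w)"
  unfolding product_tilt_hvec R.ptilt_def by (intro PiM_cong refl) (simp add: R.tau_tilde_def)

lemma KL_conv:
  "conv_in_prob P (\<lambda>p \<omega>. KL (post p (fst \<omega>)) (product_tilt (X p) \<sigma> \<mu> (hvec (X p) \<sigma> \<mu> (utilde p \<omega>))) / real p) 0"
proof (rule conv_in_probI)
  fix \<epsilon> \<eta> :: real assume \<epsilon>: "\<epsilon> > 0" and \<eta>: "\<eta> > 0"
  show "\<forall>\<^sub>F p in sequentially. holds_upto (P p) \<eta>
     (\<lambda>\<omega>. \<bar>KL (post p (fst \<omega>)) (product_tilt (X p) \<sigma> \<mu> (hvec (X p) \<sigma> \<mu> (utilde p \<omega>))) / real p\<bar> \<le> \<epsilon>)"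
    using trcov_small[OF \<epsilon> \<eta>] eventually_ge_1
  proof eventually_elim
    case (elim p)
    show ?case
    proof (rule holds_upto_mono[OF holds_upto_conj[OF elim(1) post_gibbs[OF elim(2)]]])
      fix \<omega> assume h: "- R.trcov p (v p \<omega>) / 2 \<le> \<epsilon> * real p \<and> post p (fst \<omega>) = R.gibbs p (v p \<omega>)"
      let ?K = "KL (R.gibbs p (v p \<omega>)) (R.ptilt p (R.tau_tilde p (v p \<omega>)))"
      have "0 \<le> ?K" "?K \<le> \<epsilon> * real p" using R.KL_gibbs_nonneg R.KL_le_trcov[OF nd, of p "v p \<omega>"] h by auto
      hence "\<bar>?K / real p\<bar> \<le> \<epsilon>" using elim(2) by (simp add: field_simps)
      thus "\<bar>KL (post p (fst \<omega>)) (product_tilt (X p) \<sigma> \<mu> (hvec (X p) \<sigma> \<mu> (utilde p \<omega>))) / real p\<bar> \<le> \<epsilon>"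
        using h by (simp only: mean_vec_gibbs product_tilt_tilde)
    qed (use \<eta> in auto)
  qed
qed

text \<open>By \<open>objective_pmean\<close> the loss at the posterior mean is at most
  \<open>- trcov / 2\<close>, which is below \<epsilon> * p with high probability, so separation
  applies.\<close>

lemma pmean_close:
  assumes \<delta>: "\<delta> > 0" and \<eta>: "\<eta> > 0"
  shows "\<forall>\<^sub>F p in sequentially. holds_upto (P p) \<eta> (\<lambda>\<omega>. (\<Sum>i<p. (R.pmean p (v p \<omega>) i - ustar p \<omega> $ i)\<^sup>2) \<le> \<delta> * real p)"
proof -
  obtain \<epsilon> where \<epsilon>: "\<epsilon> > 0" and sep: "\<And>\<eta>. \<eta> > 0 \<Longrightarrow> \<forall>\<^sub>F p in sequentially. holds_upto (P p) \<eta> (separated p \<delta> \<epsilon>)"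
    using eventually_separated[OF \<delta>] by blast
  have \<eta>2: "\<eta> / 2 > 0" using \<eta> by simp
  show ?thesis using sep[OF \<eta>2] trcov_small[OF \<epsilon> \<eta>2]
  proof eventually_elim
    case (elim p)
    show ?case
    proof (rule holds_upto_mono[OF holds_upto_conj[OF elim]])
      fix \<omega> assume h: "separated p \<delta> \<epsilon> \<omega> \<and> - R.trcov p (v p \<omega>) / 2 \<le> \<epsilon> * real p"
      have "obj p \<mu> \<omega> z \<le> obj p \<mu> \<omega> (R.pmean p (v p \<omega>)) + \<epsilon> * real p" if "R.in_box p \<mu> z" for z
        using R.objective_pmean[OF nd that, of "v p \<omega>"] h by linarith
      thus "(\<Sum>i<p. (R.pmean p (v p \<omega>) i - ustar p \<omega> $ i)\<^sup>2) \<le> \<delta> * real p"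
        using h R.in_box_pmean[OF nd] unfolding separated_def by blast
    qed (use \<eta> in auto)
  qed
qed

lemma utilde_conv:
  "conv_in_prob P (\<lambda>p \<omega>. sq_dist (ustar p \<omega>) (utilde p \<omega>) / real p) 0"
proof (rule conv_in_probI)
  fix \<epsilon> \<eta> :: real assume \<epsilon>: "\<epsilon> > 0" and \<eta>: "\<eta> > 0"
  show "\<forall>\<^sub>F p in sequentially. holds_upto (P p) \<eta> (\<lambda>\<omega>. \<bar>sq_dist (ustar p \<omega>) (utilde p \<omega>) / real p\<bar> \<le> \<epsilon>)"
    using pmean_close[OF \<epsilon> \<eta>] eventually_ge_1
  proof eventually_elim
    case (elim p)
    show ?case
    proof (rule holds_upto_mono[OF holds_upto_conj[OF elim(1) post_gibbs[OF elim(2)]]])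
      fix \<omega> assume sp: "\<omega> \<in> space (P p)"
        and h: "(\<Sum>i<p. (R.pmean p (v p \<omega>) i - ustar p \<omega> $ i)\<^sup>2) \<le> \<epsilon> * real p \<and> post p (fst \<omega>) = R.gibbs p (v p \<omega>)"
      have "utilde p \<omega> = vec p (R.pmean p (v p \<omega>))" using h by (simp only: mean_vec_gibbs)
      moreover have "ustar p \<omega> \<in> carrier_vec p" using ustar_box[OF elim(2) sp] by (simp add: supp_box_def)
      ultimately have "sq_dist (ustar p \<omega>) (utilde p \<omega>) = (\<Sum>i<p. (R.pmean p (v p \<omega>) i - ustar p \<omega> $ i)\<^sup>2)"
        by (simp add: R.sq_dist_eq power2_commute)
      hence "0 \<le> sq_dist (ustar p \<omega>) (utilde p \<omega>)" "sq_dist (ustar p \<omega>) (utilde p \<omega>) \<le> \<epsilon> * real p"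
        using h by (simp_all add: sum_nonneg)
      thus "\<bar>sq_dist (ustar p \<omega>) (utilde p \<omega>) / real p\<bar> \<le> \<epsilon>" using elim(2) by (simp add: field_simps)
    qed (use \<eta> in auto)
  qed
qed

lemma us_argmax:
  assumes p: "p \<ge> 1" and nds: "\<not> degenerate (\<mu>s p)" and sp: "\<omega> \<in> space (P p)"
  shows "us p \<omega> \<in> carrier_vec p" "R.in_box p (\<mu>s p) (($) (us p \<omega>))"
    and "R.in_box p (\<mu>s p) z \<Longrightarrow> obj p (\<mu>s p) \<omega> z \<le> obj p (\<mu>s p) \<omega> (($) (us p \<omega>))"
proof -
  note ul = \<mu>s_law[OF p]
  have a: "us p \<omega> \<in> supp_box p (\<mu>s p)"
    and m: "\<And>y. y \<in> supp_box p (\<mu>s p) \<Longrightarrow> mf_objective (X p) \<sigma> y (wvec (X p) \<sigma> (fst \<omega>)) (\<mu>s p)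
       \<le> mf_objective (X p) \<sigma> (us p \<omega>) (wvec (X p) \<sigma> (fst \<omega>)) (\<mu>s p)"
    using us[OF p nds sp] unfolding is_arg_max_def by (auto simp: not_less)
  show c: "us p \<omega> \<in> carrier_vec p" and "R.in_box p (\<mu>s p) (($) (us p \<omega>))"
    using a unfolding R.supp_box_iff by auto
  assume z: "R.in_box p (\<mu>s p) z"
  have zb: "vec p z \<in> supp_box p (\<mu>s p)" unfolding R.supp_box_iff using z by (simp add: R.in_box_def)
  have "obj p (\<mu>s p) \<omega> z = obj p (\<mu>s p) \<omega> (($) (vec p z))"
  proof -
    have "qf p (R.A p) (($) (vec p z)) (($) (vec p z)) = qf p (R.A p) z z" by (rule qf_cong) auto
    thus ?thesis by (simp add: R.quad_def R.rates_def)
  qed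
  also have "\<dots> = mf_objective (X p) \<sigma> (vec p z) (wvec (X p) \<sigma> (fst \<omega>)) (\<mu>s p)"
    by (rule R.mf_objective_eq[OF ul, symmetric]) simp
  also have "\<dots> \<le> mf_objective (X p) \<sigma> (us p \<omega>) (wvec (X p) \<sigma> (fst \<omega>)) (\<mu>s p)" by (rule m[OF zb])
  also have "\<dots> = obj p (\<mu>s p) \<omega> (($) (us p \<omega>))" by (rule R.mf_objective_eq[OF ul c])
  finally show "obj p (\<mu>s p) \<omega> z \<le> obj p (\<mu>s p) \<omega> (($) (us p \<omega>))" .
qed

text \<open>\<open>us\<close> maximizes for the prior \<open>\<mu>s p\<close> and not for \<mu>, so
  separation is applied to the point that \<open>near_maximizer\<close> supplies next to it.\<close>

lemma us_close:
  assumes \<delta>: "\<delta> > 0" and \<eta>: "\<eta> > 0"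
  shows "\<forall>\<^sub>F p in sequentially. holds_upto (P p) \<eta> (\<lambda>\<omega>. (\<Sum>i<p. (us p \<omega> $ i - ustar p \<omega> $ i)\<^sup>2) \<le> \<delta> * real p)"
proof -
  have \<delta>4: "\<delta> / 4 > 0" using \<delta> by simp
  obtain e where e: "e > 0" and sep: "\<And>\<eta>. \<eta> > 0 \<Longrightarrow> \<forall>\<^sub>F p in sequentially. holds_upto (P p) \<eta> (separated p (\<delta> / 4) e)"
    using eventually_separated[OF \<delta>4] by blast
  have \<eta>2: "\<eta> / 2 > 0" using \<eta> by simp
  define K where "K = (2 * (C2\<^sup>2 + C2) + 1) / (\<eta> / 2)"
  \<comment> \<open>One tolerance serves two ends: e is the loss that separation allows, and an
    average l1 distance \<delta> / 8 gives \<delta> / 4 in squared distance. Both legs then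
    contribute twice \<delta> / 4 to the final \<delta>.\<close>
  have "min e (\<delta> / 8) > 0" using e \<delta> by simp
  from quad_mod_small[OF this, of C2 K] obtain \<epsilon> where \<epsilon>: "\<epsilon> > 0"
    "\<epsilon> * (1 + quad_mod C2 K 2) \<le> min e (\<delta> / 8)"
    "quad_mod C2 K (\<epsilon> * (1 + quad_mod C2 K 2)) + quad_mod C2 K \<epsilon> + 2 * \<epsilon> \<le> min e (\<delta> / 8)" by blast
  obtain \<delta>1 where \<delta>1: "\<delta>1 > 0" "\<And>\<nu> d \<gamma>. unit_law \<nu> \<Longrightarrow> qdist \<mu> \<nu> < \<delta>1 \<Longrightarrow> d \<in> {0..C2} \<Longrightarrow> \<exists>\<gamma>'.
     \<bar>tmean \<mu> \<gamma> d - tmean \<nu> \<gamma>' d\<bar> \<le> \<epsilon> \<and> rate \<nu> \<gamma>' d \<le> rate \<mu> \<gamma> d + \<epsilon>"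
    using rate_transfer_to[OF law \<epsilon>(1) C2] by blast
  obtain \<delta>2 where \<delta>2: "\<delta>2 > 0" "\<And>\<nu> d \<gamma>'. unit_law \<nu> \<Longrightarrow> qdist \<mu> \<nu> < \<delta>2 \<Longrightarrow> d \<in> {0..C2} \<Longrightarrow> \<exists>\<gamma>.
     \<bar>tmean \<mu> \<gamma> d - tmean \<nu> \<gamma>' d\<bar> \<le> \<epsilon> * (1 + rate \<nu> \<gamma>' d) \<and> rate \<mu> \<gamma> d \<le> rate \<nu> \<gamma>' d + \<epsilon>"
    using rate_transfer_from[OF law \<epsilon>(1) C2] by blast
  show ?thesis
    using sep[OF \<eta>2] w_tight[OF \<eta>2] eventually_qdist[OF \<delta>1(1)] eventually_qdist[OF \<delta>2(1)] eventually_nondegenerate eventually_ge_1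
  proof eventually_elim
    case (elim p)
    note ul = \<mu>s_law[OF elim(6)]
    show ?case
    proof (rule holds_upto_mono[OF holds_upto_conj[OF elim(1,2)]])
      fix \<omega> assume sp: "\<omega> \<in> space (P p)"
        and h: "separated p (\<delta> / 4) e \<omega> \<and> (\<Sum>i<p. (v p \<omega> i)\<^sup>2) \<le> (2 * (C2\<^sup>2 + C2) + 1) / (\<eta> / 2) * real p"
      note arg = us_argmax[OF elim(6,5) sp]
      have vK: "(\<Sum>i<p. (v p \<omega> i)\<^sup>2) \<le> K * real p" using h by (simp only: K_def)
      let ?u' = "($) (us p \<omega>)"
      obtain u where u: "R.in_box p \<mu> u" "(\<Sum>i<p. \<bar>u i - ?u' i\<bar>) \<le> \<epsilon> * (1 + quad_mod C2 K 2) * real p"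
        "\<And>z. R.in_box p \<mu> z \<Longrightarrow> obj p \<mu> \<omega> z \<le> obj p \<mu> \<omega> u
         + (quad_mod C2 K (\<epsilon> * (1 + quad_mod C2 K 2)) + quad_mod C2 K \<epsilon> + 2 * \<epsilon>) * real p"
        using R.near_maximizer[OF upper[OF elim(6)] C2 vK ul nd elim(5) \<epsilon>(1) \<delta>2(2)[OF ul elim(4)] \<delta>1(2)[OF ul elim(3)] arg(2,3)]
        by blast
      have "obj p \<mu> \<omega> z \<le> obj p \<mu> \<omega> u + e * real p" if "R.in_box p \<mu> z" for z
      proof -
        have "(quad_mod C2 K (\<epsilon> * (1 + quad_mod C2 K 2)) + quad_mod C2 K \<epsilon> + 2 * \<epsilon>) * real p \<le> e * real p"
          using \<epsilon>(3) by (intro mult_right_mono) auto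
        thus ?thesis using u(3)[OF that] by linarith
      qed
      hence s: "(\<Sum>i<p. (u i - ustar p \<omega> $ i)\<^sup>2) \<le> \<delta> / 4 * real p"
        using h u(1) unfolding separated_def by blast
      have "(\<Sum>i<p. (u i - ?u' i)\<^sup>2) \<le> 2 * (\<Sum>i<p. \<bar>u i - ?u' i\<bar>)"
        by (rule sum_sq_le_abs) (use R.in_box_bounded[OF law u(1)] R.in_box_bounded[OF ul arg(2)] in auto)
      also have "\<dots> \<le> 2 * (\<delta> / 8 * real p)"
      proof -
        have "\<epsilon> * (1 + quad_mod C2 K 2) * real p \<le> \<delta> / 8 * real p" using \<epsilon>(2) by (intro mult_right_mono) auto
        thus ?thesis using u(2) by linarith
      qed
      finally have s': "(\<Sum>i<p. (u i - ?u' i)\<^sup>2) \<le> \<delta> / 4 * real p" by simp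
      have "(\<Sum>i<p. (us p \<omega> $ i - ustar p \<omega> $ i)\<^sup>2) \<le> (\<Sum>i<p. 2 * (u i - ?u' i)\<^sup>2 + 2 * (u i - ustar p \<omega> $ i)\<^sup>2)"
      proof (rule sum_mono)
        fix i
        have "(a - b)\<^sup>2 \<le> 2 * (c - a)\<^sup>2 + 2 * (c - b)\<^sup>2" for a b c :: real
          using zero_le_power2[of "(c - a) + (c - b)"] by (simp add: power2_eq_square algebra_simps)
        thus "(us p \<omega> $ i - ustar p \<omega> $ i)\<^sup>2 \<le> 2 * (u i - ?u' i)\<^sup>2 + 2 * (u i - ustar p \<omega> $ i)\<^sup>2" .
      qed
      also have "\<dots> = 2 * (\<Sum>i<p. (u i - ?u' i)\<^sup>2) + 2 * (\<Sum>i<p. (u i - ustar p \<omega> $ i)\<^sup>2)"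
        by (simp add: sum.distrib sum_distrib_left)
      also have "\<dots> \<le> \<delta> * real p" using s s' by linarith
      finally show "(\<Sum>i<p. (us p \<omega> $ i - ustar p \<omega> $ i)\<^sup>2) \<le> \<delta> * real p" .
    qed (use \<eta> in auto)
  qed
qed

lemma us_conv: "conv_in_prob P (\<lambda>p \<omega>. sq_dist (ustar p \<omega>) (us p \<omega>) / real p) 0"
proof (rule conv_in_probI)
  fix \<epsilon> \<eta> :: real assume \<epsilon>: "\<epsilon> > 0" and \<eta>: "\<eta> > 0"
  show "\<forall>\<^sub>F p in sequentially. holds_upto (P p) \<eta> (\<lambda>\<omega>. \<bar>sq_dist (ustar p \<omega>) (us p \<omega>) / real p\<bar> \<le> \<epsilon>)"
    using us_close[OF \<epsilon> \<eta>] eventually_nondegenerate eventually_ge_1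
  proof eventually_elim
    case (elim p)
    show ?case
    proof (rule holds_upto_mono[OF elim(1) order_refl])
      fix \<omega> assume sp: "\<omega> \<in> space (P p)" and h: "(\<Sum>i<p. (us p \<omega> $ i - ustar p \<omega> $ i)\<^sup>2) \<le> \<epsilon> * real p"
      have "ustar p \<omega> \<in> carrier_vec p" using ustar_box[OF elim(3) sp] by (simp add: supp_box_def)
      hence "sq_dist (ustar p \<omega>) (us p \<omega>) = (\<Sum>i<p. (us p \<omega> $ i - ustar p \<omega> $ i)\<^sup>2)"
        using us_argmax(1)[OF elim(3,2) sp] by (simp add: R.sq_dist_eq power2_commute)
      hence "0 \<le> sq_dist (ustar p \<omega>) (us p \<omega>)" "sq_dist (ustar p \<omega>) (us p \<omega>) \<le> \<epsilon> * real p"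
        using h by (simp_all add: sum_nonneg)
      thus "\<bar>sq_dist (ustar p \<omega>) (us p \<omega>) / real p\<bar> \<le> \<epsilon>" using elim(3) by (simp add: field_simps)
    qed
  qed
qed

lemma wasserstein_tilde_conv:
  "conv_in_prob P (\<lambda>p \<omega>. wasserstein1 p (post p (fst \<omega>)) (product_tilt (X p) \<sigma> \<mu> (hvec (X p) \<sigma> \<mu> (utilde p \<omega>))) / real p) 0"
proof (rule conv_in_probI)
  fix \<epsilon> \<eta> :: real assume \<epsilon>: "\<epsilon> > 0" and \<eta>: "\<eta> > 0"
  \<comment> \<open>With this choice and the next,
    \<open>2 * (e / s + s) = \<epsilon>\<close>.\<close>
  define s where "s = \<epsilon> / 4"
  define e where "e = \<epsilon> / 4 * s"
  have s: "s > 0" "e > 0" using \<epsilon> by (auto simp: s_def e_def)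
  show "\<forall>\<^sub>F p in sequentially. holds_upto (P p) \<eta>
     (\<lambda>\<omega>. \<bar>wasserstein1 p (post p (fst \<omega>)) (product_tilt (X p) \<sigma> \<mu> (hvec (X p) \<sigma> \<mu> (utilde p \<omega>))) / real p\<bar> \<le> \<epsilon>)"
    using trcov_small[OF s(2) \<eta>] eventually_ge_1
  proof eventually_elim
    case (elim p)
    show ?case
    proof (rule holds_upto_mono[OF holds_upto_conj[OF elim(1) post_gibbs[OF elim(2)]]])
      fix \<omega> assume h: "- R.trcov p (v p \<omega>) / 2 \<le> e * real p \<and> post p (fst \<omega>) = R.gibbs p (v p \<omega>)"
      let ?\<tau> = "R.tau_tilde p (v p \<omega>)"
      let ?Q = "\<lambda>i. tilt \<mu> (?\<tau> i) (R.S p i i)"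
      let ?W = "wasserstein1 p (R.gibbs p (v p \<omega>)) (PiM {..<p} ?Q)"
      have ulQ: "unit_law (?Q i)" for i by (rule R.ul_tilt)
      have K: "KL (R.gibbs p (v p \<omega>)) (R.ptilt p ?\<tau>) \<le> e * real p" using R.KL_le_trcov[OF nd, of p "v p \<omega>"] h by linarith
      have "?W \<le> 2 * (KL (R.gibbs p (v p \<omega>)) (R.ptilt p ?\<tau>) / s + real p * s) + (\<Sum>i<p. qdist (?Q i) (?Q i))"
        by (rule R.wasserstein1_gibbs(2)[OF ulQ s(1)])
      also have "(\<Sum>i<p. qdist (?Q i) (?Q i)) = 0" by (simp add: qdist_def)
      also have "2 * (KL (R.gibbs p (v p \<omega>)) (R.ptilt p ?\<tau>) / s + real p * s) \<le> 2 * (e * real p / s + real p * s)"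
        using K s(1) by (simp add: divide_right_mono)
      also have "\<dots> = \<epsilon> * real p" using \<epsilon> by (simp add: e_def s_def field_simps)
      finally have "?W \<le> \<epsilon> * real p" by simp
      moreover have "0 \<le> ?W" by (rule R.wasserstein1_gibbs(1)[OF ulQ s(1)])
      ultimately have "\<bar>?W / real p\<bar> \<le> \<epsilon>" using elim(2) by (simp add: field_simps)
      thus "\<bar>wasserstein1 p (post p (fst \<omega>)) (product_tilt (X p) \<sigma> \<mu> (hvec (X p) \<sigma> \<mu> (utilde p \<omega>))) / real p\<bar> \<le> \<epsilon>"
        using h by (simp only: mean_vec_gibbs product_tilt_tilde R.ptilt_def)
    qed (use \<eta> in auto)
  qed
qed

text \<open>The two product laws are compared coordinatewise: the posterior mean and
  \<open>us\<close> are both near \<open>ustar\<close>, and \<open>qdist_tilt_transfer\<close> turns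
  closeness of means into closeness of tilts of different priors.\<close>

lemma wasserstein_us_conv:
  "conv_in_prob P (\<lambda>p \<omega>. wasserstein1 p (post p (fst \<omega>)) (product_tilt (X p) \<sigma> (\<mu>s p) (hvec (X p) \<sigma> (\<mu>s p) (us p \<omega>))) / real p) 0"
proof (rule conv_in_probI)
  fix \<epsilon> \<eta> :: real assume \<epsilon>: "\<epsilon> > 0" and \<eta>: "\<eta> > 0"
  \<comment> \<open>Half of \<epsilon> goes to the transport from the posterior, as
    \<open>2 * (e / s + s) = \<epsilon> / 2\<close>. The other half pays for the change of product:
    \<rho> makes the average distance of the means at most \<epsilon> / 12, which enters three
    times, and \<epsilon> / 4 is the additive error of \<open>qdist_tilt_transfer\<close>.\<close>
  define s where "s = \<epsilon> / 8"
  define e where "e = \<epsilon> / 8 * s"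
  define \<rho> where "\<rho> = (\<epsilon> / 24)\<^sup>2"
  have s: "s > 0" "e > 0" "\<rho> > 0" using \<epsilon> by (auto simp: s_def e_def \<rho>_def)
  have \<epsilon>4: "\<epsilon> / 4 > 0" and \<eta>3: "\<eta> / 3 > 0" using \<epsilon> \<eta> by auto
  obtain \<delta>1 where \<delta>1: "\<delta>1 > 0" "\<And>\<nu> d \<gamma> \<gamma>'. unit_law \<nu> \<Longrightarrow> qdist \<mu> \<nu> < \<delta>1 \<Longrightarrow> d \<in> {0..C2} \<Longrightarrow>
     qdist (tilt \<mu> \<gamma> d) (tilt \<nu> \<gamma>' d) \<le> 3 * \<bar>tmean \<mu> \<gamma> d - tmean \<nu> \<gamma>' d\<bar> + \<epsilon> / 4"
    using qdist_tilt_transfer[OF law \<epsilon>4 C2] by blast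
  show "\<forall>\<^sub>F p in sequentially. holds_upto (P p) \<eta>
     (\<lambda>\<omega>. \<bar>wasserstein1 p (post p (fst \<omega>)) (product_tilt (X p) \<sigma> (\<mu>s p) (hvec (X p) \<sigma> (\<mu>s p) (us p \<omega>))) / real p\<bar> \<le> \<epsilon>)"
    using trcov_small[OF s(2) \<eta>3] pmean_close[OF s(3) \<eta>3] us_close[OF s(3) \<eta>3] eventually_qdist[OF \<delta>1(1)]
      eventually_nondegenerate eventually_ge_1
  proof eventually_elim
    case (elim p)
    note ul = \<mu>s_law[OF elim(6)]
    interpret N: unit_law "\<mu>s p" by (rule ul)
    have \<eta>0: "0 \<le> \<eta> / 3" "0 \<le> \<eta> / 3 + \<eta> / 3" "0 \<le> \<eta> / 3 + \<eta> / 3 + \<eta> / 3" using \<eta> by auto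
    show ?case
    proof (rule holds_upto_mono[OF holds_upto_conj[OF holds_upto_conj[OF holds_upto_conj[OF elim(1,2) \<eta>0(1,1)] elim(3) \<eta>0(2,1)] post_gibbs[OF elim(6)] \<eta>0(3) order_refl]])
      fix \<omega> assume sp: "\<omega> \<in> space (P p)"
        and h: "((- R.trcov p (v p \<omega>) / 2 \<le> e * real p
          \<and> (\<Sum>i<p. (R.pmean p (v p \<omega>) i - ustar p \<omega> $ i)\<^sup>2) \<le> \<rho> * real p)
          \<and> (\<Sum>i<p. (us p \<omega> $ i - ustar p \<omega> $ i)\<^sup>2) \<le> \<rho> * real p) \<and> post p (fst \<omega>) = R.gibbs p (v p \<omega>)"
      note arg = us_argmax[OF elim(6,5) sp]
      let ?\<tau> = "R.tau_tilde p (v p \<omega>)" and ?m = "R.pmean p (v p \<omega>)"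
      let ?Q = "\<lambda>i. tilt \<mu> (?\<tau> i) (R.S p i i)"
      let ?h = "\<lambda>i. hfun (\<mu>s p) (R.S p i i) (us p \<omega> $ i)"
      let ?Q' = "\<lambda>i. tilt (\<mu>s p) (?h i) (R.S p i i)"
      let ?W = "wasserstein1 p (R.gibbs p (v p \<omega>)) (PiM {..<p} ?Q')"
      have ulQ': "unit_law (?Q' i)" for i by (rule N.unit_law_tilt)
      have K: "KL (R.gibbs p (v p \<omega>)) (R.ptilt p ?\<tau>) \<le> e * real p" using R.KL_le_trcov[OF nd, of p "v p \<omega>"] h by linarith
      have "(\<Sum>i<p. (?m i - us p \<omega> $ i)\<^sup>2) \<le> (\<Sum>i<p. 2 * (?m i - ustar p \<omega> $ i)\<^sup>2 + 2 * (us p \<omega> $ i - ustar p \<omega> $ i)\<^sup>2)"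
      proof (rule sum_mono)
        fix i
        have "(a - b)\<^sup>2 \<le> 2 * (a - c)\<^sup>2 + 2 * (b - c)\<^sup>2" for a b c :: real
          using zero_le_power2[of "(a - c) + (b - c)"] by (simp add: power2_eq_square algebra_simps)
        thus "(?m i - us p \<omega> $ i)\<^sup>2 \<le> 2 * (?m i - ustar p \<omega> $ i)\<^sup>2 + 2 * (us p \<omega> $ i - ustar p \<omega> $ i)\<^sup>2" .
      qed
      also have "\<dots> = 2 * (\<Sum>i<p. (?m i - ustar p \<omega> $ i)\<^sup>2) + 2 * (\<Sum>i<p. (us p \<omega> $ i - ustar p \<omega> $ i)\<^sup>2)"
        by (simp add: sum.distrib sum_distrib_left)
      also have "\<dots> \<le> (4 * \<rho>) * real p" using h by linarith
      finally have "(\<Sum>i<p. \<bar>?m i - us p \<omega> $ i\<bar>) \<le> sqrt (4 * \<rho>) * real p" by (rule sum_abs_le_sqrt)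
      also have "sqrt (4 * \<rho>) = \<epsilon> / 12"
        using \<epsilon> by (intro real_sqrt_unique) (auto simp: \<rho>_def power2_eq_square)
      finally have d: "(\<Sum>i<p. \<bar>?m i - us p \<omega> $ i\<bar>) \<le> \<epsilon> / 12 * real p" .
      have "(\<Sum>i<p. qdist (?Q i) (?Q' i)) \<le> (\<Sum>i<p. 3 * \<bar>?m i - us p \<omega> $ i\<bar> + \<epsilon> / 4)"
      proof (rule sum_mono)
        fix i assume i: "i \<in> {..<p}"
        have dS: "R.S p i i \<in> {0..C2}" using R.S_diag_bound[OF upper[OF elim(6)]] i by simp
        have "tmean \<mu> (?\<tau> i) (R.S p i i) = ?m i" using R.tm_tau_tilde[OF nd] i by simp
        moreover have "tmean (\<mu>s p) (?h i) (R.S p i i) = us p \<omega> $ i"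
          using N.tmean_hfun[of "us p \<omega> $ i" "R.S p i i"] arg(2) i R.S_nonneg by (simp add: R.in_box_def)
        ultimately show "qdist (?Q i) (?Q' i) \<le> 3 * \<bar>?m i - us p \<omega> $ i\<bar> + \<epsilon> / 4"
          using \<delta>1(2)[OF ul elim(4) dS, of "?\<tau> i" "?h i"] by simp
      qed
      also have "\<dots> = 3 * (\<Sum>i<p. \<bar>?m i - us p \<omega> $ i\<bar>) + real p * (\<epsilon> / 4)"
        by (simp add: sum.distrib sum_distrib_left)
      also have "\<dots> \<le> \<epsilon> / 2 * real p" using d by (simp add: field_simps)
      finally have q: "(\<Sum>i<p. qdist (?Q i) (?Q' i)) \<le> \<epsilon> / 2 * real p" .
      have "?W \<le> 2 * (KL (R.gibbs p (v p \<omega>)) (R.ptilt p ?\<tau>) / s + real p * s) + (\<Sum>i<p. qdist (?Q i) (?Q' i))"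
        by (rule R.wasserstein1_gibbs(2)[OF ulQ' s(1)])
      also have "\<dots> \<le> 2 * (e * real p / s + real p * s) + \<epsilon> / 2 * real p"
        using K s(1) q by (intro add_mono mult_left_mono divide_right_mono) auto
      also have "\<dots> = \<epsilon> * real p" using \<epsilon> by (simp add: e_def s_def field_simps)
      finally have "?W \<le> \<epsilon> * real p" .
      moreover have "0 \<le> ?W" by (rule R.wasserstein1_gibbs(1)[OF ulQ' s(1)])
      ultimately have "\<bar>?W / real p\<bar> \<le> \<epsilon>" using elim(6) by (simp add: field_simps)
      thus "\<bar>wasserstein1 p (post p (fst \<omega>)) (product_tilt (X p) \<sigma> (\<mu>s p) (hvec (X p) \<sigma> (\<mu>s p) (us p \<omega>))) / real p\<bar> \<le> \<epsilon>"
        using h by (simp only: product_tilt_hvec)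
    qed (use \<eta> in auto)
  qed
qed

end

theorem theorem3:
  fixes X :: "nat \<Rightarrow> real mat" and n :: "nat \<Rightarrow> nat" and \<sigma> C1 C2 :: real
    and \<mu>star :: "real measure" and \<mu>s :: "nat \<Rightarrow> real measure" and Pcl :: "real measure set"
    and ustar us :: "nat \<Rightarrow> (nat \<Rightarrow> real) \<times> (nat \<Rightarrow> real) \<Rightarrow> real vec"
    and post :: "nat \<Rightarrow> (nat \<Rightarrow> real) \<Rightarrow> (nat \<Rightarrow> real) measure"
  assumes \<sigma>: "\<sigma> > 0"
    and X: "\<And>p. X p \<in> carrier_mat (n p) p"
    and \<mu>star: "\<mu>star \<in> prob_measures_on {-1..1}" "\<not> degenerate \<mu>star"
    and C: "0 < C1" "C1 \<le> 1" "1 \<le> C2"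
    and eig_lower: "\<And>p. p \<ge> 1 \<Longrightarrow> C1 \<le> lambda_min ((X p)\<^sup>T * X p) / \<sigma>\<^sup>2"
    and eig_upper: "\<And>p. p \<ge> 1 \<Longrightarrow> lambda_max ((X p)\<^sup>T * X p) / \<sigma>\<^sup>2 \<le> C2"
    and closed: "closedin (subtopology weak_topology (prob_measures_on {-1..1})) Pcl"
    and trace: "(\<lambda>p. mat_trace (off_diag (X p) \<sigma> * off_diag (X p) \<sigma>)) \<in> o(\<lambda>p. real p)"
    and \<mu>s_mem: "\<And>p. p \<ge> 1 \<Longrightarrow> \<mu>s p \<in> Pcl"
    and \<mu>s_lim: "weak_conv_m \<mu>s \<mu>star"
    and post: "\<And>p. p \<ge> 1 \<Longrightarrow> is_posterior (X p) \<sigma> \<mu>star (post p)"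
    and ustar: "well_separated_optimizer X \<sigma> \<mu>star ustar"
    and us: "\<And>p \<omega>. p \<ge> 1 \<Longrightarrow> \<not> degenerate (\<mu>s p) \<Longrightarrow> \<omega> \<in> space (joint_law (X p) \<sigma> \<mu>star) \<Longrightarrow>
       is_arg_max (\<lambda>u. mf_objective (X p) \<sigma> u (wvec (X p) \<sigma> (fst \<omega>)) (\<mu>s p))
         (\<lambda>u. u \<in> supp_box p (\<mu>s p)) (us p \<omega>)"
  shows "let \<P> = (\<lambda>p. joint_law (X p) \<sigma> \<mu>star);
             utilde = (\<lambda>p \<omega>. mean_vec p (post p (fst \<omega>)));
             \<tau>tilde = (\<lambda>p \<omega>. hvec (X p) \<sigma> \<mu>star (utilde p \<omega>));
             \<tau>s = (\<lambda>p \<omega>. hvec (X p) \<sigma> (\<mu>s p) (us p \<omega>))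
         in conv_in_prob \<P> (\<lambda>p \<omega>. sq_dist (ustar p \<omega>) (us p \<omega>) / real p) 0
          \<and> conv_in_prob \<P> (\<lambda>p \<omega>. sq_dist (ustar p \<omega>) (utilde p \<omega>) / real p) 0
          \<and> conv_in_prob \<P> (\<lambda>p \<omega>. KL (post p (fst \<omega>))
                (product_tilt (X p) \<sigma> \<mu>star (\<tau>tilde p \<omega>)) / real p) 0
          \<and> conv_in_prob \<P> (\<lambda>p \<omega>. wasserstein1 p (post p (fst \<omega>))
                (product_tilt (X p) \<sigma> \<mu>star (\<tau>tilde p \<omega>)) / real p) 0
          \<and> conv_in_prob \<P> (\<lambda>p \<omega>. wasserstein1 p (post p (fst \<omega>))
                (product_tilt (X p) \<sigma> (\<mu>s p) (\<tau>s p \<omega>)) / real p) 0"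
proof -
  have mem: "\<mu> \<in> Pcl \<Longrightarrow> \<mu> \<in> prob_measures_on {-1..1}" for \<mu>
    using closedin_subset[OF closed] by (auto simp: topspace_subtopology)
  interpret regression_sequence X n \<sigma> C1 C2 \<mu>star \<mu>s ustar us post
  proof (rule regression_sequence.intro)
    show "unit_law \<mu>star" by (rule unit_lawI[OF \<mu>star(1)])
    show "unit_law (\<mu>s p)" if "p \<ge> 1" for p by (rule unit_lawI[OF mem[OF \<mu>s_mem[OF that]]])
  qed (use assms in auto)
  show ?thesis
    unfolding Let_def
    by (intro conjI us_conv utilde_conv KL_conv wasserstein_tilde_conv wasserstein_us_conv)
qed

end
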